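(* Let $(G_m)_m$, $(\pi^m_k:G_m\to G_k)_{m\ge k}$ be an inverse system of compact groups with continuous surjective connecting homomorphisms, whose inverse limit $G$, with canonical surjections $\pi_m:G\to G_m$, is second countable. Let $A$ be either a discrete Abelian group or a finite-dimensional torus, equipped with a continuous action of $G$ by automorphisms that factorizes through every $\pi_m$ (so that $A$ is also a $G_m$-module for every $m$). Then for every $p\ge 0$ the direct limit of the inflation maps $$\lim_{m\to}\inf\nolimits^p_{\pi_m}:\ \lim_{m\to}\mathrm{H}^p_{\mathrm{m}}(G_m,A)\longrightarrow \mathrm{H}^p_{\mathrm{m}}(G,A)$$ is an isomorphism.
   Context: A Polish $G$-module is a Polish Abelian group $A$ with a continuous action $T:G\curvearrowright A$ by continuous automorphisms; all modules are Polish (so a discrete module is countable). For $p\ge 1$, $\mathcal{C}^p(G,A)$ is the group of Haar-a.e. equivalence classes of Borel maps $G^p\to A$; $\mathcal{C}^0(G,A)=A$, and $\mathcal{C}^{p}(G,A)=(0)$ for $p<0$. The coboundary $d:\mathcal{C}^p(G,A)\to\mathcal{C}^{p+1}(G,A)$ is $$d\phi(g_1,\dots,g_{p+1}) = T^{g_1}\phi(g_2,\dots,g_{p+1})+\sum_{i=1}^p(-1)^i\phi(g_1,\dots,g_ig_{i+1},\dots,g_{p+1})+(-1)^{p+1}\phi(g_1,\dots,g_p)$$ (a.e.). Put $\mathcal{Z}^p(G,A)=\ker d|_{\mathcal{C}^p(G,A)}$, $\mathcal{B}^p(G,A)=d(\mathcal{C}^{p-1}(G,A))$ and $\mathrm{H}^p_{\mathrm{m}}(G,A)=\mathcal{Z}^p(G,A)/\mathcal{B}^p(G,A)$.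 For a continuous epimorphism $\pi:G'\to G$ and a $G$-module $A$ (viewed as a $G'$-module through $\pi$), the inflation map $\inf^p_\pi:\mathrm{H}^p_{\mathrm{m}}(G,A)\to\mathrm{H}^p_{\mathrm{m}}(G',A)$ is induced by $\psi\mapsto\psi\circ\pi^{\times p}$, where $\pi^{\times p}=\pi\times\cdots\times\pi:(G')^p\to G^p$. The groups $\mathrm{H}^p_{\mathrm{m}}(G_m,A)$ form a direct system under the inflation maps of the $\pi^m_k$. *)

theory Defs
  imports
    "HOL-Analysis.Analysis"
    "HOL-Algebra.Bij"
    "HOL-Algebra.FiniteProduct"
    "HOL-Algebra.Product_Groups"
begin

section \<open>Topological groups\<close>

record 'a tgroup = "'a monoid" +
  gtop :: "'a topology"

locale topological_group = group G for G :: "'a tgroup" (structure) +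
  assumes topspace_gtop: "topspace (gtop G) = carrier G"
    and continuous_mult:
      "continuous_map (prod_topology (gtop G) (gtop G)) (gtop G) (\<lambda>(x, y). x \<otimes> y)"
    and continuous_inv: "continuous_map (gtop G) (gtop G) (\<lambda>x. inv x)"

locale compact_group = topological_group +
  assumes compact: "compact_space (gtop G)"
    and Hausdorff: "Hausdorff_space (gtop G)"

definition product_tgroup :: "'i set \<Rightarrow> ('i \<Rightarrow> 'a tgroup) \<Rightarrow> ('i \<Rightarrow> 'a) tgroup" where
  "product_tgroup I G =
     \<lparr>carrier = carrier (product_group I G), mult = mult (product_group I G),
      one = one (product_group I G), gtop = product_topology (\<lambda>i. gtop (G i)) I\<rparr>"

definition tgroup_iso :: "'a tgroup \<Rightarrow> 'b tgroup \<Rightarrow> ('a \<Rightarrow> 'b) set" where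
  "tgroup_iso G H = {f \<in> iso G H. homeomorphic_map (gtop G) (gtop H) f}"

definition discrete_group :: "'a tgroup \<Rightarrow> bool" where
  "discrete_group A \<longleftrightarrow> gtop A = discrete_topology (carrier A)"

definition circle_group :: "complex tgroup" where
  "circle_group =
     \<lparr>carrier = sphere 0 1, mult = (*), one = 1, gtop = top_of_set (sphere 0 1)\<rparr>"

definition finite_dim_torus :: "'a tgroup \<Rightarrow> bool" where
  "finite_dim_torus A \<longleftrightarrow>
     (\<exists>n::nat. tgroup_iso A (product_tgroup {..<n} (\<lambda>_. circle_group)) \<noteq> {})"

text \<open>
  The action is a homomorphism from the acting group into the automorphism group of the
  (multiplicatively written) abelian group \<open>A\<close>. A discrete Polish module is countable by
  second countability.
\<close>

locale polish_module =
  G?: topological_group G + A?: topological_group A + A?: comm_group A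
  for G :: "'g tgroup" and A :: "'a tgroup" and T :: "'g \<Rightarrow> 'a \<Rightarrow> 'a" +
  assumes completely_metrizable: "completely_metrizable_space (gtop A)"
    and second_countable: "second_countable (gtop A)"
    and action: "T \<in> hom G (AutoGroup A)"
    and continuous_action:
      "continuous_map (prod_topology (gtop G) (gtop A)) (gtop A) (\<lambda>(g, a). T g a)"


section \<open>Measurable cochains\<close>

definition borel_of :: "'a topology \<Rightarrow> 'a measure" where
  "borel_of X = sigma (topspace X) {U. openin X U}"

text \<open>
  The normalised Haar measure of a compact group. Regularity is not demanded: it is automatic
  for second countable groups, the only ones for which the notion is used below.
\<close>

definition haar_measure :: "'g tgroup \<Rightarrow> 'g measure \<Rightarrow> bool" where
  "haar_measure G \<mu> \<longleftrightarrow>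
     sets \<mu> = sets (borel_of (gtop G)) \<and>
     emeasure \<mu> (carrier G) = 1 \<and>
     (\<forall>g\<in>carrier G. \<forall>B\<in>sets \<mu>. emeasure \<mu> (g <#\<^bsub>G\<^esub> B) = emeasure \<mu> B)"

text \<open>
  The power \<open>G\<^sup>p\<close> consists of the extensional functions on \<open>{..<p}\<close>, so coordinates are
  numbered from 0. Since a second countable compact group has exactly one normalised Haar
  measure, the quantifier over \<open>\<mu>\<close> merely names it.
\<close>

abbreviation tpower :: "'g tgroup \<Rightarrow> nat \<Rightarrow> (nat \<Rightarrow> 'g) tgroup" where
  "tpower G p \<equiv> product_tgroup {..<p} (\<lambda>_. G)"

definition haar_AE :: "'g tgroup \<Rightarrow> nat \<Rightarrow> ((nat \<Rightarrow> 'g) \<Rightarrow> bool) \<Rightarrow> bool" where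
  "haar_AE G p P \<longleftrightarrow>
     (\<forall>\<mu>. haar_measure G \<mu> \<longrightarrow> (AE x in Pi\<^sub>M {..<p} (\<lambda>_. \<mu>). P x))"

definition borel_maps :: "'g tgroup \<Rightarrow> 'a tgroup \<Rightarrow> nat \<Rightarrow> ((nat \<Rightarrow> 'g) \<Rightarrow> 'a) monoid" where
  "borel_maps G A p =
     \<lparr>carrier = extensional (carrier (tpower G p)) \<inter>
        measurable (borel_of (gtop (tpower G p))) (borel_of (gtop A)),
      mult = \<lambda>\<phi> \<psi>. \<lambda>x\<in>carrier (tpower G p). \<phi> x \<otimes>\<^bsub>A\<^esub> \<psi> x,
      one = \<lambda>x\<in>carrier (tpower G p). \<one>\<^bsub>A\<^esub>\<rparr>"

definition null_maps :: "'g tgroup \<Rightarrow> 'a tgroup \<Rightarrow> nat \<Rightarrow> ((nat \<Rightarrow> 'g) \<Rightarrow> 'a) set" where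
  "null_maps G A p = {\<phi> \<in> carrier (borel_maps G A p). haar_AE G p (\<lambda>x. \<phi> x = \<one>\<^bsub>A\<^esub>)}"

text \<open>
  Classes of Borel maps modulo equality almost everywhere. As \<open>G\<^sup>0\<close> is a single point of
  measure 1, the group of 0-cochains is \<open>A\<close>, an element of \<open>A\<close> being identified with the
  singleton class of the map on \<open>G\<^sup>0\<close> with that value.
\<close>

definition cochains :: "'g tgroup \<Rightarrow> 'a tgroup \<Rightarrow> nat \<Rightarrow> ((nat \<Rightarrow> 'g) \<Rightarrow> 'a) set monoid" where
  "cochains G A p = borel_maps G A p Mod null_maps G A p"

text \<open>
  If \<open>f\<close> is a homomorphism \<open>K \<rightarrow> H\<close> mapping \<open>M\<close> into \<open>N\<close>, then \<open>quotient_hom H N f\<close> is the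
  homomorphism \<open>K Mod M \<rightarrow> H Mod N\<close> it induces: all cosets in the union coincide.
\<close>

definition quotient_hom :: "('b, 'c) monoid_scheme \<Rightarrow> 'b set \<Rightarrow> ('a \<Rightarrow> 'b) \<Rightarrow> 'a set \<Rightarrow> 'b set" where
  "quotient_hom H N f X = (\<Union>x\<in>X. N #>\<^bsub>H\<^esub> f x)"


section \<open>Measurable cohomology\<close>

text \<open>
  With coordinates numbered from 0, \<open>merge_coords G p i x\<close> for \<open>1 \<le> i \<le> p\<close> is the tuple
  \<open>(x\<^sub>0, \<dots>, x\<^sub>i\<^sub>-\<^sub>1 x\<^sub>i, \<dots>, x\<^sub>p)\<close>.
\<close>

definition merge_coords :: "'g tgroup \<Rightarrow> nat \<Rightarrow> nat \<Rightarrow> (nat \<Rightarrow> 'g) \<Rightarrow> nat \<Rightarrow> 'g" where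
  "merge_coords G p i x =
     (\<lambda>j\<in>{..<p}. if Suc j < i then x j
                 else if Suc j = i then x j \<otimes>\<^bsub>G\<^esub> x (Suc j)
                 else x (Suc j))"

definition coboundary_fun ::
  "'g tgroup \<Rightarrow> 'a tgroup \<Rightarrow> ('g \<Rightarrow> 'a \<Rightarrow> 'a) \<Rightarrow> nat \<Rightarrow> ((nat \<Rightarrow> 'g) \<Rightarrow> 'a) \<Rightarrow> (nat \<Rightarrow> 'g) \<Rightarrow> 'a" where
  "coboundary_fun G A T p \<phi> =
     (\<lambda>x\<in>carrier (tpower G (Suc p)).
        T (x 0) (\<phi> (\<lambda>j\<in>{..<p}. x (Suc j)))
        \<otimes>\<^bsub>A\<^esub> (\<Otimes>\<^bsub>A\<^esub>i\<in>{1..p}. \<phi> (merge_coords G p i x) [^]\<^bsub>A\<^esub> ((-1::int) ^ i))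
        \<otimes>\<^bsub>A\<^esub> \<phi> (restrict x {..<p}) [^]\<^bsub>A\<^esub> ((-1::int) ^ (p + 1)))"

definition coboundary ::
  "'g tgroup \<Rightarrow> 'a tgroup \<Rightarrow> ('g \<Rightarrow> 'a \<Rightarrow> 'a) \<Rightarrow> nat \<Rightarrow>
     ((nat \<Rightarrow> 'g) \<Rightarrow> 'a) set \<Rightarrow> ((nat \<Rightarrow> 'g) \<Rightarrow> 'a) set" where
  "coboundary G A T p =
     quotient_hom (borel_maps G A (Suc p)) (null_maps G A (Suc p)) (coboundary_fun G A T p)"

definition cocycles ::
  "'g tgroup \<Rightarrow> 'a tgroup \<Rightarrow> ('g \<Rightarrow> 'a \<Rightarrow> 'a) \<Rightarrow> nat \<Rightarrow> ((nat \<Rightarrow> 'g) \<Rightarrow> 'a) set set" where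
  "cocycles G A T p = kernel (cochains G A p) (cochains G A (Suc p)) (coboundary G A T p)"

text \<open>The case 0 reflects that there are no nonzero cochains of negative degree.\<close>

fun coboundaries ::
  "'g tgroup \<Rightarrow> 'a tgroup \<Rightarrow> ('g \<Rightarrow> 'a \<Rightarrow> 'a) \<Rightarrow> nat \<Rightarrow> ((nat \<Rightarrow> 'g) \<Rightarrow> 'a) set set" where
  "coboundaries G A T 0 = {\<one>\<^bsub>cochains G A 0\<^esub>}"
| "coboundaries G A T (Suc p) = coboundary G A T p ` carrier (cochains G A p)"

definition cocycle_group ::
  "'g tgroup \<Rightarrow> 'a tgroup \<Rightarrow> ('g \<Rightarrow> 'a \<Rightarrow> 'a) \<Rightarrow> nat \<Rightarrow> ((nat \<Rightarrow> 'g) \<Rightarrow> 'a) set monoid" where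
  "cocycle_group G A T p = cochains G A p \<lparr>carrier := cocycles G A T p\<rparr>"

definition cohomology ::
  "'g tgroup \<Rightarrow> 'a tgroup \<Rightarrow> ('g \<Rightarrow> 'a \<Rightarrow> 'a) \<Rightarrow> nat \<Rightarrow> ((nat \<Rightarrow> 'g) \<Rightarrow> 'a) set set monoid" where
  "cohomology G A T p = cocycle_group G A T p Mod coboundaries G A T p"

text \<open>
  The inflation map along \<open>\<pi> : G' \<rightarrow> G\<close>; here \<open>T'\<close> is the action of \<open>G'\<close> on \<open>A\<close>, that is, the
  composition of \<open>\<pi>\<close> with the action of \<open>G\<close>.
\<close>

definition pullback_fun ::
  "'h tgroup \<Rightarrow> nat \<Rightarrow> ('h \<Rightarrow> 'g) \<Rightarrow> ((nat \<Rightarrow> 'g) \<Rightarrow> 'a) \<Rightarrow> (nat \<Rightarrow> 'h) \<Rightarrow> 'a" where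
  "pullback_fun G' p \<pi> \<psi> = (\<lambda>x\<in>carrier (tpower G' p). \<psi> (\<lambda>j\<in>{..<p}. \<pi> (x j)))"

definition inflation ::
  "'h tgroup \<Rightarrow> 'a tgroup \<Rightarrow> ('h \<Rightarrow> 'a \<Rightarrow> 'a) \<Rightarrow> nat \<Rightarrow> ('h \<Rightarrow> 'g) \<Rightarrow>
     ((nat \<Rightarrow> 'g) \<Rightarrow> 'a) set set \<Rightarrow> ((nat \<Rightarrow> 'h) \<Rightarrow> 'a) set set" where
  "inflation G' A T' p \<pi> =
     quotient_hom (cocycle_group G' A T' p) (coboundaries G' A T' p)
       (quotient_hom (borel_maps G' A p) (null_maps G' A p) (pullback_fun G' p \<pi>))"


section \<open>Inverse and direct limits\<close>

text \<open>
  Systems are indexed by a type \<open>'i\<close> with a directed preorder. The connecting map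
  \<open>\<pi> m k : G m \<rightarrow> G k\<close> is meaningful for \<open>k \<le> m\<close> only.
\<close>

locale compact_inverse_system =
  fixes G :: "'i::preorder \<Rightarrow> 'g tgroup" and \<pi> :: "'i \<Rightarrow> 'i \<Rightarrow> 'g \<Rightarrow> 'g"
  assumes directed: "\<exists>n::'i. k \<le> n \<and> m \<le> n"
    and compact_group: "compact_group (G m)"
    and epi: "k \<le> m \<Longrightarrow> \<pi> m k \<in> epi (G m) (G k)"
    and continuous: "k \<le> m \<Longrightarrow> continuous_map (gtop (G m)) (gtop (G k)) (\<pi> m k)"
    and connecting_id: "x \<in> carrier (G m) \<Longrightarrow> \<pi> m m x = x"
    and connecting_comp:
      "\<lbrakk>k \<le> m; m \<le> n; x \<in> carrier (G n)\<rbrakk> \<Longrightarrow> \<pi> m k (\<pi> n m x) = \<pi> n k x"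

definition inverse_limit ::
  "('i::preorder \<Rightarrow> 'g tgroup) \<Rightarrow> ('i \<Rightarrow> 'i \<Rightarrow> 'g \<Rightarrow> 'g) \<Rightarrow> ('i \<Rightarrow> 'g) tgroup" where
  "inverse_limit G \<pi> =
     (let P = product_tgroup UNIV G;
          L = {x \<in> carrier P. \<forall>k m. k \<le> m \<longrightarrow> \<pi> m k (x m) = x k}
      in P\<lparr>carrier := L, gtop := subtopology (gtop P) L\<rparr>)"

definition direct_limit_rel ::
  "('i::preorder \<Rightarrow> 'h monoid) \<Rightarrow> ('i \<Rightarrow> 'i \<Rightarrow> 'h \<Rightarrow> 'h) \<Rightarrow> (('i \<times> 'h) \<times> ('i \<times> 'h)) set" where
  "direct_limit_rel H f =
     {((k, x), (l, y)). x \<in> carrier (H k) \<and> y \<in> carrier (H l) \<and>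
        (\<exists>m. k \<le> m \<and> l \<le> m \<and> f k m x = f l m y)}"

text \<open>
  The direct limit of groups \<open>H m\<close> under \<open>f k m : H k \<rightarrow> H m\<close> for \<open>k \<le> m\<close>, as a quotient of the
  disjoint union. The unions in \<open>mult\<close> and \<open>one\<close> are unions of coinciding classes.
\<close>

definition direct_limit ::
  "('i::preorder \<Rightarrow> 'h monoid) \<Rightarrow> ('i \<Rightarrow> 'i \<Rightarrow> 'h \<Rightarrow> 'h) \<Rightarrow> ('i \<times> 'h) set monoid" where
  "direct_limit H f =
     \<lparr>carrier = (SIGMA m:UNIV. carrier (H m)) // direct_limit_rel H f,
      mult = \<lambda>X Y. \<Union> {direct_limit_rel H f `` {(m, f k m x \<otimes>\<^bsub>H m\<^esub> f l m y)} | k l m x y.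
                          (k, x) \<in> X \<and> (l, y) \<in> Y \<and> k \<le> m \<and> l \<le> m},
      one = (\<Union>m. direct_limit_rel H f `` {(m, \<one>\<^bsub>H m\<^esub>)})\<rparr>"

text \<open>
  The map on the direct limit determined by maps \<open>F m\<close> on \<open>H m\<close> with \<open>F m \<circ> f k m = F k\<close>; these
  give a single value on each class.
\<close>

definition direct_limit_map :: "('i \<Rightarrow> 'h \<Rightarrow> 'b) \<Rightarrow> ('i \<times> 'h) set \<Rightarrow> 'b" where
  "direct_limit_map F X = the_elem ((\<lambda>(m, x). F m x) ` X)"

end

theory Submission
  imports Defs "HOL-Probability.Probability"
begin

text \<open>
  The proof rests on a stability principle: measurable cocycles of positive degree that are small
  in mean are coboundaries of cochains that are small in mean, with bounds that depend on the
  degree and the module but not on the acting compact group. Here smallness refers to an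
  invariant length on the module, which is the discrete length for discrete modules and, for a
  torus, the largest distance from the identity within an orbit. The mean of the length is taken
  with respect to Haar measure. This is \<open>small_cocycle_is_small_coboundary\<close>.

  A Borel cochain on the limit \<open>G\<close> is arbitrarily close in mean to a cochain pulled back from
  some \<open>G\<^sub>m\<close>, since Borel sets of \<open>G\<^sup>p\<close> are approximated in measure by preimages of Borel sets of
  \<open>G\<^sub>m\<^sup>p\<close> (\<open>cochain_approximation\<close>), and pulling back preserves mean lengths. Both halves of the
  theorem follow. Let \<open>\<sigma>\<close> be a cocycle on \<open>G\<close> and \<open>\<psi>\<close> a cochain on \<open>G\<^sub>m\<close> close to it. Then \<open>d\<psi>\<close> is a
  small cocycle on \<open>G\<^sub>m\<close>, hence the coboundary of a small cochain, and subtracting the latter from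
  \<open>\<psi>\<close> gives a cocycle on \<open>G\<^sub>m\<close> whose pullback is still close to \<open>\<sigma>\<close>. The difference is a small
  cocycle on \<open>G\<close>, so the two classes agree, which is surjectivity (\<open>cocycle_from_factor\<close>). If a
  cocycle \<open>\<psi>\<close> on \<open>G\<^sub>m\<close> becomes a coboundary \<open>d\<phi>\<close> on \<open>G\<close>, approximate \<open>\<phi>\<close> by a cochain \<open>\<phi>'\<close> on some
  \<open>G\<^sub>n\<close> with \<open>n \<ge> m\<close>. The inflation of \<open>\<psi>\<close> to \<open>G\<^sub>n\<close> minus \<open>d\<phi>'\<close> is a small cocycle, hence a
  coboundary, which is injectivity (\<open>coboundary_on_factor\<close>). In degree 0 the cochains are the
  elements of \<open>A\<close>, and nothing has to be approximated.

  The stability principle is proved in two steps, for homogeneous cochains regarded as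
  equivariant functions of a sequence of independent Haar distributed points. In the first step
  a cocycle \<open>f\<close> with small mean is changed by a small coboundary into one that is small almost
  everywhere (\<open>small_cocycle_cohomologous_to_uniformly_small\<close>). The usual contraction of the
  homogeneous complex inserts a point \<open>b\<close> as an additional argument. If \<open>b\<close> is chosen well, the
  lengths after insertion exceed their means by a factor of at most 3. The choice has to be
  measurable and equivariant in the remaining arguments; it is made by testing countably many
  random points relative to the first argument (\<open>equivariant_choice\<close>). Carrying this out for one
  argument after the other, as in a zigzag through a double complex, transforms a bound in mean
  into a pointwise one. In the second step a cocycle that is small almost everywhere is written as
  a coboundary. For a discrete module it is trivial. For a torus its values have small angles,
  for which the cocycle identity holds in the reals and on which the action is linear, so that it
  can be integrated over one variable (\<open>torus_averaging\<close>).

  Haar measure is constructed from covering numbers (\<open>exists_haar_measure\<close>), and on a second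
  countable compact group it is unique (\<open>haar_measure_unique\<close>). Uniqueness yields that the
  continuous epimorphisms of the system preserve Haar measure.
\<close>


section \<open>Alternating products\<close>

text \<open>
  The alternating product \<open>F 0 - F 1 + F 2 - \<dots>\<close> of \<open>n\<close> terms, for a multiplicatively written group.
\<close>

primrec altprod :: "('a, 'b) monoid_scheme \<Rightarrow> nat \<Rightarrow> (nat \<Rightarrow> 'a) \<Rightarrow> 'a" where
  "altprod A 0 F = \<one>\<^bsub>A\<^esub>"
| "altprod A (Suc n) F = F 0 \<otimes>\<^bsub>A\<^esub> inv\<^bsub>A\<^esub> (altprod A n (\<lambda>i. F (Suc i)))"

lemma altprod_cong: "(\<And>i. i < n \<Longrightarrow> F i = F' i) \<Longrightarrow> altprod A n F = altprod A n F'"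
proof (induction n arbitrary: F F')
  case (Suc n)
  have "altprod A n (\<lambda>i. F (Suc i)) = altprod A n (\<lambda>i. F' (Suc i))"
    by (rule Suc.IH) (simp add: Suc.prems)
  then show ?case
    using Suc.prems[of 0] by simp
qed simp

context comm_group
begin

lemma mult_div_mult_div:
  assumes "a \<in> carrier G" "b \<in> carrier G" "c \<in> carrier G" "d \<in> carrier G"
  shows "(a \<otimes> inv b) \<otimes> (c \<otimes> inv d) = (a \<otimes> c) \<otimes> inv (b \<otimes> d)"
  using assms by (simp add: inv_mult m_ac)

lemma div_eq_one_iff:
  "\<lbrakk>a \<in> carrier G; b \<in> carrier G\<rbrakk> \<Longrightarrow> a \<otimes> inv b = \<one> \<longleftrightarrow> a = b"
  by (metis inv_closed inv_inv inv_unique r_inv)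

lemma altprod_closed [simp, intro]:
  "(\<And>i. i < n \<Longrightarrow> F i \<in> carrier G) \<Longrightarrow> altprod G n F \<in> carrier G"
  by (induction n arbitrary: F) auto

lemma altprod_one: "altprod G n (\<lambda>_. \<one>) = \<one>"
  by (induction n) auto

lemma altprod_mult:
  "\<lbrakk>\<And>i. i < n \<Longrightarrow> F i \<in> carrier G; \<And>i. i < n \<Longrightarrow> F' i \<in> carrier G\<rbrakk> \<Longrightarrow>
    altprod G n (\<lambda>i. F i \<otimes> F' i) = altprod G n F \<otimes> altprod G n F'"
  by (induction n arbitrary: F F') (simp_all add: mult_div_mult_div)

lemma altprod_inv:
  "(\<And>i. i < n \<Longrightarrow> F i \<in> carrier G) \<Longrightarrow> altprod G n (\<lambda>i. inv (F i)) = inv (altprod G n F)"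
  by (induction n arbitrary: F) (simp_all add: inv_mult)

lemma altprod_div:
  "\<lbrakk>\<And>i. i < n \<Longrightarrow> F i \<in> carrier G; \<And>i. i < n \<Longrightarrow> F' i \<in> carrier G\<rbrakk> \<Longrightarrow>
    altprod G n (\<lambda>i. F i \<otimes> inv (F' i)) = altprod G n F \<otimes> inv (altprod G n F')"
  by (simp add: altprod_mult altprod_inv)

lemma altprod_swap:
  "(\<And>i j. \<lbrakk>i < m; j < n\<rbrakk> \<Longrightarrow> F i j \<in> carrier G) \<Longrightarrow>
    altprod G m (\<lambda>i. altprod G n (F i)) = altprod G n (\<lambda>j. altprod G m (\<lambda>i. F i j))"
proof (induction m arbitrary: F)
  case 0
  then show ?case by (simp add: altprod_one)
next
  case (Suc m)
  then show ?case by (simp add: altprod_div)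
qed

lemma altprod_add:
  "(\<And>i. i < m + n \<Longrightarrow> F i \<in> carrier G) \<Longrightarrow>
    altprod G (m + n) F = altprod G m F \<otimes>
      (if even m then altprod G n (\<lambda>i. F (m + i)) else inv (altprod G n (\<lambda>i. F (m + i))))"
  by (induction m arbitrary: F) (auto simp: inv_mult m_assoc)

lemma altprod_hom:
  assumes h: "h \<in> hom G K" and K: "group K"
  shows "(\<And>i. i < n \<Longrightarrow> F i \<in> carrier G) \<Longrightarrow> h (altprod G n F) = altprod K n (\<lambda>i. h (F i))"
proof (induction n arbitrary: F)
  interpret K: group K by fact
  interpret group_hom G K h by unfold_locales fact
  case 0
  then show ?case by simp
next
  case (Suc n)
  interpret K: group K by fact
  interpret group_hom G K h by unfold_locales fact
  show ?case using Suc by simp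
qed

end


section \<open>Sequences with a deleted entry\<close>

definition skip :: "nat \<Rightarrow> (nat \<Rightarrow> 'a) \<Rightarrow> nat \<Rightarrow> 'a" where
  "skip i x = (\<lambda>j. x (if j < i then j else Suc j))"

lemma skip_0_case_nat [simp]: "skip 0 (case_nat b y) = y"
  by (simp add: skip_def)

lemma skip_Suc_case_nat [simp]: "skip (Suc i) (case_nat b y) = case_nat b (skip i y)"
  by (auto simp: skip_def split: nat.split)

lemma skip_comb_seq_less:
  "i < Suc k \<Longrightarrow> skip i (comb_seq (Suc k) x y) = comb_seq k (skip i x) y"
  by (auto simp: skip_def comb_seq_def fun_eq_iff Suc_diff_le not_less)

lemma skip_comb_seq_add: "skip (k + i) (comb_seq k x y) = comb_seq k x (skip i y)"
  by (auto simp: skip_def comb_seq_def fun_eq_iff Suc_diff_le)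

lemma case_nat_split: "case_nat (x 0) (\<lambda>i. x (Suc i)) = x"
  by (auto simp: fun_eq_iff split: nat.split)

text \<open>
  Splitting off the first entry reduces one application of the simplicial coboundary to one of
  lower degree, so that an induction proves that the square of the coboundary is trivial.
\<close>

lemma (in comm_group) altprod_skip_skip:
  assumes "\<And>x. (\<And>j. x j \<in> X) \<Longrightarrow> u x \<in> carrier G" and "\<And>j. x j \<in> X"
  shows "altprod G (Suc n) (\<lambda>i. altprod G n (\<lambda>j. u (skip j (skip i x)))) = \<one>"
  using assms
proof (induction n arbitrary: u x)
  case 0
  then show ?case by simp
next
  case (Suc n)
  define b y where "b = x 0" and "y = (\<lambda>i. x (Suc i))"
  have x: "x = case_nat b y" and b: "b \<in> X" and y: "\<And>j. y j \<in> X"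
    using Suc.prems by (auto simp: b_def y_def case_nat_split)
  have skX: "skip i z j \<in> X" if "\<And>j. z j \<in> X" for i j z
    using that by (simp add: skip_def)
  have cX: "case_nat b z j \<in> X" if "\<And>j. z j \<in> X" for j z
    using that b by (simp split: nat.split)
  have ux: "u z \<in> carrier G" if "\<And>j. z j \<in> X" for z
    using Suc.prems that by blast
  have IH: "altprod G (Suc n) (\<lambda>i. altprod G n (\<lambda>j. u (case_nat b (skip j (skip i y))))) = \<one>"
    using Suc.IH[of "\<lambda>z. u (case_nat b z)" y] y ux cX by blast
  have "altprod G (Suc (Suc n)) (\<lambda>i. altprod G (Suc n) (\<lambda>j. u (skip j (skip i x))))
    = altprod G (Suc n) (\<lambda>j. u (skip j y)) \<otimes> inv altprod G (Suc n) (\<lambda>i. u (skip i y) \<otimes>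
       inv altprod G n (\<lambda>j. u (case_nat b (skip j (skip i y)))))"
    by (simp add: x)
  also have "altprod G (Suc n) (\<lambda>i. u (skip i y) \<otimes>
       inv altprod G n (\<lambda>j. u (case_nat b (skip j (skip i y)))))
     = altprod G (Suc n) (\<lambda>i. u (skip i y)) \<otimes>
       inv (altprod G (Suc n) (\<lambda>i. altprod G n (\<lambda>j. u (case_nat b (skip j (skip i y))))))"
    by (rule altprod_div) (auto intro!: ux cX skX y altprod_closed simp del: altprod.simps)
  also have "\<dots> = altprod G (Suc n) (\<lambda>i. u (skip i y))"
    unfolding IH using ux skX y by (simp del: altprod.simps add: altprod_closed)
  finally show ?case
    using ux skX y by (simp del: altprod.simps add: altprod_closed)
qed


section \<open>Homogeneous cochains on sequence space\<close>

context sequence_space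
begin

lemma measurable_skip [measurable]: "skip i \<in> S \<rightarrow>\<^sub>M S"
  unfolding skip_def by (rule measurable_PiM_single') (auto simp: space_PiM PiE_iff)

lemma distr_skip: "distr S S (skip i) = S"
proof -
  have "distr S S (\<lambda>\<omega>. \<lambda>j\<in>UNIV. \<omega> (if j < i then j else Suc j)) = S"
    by (rule distr_PiM_reindex) (auto simp: inj_on_def prob_space_axioms split: if_splits
        intro: M.prob_space_axioms)
  then show ?thesis by (simp add: skip_def[abs_def] restrict_UNIV)
qed

lemma AE_skip: "AE x in S. P x \<Longrightarrow> AE x in S. P (skip i x)"
  by (rule AE_distrD[OF measurable_skip]) (simp only: distr_skip)

lemma nn_integral_skip:
  "g \<in> borel_measurable S \<Longrightarrow> (\<integral>\<^sup>+x. g (skip i x) \<partial>S) = (\<integral>\<^sup>+x. g x \<partial>S)"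
  using nn_integral_distr[OF measurable_skip, of g i] by (simp add: distr_skip)

lemma nn_integral_comb_seq:
  assumes [measurable]: "g \<in> borel_measurable S"
  shows "(\<integral>\<^sup>+x. \<integral>\<^sup>+y. g (comb_seq k x y) \<partial>S \<partial>S) = (\<integral>\<^sup>+x. g x \<partial>S)"
proof -
  have "(\<integral>\<^sup>+x. \<integral>\<^sup>+y. g (comb_seq k x y) \<partial>S \<partial>S) = (\<integral>\<^sup>+z. g (case_prod (comb_seq k) z) \<partial>(S \<Otimes>\<^sub>M S))"
    by (subst P.nn_integral_fst[symmetric]) (simp_all add: split_beta')
  also have "\<dots> = (\<integral>\<^sup>+x. g x \<partial>distr (S \<Otimes>\<^sub>M S) S (case_prod (comb_seq k)))"
    by (subst nn_integral_distr) (simp_all add: measurable_comb_seq)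
  finally show ?thesis by (simp add: PiM_comb_seq)
qed

lemma AE_comb_seq:
  assumes "AE x in S. P x"
  shows "AE x in S. AE y in S. P (comb_seq k x y)"
proof -
  have *: "AE z in S \<Otimes>\<^sub>M S. P (case_prod (comb_seq k) z)"
    by (rule AE_distrD[OF measurable_comb_seq]) (simp only: PiM_comb_seq assms)
  interpret SS: pair_sigma_finite S S ..
  from SS.AE_pair[OF *] show ?thesis by (simp only: prod.case)
qed

lemma nn_integral_case_nat:
  assumes [measurable]: "g \<in> borel_measurable S"
  shows "(\<integral>\<^sup>+b. \<integral>\<^sup>+y. g (case_nat b y) \<partial>S \<partial>M) = (\<integral>\<^sup>+x. g x \<partial>S)"
proof -
  have [measurable]: "(\<lambda>z. case_nat (fst z) (snd z)) \<in> M \<Otimes>\<^sub>M S \<rightarrow>\<^sub>M S"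
    by measurable
  have "(\<integral>\<^sup>+b. \<integral>\<^sup>+y. g (case_nat b y) \<partial>S \<partial>M)
    = (\<integral>\<^sup>+z. g (case_nat (fst z) (snd z)) \<partial>(M \<Otimes>\<^sub>M S))"
    by (subst P.nn_integral_fst[symmetric]) simp_all
  also have "\<dots> = (\<integral>\<^sup>+x. g x \<partial>distr (M \<Otimes>\<^sub>M S) S (\<lambda>(s, \<omega>). case_nat s \<omega>))"
    by (subst nn_integral_distr) (simp_all add: split_beta')
  finally show ?thesis by (simp add: PiM_iter)
qed

lemma space_case_nat: "b \<in> space M \<Longrightarrow> y \<in> space S \<Longrightarrow> case_nat b y \<in> space S"
  by (auto simp: space_PiM PiE_iff split: nat.split)

lemma space_skip: "y \<in> space S \<Longrightarrow> skip i y \<in> space S"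
  by (auto simp: space_PiM PiE_iff skip_def)

lemma space_comb_seq: "x \<in> space S \<Longrightarrow> y \<in> space S \<Longrightarrow> comb_seq k x y \<in> space S"
  by (auto simp: space_PiM PiE_iff comb_seq_def)

text \<open>A set of positive measure is hit by almost every sequence of independent points.\<close>

lemma AE_sequence_hits:
  assumes [measurable]: "E \<in> sets M" and pos: "emeasure M E > 0"
  shows "AE h in S. \<exists>n. h n \<in> E"
proof -
  let ?F = "space M - E"
  have lt: "measure M ?F < 1"
  proof -
    have "measure M E > 0"
      using pos M.emeasure_eq_measure by (simp add: ennreal_less_zero_iff)
    then show ?thesis by (simp add: M.prob_compl)
  qed
  have lim1: "(\<lambda>n. \<Prod>i\<le>n. measure M ?F) \<longlonglongrightarrow> measure S (Pi UNIV (\<lambda>_. ?F))"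
    by (rule measure_PiM_countable) auto
  have "(\<lambda>n. measure M ?F ^ Suc n) \<longlonglongrightarrow> 0"
    by (intro LIMSEQ_Suc LIMSEQ_realpow_zero lt measure_nonneg)
  then have "measure S (Pi UNIV (\<lambda>_. ?F)) = 0"
    using LIMSEQ_unique[OF lim1] by simp
  moreover have "Pi UNIV (\<lambda>_. ?F) \<in> sets S"
    by (rule infprod_in_sets) auto
  ultimately have "Pi UNIV (\<lambda>_. ?F) \<in> null_sets S"
    by (simp add: null_sets_def P.emeasure_eq_measure)
  then show ?thesis
    by (rule AE_I') (auto simp: space_PiM PiE_iff)
qed

text \<open>
  Countably many random points suffice to meet, for almost every parameter at once, a
  measurable family of sets of positive measure. This replaces a measurable selection theorem.
\<close>

lemma exists_hitting_sequence:
  assumes [measurable]: "Measurable.pred (S \<Otimes>\<^sub>M M) (\<lambda>z. Q (fst z) (snd z))"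
    and pos: "\<And>x. x \<in> space S \<Longrightarrow> emeasure M {b \<in> space M. Q x b} > 0"
  obtains h where "h \<in> space S" "AE x in S. \<exists>n. Q x (h n)"
proof -
  interpret SS: pair_sigma_finite S S ..
  have Qx: "Measurable.pred M (Q x)" if "x \<in> space S" for x
    using measurable_compose[OF measurable_Pair1'[OF that] assms(1)] by simp
  have "AE x in S. AE h in S. \<exists>n. Q x (h n)"
  proof (rule AE_I2)
    fix x assume x: "x \<in> space S"
    have "AE h in S. \<exists>n. h n \<in> {b \<in> space M. Q x b}"
      by (rule AE_sequence_hits) (use Qx[OF x] pos[OF x] in auto)
    then show "AE h in S. \<exists>n. Q x (h n)" by auto
  qed
  moreover have [measurable]: "Measurable.pred (S \<Otimes>\<^sub>M S) (\<lambda>z. Q (fst z) (snd z n))" for n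
    using measurable_compose[of "\<lambda>z. (fst z, snd z n)" "S \<Otimes>\<^sub>M S" "S \<Otimes>\<^sub>M M", OF _ assms(1)]
    by simp
  have "{z \<in> space (S \<Otimes>\<^sub>M S). \<exists>n. Q (fst z) (snd z n)} \<in> sets (S \<Otimes>\<^sub>M S)"
    by measurable
  ultimately have "AE h in S. AE x in S. \<exists>n. Q x (h n)"
    using SS.AE_commute[of "\<lambda>x h. \<exists>n. Q x (h n)"] by (simp add: split_beta')
  then have "AE h in S. h \<in> space S \<and> (AE x in S. \<exists>n. Q x (h n))" by auto
  then show thesis
    using that P.AE_contr by blast
qed

end

lemma (in prob_space) emeasure_exceeds_triple_nn_integral:
  assumes [measurable]: "r \<in> borel_measurable M"
  shows "emeasure M {b \<in> space M. \<not> r b \<le> 3 * (\<integral>\<^sup>+b. r b \<partial>M)} \<le> ennreal (1/3)" (is "emeasure M ?N \<le> _")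
proof -
  let ?I = "\<integral>\<^sup>+b. r b \<partial>M"
  consider "?I = 0" | "?I = \<infinity>" | "?I \<noteq> 0" "?I \<noteq> \<infinity>" by blast
  then show ?thesis
  proof cases
    case 1
    then have "AE b in M. r b = 0" by (simp add: nn_integral_0_iff_AE)
    then have "AE b in M. b \<notin> ?N" using 1 by auto
    then have "emeasure M ?N = 0" by (subst emeasure_eq_0_AE) auto
    then show ?thesis by simp
  next
    case 2
    then have "?N = {}" by (auto simp add: ennreal_mult_eq_top_iff top_unique ennreal_mult_top)
    then show ?thesis by (simp only: emeasure_empty zero_le)
  next
    case 3
    have "3 * ?I * emeasure M ?N = (\<integral>\<^sup>+b. 3 * ?I * indicator ?N b \<partial>M)"
      by (subst nn_integral_cmult_indicator) auto
    also have "\<dots> \<le> ?I"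
      by (rule nn_integral_mono) (auto simp: indicator_def)
    finally have le: "3 * ?I * emeasure M ?N \<le> ?I" .
    obtain i m where i: "?I = ennreal i" "i > 0" and m: "emeasure M ?N = ennreal m" "m \<ge> 0"
      using 3 emeasure_eq_measure[of ?N] by (cases ?I) (auto simp: ennreal_zero_less_top)
    have "ennreal (3 * i * m) \<le> ennreal i"
      using le i m by (simp add: ennreal_mult' ennreal_mult)
    then have "3 * i * m \<le> i" using i m by (simp add: ennreal_le_iff)
    then show ?thesis using i m by (simp add: field_simps)
  qed
qed

text \<open>
  By Markov's inequality each of two functions exceeds three times its mean with probability at
  most 1/3. Hence both stay below this bound at the same time with positive probability.
\<close>

lemma (in prob_space) emeasure_two_averages_pos:
  assumes [measurable]: "r \<in> borel_measurable M" "s \<in> borel_measurable M"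
  shows "emeasure M {b \<in> space M. r b \<le> 3 * (\<integral>\<^sup>+b. r b \<partial>M) \<and> s b \<le> 3 * (\<integral>\<^sup>+b. s b \<partial>M)} > 0"
    (is "emeasure M ?P > 0")
proof (rule ccontr)
  let ?N = "\<lambda>r. {b \<in> space M. \<not> r b \<le> 3 * (\<integral>\<^sup>+b. r b \<partial>M)}"
  assume "\<not> emeasure M ?P > 0"
  then have P0: "emeasure M ?P = 0" by (simp add: zero_less_iff_neq_zero)
  have "1 = emeasure M (space M)" by (simp add: emeasure_space_1)
  also have "\<dots> \<le> emeasure M (?P \<union> (?N r \<union> ?N s))"
    by (rule emeasure_mono) auto
  also have "\<dots> \<le> emeasure M ?P + (emeasure M (?N r) + emeasure M (?N s))"
    by (intro order_trans[OF emeasure_subadditive] add_mono emeasure_subadditive) auto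
  also have "\<dots> \<le> 0 + (ennreal (1/3) + ennreal (1/3))"
    using P0 by (intro add_mono emeasure_exceeds_triple_nn_integral assms) auto
  also have "\<dots> = ennreal (2/3)" by (simp flip: ennreal_plus)
  finally show False by (simp add: ennreal_1[symmetric] del: ennreal_1)
qed


locale measurable_module = sequence_space M + H: group H + A: comm_group A
  for M :: "'g measure" and H :: "('g, 'h) monoid_scheme" and A :: "('a, 'b) monoid_scheme"
    and B :: "'a measure" and T :: "'g \<Rightarrow> 'a \<Rightarrow> 'a" +
  assumes space_M: "space M = carrier H"
    and mult_measurable: "(\<lambda>z. fst z \<otimes>\<^bsub>H\<^esub> snd z) \<in> M \<Otimes>\<^sub>M M \<rightarrow>\<^sub>M M"
    and inv_measurable: "(\<lambda>x. inv\<^bsub>H\<^esub> x) \<in> M \<rightarrow>\<^sub>M M"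
    and left_invariant: "g \<in> carrier H \<Longrightarrow> distr M M (\<lambda>x. g \<otimes>\<^bsub>H\<^esub> x) = M"
    and space_B: "space B = carrier A"
    and mult_A_measurable: "(\<lambda>z. fst z \<otimes>\<^bsub>A\<^esub> snd z) \<in> B \<Otimes>\<^sub>M B \<rightarrow>\<^sub>M B"
    and inv_A_measurable: "(\<lambda>a. inv\<^bsub>A\<^esub> a) \<in> B \<rightarrow>\<^sub>M B"
    and action_measurable: "(\<lambda>z. T (fst z) (snd z)) \<in> M \<Otimes>\<^sub>M B \<rightarrow>\<^sub>M B"
    and action_hom: "g \<in> carrier H \<Longrightarrow> T g \<in> hom A A"
    and action_mult: "\<lbrakk>g \<in> carrier H; h \<in> carrier H; a \<in> carrier A\<rbrakk> \<Longrightarrow>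
      T (g \<otimes>\<^bsub>H\<^esub> h) a = T g (T h a)"
    and action_one: "a \<in> carrier A \<Longrightarrow> T \<one>\<^bsub>H\<^esub> a = a"
begin

lemma measurable_mult [measurable (raw)]:
  "\<lbrakk>f \<in> N \<rightarrow>\<^sub>M M; f' \<in> N \<rightarrow>\<^sub>M M\<rbrakk> \<Longrightarrow> (\<lambda>x. f x \<otimes>\<^bsub>H\<^esub> f' x) \<in> N \<rightarrow>\<^sub>M M"
  using measurable_compose[OF measurable_Pair mult_measurable] by simp

lemma measurable_inv [measurable (raw)]:
  "f \<in> N \<rightarrow>\<^sub>M M \<Longrightarrow> (\<lambda>x. inv\<^bsub>H\<^esub> f x) \<in> N \<rightarrow>\<^sub>M M"
  by (rule measurable_compose[OF _ inv_measurable])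

lemma measurable_mult_A [measurable (raw)]:
  "\<lbrakk>f \<in> N \<rightarrow>\<^sub>M B; f' \<in> N \<rightarrow>\<^sub>M B\<rbrakk> \<Longrightarrow> (\<lambda>x. f x \<otimes>\<^bsub>A\<^esub> f' x) \<in> N \<rightarrow>\<^sub>M B"
  using measurable_compose[OF measurable_Pair mult_A_measurable] by simp

lemma measurable_inv_A [measurable (raw)]:
  "f \<in> N \<rightarrow>\<^sub>M B \<Longrightarrow> (\<lambda>x. inv\<^bsub>A\<^esub> f x) \<in> N \<rightarrow>\<^sub>M B"
  by (rule measurable_compose[OF _ inv_A_measurable])

lemma measurable_action [measurable (raw)]:
  "\<lbrakk>f \<in> N \<rightarrow>\<^sub>M M; f' \<in> N \<rightarrow>\<^sub>M B\<rbrakk> \<Longrightarrow> (\<lambda>x. T (f x) (f' x)) \<in> N \<rightarrow>\<^sub>M B"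
  using measurable_compose[OF measurable_Pair action_measurable] by simp

lemma measurable_altprod [measurable (raw)]:
  "(\<And>i. F i \<in> N \<rightarrow>\<^sub>M B) \<Longrightarrow> (\<lambda>x. altprod A n (\<lambda>i. F i x)) \<in> N \<rightarrow>\<^sub>M B"
proof (induction n arbitrary: F)
  case 0
  then show ?case by (simp add: space_B)
next
  case (Suc n)
  show ?case
    using Suc.prems Suc.IH[of "\<lambda>i. F (Suc i)"] by (auto intro: measurable_mult_A measurable_inv_A)
qed

lemma action_closed [simp, intro]: "\<lbrakk>g \<in> carrier H; a \<in> carrier A\<rbrakk> \<Longrightarrow> T g a \<in> carrier A"
  using action_hom by (auto simp: hom_def)

lemma action_group_hom: "g \<in> carrier H \<Longrightarrow> group_hom A A (T g)"
  by unfold_locales (rule action_hom)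

lemma action_prod:
  "\<lbrakk>g \<in> carrier H; a \<in> carrier A; b \<in> carrier A\<rbrakk> \<Longrightarrow> T g (a \<otimes>\<^bsub>A\<^esub> b) = T g a \<otimes>\<^bsub>A\<^esub> T g b"
  using action_hom by (auto simp: hom_def)

lemma action_inv:
  "\<lbrakk>g \<in> carrier H; a \<in> carrier A\<rbrakk> \<Longrightarrow> T g (inv\<^bsub>A\<^esub> a) = inv\<^bsub>A\<^esub> T g a"
  using group_hom.hom_inv[OF action_group_hom] by simp

lemma action_altprod:
  "\<lbrakk>g \<in> carrier H; \<And>i. i < n \<Longrightarrow> F i \<in> carrier A\<rbrakk> \<Longrightarrow>
    T g (altprod A n F) = altprod A n (\<lambda>i. T g (F i))"
  by (rule A.altprod_hom) (auto intro: action_hom)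

abbreviation translate :: "'g \<Rightarrow> (nat \<Rightarrow> 'g) \<Rightarrow> nat \<Rightarrow> 'g" where
  "translate g x \<equiv> \<lambda>j. g \<otimes>\<^bsub>H\<^esub> x j"

lemma space_S_iff: "x \<in> space S \<longleftrightarrow> (\<forall>j. x j \<in> carrier H)"
  by (auto simp: space_PiM PiE_iff space_M)

lemma space_translate: "\<lbrakk>g \<in> carrier H; x \<in> space S\<rbrakk> \<Longrightarrow> translate g x \<in> space S"
  by (simp add: space_S_iff)

lemma measurable_translate [measurable]: "g \<in> carrier H \<Longrightarrow> translate g \<in> S \<rightarrow>\<^sub>M S"
  by (rule measurable_PiM_single') (auto simp: space_M space_S_iff intro!: measurable_mult)

lemma distr_translate: "g \<in> carrier H \<Longrightarrow> distr S S (translate g) = S"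
proof (rule PiM_eq)
  assume g: "g \<in> carrier H"
  have gM [measurable]: "(\<lambda>x. g \<otimes>\<^bsub>H\<^esub> x) \<in> M \<rightarrow>\<^sub>M M"
    using g by (auto intro!: measurable_mult simp: space_M)
  fix J :: "nat set" and F
  assume J: "finite J" "J \<subseteq> UNIV" and F: "\<And>j. j \<in> J \<Longrightarrow> F j \<in> sets M"
  let ?F = "\<lambda>j. (\<lambda>x. g \<otimes>\<^bsub>H\<^esub> x) -` F j \<inter> space M"
  have "translate g -` prod_emb UNIV (\<lambda>_. M) J (Pi\<^sub>E J F) \<inter> space S
      = prod_emb UNIV (\<lambda>_. M) J (Pi\<^sub>E J ?F)"
    using g by (auto simp: prod_emb_def space_PiM PiE_iff space_M)
  then have "emeasure (distr S S (translate g)) (prod_emb UNIV (\<lambda>_. M) J (Pi\<^sub>E J F))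
    = emeasure S (prod_emb UNIV (\<lambda>_. M) J (Pi\<^sub>E J ?F))"
    using J F g by (subst emeasure_distr) (auto intro!: sets_PiM_I)
  also have "\<dots> = (\<Prod>j\<in>J. emeasure M (?F j))"
    using J F by (intro emeasure_PiM_emb) auto
  also have "\<dots> = (\<Prod>j\<in>J. emeasure M (F j))"
  proof (rule prod.cong[OF refl])
    fix j assume "j \<in> J"
    then have "emeasure (distr M M (\<lambda>x. g \<otimes>\<^bsub>H\<^esub> x)) (F j) = emeasure M (?F j)"
      using F by (subst emeasure_distr) auto
    then show "emeasure M (?F j) = emeasure M (F j)"
      using left_invariant[OF g] by simp
  qed
  finally show "emeasure (distr S S (translate g)) (prod_emb UNIV (\<lambda>_. M) J (Pi\<^sub>E J F))
     = (\<Prod>j\<in>J. emeasure M (F j))" .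
qed simp

lemma nn_integral_translate:
  "\<lbrakk>g \<in> carrier H; u \<in> borel_measurable S\<rbrakk> \<Longrightarrow> (\<integral>\<^sup>+x. u (translate g x) \<partial>S) = (\<integral>\<^sup>+x. u x \<partial>S)"
  using nn_integral_distr[OF measurable_translate, of g u] by (simp add: distr_translate)

text \<open>
  A homogeneous cochain is a function on sequences that depends on finitely many entries only;
  in this way all degrees live on one probability space. The two-variable version is a
  bicochain, with \<open>k\<close> entries of the first and \<open>n\<close> entries of the second kind.
\<close>

definition cochain :: "nat \<Rightarrow> ((nat \<Rightarrow> 'g) \<Rightarrow> 'a) \<Rightarrow> bool" where
  "cochain n f \<longleftrightarrow> f \<in> S \<rightarrow>\<^sub>M B \<and>
     (\<forall>g\<in>carrier H. \<forall>x\<in>space S. f (translate g x) = T g (f x)) \<and>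
     (\<forall>x x'. (\<forall>j<n. x j = x' j) \<longrightarrow> f x = f x')"

definition bicochain :: "nat \<Rightarrow> nat \<Rightarrow> ((nat \<Rightarrow> 'g) \<Rightarrow> (nat \<Rightarrow> 'g) \<Rightarrow> 'a) \<Rightarrow> bool" where
  "bicochain k n u \<longleftrightarrow> (\<lambda>z. u (fst z) (snd z)) \<in> S \<Otimes>\<^sub>M S \<rightarrow>\<^sub>M B \<and>
     (\<forall>g\<in>carrier H. \<forall>x\<in>space S. \<forall>y\<in>space S. u (translate g x) (translate g y) = T g (u x y)) \<and>
     (\<forall>x x' y y'. (\<forall>j<k. x j = x' j) \<longrightarrow> (\<forall>j<n. y j = y' j) \<longrightarrow> u x y = u x' y')"

abbreviation d :: "nat \<Rightarrow> ((nat \<Rightarrow> 'g) \<Rightarrow> 'a) \<Rightarrow> (nat \<Rightarrow> 'g) \<Rightarrow> 'a" where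
  "d n f \<equiv> \<lambda>x. altprod A n (\<lambda>i. f (skip i x))"

abbreviation dx :: "nat \<Rightarrow> ((nat \<Rightarrow> 'g) \<Rightarrow> (nat \<Rightarrow> 'g) \<Rightarrow> 'a) \<Rightarrow> (nat \<Rightarrow> 'g) \<Rightarrow> (nat \<Rightarrow> 'g) \<Rightarrow> 'a" where
  "dx n u \<equiv> \<lambda>x y. altprod A n (\<lambda>i. u (skip i x) y)"

abbreviation dy :: "nat \<Rightarrow> ((nat \<Rightarrow> 'g) \<Rightarrow> (nat \<Rightarrow> 'g) \<Rightarrow> 'a) \<Rightarrow> (nat \<Rightarrow> 'g) \<Rightarrow> (nat \<Rightarrow> 'g) \<Rightarrow> 'a" where
  "dy n u \<equiv> \<lambda>x y. altprod A n (\<lambda>i. u x (skip i y))"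

lemma cochain_measurable: "cochain n f \<Longrightarrow> f \<in> S \<rightarrow>\<^sub>M B"
  by (simp add: cochain_def)

lemma bicochain_measurable: "bicochain k n u \<Longrightarrow> (\<lambda>z. u (fst z) (snd z)) \<in> S \<Otimes>\<^sub>M S \<rightarrow>\<^sub>M B"
  by (simp add: bicochain_def)

lemma bicochain_measurable2:
  "\<lbrakk>bicochain k n u; f \<in> N \<rightarrow>\<^sub>M S; f' \<in> N \<rightarrow>\<^sub>M S\<rbrakk> \<Longrightarrow> (\<lambda>z. u (f z) (f' z)) \<in> N \<rightarrow>\<^sub>M B"
  using measurable_compose[OF measurable_Pair bicochain_measurable] by simp

lemma cochain_closed: "\<lbrakk>cochain n f; x \<in> space S\<rbrakk> \<Longrightarrow> f x \<in> carrier A"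
  using measurable_space[OF cochain_measurable] space_B by blast

lemma bicochain_closed: "\<lbrakk>bicochain k n u; x \<in> space S; y \<in> space S\<rbrakk> \<Longrightarrow> u x y \<in> carrier A"
  using measurable_space[OF bicochain_measurable, of k n u "(x, y)"] space_B
  by (simp add: space_pair_measure)

lemma cochain_equivariant:
  "\<lbrakk>cochain n f; g \<in> carrier H; x \<in> space S\<rbrakk> \<Longrightarrow> f (translate g x) = T g (f x)"
  by (simp add: cochain_def)

lemma bicochain_equivariant:
  "\<lbrakk>bicochain k n u; g \<in> carrier H; x \<in> space S; y \<in> space S\<rbrakk> \<Longrightarrow>
    u (translate g x) (translate g y) = T g (u x y)"
  by (simp add: bicochain_def)

lemma bicochain_depends:
  "\<lbrakk>bicochain k n u; \<And>j. j < k \<Longrightarrow> x j = x' j; \<And>j. j < n \<Longrightarrow> y j = y' j\<rbrakk> \<Longrightarrow> u x y = u x' y'"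
  by (simp add: bicochain_def)

lemma cochain_one: "cochain n (\<lambda>_. \<one>\<^bsub>A\<^esub>)"
  using group_hom.hom_one[OF action_group_hom] by (auto simp: cochain_def space_B)

lemma cochain_mult: "\<lbrakk>cochain n f; cochain n f'\<rbrakk> \<Longrightarrow> cochain n (\<lambda>x. f x \<otimes>\<^bsub>A\<^esub> f' x)"
  using cochain_closed[of n f] cochain_closed[of n f'] unfolding cochain_def
  by (auto simp: action_prod intro!: arg_cong2[of _ _ _ _ "mult A"])

lemma cochain_inv: "cochain n f \<Longrightarrow> cochain n (\<lambda>x. inv\<^bsub>A\<^esub> f x)"
  using cochain_closed[of n f] unfolding cochain_def
  by (auto simp: action_inv intro!: arg_cong[of _ _ "m_inv A"])

lemma skip_translate: "skip i (translate g x) = translate g (skip i x)"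
  by (simp add: skip_def)

lemma cochain_d: "cochain n f \<Longrightarrow> cochain (Suc n) (d m f)"
  using cochain_closed[of n f] unfolding cochain_def
  by (auto simp: skip_translate action_altprod space_skip intro!: altprod_cong)
     (auto simp: skip_def)

lemma bicochain_one: "bicochain k n (\<lambda>_ _. \<one>\<^bsub>A\<^esub>)"
  using group_hom.hom_one[OF action_group_hom] by (auto simp: bicochain_def space_B)

lemma bicochain_div:
  "\<lbrakk>bicochain k n u; bicochain k n u'\<rbrakk> \<Longrightarrow> bicochain k n (\<lambda>x y. u x y \<otimes>\<^bsub>A\<^esub> inv\<^bsub>A\<^esub> u' x y)"
  using bicochain_closed[of k n u] bicochain_closed[of k n u'] unfolding bicochain_def
  by (auto simp: action_prod action_inv
      intro!: arg_cong2[of _ _ _ _ "\<lambda>a b. a \<otimes>\<^bsub>A\<^esub> inv\<^bsub>A\<^esub> b"])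

lemma bicochain_inv: "bicochain k n u \<Longrightarrow> bicochain k n (\<lambda>x y. inv\<^bsub>A\<^esub> u x y)"
  using bicochain_closed[of k n u] unfolding bicochain_def
  by (auto simp: action_inv intro!: arg_cong[of _ _ "m_inv A"])

lemma bicochain_dx: 
  assumes u: "bicochain k n u"
  shows "bicochain (Suc k) n (dx m u)"
proof -
  note [measurable] = bicochain_measurable2[OF u]
  have "(\<lambda>z. dx m u (fst z) (snd z)) \<in> S \<Otimes>\<^sub>M S \<rightarrow>\<^sub>M B"
    by measurable
  then show ?thesis
    using bicochain_closed[OF u] bicochain_equivariant[OF u] unfolding bicochain_def
    by (auto simp: skip_translate action_altprod space_skip intro!: altprod_cong bicochain_depends[OF u])
       (auto simp: skip_def)
qed

lemma bicochain_comb_seq: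
  assumes f: "cochain (k + n) f"
  shows "bicochain k n (\<lambda>x y. f (comb_seq k x y))"
proof -
  note [measurable] = cochain_measurable[OF f]
  have "comb_seq k (translate g x) (translate g y) = translate g (comb_seq k x y)" for g x y
    by (auto simp: comb_seq_def)
  then show ?thesis
    using f unfolding cochain_def bicochain_def
    by (auto simp: space_comb_seq) (auto simp: comb_seq_def)
qed

end


locale length_module = measurable_module M H A B T
  for M :: "'g measure" and H :: "('g, 'h) monoid_scheme" and A :: "('a, 'b) monoid_scheme"
    and B :: "'a measure" and T :: "'g \<Rightarrow> 'a \<Rightarrow> 'a" +
  fixes len :: "'a \<Rightarrow> ennreal"
  assumes len_measurable: "len \<in> borel_measurable B"
    and len_one: "len \<one>\<^bsub>A\<^esub> = 0"
    and len_mult: "\<lbrakk>a \<in> carrier A; b \<in> carrier A\<rbrakk> \<Longrightarrow> len (a \<otimes>\<^bsub>A\<^esub> b) \<le> len a + len b"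
    and len_inv: "a \<in> carrier A \<Longrightarrow> len (inv\<^bsub>A\<^esub> a) = len a"
    and len_action: "\<lbrakk>g \<in> carrier H; a \<in> carrier A\<rbrakk> \<Longrightarrow> len (T g a) = len a"

text \<open>
  A step from \<open>k\<close> to \<open>k + 1\<close> loses a factor 3 in the choice of a point and adds \<open>k + 2\<close> faces of
  the new correction to the cochain \<open>F\<close>, whose mean length is the unit.
\<close>

primrec zigzag_const :: "nat \<Rightarrow> ennreal" where
  "zigzag_const 0 = 1"
| "zigzag_const (Suc k) = 1 + of_nat (Suc (Suc k)) * (3 * zigzag_const k)"

lemma zigzag_const_less_top: "zigzag_const k < \<infinity>"
  by (induction k) (auto simp: ennreal_mult_less_top of_nat_less_top simp del: of_nat_Suc)

lemma zigzag_const_mono: "3 * zigzag_const k \<le> zigzag_const (Suc k)"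
proof -
  have "1 * (3 * zigzag_const k) \<le> of_nat (Suc (Suc k)) * (3 * zigzag_const k)"
    by (intro mult_right_mono) auto
  then show ?thesis by (simp add: add_increasing del: of_nat_Suc)
qed

context length_module
begin

lemma measurable_len [measurable (raw)]:
  "f \<in> N \<rightarrow>\<^sub>M B \<Longrightarrow> (\<lambda>x. len (f x)) \<in> borel_measurable N"
  by (rule measurable_compose[OF _ len_measurable])

lemma len_div: "\<lbrakk>a \<in> carrier A; b \<in> carrier A\<rbrakk> \<Longrightarrow> len (a \<otimes>\<^bsub>A\<^esub> inv\<^bsub>A\<^esub> b) \<le> len a + len b"
  using len_mult[of a "inv\<^bsub>A\<^esub> b"] by (simp add: len_inv)

lemma len_altprod:
  "(\<And>i. i < n \<Longrightarrow> F i \<in> carrier A) \<Longrightarrow> len (altprod A n F) \<le> (\<Sum>i<n. len (F i))"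
proof (induction n arbitrary: F)
  case (Suc n)
  have "len (altprod A (Suc n) F) \<le> len (F 0) + len (altprod A n (\<lambda>i. F (Suc i)))"
    using Suc.prems by (simp add: len_div)
  also have "\<dots> \<le> len (F 0) + (\<Sum>i<n. len (F (Suc i)))"
    using Suc by (intro add_left_mono) simp
  finally show ?case by (simp add: sum.lessThan_Suc_shift del: sum.lessThan_Suc)
qed (simp add: len_one)

text \<open>
  Stage \<open>k\<close> of the zigzag. Up to sign, \<open>F\<close> is the cocycle \<open>f\<close> whose first \<open>k + 1\<close> arguments
  have been separated from the others, and \<open>v\<close> corrects it to \<open>u\<close>. The point is the first bound,
  which holds for almost every \<open>x\<close> and not only in mean.
\<close>

definition stage ::
  "((nat \<Rightarrow> 'g) \<Rightarrow> 'a) \<Rightarrow> nat \<Rightarrow> ennreal \<Rightarrow> nat \<Rightarrow> ((nat \<Rightarrow> 'g) \<Rightarrow> (nat \<Rightarrow> 'g) \<Rightarrow> 'a) \<Rightarrow>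
     ((nat \<Rightarrow> 'g) \<Rightarrow> (nat \<Rightarrow> 'g) \<Rightarrow> 'a) \<Rightarrow> ((nat \<Rightarrow> 'g) \<Rightarrow> (nat \<Rightarrow> 'g) \<Rightarrow> 'a) \<Rightarrow> bool" where
  "stage f p \<epsilon> k F u v \<longleftrightarrow>
     (F = (\<lambda>x y. f (comb_seq (Suc k) x y)) \<or> F = (\<lambda>x y. inv\<^bsub>A\<^esub> f (comb_seq (Suc k) x y))) \<and>
     bicochain k (p - k) v \<and>
     u = (\<lambda>x y. F x y \<otimes>\<^bsub>A\<^esub> inv\<^bsub>A\<^esub> dx (Suc k) v x y) \<and>
     (AE x in S. (\<integral>\<^sup>+y. len (dy (Suc (p - k)) u x y) \<partial>S) \<le> zigzag_const k * \<epsilon>) \<and>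
     (\<integral>\<^sup>+x. \<integral>\<^sup>+y. len (u x y) \<partial>S \<partial>S) \<le> zigzag_const k * \<epsilon> \<and>
     (\<integral>\<^sup>+x. \<integral>\<^sup>+y. len (v x y) \<partial>S \<partial>S) \<le> zigzag_const k * \<epsilon>"

lemma bicochain_signed_comb_seq:
  assumes f: "cochain (k + n) f"
    and F: "F = (\<lambda>x y. f (comb_seq k x y)) \<or> F = (\<lambda>x y. inv\<^bsub>A\<^esub> f (comb_seq k x y))"
  shows "bicochain k n F"
  using F bicochain_comb_seq[OF f] bicochain_inv[OF bicochain_comb_seq[OF f]] by auto

text \<open>
  The cocycle identity with the first argument split off says that the coboundary in the
  remaining arguments is \<open>f\<close> again, which no longer depends on the split argument.
\<close>

lemma stage_0:
  assumes f: "cochain (Suc p) f" and cocycle: "AE x in S. d (Suc (Suc p)) f x = \<one>\<^bsub>A\<^esub>"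
    and small: "(\<integral>\<^sup>+x. len (f x) \<partial>S) \<le> \<epsilon>"
  shows "\<exists>F u v. stage f p \<epsilon> 0 F u v"
proof -
  note [measurable] = cochain_measurable[OF f]
  let ?F = "\<lambda>x y. f (comb_seq (Suc 0) x y)"
  have F: "bicochain (Suc 0) p ?F"
    using bicochain_comb_seq[of 1 p f] f by simp
  note [measurable] = bicochain_measurable2[OF F]
  have Fcl: "x \<in> space S \<Longrightarrow> y \<in> space S \<Longrightarrow> ?F x y \<in> carrier A" for x y
    using bicochain_closed[OF F] by simp
  have "AE x in S. AE y in S. d (Suc (Suc p)) f (comb_seq 1 x y) = \<one>\<^bsub>A\<^esub>"
    by (rule AE_comb_seq[OF cocycle])
  then have "AE x in S. (\<integral>\<^sup>+y. len (dy (Suc p) ?F x y) \<partial>S) \<le> \<epsilon>"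
  proof (rule AE_mp, intro AE_I2 impI)
    fix x assume x: "x \<in> space S"
      and ae: "AE y in S. d (Suc (Suc p)) f (comb_seq 1 x y) = \<one>\<^bsub>A\<^esub>"
    have "AE y in S. len (dy (Suc p) ?F x y) = len (f y)"
      using ae
    proof (rule AE_mp, intro AE_I2 impI)
      fix y assume y: "y \<in> space S" and eq: "d (Suc (Suc p)) f (comb_seq 1 x y) = \<one>\<^bsub>A\<^esub>"
      have "f y \<otimes>\<^bsub>A\<^esub> inv\<^bsub>A\<^esub> dy (Suc p) ?F x y = \<one>\<^bsub>A\<^esub>"
        using eq by simp
      then show "len (dy (Suc p) ?F x y) = len (f y)"
        using x y Fcl cochain_closed[OF f] space_skip
        by (subst (asm) A.div_eq_one_iff) (auto simp del: altprod.simps intro: A.altprod_closed)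
    qed
    then have "(\<integral>\<^sup>+y. len (dy (Suc p) ?F x y) \<partial>S) = (\<integral>\<^sup>+y. len (f y) \<partial>S)"
      by (rule nn_integral_cong_AE)
    with small show "(\<integral>\<^sup>+y. len (dy (Suc p) ?F x y) \<partial>S) \<le> \<epsilon>" by (simp del: altprod.simps)
  qed
  moreover have "(\<integral>\<^sup>+x. \<integral>\<^sup>+y. len (?F x y) \<partial>S \<partial>S) \<le> \<epsilon>"
    using small by (subst nn_integral_comb_seq[of "\<lambda>x. len (f x)"]) auto
  moreover have "?F x y \<otimes>\<^bsub>A\<^esub> inv\<^bsub>A\<^esub> dx (Suc 0) (\<lambda>_ _. \<one>\<^bsub>A\<^esub>) x y = ?F x y"
    if "x \<in> space S" "y \<in> space S" for x y
    using Fcl that by simp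
  then have "(\<integral>\<^sup>+x. \<integral>\<^sup>+y. len (?F x y \<otimes>\<^bsub>A\<^esub> inv\<^bsub>A\<^esub> dx (Suc 0) (\<lambda>_ _. \<one>\<^bsub>A\<^esub>) x y) \<partial>S \<partial>S)
     = (\<integral>\<^sup>+x. \<integral>\<^sup>+y. len (?F x y) \<partial>S \<partial>S)"
    "\<And>x. x \<in> space S \<Longrightarrow> (\<integral>\<^sup>+y. len (dy (Suc p) (\<lambda>x y. ?F x y \<otimes>\<^bsub>A\<^esub> inv\<^bsub>A\<^esub> dx (Suc 0) (\<lambda>_ _. \<one>\<^bsub>A\<^esub>) x y) x y) \<partial>S)
      = (\<integral>\<^sup>+y. len (dy (Suc p) ?F x y) \<partial>S)"
    by (auto intro!: nn_integral_cong arg_cong[of _ _ len] altprod_cong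
        simp del: altprod.simps comb_seq_Suc_0 simp: space_skip)
  ultimately have "stage f p \<epsilon> 0 ?F (\<lambda>x y. ?F x y \<otimes>\<^bsub>A\<^esub> inv\<^bsub>A\<^esub> dx (Suc 0) (\<lambda>_ _. \<one>\<^bsub>A\<^esub>) x y) (\<lambda>_ _. \<one>\<^bsub>A\<^esub>)"
    unfolding stage_def
    by (auto simp: bicochain_one len_one simp del: altprod.simps comb_seq_Suc_0 cong: AE_cong_simp)
  then show ?thesis by blast
qed

text \<open>
  The set of good points \<open>b\<close> for given \<open>x\<close> has positive measure. The candidates are the points
  \<open>x 0\<close> times \<open>h n\<close> for one fixed sequence \<open>h\<close>, and the first good one is taken: since the
  condition on \<open>h n\<close> is invariant under translation of \<open>x\<close>, the choice is equivariant.
\<close>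

lemma equivariant_choice:
  assumes u: "bicochain (Suc k) (Suc m) u"
  obtains b where "b \<in> S \<rightarrow>\<^sub>M M"
    and "bicochain (Suc k) m (\<lambda>x y. u x (case_nat (b x) y))"
    and "AE x in S.
      (\<integral>\<^sup>+y. len (dy n u x (case_nat (b x) y)) \<partial>S) \<le> 3 * (\<integral>\<^sup>+y. len (dy n u x y) \<partial>S) \<and>
      (\<integral>\<^sup>+y. len (u x (case_nat (b x) y)) \<partial>S) \<le> 3 * (\<integral>\<^sup>+y. len (u x y) \<partial>S)"
proof -
  note [measurable] = bicochain_measurable2[OF u]
  define r where "r = (\<lambda>x b. \<integral>\<^sup>+y. len (dy n u x (case_nat b y)) \<partial>S)"
  define s where "s = (\<lambda>x b. \<integral>\<^sup>+y. len (u x (case_nat b y)) \<partial>S)"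
  define rr where "rr = (\<lambda>x. \<integral>\<^sup>+y. len (dy n u x y) \<partial>S)"
  define ss where "ss = (\<lambda>x. \<integral>\<^sup>+y. len (u x y) \<partial>S)"
  define Q where "Q = (\<lambda>x h. r x (x 0 \<otimes>\<^bsub>H\<^esub> h) \<le> 3 * rr x \<and> s x (x 0 \<otimes>\<^bsub>H\<^esub> h) \<le> 3 * ss x)"
  have rm [measurable]: "(\<lambda>z. r (f z) (f' z)) \<in> borel_measurable N"
    if [measurable]: "f \<in> N \<rightarrow>\<^sub>M S" "f' \<in> N \<rightarrow>\<^sub>M M" for f f' and N :: "'z measure"
    unfolding r_def by measurable
  have sm [measurable]: "(\<lambda>z. s (f z) (f' z)) \<in> borel_measurable N"
    if [measurable]: "f \<in> N \<rightarrow>\<^sub>M S" "f' \<in> N \<rightarrow>\<^sub>M M" for f f' and N :: "'z measure"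
    unfolding s_def by measurable
  have [measurable]: "rr \<in> borel_measurable S" "ss \<in> borel_measurable S"
    unfolding rr_def ss_def by measurable
  have Qm [measurable]: "Measurable.pred (S \<Otimes>\<^sub>M M) (\<lambda>z. Q (fst z) (snd z))"
    unfolding Q_def by measurable
  have ru: "(\<lambda>y. len (dy n u x y)) \<in> borel_measurable S"
    and su: "(\<lambda>y. len (u x y)) \<in> borel_measurable S" if x: "x \<in> space S" for x
  proof -
    have [measurable]: "(\<lambda>_. x) \<in> S \<rightarrow>\<^sub>M S" using x by simp
    show "(\<lambda>y. len (dy n u x y)) \<in> borel_measurable S"
      and "(\<lambda>y. len (u x y)) \<in> borel_measurable S" by measurable
  qed
  have rrr: "(\<integral>\<^sup>+b. r x b \<partial>M) = rr x" "(\<integral>\<^sup>+b. s x b \<partial>M) = ss x" if x: "x \<in> space S" for x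
    unfolding r_def s_def rr_def ss_def
    by (rule nn_integral_case_nat[OF ru[OF x]], rule nn_integral_case_nat[OF su[OF x]])
  have pos: "emeasure M {h \<in> space M. Q x h} > 0" if x: "x \<in> space S" for x
  proof -
    have [measurable]: "(\<lambda>_. x) \<in> M \<rightarrow>\<^sub>M S" using x by simp
    have x0: "x 0 \<in> carrier H" using x by (simp add: space_S_iff)
    then have [measurable]: "(\<lambda>h. x 0 \<otimes>\<^bsub>H\<^esub> h) \<in> M \<rightarrow>\<^sub>M M"
      by (auto intro!: measurable_mult simp: space_M)
    let ?E = "{b \<in> space M. r x b \<le> 3 * rr x \<and> s x b \<le> 3 * ss x}"
    have "0 < emeasure M ?E"
      using M.emeasure_two_averages_pos[of "r x" "s x"] by (simp add: rrr[OF x])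
    also have "emeasure M ?E = emeasure (distr M M (\<lambda>h. x 0 \<otimes>\<^bsub>H\<^esub> h)) ?E"
      by (simp add: left_invariant[OF x0])
    also have "\<dots> = emeasure M ((\<lambda>h. x 0 \<otimes>\<^bsub>H\<^esub> h) -` ?E \<inter> space M)"
      by (subst emeasure_distr) auto
    also have "(\<lambda>h. x 0 \<otimes>\<^bsub>H\<^esub> h) -` ?E \<inter> space M = {h \<in> space M. Q x h}"
      using x0 by (auto simp: Q_def space_M)
    finally show ?thesis .
  qed
  obtain h where h: "h \<in> space S" and hits: "AE x in S. \<exists>n. Q x (h n)"
    using exists_hitting_sequence[of Q] pos by auto
  define b where "b = (\<lambda>x. x 0 \<otimes>\<^bsub>H\<^esub> h (LEAST n. Q x (h n)))"
  have [measurable]: "h \<in> count_space UNIV \<rightarrow>\<^sub>M M"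
    using h by (auto simp: space_S_iff space_M)
  have [measurable]: "Measurable.pred S (\<lambda>x. Q x (h n))" for n
  proof -
    have "(\<lambda>x. (x, h n)) \<in> S \<rightarrow>\<^sub>M S \<Otimes>\<^sub>M M" using h by (simp add: space_S_iff space_M)
    from measurable_compose[OF this Qm] show ?thesis by simp
  qed
  have b [measurable]: "b \<in> S \<rightarrow>\<^sub>M M"
    unfolding b_def by measurable
  have bsp: "b x \<in> carrier H" if "x \<in> space S" for x
    using measurable_space[OF b that] by (simp add: space_M)
  have Qt: "Q (translate g x) a \<longleftrightarrow> Q x a"
    if g: "g \<in> carrier H" and x: "x \<in> space S" and a: "a \<in> carrier H" for g x a
  proof -
    have gx: "translate g x \<in> space S" using g x by (rule space_translate)
    have x0: "x 0 \<in> carrier H" using x by (simp add: space_S_iff)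
    have leneq: "len (u (translate g x) (translate g y)) = len (u x y)"
        "len (dy n u (translate g x) (translate g y)) = len (dy n u x y)" if "y \<in> space S" for y
      using x g that
      by (simp_all add: bicochain_equivariant[OF u] skip_translate space_skip bicochain_closed[OF u]
          action_altprod[symmetric] len_action)
    have cn: "case_nat (translate g x 0 \<otimes>\<^bsub>H\<^esub> a) (translate g y) = translate g (case_nat (x 0 \<otimes>\<^bsub>H\<^esub> a) y)"
      for y using g x0 a by (auto simp: H.m_assoc fun_eq_iff split: nat.split)
    have cm: "(\<lambda>y. case_nat c y) \<in> S \<rightarrow>\<^sub>M S" if "c \<in> carrier H" for c
    proof -
      have [measurable]: "(\<lambda>_. c) \<in> S \<rightarrow>\<^sub>M M" using that by (simp add: space_M)
      show ?thesis by measurable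
    qed
    have "rr (translate g x) = rr x" "ss (translate g x) = ss x"
      unfolding rr_def ss_def
      using nn_integral_translate[OF g ru[OF gx]] nn_integral_translate[OF g su[OF gx]]
      by (simp_all add: leneq cong: nn_integral_cong)
    moreover have "r (translate g x) (translate g x 0 \<otimes>\<^bsub>H\<^esub> a) = r x (x 0 \<otimes>\<^bsub>H\<^esub> a)"
        "s (translate g x) (translate g x 0 \<otimes>\<^bsub>H\<^esub> a) = s x (x 0 \<otimes>\<^bsub>H\<^esub> a)"
      unfolding r_def s_def
      using nn_integral_translate[OF g measurable_compose[OF cm ru[OF gx]], of "translate g x 0 \<otimes>\<^bsub>H\<^esub> a"]
        nn_integral_translate[OF g measurable_compose[OF cm su[OF gx]], of "translate g x 0 \<otimes>\<^bsub>H\<^esub> a"]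
        g x0 a
      unfolding cn
      by (simp_all add: leneq space_case_nat space_M cong: nn_integral_cong)
    ultimately show ?thesis by (simp add: Q_def)
  qed
  have bt: "b (translate g x) = g \<otimes>\<^bsub>H\<^esub> b x" if g: "g \<in> carrier H" and x: "x \<in> space S" for g x
  proof -
    have hn: "h n \<in> carrier H" for n using h by (simp add: space_S_iff)
    then show ?thesis
      using x by (simp add: b_def Qt[OF g x hn] H.m_assoc g space_S_iff)
  qed
  have uu: "u x = u x'" if "\<And>j. j < Suc k \<Longrightarrow> x j = x' j" for x x'
    by (rule ext, rule bicochain_depends[OF u]) (use that in auto)
  have bb: "b x = b x'" if a: "\<And>j. j < Suc k \<Longrightarrow> x j = x' j" for x x'
  proof -
    have "Q x = Q x'" "x 0 = x' 0"
      using uu[of x x', OF a] a by (auto simp: Q_def r_def s_def rr_def ss_def fun_eq_iff)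
    then show ?thesis by (simp add: b_def)
  qed
  have "bicochain (Suc k) m (\<lambda>x y. u x (case_nat (b x) y))"
    unfolding bicochain_def
  proof (intro conjI ballI allI impI)
    show "(\<lambda>z. u (fst z) (case_nat (b (fst z)) (snd z))) \<in> S \<Otimes>\<^sub>M S \<rightarrow>\<^sub>M B"
      by measurable
  next
    fix g x y assume g: "g \<in> carrier H" and x: "x \<in> space S" and y: "y \<in> space S"
    have "case_nat (b (translate g x)) (translate g y) = translate g (case_nat (b x) y)"
      using bt[OF g x] by (auto simp: fun_eq_iff split: nat.split)
    then show "u (translate g x) (case_nat (b (translate g x)) (translate g y)) = T g (u x (case_nat (b x) y))"
      using bicochain_equivariant[OF u g x, of "case_nat (b x) y"] x y bsp
      by (simp add: space_case_nat space_M)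
  next
    fix x x' y y' :: "nat \<Rightarrow> 'g"
    assume "\<forall>j<Suc k. x j = x' j" and y: "\<forall>j<m. y j = y' j"
    then have "u x = u x'" "b x = b x'" using uu[of x x'] bb[of x x'] by auto
    moreover have "u x' (case_nat (b x') y) = u x' (case_nat (b x') y')"
      by (rule bicochain_depends[OF u]) (use y in \<open>auto split: nat.split\<close>)
    ultimately show "u x (case_nat (b x) y) = u x' (case_nat (b x') y')" by simp
  qed
  moreover have "AE x in S. Q x (h (LEAST n. Q x (h n)))"
    using hits by (rule AE_mp) (intro AE_I2 impI LeastI_ex[of "\<lambda>n. Q x (h n)" for x])
  then have "AE x in S. r x (b x) \<le> 3 * rr x \<and> s x (b x) \<le> 3 * ss x"
    by (simp add: Q_def b_def)
  ultimately show thesis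
    using that[OF b] unfolding r_def s_def rr_def ss_def by blast
qed

end


lemma (in sequence_space) AE_AE_mp:
  assumes "AE x in S. AE y in S. P x y"
    and imp: "\<And>x y. \<lbrakk>x \<in> space S; y \<in> space S; P x y\<rbrakk> \<Longrightarrow> Q x y"
  shows "AE x in S. AE y in S. Q x y"
proof (rule AE_mp[OF assms(1)], rule AE_I2, rule impI)
  fix x assume x: "x \<in> space S" and "AE y in S. P x y"
  from this(2) show "AE y in S. Q x y"
    by (rule AE_mp) (intro AE_I2 impI imp x)
qed

context length_module
begin

declare space_skip [simp] space_comb_seq [simp]

text \<open>
  Inserting a well chosen point \<open>b x\<close> into \<open>u\<close> gives \<open>v'\<close>, and \<open>u - dy v'\<close> is \<open>dy u\<close> with the point
  inserted, so it is small for almost every \<open>x\<close>. By the cocycle identity for \<open>f\<close> and because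
  \<open>dx\<close> applied twice is trivial, \<open>dy\<close> of the next \<open>u'\<close> is up to sign \<open>dx\<close> of this small function.
\<close>

lemma stage_Suc:
  assumes f: "cochain (Suc p) f" and cocycle: "AE x in S. d (Suc (Suc p)) f x = \<one>\<^bsub>A\<^esub>"
    and small: "(\<integral>\<^sup>+x. len (f x) \<partial>S) \<le> \<epsilon>" and k: "k < p" and st: "stage f p \<epsilon> k F u v"
  shows "\<exists>F' u' v'. stage f p \<epsilon> (Suc k) F' u' v'"
proof -
  note [measurable] = cochain_measurable[OF f]
  define m where "m = p - Suc k"
  have pk: "p - k = Suc m" and pm: "p - Suc k = m" and p: "p = Suc k + m" using k by (auto simp: m_def)
  have Fdef: "F = (\<lambda>x y. f (comb_seq (Suc k) x y)) \<or> F = (\<lambda>x y. inv\<^bsub>A\<^esub> f (comb_seq (Suc k) x y))"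
    and v: "bicochain k (Suc m) v" and udef: "u = (\<lambda>x y. F x y \<otimes>\<^bsub>A\<^esub> inv\<^bsub>A\<^esub> dx (Suc k) v x y)"
    and small_dy: "AE x in S. (\<integral>\<^sup>+y. len (dy (Suc (Suc m)) u x y) \<partial>S) \<le> zigzag_const k * \<epsilon>"
    and small_u: "(\<integral>\<^sup>+x. \<integral>\<^sup>+y. len (u x y) \<partial>S \<partial>S) \<le> zigzag_const k * \<epsilon>"
    using st unfolding stage_def pk by blast+
  have F: "bicochain (Suc k) (Suc m) F"
    by (rule bicochain_signed_comb_seq[OF _ Fdef]) (use f in \<open>simp add: p\<close>)
  have u: "bicochain (Suc k) (Suc m) u"
    unfolding udef by (intro bicochain_div F bicochain_dx v)
  note [measurable] = bicochain_measurable2[OF u]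
  obtain b where [measurable]: "b \<in> S \<rightarrow>\<^sub>M M"
    and v': "bicochain (Suc k) m (\<lambda>x y. u x (case_nat (b x) y))"
    and choice: "AE x in S.
      (\<integral>\<^sup>+y. len (dy (Suc (Suc m)) u x (case_nat (b x) y)) \<partial>S) \<le> 3 * (\<integral>\<^sup>+y. len (dy (Suc (Suc m)) u x y) \<partial>S) \<and>
      (\<integral>\<^sup>+y. len (u x (case_nat (b x) y)) \<partial>S) \<le> 3 * (\<integral>\<^sup>+y. len (u x y) \<partial>S)"
    by (rule equivariant_choice[OF u, of "Suc (Suc m)"])
  define v' where "v' = (\<lambda>x y. u x (case_nat (b x) y))"
  have v': "bicochain (Suc k) m v'" using v' by (simp add: v'_def)
  note [measurable] = bicochain_measurable2[OF v']
  define w where "w = (\<lambda>x y. u x y \<otimes>\<^bsub>A\<^esub> inv\<^bsub>A\<^esub> dy (Suc m) v' x y)"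
  have wm [measurable]: "(\<lambda>z. w (g z) (g' z)) \<in> N \<rightarrow>\<^sub>M B" 
    if [measurable]: "g \<in> N \<rightarrow>\<^sub>M S" "g' \<in> N \<rightarrow>\<^sub>M S" for g g' and N :: "'z measure"
    unfolding w_def by measurable
  have cl: "F x y \<in> carrier A" "u x y \<in> carrier A" "v x y \<in> carrier A" "v' x y \<in> carrier A"
    if "x \<in> space S" "y \<in> space S" for x y
    by (rule bicochain_closed[OF F that] bicochain_closed[OF u that] bicochain_closed[OF v that]
      bicochain_closed[OF v' that])+
  have wcl: "w x y \<in> carrier A" if "x \<in> space S" "y \<in> space S" for x y
    unfolding w_def using that
    by (intro A.m_closed A.inv_closed A.altprod_closed cl space_skip)
  have small_w: "AE x in S. (\<integral>\<^sup>+y. len (w x y) \<partial>S) \<le> 3 * zigzag_const k * \<epsilon>"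
    using choice small_dy
  proof eventually_elim
    case (elim x)
    have "dy (Suc (Suc m)) u x (case_nat (b x) y) = w x y" for y
      by (simp only: w_def v'_def altprod.simps(2)[of A "Suc m"] skip_0_case_nat skip_Suc_case_nat)
    then have "(\<integral>\<^sup>+y. len (w x y) \<partial>S) \<le> 3 * (\<integral>\<^sup>+y. len (dy (Suc (Suc m)) u x y) \<partial>S)"
      using elim(1) by simp
    also have "\<dots> \<le> 3 * (zigzag_const k * \<epsilon>)"
      using elim(2) by (intro mult_left_mono) auto
    finally show ?case by (simp add: mult.assoc)
  qed
  have small_v': "(\<integral>\<^sup>+x. \<integral>\<^sup>+y. len (v' x y) \<partial>S \<partial>S) \<le> 3 * zigzag_const k * \<epsilon>"
  proof -
    have "(\<integral>\<^sup>+x. \<integral>\<^sup>+y. len (v' x y) \<partial>S \<partial>S) \<le> (\<integral>\<^sup>+x. 3 * (\<integral>\<^sup>+y. len (u x y) \<partial>S) \<partial>S)"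
      by (rule nn_integral_mono_AE) (use choice in \<open>auto simp: v'_def\<close>)
    also have "\<dots> = 3 * (\<integral>\<^sup>+x. \<integral>\<^sup>+y. len (u x y) \<partial>S \<partial>S)"
      by (rule nn_integral_cmult) measurable
    also have "\<dots> \<le> 3 * (zigzag_const k * \<epsilon>)"
      using small_u by (intro mult_left_mono) auto
    finally show ?thesis by (simp add: mult.assoc)
  qed
  \<comment> \<open>The sign of the next cochain is forced by the cocycle identity.\<close>
  let ?f = "\<lambda>x y. f (comb_seq (Suc (Suc k)) x y)"
  have f2: "bicochain (Suc (Suc k)) m ?f"
    by (rule bicochain_comb_seq) (use f in \<open>simp add: p\<close>)
  have fcl: "x \<in> space S \<Longrightarrow> f x \<in> carrier A" for x
    using cochain_closed[OF f] .
  have cocycle2: "AE x in S. AE y in S.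
      dx (Suc (Suc k)) (\<lambda>x y. f (comb_seq (Suc k) x y)) x y \<otimes>\<^bsub>A\<^esub>
      (if even k then dy (Suc m) ?f x y else inv\<^bsub>A\<^esub> dy (Suc m) ?f x y) = \<one>\<^bsub>A\<^esub>"
  proof -
    have eq: "d (Suc (Suc p)) f (comb_seq (Suc (Suc k)) x y) =
      dx (Suc (Suc k)) (\<lambda>x y. f (comb_seq (Suc k) x y)) x y \<otimes>\<^bsub>A\<^esub>
      (if even k then dy (Suc m) ?f x y else inv\<^bsub>A\<^esub> dy (Suc m) ?f x y)"
      if "x \<in> space S" "y \<in> space S" for x y
    proof -
      have pp: "Suc (Suc p) = Suc (Suc k) + Suc m" by (simp add: p)
      have "altprod A (Suc (Suc k)) (\<lambda>i. f (skip i (comb_seq (Suc (Suc k)) x y))) =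
          dx (Suc (Suc k)) (\<lambda>x y. f (comb_seq (Suc k) x y)) x y"
        by (rule altprod_cong) (simp add: skip_comb_seq_less)
      then show ?thesis
        unfolding pp using that fcl
        by (subst A.altprod_add) (auto simp del: altprod.simps add_Suc add_Suc_right simp: skip_comb_seq_add)
    qed
    have "AE x in S. AE y in S. d (Suc (Suc p)) f (comb_seq (Suc (Suc k)) x y) = \<one>\<^bsub>A\<^esub>"
      by (rule AE_comb_seq[OF cocycle])
    then show ?thesis
      by (rule AE_AE_mp) (simp only: eq)
  qed
  obtain F' where F'def: "F' = ?f \<or> F' = (\<lambda>x y. inv\<^bsub>A\<^esub> f (comb_seq (Suc (Suc k)) x y))"
    and dyF': "AE x in S. AE y in S. dy (Suc m) F' x y = dx (Suc (Suc k)) F x y"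
  proof -
    have dcl: "dx (Suc (Suc k)) (\<lambda>x y. f (comb_seq (Suc k) x y)) x y \<in> carrier A"
         "dy (Suc m) ?f x y \<in> carrier A" if "x \<in> space S" "y \<in> space S" for x y
      using that fcl
      by (intro A.altprod_closed; auto)+
    have invs: "dy (Suc m) (\<lambda>x y. inv\<^bsub>A\<^esub> f (comb_seq (Suc (Suc k)) x y)) x y = inv\<^bsub>A\<^esub> dy (Suc m) ?f x y"
         "dx (Suc (Suc k)) (\<lambda>x y. inv\<^bsub>A\<^esub> f (comb_seq (Suc k) x y)) x y =
          inv\<^bsub>A\<^esub> dx (Suc (Suc k)) (\<lambda>x y. f (comb_seq (Suc k) x y)) x y"
      if "x \<in> space S" "y \<in> space S" for x y
      using that fcl
      by (subst A.altprod_inv; auto simp del: altprod.simps)+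
    have alg: "a = inv\<^bsub>A\<^esub> c" "inv\<^bsub>A\<^esub> a = c" if "a \<otimes>\<^bsub>A\<^esub> c = \<one>\<^bsub>A\<^esub>" "a \<in> carrier A" "c \<in> carrier A" for a c
      using that A.inv_equality[of a c] A.inv_inv[of c] by auto
    let ?X = "dx (Suc (Suc k)) (\<lambda>x y. f (comb_seq (Suc k) x y))"
    let ?Y = "dy (Suc m) ?f"
    have "AE x in S. AE y in S. x \<in> space S \<and> y \<in> space S \<and>
        ?X x y \<otimes>\<^bsub>A\<^esub> (if even k then ?Y x y else inv\<^bsub>A\<^esub> ?Y x y) = \<one>\<^bsub>A\<^esub>"
      using cocycle2 by (rule AE_AE_mp) (intro conjI)
    then have ev: "AE x in S. AE y in S. x \<in> space S \<and> y \<in> space S \<and>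
        (if even k then ?X x y = inv\<^bsub>A\<^esub> ?Y x y \<and> inv\<^bsub>A\<^esub> ?X x y = ?Y x y
         else ?X x y = ?Y x y \<and> inv\<^bsub>A\<^esub> ?X x y = inv\<^bsub>A\<^esub> ?Y x y)"
    proof (rule AE_AE_mp)
      fix x y assume h: "x \<in> space S \<and> y \<in> space S \<and>
        ?X x y \<otimes>\<^bsub>A\<^esub> (if even k then ?Y x y else inv\<^bsub>A\<^esub> ?Y x y) = \<one>\<^bsub>A\<^esub>"
      then have c: "?X x y \<in> carrier A" "?Y x y \<in> carrier A" using dcl by blast+
      show "x \<in> space S \<and> y \<in> space S \<and>
        (if even k then ?X x y = inv\<^bsub>A\<^esub> ?Y x y \<and> inv\<^bsub>A\<^esub> ?X x y = ?Y x y
         else ?X x y = ?Y x y \<and> inv\<^bsub>A\<^esub> ?X x y = inv\<^bsub>A\<^esub> ?Y x y)"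
        using h c alg[of "?X x y" "?Y x y"] alg[of "?X x y" "inv\<^bsub>A\<^esub> ?Y x y"] A.inv_inv[OF c(2)]
          A.inv_closed[OF c(2)]
        by (cases "even k") (simp_all del: altprod.simps)
    qed
    show thesis
    proof (cases "(F = (\<lambda>x y. f (comb_seq (Suc k) x y))) = even k")
      case True
      show ?thesis
      proof (rule that[OF disjI2[OF refl]])
        show "AE x in S. AE y in S. dy (Suc m) (\<lambda>x y. inv\<^bsub>A\<^esub> f (comb_seq (Suc (Suc k)) x y)) x y
           = dx (Suc (Suc k)) F x y"
          using ev
        proof (rule AE_AE_mp, goal_cases)
          case (1 x y)
          show ?case using 1 True Fdef invs[of x y]
            by (cases "even k") (auto simp del: altprod.simps)
        qed
      qed
    next
      case False
      show ?thesis
      proof (rule that[OF disjI1[OF refl]])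
        show "AE x in S. AE y in S. dy (Suc m) ?f x y = dx (Suc (Suc k)) F x y"
          using ev
        proof (rule AE_AE_mp, goal_cases)
          case (1 x y)
          show ?case using 1 False Fdef invs[of x y]
            by (cases "even k") (auto simp del: altprod.simps)
        qed
      qed
    qed
  qed
  have F': "bicochain (Suc (Suc k)) m F'"
    by (rule bicochain_signed_comb_seq[OF _ F'def]) (use f in \<open>simp add: p\<close>)
  note [measurable] = bicochain_measurable2[OF F']
  have F'cl: "x \<in> space S \<Longrightarrow> y \<in> space S \<Longrightarrow> F' x y \<in> carrier A" for x y
    using bicochain_closed[OF F'] .
  define u' where "u' = (\<lambda>x y. F' x y \<otimes>\<^bsub>A\<^esub> inv\<^bsub>A\<^esub> dx (Suc (Suc k)) v' x y)"
  have dyu': "AE x in S. AE y in S. dy (Suc m) u' x y = dx (Suc (Suc k)) w x y"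
    using dyF'
  proof (rule AE_AE_mp)
    fix x y assume x: "x \<in> space S" and y: "y \<in> space S"
      and F'eq: "dy (Suc m) F' x y = dx (Suc (Suc k)) F x y"
    note [simp] = space_skip[OF x] space_skip[OF y] space_skip[OF space_skip[OF x]]
    note [simp del] = altprod.simps
    have "dx (Suc (Suc k)) u x y = dx (Suc (Suc k)) F x y \<otimes>\<^bsub>A\<^esub>
        inv\<^bsub>A\<^esub> dx (Suc (Suc k)) (dx (Suc k) v) x y"
      unfolding udef by (rule A.altprod_div) (auto simp: cl y)
    also have "dx (Suc (Suc k)) (dx (Suc k) v) x y = \<one>\<^bsub>A\<^esub>"
      by (rule A.altprod_skip_skip[where X="carrier H"]) (use x y cl in \<open>auto simp: space_S_iff\<close>)
    finally have dxu: "dx (Suc (Suc k)) u x y = dx (Suc (Suc k)) F x y"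
      using cl x y by simp
    have "dy (Suc m) u' x y = dy (Suc m) F' x y \<otimes>\<^bsub>A\<^esub> inv\<^bsub>A\<^esub> dy (Suc m) (dx (Suc (Suc k)) v') x y"
      unfolding u'_def by (rule A.altprod_div) (auto simp: cl F'cl x)
    also have "dy (Suc m) (dx (Suc (Suc k)) v') x y = dx (Suc (Suc k)) (dy (Suc m) v') x y"
      by (rule A.altprod_swap) (simp add: cl)
    also have "dy (Suc m) F' x y \<otimes>\<^bsub>A\<^esub> inv\<^bsub>A\<^esub> dx (Suc (Suc k)) (dy (Suc m) v') x y =
       dx (Suc (Suc k)) u x y \<otimes>\<^bsub>A\<^esub> inv\<^bsub>A\<^esub> dx (Suc (Suc k)) (dy (Suc m) v') x y"
      by (simp add: F'eq dxu)
    also have "\<dots> = dx (Suc (Suc k)) w x y"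
      unfolding w_def by (rule A.altprod_div[symmetric]) (auto simp: cl y)
    finally show "dy (Suc m) u' x y = dx (Suc (Suc k)) w x y" .
  qed
  have C: "of_nat (Suc (Suc k)) * (3 * zigzag_const k * \<epsilon>) \<le> zigzag_const (Suc k) * \<epsilon>"
    "\<epsilon> + of_nat (Suc (Suc k)) * (3 * zigzag_const k * \<epsilon>) \<le> zigzag_const (Suc k) * \<epsilon>"
    by (simp_all add: distrib_right mult.assoc del: of_nat_Suc)
  have "AE x in S. \<forall>i<Suc (Suc k). (\<integral>\<^sup>+y. len (w (skip i x) y) \<partial>S) \<le> 3 * zigzag_const k * \<epsilon>"
    by (simp only: AE_all_countable) (intro allI AE_impI AE_skip small_w)
  then have 1: "AE x in S. (\<integral>\<^sup>+y. len (dy (Suc m) u' x y) \<partial>S) \<le> zigzag_const (Suc k) * \<epsilon>"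
    using dyu' AE_space
  proof eventually_elim
    case (elim x)
    then have x: "x \<in> space S"
      and eq: "AE y in S. dy (Suc m) u' x y = dx (Suc (Suc k)) w x y"
      and sm: "\<forall>i<Suc (Suc k). (\<integral>\<^sup>+y. len (w (skip i x) y) \<partial>S) \<le> 3 * zigzag_const k * \<epsilon>"
      by blast+
    have [measurable]: "(\<lambda>_. skip i x) \<in> S \<rightarrow>\<^sub>M S" for i using x by (simp add: space_skip)
    have "(\<integral>\<^sup>+y. len (dy (Suc m) u' x y) \<partial>S) = (\<integral>\<^sup>+y. len (dx (Suc (Suc k)) w x y) \<partial>S)"
      by (rule nn_integral_cong_AE) (use eq in auto)
    also have "\<dots> \<le> (\<integral>\<^sup>+y. (\<Sum>i<Suc (Suc k). len (w (skip i x) y)) \<partial>S)"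
      by (intro nn_integral_mono len_altprod wcl) (auto simp: x)
    also have "\<dots> = (\<Sum>i<Suc (Suc k). \<integral>\<^sup>+y. len (w (skip i x) y) \<partial>S)"
      by (rule nn_integral_sum) measurable
    also have "\<dots> \<le> (\<Sum>i<Suc (Suc k). 3 * zigzag_const k * \<epsilon>)"
      using sm by (intro sum_mono) auto
    also have "\<dots> \<le> zigzag_const (Suc k) * \<epsilon>" using C(1) by simp
    finally show ?case .
  qed
  have F'm: "(\<integral>\<^sup>+x. \<integral>\<^sup>+y. len (F' x y) \<partial>S \<partial>S) = (\<integral>\<^sup>+x. \<integral>\<^sup>+y. len (f (comb_seq (Suc (Suc k)) x y)) \<partial>S \<partial>S)"
    using F'def by (auto intro!: nn_integral_cong simp: len_inv fcl)
  also have "\<dots> = (\<integral>\<^sup>+x. len (f x) \<partial>S)"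
    by (rule nn_integral_comb_seq) measurable
  finally have F'small: "(\<integral>\<^sup>+x. \<integral>\<^sup>+y. len (F' x y) \<partial>S \<partial>S) \<le> \<epsilon>" using small by simp
  have 2: "(\<integral>\<^sup>+x. \<integral>\<^sup>+y. len (u' x y) \<partial>S \<partial>S) \<le> zigzag_const (Suc k) * \<epsilon>"
  proof -
    have "(\<integral>\<^sup>+x. \<integral>\<^sup>+y. len (u' x y) \<partial>S \<partial>S)
       \<le> (\<integral>\<^sup>+x. \<integral>\<^sup>+y. len (F' x y) + (\<Sum>i<Suc (Suc k). len (v' (skip i x) y)) \<partial>S \<partial>S)"
    proof (intro nn_integral_mono)
      fix x y assume x: "x \<in> space S" and y: "y \<in> space S"
      have "len (u' x y) \<le> len (F' x y) + len (dx (Suc (Suc k)) v' x y)"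
        unfolding u'_def using x y
        by (intro len_div F'cl A.altprod_closed cl) auto
      also have "len (dx (Suc (Suc k)) v' x y) \<le> (\<Sum>i<Suc (Suc k). len (v' (skip i x) y))"
        using x y by (intro len_altprod cl) auto
      finally show "len (u' x y) \<le> len (F' x y) + (\<Sum>i<Suc (Suc k). len (v' (skip i x) y))"
        by (simp add: add_left_mono del: sum.lessThan_Suc)
    qed
    also have "\<dots> = (\<integral>\<^sup>+x. (\<integral>\<^sup>+y. len (F' x y) \<partial>S) + (\<Sum>i<Suc (Suc k). \<integral>\<^sup>+y. len (v' (skip i x) y) \<partial>S) \<partial>S)"
    proof (rule nn_integral_cong)
      fix x assume "x \<in> space S"
      then have [measurable]: "(\<lambda>_. x) \<in> S \<rightarrow>\<^sub>M S" "(\<lambda>_. skip i x) \<in> S \<rightarrow>\<^sub>M S" for i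
        by (simp_all add: space_skip)
      show "(\<integral>\<^sup>+y. len (F' x y) + (\<Sum>i<Suc (Suc k). len (v' (skip i x) y)) \<partial>S) =
        (\<integral>\<^sup>+y. len (F' x y) \<partial>S) + (\<Sum>i<Suc (Suc k). \<integral>\<^sup>+y. len (v' (skip i x) y) \<partial>S)"
        by (subst nn_integral_add) (auto simp: nn_integral_sum simp del: sum.lessThan_Suc)
    qed
    also have "\<dots> = (\<integral>\<^sup>+x. \<integral>\<^sup>+y. len (F' x y) \<partial>S \<partial>S) +
        (\<Sum>i<Suc (Suc k). \<integral>\<^sup>+x. \<integral>\<^sup>+y. len (v' (skip i x) y) \<partial>S \<partial>S)"
      by (subst nn_integral_add) (auto simp: nn_integral_sum simp del: sum.lessThan_Suc)
    also have "\<dots> = (\<integral>\<^sup>+x. \<integral>\<^sup>+y. len (F' x y) \<partial>S \<partial>S) +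
        (\<Sum>i<Suc (Suc k). \<integral>\<^sup>+x. \<integral>\<^sup>+y. len (v' x y) \<partial>S \<partial>S)"
      by (intro arg_cong2[of _ _ _ _ "(+)"] sum.cong refl nn_integral_skip) measurable
    also have "\<dots> \<le> \<epsilon> + (\<Sum>i<Suc (Suc k). 3 * zigzag_const k * \<epsilon>)"
      by (intro add_mono F'small sum_mono small_v')
    also have "\<dots> \<le> zigzag_const (Suc k) * \<epsilon>" using C(2) by simp
    finally show ?thesis .
  qed
  have 3: "(\<integral>\<^sup>+x. \<integral>\<^sup>+y. len (v' x y) \<partial>S \<partial>S) \<le> zigzag_const (Suc k) * \<epsilon>"
    using small_v' mult_right_mono[OF zigzag_const_mono[of k], of \<epsilon>] by (simp del: zigzag_const.simps)
  have "stage f p \<epsilon> (Suc k) F' u' v'"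
    unfolding stage_def pm using F'def v' 1 2 3 by (simp add: u'_def del: altprod.simps zigzag_const.simps)
  then show ?thesis by blast
qed

text \<open>
  At the last stage all arguments have been separated, so that the bound for almost every \<open>x\<close>
  in the mean over the empty set of remaining arguments is a bound almost everywhere.
\<close>

theorem small_cocycle_cohomologous_to_uniformly_small:
  assumes f: "cochain (Suc (Suc q)) f"
    and cocycle: "AE x in S. d (Suc (Suc (Suc q))) f x = \<one>\<^bsub>A\<^esub>"
    and small: "(\<integral>\<^sup>+x. len (f x) \<partial>S) \<le> \<epsilon>"
  obtains \<phi> where "cochain (Suc q) \<phi>" "(\<integral>\<^sup>+x. len (\<phi> x) \<partial>S) \<le> zigzag_const (Suc q) * \<epsilon>"
    "AE x in S. len (f x \<otimes>\<^bsub>A\<^esub> inv\<^bsub>A\<^esub> d (Suc (Suc q)) \<phi> x) \<le> zigzag_const (Suc q) * \<epsilon>"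
proof -
  let ?p = "Suc q"
  have "k \<le> ?p \<Longrightarrow> \<exists>F u v. stage f ?p \<epsilon> k F u v" for k
  proof (induction k)
    case 0
    show ?case by (rule stage_0[OF f cocycle small])
  next
    case (Suc k)
    then show ?case using stage_Suc[OF f cocycle small, of k] by auto
  qed
  then obtain F u v where "stage f ?p \<epsilon> ?p F u v" by blast
  then have Fdef: "F = (\<lambda>x y. f (comb_seq (Suc ?p) x y)) \<or> F = (\<lambda>x y. inv\<^bsub>A\<^esub> f (comb_seq (Suc ?p) x y))"
    and v: "bicochain ?p 0 v" and udef: "u = (\<lambda>x y. F x y \<otimes>\<^bsub>A\<^esub> inv\<^bsub>A\<^esub> dx (Suc ?p) v x y)"
    and small_u: "AE x in S. (\<integral>\<^sup>+y. len (dy 1 u x y) \<partial>S) \<le> zigzag_const ?p * \<epsilon>"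
    and small_v: "(\<integral>\<^sup>+x. \<integral>\<^sup>+y. len (v x y) \<partial>S \<partial>S) \<le> zigzag_const ?p * \<epsilon>"
    unfolding stage_def by auto
  obtain y0 where y0: "y0 \<in> space S" using P.not_empty by blast
  have cut: "f (comb_seq (Suc ?p) x y) = f x" for x y
    using f by (auto simp: cochain_def comb_seq_def)
  have vy: "v x y = v x y0" for x y
    by (rule bicochain_depends[OF v]) auto
  define \<psi> where "\<psi> = (\<lambda>x. v x y0)"
  have v\<psi>: "v x y = \<psi> x" for x y
    unfolding \<psi>_def by (rule vy)
  have \<psi>: "cochain ?p \<psi>"
    unfolding cochain_def
  proof (intro conjI ballI allI impI)
    have [measurable]: "(\<lambda>_. y0) \<in> S \<rightarrow>\<^sub>M S" using y0 by simp
    show "\<psi> \<in> S \<rightarrow>\<^sub>M B" unfolding \<psi>_def by (rule bicochain_measurable2[OF v]) measurable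
  next
    fix g x assume "g \<in> carrier H" "x \<in> space S"
    then show "\<psi> (translate g x) = T g (\<psi> x)"
      using bicochain_equivariant[OF v, of g x y0] y0 by (simp add: v\<psi>)
  next
    fix x x' :: "nat \<Rightarrow> 'g" assume "\<forall>j<?p. x j = x' j"
    then show "\<psi> x = \<psi> x'" unfolding \<psi>_def by (intro bicochain_depends[OF v]) auto
  qed
  have \<psi>small: "(\<integral>\<^sup>+x. len (\<psi> x) \<partial>S) \<le> zigzag_const ?p * \<epsilon>"
    using small_v by (simp add: v\<psi> P.emeasure_space_1)
  have fcl: "x \<in> space S \<Longrightarrow> f x \<in> carrier A" and \<psi>cl: "x \<in> space S \<Longrightarrow> \<psi> x \<in> carrier A" for x
    using cochain_closed[OF f] cochain_closed[OF \<psi>] by auto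
  have usmall: "AE x in S. len (F x y0 \<otimes>\<^bsub>A\<^esub> inv\<^bsub>A\<^esub> d (Suc ?p) \<psi> x) \<le> zigzag_const ?p * \<epsilon>"
    using small_u
  proof (rule AE_mp, intro AE_I2 impI)
    fix x assume x: "x \<in> space S" and sm: "(\<integral>\<^sup>+y. len (dy 1 u x y) \<partial>S) \<le> zigzag_const ?p * \<epsilon>"
    have Fy: "F x y = F x y0" for y using Fdef cut by auto
    have uy: "u x y = F x y0 \<otimes>\<^bsub>A\<^esub> inv\<^bsub>A\<^esub> d (Suc ?p) \<psi> x" for y
      by (simp only: udef v\<psi> Fy[of y])
    have c: "F x y0 \<otimes>\<^bsub>A\<^esub> inv\<^bsub>A\<^esub> d (Suc ?p) \<psi> x \<in> carrier A"
      using Fdef x y0 fcl \<psi>cl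
      by (auto intro!: A.m_closed A.inv_closed A.altprod_closed simp del: altprod.simps)
    have "len (dy 1 u x y) = len (F x y0 \<otimes>\<^bsub>A\<^esub> inv\<^bsub>A\<^esub> d (Suc ?p) \<psi> x)" for y
      by (simp only: uy One_nat_def altprod.simps(1) altprod.simps(2)[of A 0] A.inv_one A.r_one c)
    then show "len (F x y0 \<otimes>\<^bsub>A\<^esub> inv\<^bsub>A\<^esub> d (Suc ?p) \<psi> x) \<le> zigzag_const ?p * \<epsilon>"
      using sm by (simp add: P.emeasure_space_1 del: altprod.simps zigzag_const.simps)
  qed
  show thesis
    using Fdef
  proof
    assume "F = (\<lambda>x y. f (comb_seq (Suc ?p) x y))"
    then show ?thesis using that[OF \<psi> \<psi>small] usmall by (simp add: cut del: altprod.simps zigzag_const.simps)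
  next
    assume F: "F = (\<lambda>x y. inv\<^bsub>A\<^esub> f (comb_seq (Suc ?p) x y))"
    show ?thesis
    proof (rule that[OF cochain_inv[OF \<psi>]])
      show "(\<integral>\<^sup>+x. len (inv\<^bsub>A\<^esub> \<psi> x) \<partial>S) \<le> zigzag_const ?p * \<epsilon>"
        using \<psi>small by (simp add: len_inv \<psi>cl cong: nn_integral_cong del: zigzag_const.simps)
      show "AE x in S. len (f x \<otimes>\<^bsub>A\<^esub> inv\<^bsub>A\<^esub> d (Suc ?p) (\<lambda>x. inv\<^bsub>A\<^esub> \<psi> x) x) \<le> zigzag_const ?p * \<epsilon>"
        using usmall
      proof (rule AE_mp, intro AE_I2 impI)
        fix x assume x: "x \<in> space S"
          and le: "len (F x y0 \<otimes>\<^bsub>A\<^esub> inv\<^bsub>A\<^esub> d (Suc ?p) \<psi> x) \<le> zigzag_const ?p * \<epsilon>"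
        have c: "d (Suc ?p) \<psi> x \<in> carrier A" using x \<psi>cl by (intro A.altprod_closed) auto
        have "d (Suc ?p) (\<lambda>x. inv\<^bsub>A\<^esub> \<psi> x) x = inv\<^bsub>A\<^esub> d (Suc ?p) \<psi> x"
          using x \<psi>cl by (intro A.altprod_inv) auto
        then have "f x \<otimes>\<^bsub>A\<^esub> inv\<^bsub>A\<^esub> d (Suc ?p) (\<lambda>x. inv\<^bsub>A\<^esub> \<psi> x) x =
           inv\<^bsub>A\<^esub> (F x y0 \<otimes>\<^bsub>A\<^esub> inv\<^bsub>A\<^esub> d (Suc ?p) \<psi> x)"
          using c fcl[OF x] by (simp add: F cut A.inv_mult del: altprod.simps)
        then show "len (f x \<otimes>\<^bsub>A\<^esub> inv\<^bsub>A\<^esub> d (Suc ?p) (\<lambda>x. inv\<^bsub>A\<^esub> \<psi> x) x) \<le> zigzag_const ?p * \<epsilon>"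
          using le c fcl[OF x] by (simp add: len_inv F cut del: altprod.simps zigzag_const.simps)
      qed
    qed
  qed
qed

end


section \<open>Borel sets of second countable spaces\<close>

lemma space_borel_of [simp]: "space (borel_of X) = topspace X"
  by (simp add: borel_of_def space_measure_of_conv)

lemma sets_borel_of: "sets (borel_of X) = sigma_sets (topspace X) {U. openin X U}"
  unfolding borel_of_def by (rule sets_measure_of) (auto dest: openin_subset)

lemma openin_sets_borel_of [intro]: "openin X U \<Longrightarrow> U \<in> sets (borel_of X)"
  by (auto simp: sets_borel_of)

lemma closedin_sets_borel_of [intro]: "closedin X K \<Longrightarrow> K \<in> sets (borel_of X)"
proof -
  assume K: "closedin X K"
  then have "topspace X - K \<in> sets (borel_of X)" by blast
  then have "space (borel_of X) - (topspace X - K) \<in> sets (borel_of X)" by (rule sets.compl_sets)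
  then show ?thesis using closedin_subset[OF K] by (simp add: double_diff)
qed

lemma measurable_borel_of:
  assumes "f \<in> space N \<rightarrow> topspace X"
    and "\<And>U. openin X U \<Longrightarrow> f -` U \<inter> space N \<in> sets N"
  shows "f \<in> N \<rightarrow>\<^sub>M borel_of X"
  unfolding borel_of_def by (rule measurable_measure_of) (use assms in \<open>auto dest: openin_subset\<close>)

lemma continuous_map_measurable:
  assumes f: "continuous_map X Y f"
  shows "f \<in> borel_of X \<rightarrow>\<^sub>M borel_of Y"
proof (rule measurable_borel_of)
  show "f \<in> space (borel_of X) \<rightarrow> topspace Y"
    using continuous_map_image_subset_topspace[OF f] by auto
next
  fix U assume "openin Y U"
  then have "openin X {x \<in> topspace X. f x \<in> U}"
    using f by (simp add: continuous_map_def)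
  moreover have "f -` U \<inter> space (borel_of X) = {x \<in> topspace X. f x \<in> U}" by auto
  ultimately show "f -` U \<inter> space (borel_of X) \<in> sets (borel_of X)" by auto
qed

lemma sets_borel_of_prod:
  assumes X: "second_countable X" and Y: "second_countable Y"
  shows "sets (borel_of (prod_topology X Y)) = sets (borel_of X \<Otimes>\<^sub>M borel_of Y)"
proof
  have "(\<lambda>z. (fst z, snd z)) \<in> borel_of (prod_topology X Y) \<rightarrow>\<^sub>M borel_of X \<Otimes>\<^sub>M borel_of Y"
    by (intro measurable_Pair continuous_map_measurable continuous_map_fst continuous_map_snd)
  then have "id \<in> borel_of (prod_topology X Y) \<rightarrow>\<^sub>M borel_of X \<Otimes>\<^sub>M borel_of Y"
    by (simp add: id_def)
  then show "sets (borel_of X \<Otimes>\<^sub>M borel_of Y) \<subseteq> sets (borel_of (prod_topology X Y))"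
    using measurable_sets[of id "borel_of (prod_topology X Y)" "borel_of X \<Otimes>\<^sub>M borel_of Y"]
      sets.sets_into_space[of _ "borel_of X \<Otimes>\<^sub>M borel_of Y"]
    by (auto simp: space_pair_measure Int_absorb2)
next
  obtain BX where BX: "countable BX" "\<And>V. V \<in> BX \<Longrightarrow> openin X V"
      "\<And>U x. openin X U \<Longrightarrow> x \<in> U \<Longrightarrow> \<exists>V\<in>BX. x \<in> V \<and> V \<subseteq> U"
    using X unfolding second_countable_def by metis
  obtain BY where BY: "countable BY" "\<And>V. V \<in> BY \<Longrightarrow> openin Y V"
      "\<And>U x. openin Y U \<Longrightarrow> x \<in> U \<Longrightarrow> \<exists>V\<in>BY. x \<in> V \<and> V \<subseteq> U"
    using Y unfolding second_countable_def by metis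
  have "W \<in> sets (borel_of X \<Otimes>\<^sub>M borel_of Y)" if W: "openin (prod_topology X Y) W" for W
  proof -
    let ?I = "{(U, V) \<in> BX \<times> BY. U \<times> V \<subseteq> W}"
    have "countable ?I"
      by (rule countable_subset[of _ "BX \<times> BY"]) (use BX BY in auto)
    moreover have "U \<times> V \<in> sets (borel_of X \<Otimes>\<^sub>M borel_of Y)" if "(U, V) \<in> ?I" for U V
      using that BX(2) BY(2) by (intro pair_measureI openin_sets_borel_of) auto
    ultimately have "(\<Union>(U, V)\<in>?I. U \<times> V) \<in> sets (borel_of X \<Otimes>\<^sub>M borel_of Y)"
      by (intro sets.countable_UN') auto
    moreover have "(\<Union>(U, V)\<in>?I. U \<times> V) = W"
    proof
      show "W \<subseteq> (\<Union>(U, V)\<in>?I. U \<times> V)"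
      proof (rule subrelI)
        fix x y assume "(x, y) \<in> W"
        then obtain U V where "openin X U" "openin Y V" "x \<in> U" "y \<in> V" and UV: "U \<times> V \<subseteq> W"
          using W unfolding openin_prod_topology_alt by metis
        then obtain U' V' where "U' \<in> BX" "x \<in> U'" "U' \<subseteq> U" "V' \<in> BY" "y \<in> V'" "V' \<subseteq> V"
          using BX(3) BY(3) by metis
        then show "(x, y) \<in> (\<Union>(U, V)\<in>?I. U \<times> V)" using UV by fast
      qed
    qed auto
    ultimately show ?thesis by simp
  qed
  then show "sets (borel_of (prod_topology X Y)) \<subseteq> sets (borel_of X \<Otimes>\<^sub>M borel_of Y)"
    unfolding sets_borel_of[of "prod_topology X Y"]
    by (intro sets.sigma_sets_subset'[of _ "borel_of X \<Otimes>\<^sub>M borel_of Y", unfolded space_pair_measure space_borel_of])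
       (use sets.top[of "borel_of X \<Otimes>\<^sub>M borel_of Y"] in \<open>auto simp: space_pair_measure\<close>)
qed

lemma sets_borel_of_power:
  assumes X: "second_countable X" and I: "finite I"
  shows "sets (borel_of (product_topology (\<lambda>_. X) I)) = sets (Pi\<^sub>M I (\<lambda>_. borel_of X))"
proof
  have "(\<lambda>x. \<lambda>i\<in>I. x i) \<in> borel_of (product_topology (\<lambda>_. X) I) \<rightarrow>\<^sub>M Pi\<^sub>M I (\<lambda>_. borel_of X)"
    by (intro measurable_restrict continuous_map_measurable continuous_map_product_projection)
  then have "id \<in> borel_of (product_topology (\<lambda>_. X) I) \<rightarrow>\<^sub>M Pi\<^sub>M I (\<lambda>_. borel_of X)"
    by (rule measurable_cong[THEN iffD1, rotated]) (auto simp: PiE_iff extensional_restrict)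
  then show "sets (Pi\<^sub>M I (\<lambda>_. borel_of X)) \<subseteq> sets (borel_of (product_topology (\<lambda>_. X) I))"
    using measurable_sets[of id "borel_of (product_topology (\<lambda>_. X) I)" "Pi\<^sub>M I (\<lambda>_. borel_of X)"]
      sets.sets_into_space[of _ "Pi\<^sub>M I (\<lambda>_. borel_of X)"]
    by (auto simp: space_PiM Int_absorb2)
next
  obtain BX where BX: "countable BX" "\<And>V. V \<in> BX \<Longrightarrow> openin X V"
      "\<And>U x. openin X U \<Longrightarrow> x \<in> U \<Longrightarrow> \<exists>V\<in>BX. x \<in> V \<and> V \<subseteq> U"
    using X unfolding second_countable_def by metis
  have "W \<in> sets (Pi\<^sub>M I (\<lambda>_. borel_of X))" if W: "openin (product_topology (\<lambda>_. X) I) W" for W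
  proof -
    let ?J = "{F \<in> Pi\<^sub>E I (\<lambda>_. BX). Pi\<^sub>E I F \<subseteq> W}"
    have "countable ?J"
      by (rule countable_subset[of _ "Pi\<^sub>E I (\<lambda>_. BX)"]) (use BX I in \<open>auto intro: countable_PiE\<close>)
    moreover have "Pi\<^sub>E I F \<in> sets (Pi\<^sub>M I (\<lambda>_. borel_of X))" if "F \<in> ?J" for F
      using that BX(2) I by (intro sets_PiM_I_finite openin_sets_borel_of) (auto simp: PiE_iff)
    ultimately have "(\<Union>F\<in>?J. Pi\<^sub>E I F) \<in> sets (Pi\<^sub>M I (\<lambda>_. borel_of X))"
      by (intro sets.countable_UN') auto
    moreover have "(\<Union>F\<in>?J. Pi\<^sub>E I F) = W"
    proof
      show "W \<subseteq> (\<Union>F\<in>?J. Pi\<^sub>E I F)"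
      proof
        fix x assume x: "x \<in> W"
        then obtain U where U: "\<And>i. i \<in> I \<Longrightarrow> openin X (U i)" "x \<in> Pi\<^sub>E I U" "Pi\<^sub>E I U \<subseteq> W"
          using W unfolding openin_product_topology_alt by metis
        have "\<forall>i\<in>I. \<exists>V\<in>BX. x i \<in> V \<and> V \<subseteq> U i"
          using U BX(3) by (auto simp: PiE_iff)
        then obtain F where F: "\<And>i. i \<in> I \<Longrightarrow> F i \<in> BX \<and> x i \<in> F i \<and> F i \<subseteq> U i" by metis
        have "Pi\<^sub>E I (restrict F I) \<subseteq> Pi\<^sub>E I U" using F by (intro PiE_mono) auto
        moreover have "Pi\<^sub>E I (restrict F I) = Pi\<^sub>E I F" by (rule PiE_cong) auto
        moreover have "x \<in> Pi\<^sub>E I F" using F U(2) by (auto simp: PiE_iff)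
        ultimately show "x \<in> (\<Union>F\<in>?J. Pi\<^sub>E I F)"
          using F U(3) by (intro UN_I[of "restrict F I"]) auto
      qed
    qed auto
    ultimately show ?thesis by simp
  qed
  then show "sets (borel_of (product_topology (\<lambda>_. X) I)) \<subseteq> sets (Pi\<^sub>M I (\<lambda>_. borel_of X))"
    unfolding sets_borel_of[of "product_topology (\<lambda>_. X) I"]
    using sets.top[of "Pi\<^sub>M I (\<lambda>_. borel_of X)"]
    by (intro sets.sigma_sets_subset') (auto simp: space_PiM)
qed


section \<open>Normalised Haar measure\<close>

locale sc_compact_group = compact_group +
  assumes sc: "second_countable (gtop G)"
begin

abbreviation "BG \<equiv> borel_of (gtop G)"

lemma measurable_group_mult: "(\<lambda>z. fst z \<otimes> snd z) \<in> BG \<Otimes>\<^sub>M BG \<rightarrow>\<^sub>M BG"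
  using continuous_map_measurable[OF continuous_mult]
  by (simp add: split_beta' measurable_cong_sets[OF sets_borel_of_prod[OF sc sc] refl])

lemma measurable_group_inv: "(\<lambda>x. inv x) \<in> BG \<rightarrow>\<^sub>M BG"
  by (rule continuous_map_measurable[OF continuous_inv])

lemma l_coset_eq_vimage:
  assumes "g \<in> carrier G" "X \<subseteq> carrier G"
  shows "g <# X = (\<lambda>x. inv g \<otimes> x) -` X \<inter> carrier G"
proof
  show "g <# X \<subseteq> (\<lambda>x. inv g \<otimes> x) -` X \<inter> carrier G"
    using assms by (auto simp: l_coset_def inv_solve_left subset_eq simp flip: m_assoc)
  show "(\<lambda>x. inv g \<otimes> x) -` X \<inter> carrier G \<subseteq> g <# X"
  proof
    fix x assume x: "x \<in> (\<lambda>x. inv g \<otimes> x) -` X \<inter> carrier G"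
    then have "x = g \<otimes> (inv g \<otimes> x)" using assms by (simp flip: m_assoc)
    then show "x \<in> g <# X" using x by (auto simp: l_coset_def)
  qed
qed

lemma haar_measureD:
  assumes "haar_measure G \<mu>"
  shows "sets \<mu> = sets BG" "space \<mu> = carrier G" "prob_space \<mu>"
    and "g \<in> carrier G \<Longrightarrow> distr \<mu> \<mu> (\<lambda>x. g \<otimes> x) = \<mu>"
proof -
  show s: "sets \<mu> = sets BG" using assms by (simp add: haar_measure_def)
  then show sp: "space \<mu> = carrier G" using sets_eq_imp_space_eq[of \<mu> BG] topspace_gtop by simp
  then show "prob_space \<mu>" using assms by (intro prob_spaceI) (simp add: haar_measure_def)
  show "distr \<mu> \<mu> (\<lambda>x. g \<otimes> x) = \<mu>" if g: "g \<in> carrier G"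
  proof (rule measure_eqI)
    fix X assume "X \<in> sets (distr \<mu> \<mu> (\<lambda>x. g \<otimes> x))"
    then have X: "X \<in> sets \<mu>" by simp
    have Xc: "X \<subseteq> carrier G" using sets.sets_into_space[OF X] sp by simp
    have m: "(\<lambda>x. g \<otimes> x) \<in> \<mu> \<rightarrow>\<^sub>M \<mu>"
      using measurable_compose[OF measurable_Pair1' measurable_group_mult, of g] g
      by (simp add: topspace_gtop measurable_cong_sets[OF s s])
    have "emeasure (distr \<mu> \<mu> (\<lambda>x. g \<otimes> x)) X = emeasure \<mu> (inv g <# X)"
      using l_coset_eq_vimage[of "inv g" X] g Xc by (simp add: emeasure_distr[OF m X] sp)
    also have "\<dots> = emeasure \<mu> X"
      using assms g X by (simp add: haar_measure_def)
    finally show "emeasure (distr \<mu> \<mu> (\<lambda>x. g \<otimes> x)) X = emeasure \<mu> X" .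
  qed simp
qed

lemma haar_measureI:
  assumes s: "sets \<mu> = sets BG" and p: "prob_space \<mu>"
    and inv: "\<And>g. g \<in> carrier G \<Longrightarrow> distr \<mu> \<mu> (\<lambda>x. g \<otimes> x) = \<mu>"
  shows "haar_measure G \<mu>"
  unfolding haar_measure_def
proof (intro conjI ballI)
  have sp: "space \<mu> = carrier G" using sets_eq_imp_space_eq[OF s] topspace_gtop by simp
  show "emeasure \<mu> (carrier G) = 1"
    using prob_space.emeasure_space_1[OF p] sp by simp
  fix g X assume g: "g \<in> carrier G" and X: "X \<in> sets \<mu>"
  have Xc: "X \<subseteq> carrier G" using sets.sets_into_space[OF X] sp by simp
  have ig: "inv g \<in> carrier G" using g by simp
  have m: "(\<lambda>x. inv g \<otimes> x) \<in> \<mu> \<rightarrow>\<^sub>M \<mu>"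
    using measurable_compose[OF measurable_Pair1' measurable_group_mult, of "inv g"] ig
    by (simp add: topspace_gtop measurable_cong_sets[OF s s])
  have "emeasure \<mu> X = emeasure (distr \<mu> \<mu> (\<lambda>x. inv g \<otimes> x)) X"
    by (simp add: inv[OF ig])
  then show "emeasure \<mu> (g <# X) = emeasure \<mu> X"
    by (simp add: emeasure_distr[OF m X] l_coset_eq_vimage[OF g Xc] sp)
qed (rule s)

text \<open>
  Both measures are compared with the image of one of them under inversion: averaging
  \<open>y\<^sup>-\<^sup>1 x\<close> over \<open>x\<close> gives one measure, averaging it over \<open>y\<close> the inverted other one.
\<close>

lemma haar_measure_eq_inverted:
  assumes \<mu>: "haar_measure G \<mu>" and \<nu>: "haar_measure G \<nu>" and X: "X \<in> sets BG"
  shows "emeasure \<mu> X = emeasure (distr \<nu> BG (\<lambda>y. inv y)) X"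
proof -
  interpret M: prob_space \<mu> by (rule haar_measureD[OF \<mu>])
  interpret N: prob_space \<nu> by (rule haar_measureD[OF \<nu>])
  interpret MN: pair_sigma_finite \<mu> \<nu> ..
  note sM = haar_measureD(1)[OF \<mu>] and sN = haar_measureD(1)[OF \<nu>]
  note spM = haar_measureD(2)[OF \<mu>] and spN = haar_measureD(2)[OF \<nu>]
  have mm: "(\<lambda>z. f z \<otimes> f' z) \<in> L \<rightarrow>\<^sub>M BG" if "f \<in> L \<rightarrow>\<^sub>M BG" "f' \<in> L \<rightarrow>\<^sub>M BG" for f f' and L :: "'c measure"
    using measurable_compose[OF measurable_Pair[OF that] measurable_group_mult] by simp
  have mi: "(\<lambda>z. inv f z) \<in> L \<rightarrow>\<^sub>M BG" if "f \<in> L \<rightarrow>\<^sub>M BG" for f and L :: "'c measure"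
    by (rule measurable_compose[OF that measurable_group_inv])
  have ind [measurable]: "indicator X \<in> borel_measurable BG" (is "?f \<in> _") using X by measurable
  have fM: "fst \<in> \<mu> \<Otimes>\<^sub>M \<nu> \<rightarrow>\<^sub>M BG" and fN: "snd \<in> \<mu> \<Otimes>\<^sub>M \<nu> \<rightarrow>\<^sub>M BG"
    using measurable_fst[of \<mu> \<nu>] measurable_snd[of \<mu> \<nu>]
    by (simp_all add: measurable_cong_sets[OF refl sM] measurable_cong_sets[OF refl sN])
  have joint: "(\<lambda>z. ?f (inv (snd z) \<otimes> fst z) :: ennreal) \<in> borel_measurable (\<mu> \<Otimes>\<^sub>M \<nu>)"
    by (rule measurable_compose[OF mm[OF mi[OF fN] fM] ind])
  have tM: "(\<lambda>x. c \<otimes> x) \<in> \<mu> \<rightarrow>\<^sub>M \<mu>" "(\<lambda>x. c \<otimes> x) \<in> \<nu> \<rightarrow>\<^sub>M \<nu>" if "c \<in> carrier G" for c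
    using measurable_compose[OF measurable_Pair1' measurable_group_mult, of c] that
    by (simp_all add: topspace_gtop measurable_cong_sets[OF sM sM] measurable_cong_sets[OF sN sN])
  have indM: "?f \<in> borel_measurable \<mu>" using ind by (simp add: measurable_cong_sets[OF sM refl])
  have indN: "(\<lambda>y. ?f (inv y)) \<in> borel_measurable \<nu>"
    using measurable_compose[OF measurable_group_inv ind] by (simp add: measurable_cong_sets[OF sN refl])
  have "emeasure \<mu> X = (\<integral>\<^sup>+y. \<integral>\<^sup>+x. ?f x \<partial>\<mu> \<partial>\<nu>)"
    using X sM by (simp add: N.emeasure_space_1)
  also have "\<dots> = (\<integral>\<^sup>+y. \<integral>\<^sup>+x. ?f (inv y \<otimes> x) \<partial>\<mu> \<partial>\<nu>)"
  proof (rule nn_integral_cong)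
    fix y assume "y \<in> space \<nu>"
    then have c: "inv y \<in> carrier G" using spN by simp
    show "(\<integral>\<^sup>+x. ?f x \<partial>\<mu>) = (\<integral>\<^sup>+x. ?f (inv y \<otimes> x) \<partial>\<mu>)"
      using nn_integral_distr[OF tM(1)[OF c], of ?f] indM by (simp add: haar_measureD(4)[OF \<mu> c])
  qed
  also have "\<dots> = (\<integral>\<^sup>+x. \<integral>\<^sup>+y. ?f (inv y \<otimes> x) \<partial>\<nu> \<partial>\<mu>)"
    by (rule MN.Fubini'[of "\<lambda>x y. ?f (inv y \<otimes> x)"]) (use joint in \<open>simp add: split_beta'\<close>)
  also have "\<dots> = (\<integral>\<^sup>+x. \<integral>\<^sup>+y. ?f (inv y) \<partial>\<nu> \<partial>\<mu>)"
  proof (rule nn_integral_cong)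
    fix x assume "x \<in> space \<mu>"
    then have x: "x \<in> carrier G" and c: "inv x \<in> carrier G" using spM by auto
    have "(\<integral>\<^sup>+y. ?f (inv y) \<partial>\<nu>) = (\<integral>\<^sup>+y. ?f (inv (inv x \<otimes> y)) \<partial>\<nu>)"
      using nn_integral_distr[OF tM(2)[OF c], of "\<lambda>y. ?f (inv y)"] indN
      by (simp add: haar_measureD(4)[OF \<nu> c])
    also have "\<dots> = (\<integral>\<^sup>+y. ?f (inv y \<otimes> x) \<partial>\<nu>)"
      by (rule nn_integral_cong) (simp add: spN inv_mult_group x)
    finally show "(\<integral>\<^sup>+y. ?f (inv y \<otimes> x) \<partial>\<nu>) = (\<integral>\<^sup>+y. ?f (inv y) \<partial>\<nu>)" by simp
  qed
  also have "\<dots> = (\<integral>\<^sup>+y. ?f (inv y) \<partial>\<nu>)"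
    by (simp add: M.emeasure_space_1)
  also have "\<dots> = (\<integral>\<^sup>+z. ?f z \<partial>distr \<nu> BG (\<lambda>y. inv y))"
    by (subst nn_integral_distr) (use measurable_group_inv in \<open>auto simp: measurable_cong_sets[OF sN refl]\<close>)
  also have "\<dots> = emeasure (distr \<nu> BG (\<lambda>y. inv y)) X" using X by simp
  finally show ?thesis .
qed

text \<open>
  Any two normalised Haar measures coincide with the inverted second one.
\<close>

lemma haar_measure_unique: "\<lbrakk>haar_measure G \<mu>; haar_measure G \<nu>\<rbrakk> \<Longrightarrow> \<mu> = \<nu>"
  by (rule measure_eqI) (simp_all add: haar_measureD haar_measure_eq_inverted[of _ \<nu>])

end


section \<open>Existence of Haar measure\<close>

text \<open>
  The inner content of open sets and the outer measure that it induces. The set function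
  \<open>\<kappa>\<close> is subadditive on all sets and additive on disjoint closed ones only, so it has to be
  regularised in this way before Caratheodory's theorem applies.
\<close>

definition inner_content :: "'a topology \<Rightarrow> ('a set \<Rightarrow> real) \<Rightarrow> 'a set \<Rightarrow> ennreal" where
  "inner_content X \<kappa> U = (SUP K\<in>{K. closedin X K \<and> K \<subseteq> U}. ennreal (\<kappa> K))"

definition outer_content :: "'a topology \<Rightarrow> ('a set \<Rightarrow> real) \<Rightarrow> 'a set \<Rightarrow> ennreal" where
  "outer_content X \<kappa> E = (INF U\<in>{U. openin X U \<and> E \<subseteq> U}. inner_content X \<kappa> U)"

locale closed_content =
  fixes X :: "'a topology" and \<kappa> :: "'a set \<Rightarrow> real"
  assumes compact: "compact_space X" and Hausdorff: "Hausdorff_space X"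
    and nonneg: "\<kappa> K \<ge> 0" and empty: "\<kappa> {} = 0"
    and mono: "\<lbrakk>K \<subseteq> L; L \<subseteq> topspace X\<rbrakk> \<Longrightarrow> \<kappa> K \<le> \<kappa> L"
    and subadditive: "\<lbrakk>K \<subseteq> topspace X; L \<subseteq> topspace X\<rbrakk> \<Longrightarrow> \<kappa> (K \<union> L) \<le> \<kappa> K + \<kappa> L"
    and additive: "\<lbrakk>closedin X K; closedin X L; K \<inter> L = {}\<rbrakk> \<Longrightarrow> \<kappa> K + \<kappa> L \<le> \<kappa> (K \<union> L)"
begin

lemma inner_content_le: "(\<And>K. closedin X K \<Longrightarrow> K \<subseteq> U \<Longrightarrow> ennreal (\<kappa> K) \<le> c) \<Longrightarrow> inner_content X \<kappa> U \<le> c"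
  unfolding inner_content_def by (rule SUP_least) auto

lemma inner_content_ge: "\<lbrakk>closedin X K; K \<subseteq> U\<rbrakk> \<Longrightarrow> ennreal (\<kappa> K) \<le> inner_content X \<kappa> U"
  unfolding inner_content_def by (rule SUP_upper) auto

lemma inner_content_mono: "U \<subseteq> V \<Longrightarrow> inner_content X \<kappa> U \<le> inner_content X \<kappa> V"
  by (rule inner_content_le) (auto intro: inner_content_ge)

text \<open>
  By normality a closed subset of \<open>U \<union> V\<close> is the union of closed subsets of \<open>U\<close> and of \<open>V\<close>.
\<close>

lemma inner_content_Un:
  assumes U: "openin X U" and V: "openin X V"
  shows "inner_content X \<kappa> (U \<union> V) \<le> inner_content X \<kappa> U + inner_content X \<kappa> V"
proof (rule inner_content_le)
  fix K assume K: "closedin X K" and KUV: "K \<subseteq> U \<union> V"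
  have "normal_space X"
    by (rule compact_Hausdorff_or_regular_imp_normal_space[OF compact]) (simp add: Hausdorff)
  moreover have "closedin X (K - U)" "closedin X (K - V)" "disjnt (K - U) (K - V)"
    using K U V KUV by (auto simp: closedin_diff disjnt_def)
  ultimately obtain P Q where PQ: "openin X P" "openin X Q" "K - U \<subseteq> P" "K - V \<subseteq> Q" "disjnt P Q"
    unfolding normal_space_def by meson
  have cl: "closedin X (K - P)" "closedin X (K - Q)" using K PQ by (auto simp: closedin_diff)
  have "\<kappa> K = \<kappa> ((K - P) \<union> (K - Q))"
    using PQ(5) by (intro arg_cong[of _ _ \<kappa>]) (auto simp: disjnt_def)
  also have "\<dots> \<le> \<kappa> (K - P) + \<kappa> (K - Q)"
    using cl by (intro subadditive closedin_subset)
  finally have "ennreal (\<kappa> K) \<le> ennreal (\<kappa> (K - P)) + ennreal (\<kappa> (K - Q))"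
    by (simp add: ennreal_leI nonneg flip: ennreal_plus)
  also have "\<dots> \<le> inner_content X \<kappa> U + inner_content X \<kappa> V"
    using cl PQ by (intro add_mono inner_content_ge) auto
  finally show "ennreal (\<kappa> K) \<le> inner_content X \<kappa> U + inner_content X \<kappa> V" .
qed

lemma inner_content_UN_finite:
  fixes U :: "nat \<Rightarrow> 'a set"
  assumes "\<And>i. openin X (U i)"
  shows "inner_content X \<kappa> (\<Union>i<n. U i) \<le> (\<Sum>i<n. inner_content X \<kappa> (U i))"
proof (induction n)
  case 0
  show ?case by (rule inner_content_le) (simp add: empty)
next
  case (Suc n)
  have "inner_content X \<kappa> (\<Union>i<Suc n. U i) = inner_content X \<kappa> ((\<Union>i<n. U i) \<union> U n)"
    by (simp add: lessThan_Suc Un_commute)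
  also have "\<dots> \<le> inner_content X \<kappa> (\<Union>i<n. U i) + inner_content X \<kappa> (U n)"
    using assms by (intro inner_content_Un) auto
  finally show ?case using add_right_mono[OF Suc] by (simp add: order_trans)
qed

text \<open>
  A closed set is compact and therefore covered by finitely many of the open sets.
\<close>

lemma inner_content_UN:
  fixes U :: "nat \<Rightarrow> 'a set"
  assumes U: "\<And>i. openin X (U i)"
  shows "inner_content X \<kappa> (\<Union>i. U i) \<le> (\<Sum>i. inner_content X \<kappa> (U i))"
proof (rule inner_content_le)
  fix K assume K: "closedin X K" and "K \<subseteq> (\<Union>i. U i)"
  then obtain \<F> where F: "finite \<F>" "\<F> \<subseteq> range U" "K \<subseteq> \<Union>\<F>"
    using compactinD[OF closedin_compact_space[OF compact K], of "range U"] U by blast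
  then obtain N where N: "finite N" "\<F> = U ` N" by (meson finite_subset_image)
  obtain n where "N \<subseteq> {..<n}" using finite_nat_iff_bounded[of N] N by auto
  then have "K \<subseteq> (\<Union>i<n. U i)" using F N by blast
  then have "ennreal (\<kappa> K) \<le> inner_content X \<kappa> (\<Union>i<n. U i)"
    by (rule inner_content_ge[OF K])
  also have "\<dots> \<le> (\<Sum>i<n. inner_content X \<kappa> (U i))"
    by (rule inner_content_UN_finite[OF U])
  also have "\<dots> \<le> (\<Sum>i. inner_content X \<kappa> (U i))"
    by (rule sum_le_suminf) auto
  finally show "ennreal (\<kappa> K) \<le> (\<Sum>i. inner_content X \<kappa> (U i))" .
qed

lemma outer_content_le: "\<lbrakk>openin X U; E \<subseteq> U\<rbrakk> \<Longrightarrow> outer_content X \<kappa> E \<le> inner_content X \<kappa> U"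
  unfolding outer_content_def by (rule INF_lower) auto

lemma outer_content_ge:
  "(\<And>U. openin X U \<Longrightarrow> E \<subseteq> U \<Longrightarrow> c \<le> inner_content X \<kappa> U) \<Longrightarrow> c \<le> outer_content X \<kappa> E"
  unfolding outer_content_def by (rule INF_greatest) auto

lemma outer_content_open: "openin X U \<Longrightarrow> outer_content X \<kappa> U = inner_content X \<kappa> U"
  by (intro antisym outer_content_le outer_content_ge inner_content_mono) auto

lemma outer_content_mono: "E \<subseteq> F \<Longrightarrow> outer_content X \<kappa> E \<le> outer_content X \<kappa> F"
  by (intro outer_content_ge outer_content_le) auto

lemma inner_content_finite: "inner_content X \<kappa> U < \<infinity>"
proof -
  have "inner_content X \<kappa> U \<le> ennreal (\<kappa> (topspace X))"
    by (rule inner_content_le) (intro ennreal_leI mono closedin_subset, auto)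
  then show ?thesis by (simp add: le_less_trans)
qed

lemma outer_content_UN:
  fixes E :: "nat \<Rightarrow> 'a set"
  assumes E: "\<And>i. E i \<subseteq> topspace X"
  shows "outer_content X \<kappa> (\<Union>i. E i) \<le> (\<Sum>i. outer_content X \<kappa> (E i))"
proof (rule ennreal_le_epsilon)
  fix e :: real assume e: "e > 0"
  have "\<exists>U. openin X U \<and> E i \<subseteq> U \<and> inner_content X \<kappa> U \<le> outer_content X \<kappa> (E i) + ennreal (e * (1/2) ^ Suc i)" for i
  proof (rule ccontr)
    assume neg: "\<not> ?thesis"
    have "outer_content X \<kappa> (E i) + ennreal (e * (1/2) ^ Suc i) \<le> outer_content X \<kappa> (E i)"
      by (rule outer_content_ge) (use neg in \<open>auto simp: not_le intro: less_imp_le\<close>)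
    moreover have "outer_content X \<kappa> (E i) < \<infinity>"
      using outer_content_le[OF openin_topspace E[of i]] inner_content_finite le_less_trans by blast
    then have "outer_content X \<kappa> (E i) + 0 < outer_content X \<kappa> (E i) + ennreal (e * (1/2) ^ Suc i)"
      using e by (subst ennreal_add_left_cancel_less) (auto simp: ennreal_zero_less_mult_iff)
    ultimately show False by simp
  qed
  then obtain U where U: "\<And>i. openin X (U i)" "\<And>i. E i \<subseteq> U i"
      "\<And>i. inner_content X \<kappa> (U i) \<le> outer_content X \<kappa> (E i) + ennreal (e * (1/2) ^ Suc i)" by metis
  have "outer_content X \<kappa> (\<Union>i. E i) \<le> inner_content X \<kappa> (\<Union>i. U i)"
    using U by (intro outer_content_le) auto
  also have "\<dots> \<le> (\<Sum>i. inner_content X \<kappa> (U i))" by (rule inner_content_UN[OF U(1)])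
  also have "\<dots> \<le> (\<Sum>i. outer_content X \<kappa> (E i) + ennreal (e * (1/2) ^ Suc i))"
    by (intro suminf_le U summableI)
  also have "\<dots> = (\<Sum>i. outer_content X \<kappa> (E i)) + (\<Sum>i. ennreal (e * (1/2) ^ Suc i))"
    by (rule suminf_add[symmetric]; rule summableI)
  also have "(\<Sum>i. ennreal (e * (1/2) ^ Suc i)) = ennreal e * (\<Sum>i. ennreal ((1/2) ^ Suc i))"
    using e by (simp add: ennreal_mult del: power_Suc)
  also have "(\<Sum>i. ennreal ((1/2) ^ Suc i)) = 1"
    by (subst suminf_ennreal_eq[OF _ power_half_series]) auto
  finally show "outer_content X \<kappa> (\<Union>i. E i) \<le> (\<Sum>i. outer_content X \<kappa> (E i)) + ennreal e" by simp
qed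

text \<open>
  Caratheodory's condition for an open set \<open>U\<close>: an open set around \<open>E\<close> is exhausted by a closed
  subset \<open>K\<close> of its intersection with \<open>U\<close> together with closed sets disjoint from \<open>K\<close>, and on
  these the content is additive.
\<close>

lemma outer_content_split:
  assumes U: "openin X U"
  shows "outer_content X \<kappa> (U \<inter> E) + outer_content X \<kappa> ((topspace X - U) \<inter> E) \<le> outer_content X \<kappa> E"
proof (rule outer_content_ge)
  fix W assume W: "openin X W" and EW: "E \<subseteq> W"
  have nonempty: "{K. closedin X K \<and> K \<subseteq> V} \<noteq> {}" for V by blast
  let ?c = "outer_content X \<kappa> ((topspace X - U) \<inter> E)"
  have "ennreal (\<kappa> K) + ?c \<le> inner_content X \<kappa> W" if K: "closedin X K" and KU: "K \<subseteq> W \<inter> U" for K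
  proof -
    have "?c \<le> inner_content X \<kappa> (W - K)"
      using W K KU EW openin_subset[OF W] by (intro outer_content_le) (auto simp: openin_diff)
    then have "ennreal (\<kappa> K) + ?c \<le> ennreal (\<kappa> K) + inner_content X \<kappa> (W - K)" by (rule add_left_mono)
    also have "\<dots> = (SUP L\<in>{L. closedin X L \<and> L \<subseteq> W - K}. ennreal (\<kappa> L) + ennreal (\<kappa> K))"
      unfolding inner_content_def by (subst ennreal_SUP_add_left[OF nonempty]) (rule add.commute)
    also have "\<dots> \<le> inner_content X \<kappa> W"
    proof (rule SUP_least, clarify)
      fix L assume L: "closedin X L" and LW: "L \<subseteq> W - K"
      have "ennreal (\<kappa> L) + ennreal (\<kappa> K) = ennreal (\<kappa> L + \<kappa> K)" by (simp add: nonneg)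
      also have "\<dots> \<le> ennreal (\<kappa> (L \<union> K))"
        by (intro ennreal_leI additive L K) (use LW in auto)
      also have "\<dots> \<le> inner_content X \<kappa> W"
        by (rule inner_content_ge) (use L K LW KU in auto)
      finally show "ennreal (\<kappa> L) + ennreal (\<kappa> K) \<le> inner_content X \<kappa> W" .
    qed
    finally show ?thesis .
  qed
  then have "(SUP K\<in>{K. closedin X K \<and> K \<subseteq> W \<inter> U}. ennreal (\<kappa> K) + ?c) \<le> inner_content X \<kappa> W"
    by (intro SUP_least) auto
  then have "inner_content X \<kappa> (W \<inter> U) + ?c \<le> inner_content X \<kappa> W"
    unfolding inner_content_def[of X \<kappa> "W \<inter> U"] by (subst (asm) ennreal_SUP_add_left[OF nonempty])
  moreover have "outer_content X \<kappa> (U \<inter> E) \<le> inner_content X \<kappa> (W \<inter> U)"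
    using U W EW by (intro outer_content_le) auto
  ultimately show "outer_content X \<kappa> (U \<inter> E) + ?c \<le> inner_content X \<kappa> W"
    by (meson add_right_mono order_trans)
qed

theorem measure_space_outer_content:
  "measure_space (topspace X) (sets (borel_of X)) (outer_content X \<kappa>)"
proof -
  let ?\<Omega> = "topspace X" and ?m = "outer_content X \<kappa>"
  interpret sigma_algebra ?\<Omega> "Pow ?\<Omega>" by (rule sigma_algebra_Pow)
  have m0: "?m {} = 0"
    using outer_content_open[of "{}"] inner_content_le[of "{}" 0] by (simp add: empty)
  have "outer_measure_space (Pow ?\<Omega>) ?m"
    unfolding outer_measure_space_def
  proof (intro conjI)
    show "positive (Pow ?\<Omega>) ?m" by (simp add: positive_def m0)
    show "increasing (Pow ?\<Omega>) ?m" by (simp add: increasing_def outer_content_mono)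
    show "countably_subadditive (Pow ?\<Omega>) ?m"
      unfolding countably_subadditive_def by (auto intro!: outer_content_UN)
  qed
  then have L: "measure_space ?\<Omega> (lambda_system ?\<Omega> (Pow ?\<Omega>) ?m) ?m" by (rule caratheodory_lemma)
  interpret L: sigma_algebra ?\<Omega> "lambda_system ?\<Omega> (Pow ?\<Omega>) ?m"
    using L by (simp add: measure_space_def)
  have "U \<in> lambda_system ?\<Omega> (Pow ?\<Omega>) ?m" if U: "openin X U" for U
  proof -
    have "?m (U \<inter> E) + ?m ((?\<Omega> - U) \<inter> E) = ?m E" if E: "E \<subseteq> ?\<Omega>" for E
    proof (rule antisym[OF outer_content_split[OF U]])
      let ?s = "\<lambda>i::nat. if i = 0 then U \<inter> E else if i = 1 then (?\<Omega> - U) \<inter> E else {}"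
      have "?m E \<le> ?m (\<Union>i. ?s i)"
      proof (rule outer_content_mono, rule subsetI)
        fix x assume "x \<in> E"
        then have "x \<in> ?s 0 \<or> x \<in> ?s 1" using E by auto
        then show "x \<in> (\<Union>i. ?s i)" by blast
      qed
      also have "\<dots> \<le> (\<Sum>i. ?m (?s i))" using E by (intro outer_content_UN) auto
      also have "\<dots> = (\<Sum>i\<in>{0,1}. ?m (?s i))"
        by (rule suminf_finite) (auto simp: m0)
      finally show "?m E \<le> ?m (U \<inter> E) + ?m ((?\<Omega> - U) \<inter> E)" by simp
    qed
    then show ?thesis using openin_subset[OF U] by (auto simp: lambda_system_def)
  qed
  then have "sets (borel_of X) \<subseteq> lambda_system ?\<Omega> (Pow ?\<Omega>) ?m"
    unfolding sets_borel_of by (intro L.sigma_sets_subset) auto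
  moreover have "sigma_algebra ?\<Omega> (sets (borel_of X))"
    using sets.sigma_algebra_axioms[of "borel_of X"] by simp
  ultimately show ?thesis using measure_down[OF L] by blast
qed

end


lemma openin_prod_topology_rectangle:
  assumes "openin (prod_topology X Y) W" "(x, y) \<in> W"
  obtains U V where "openin X U" "openin Y V" "x \<in> U" "y \<in> V" "U \<times> V \<subseteq> W"
  using assms unfolding openin_prod_topology_alt by metis

context compact_group
begin

lemma continuous_left_mult: "g \<in> carrier G \<Longrightarrow> continuous_map (gtop G) (gtop G) (\<lambda>x. g \<otimes> x)"
  using continuous_map_compose[OF continuous_map_pairedI continuous_mult, of "gtop G" "\<lambda>_. g" "\<lambda>x. x"]
  by (simp add: o_def topspace_gtop)

lemma l_coset_vimage:
  assumes "g \<in> carrier G" "X \<subseteq> carrier G"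
  shows "g <# X = {x \<in> carrier G. inv g \<otimes> x \<in> X}"
proof
  show "g <# X \<subseteq> {x \<in> carrier G. inv g \<otimes> x \<in> X}"
    using assms by (auto simp: l_coset_def subset_eq simp flip: m_assoc)
  show "{x \<in> carrier G. inv g \<otimes> x \<in> X} \<subseteq> g <# X"
  proof
    fix x assume x: "x \<in> {x \<in> carrier G. inv g \<otimes> x \<in> X}"
    then have "x = g \<otimes> (inv g \<otimes> x)" using assms by (simp flip: m_assoc)
    then show "x \<in> g <# X" using x by (auto simp: l_coset_def)
  qed
qed

lemma openin_l_coset: "\<lbrakk>g \<in> carrier G; openin (gtop G) V\<rbrakk> \<Longrightarrow> openin (gtop G) (g <# V)"
  using continuous_left_mult[of "inv g"] openin_subset[of "gtop G" V]
  by (simp add: l_coset_vimage continuous_map_def topspace_gtop)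

lemma closedin_l_coset: "\<lbrakk>g \<in> carrier G; closedin (gtop G) V\<rbrakk> \<Longrightarrow> closedin (gtop G) (g <# V)"
  using continuous_left_mult[of "inv g"] closedin_subset[of "gtop G" V]
  by (simp add: l_coset_vimage continuous_map_closedin topspace_gtop)

lemma l_coset_carrier: "\<lbrakk>g \<in> carrier G; X \<subseteq> carrier G\<rbrakk> \<Longrightarrow> g <# X \<subseteq> carrier G"
  by (auto simp: l_coset_def)

lemma l_coset_inv: "\<lbrakk>g \<in> carrier G; X \<subseteq> carrier G\<rbrakk> \<Longrightarrow> inv g <# (g <# X) = X"
  by (simp add: lcos_m_assoc lcos_mult_one)

definition covering_number :: "'a set \<Rightarrow> 'a set \<Rightarrow> nat" where
  "covering_number V E =
     (LEAST n. \<exists>F\<subseteq>carrier G. finite F \<and> card F = n \<and> E \<subseteq> (\<Union>g\<in>F. g <# V))"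

definition nbhds_one :: "'a set set" where
  "nbhds_one = {V. openin (gtop G) V \<and> \<one> \<in> V}"

lemma nbhds_oneD: "V \<in> nbhds_one \<Longrightarrow> openin (gtop G) V" "V \<in> nbhds_one \<Longrightarrow> \<one> \<in> V"
    "V \<in> nbhds_one \<Longrightarrow> V \<subseteq> carrier G"
  using openin_subset topspace_gtop by (auto simp: nbhds_one_def)

lemma finite_covering:
  assumes V: "V \<in> nbhds_one" and E: "E \<subseteq> carrier G"
  obtains F where "F \<subseteq> carrier G" "finite F" "card F = covering_number V E" "E \<subseteq> (\<Union>g\<in>F. g <# V)"
proof -
  have "carrier G \<subseteq> (\<Union>g\<in>carrier G. g <# V)"
  proof
    fix g assume "g \<in> carrier G"
    then have "g \<otimes> \<one> \<in> g <# V" using nbhds_oneD(2)[OF V] unfolding l_coset_def by blast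
    then show "g \<in> (\<Union>g\<in>carrier G. g <# V)" using \<open>g \<in> carrier G\<close> by auto
  qed
  moreover have "compactin (gtop G) (carrier G)"
    using compact by (simp add: compact_space_def topspace_gtop)
  moreover have "openin (gtop G) W" if "W \<in> (\<lambda>g. g <# V) ` carrier G" for W
    using that openin_l_coset[OF _ nbhds_oneD(1)[OF V]] by (elim imageE) simp
  ultimately obtain \<F> where "finite \<F>" "\<F> \<subseteq> (\<lambda>g. g <# V) ` carrier G" "carrier G \<subseteq> \<Union>\<F>"
    using compactinD[of "gtop G" "carrier G" "(\<lambda>g. g <# V) ` carrier G"] by metis
  then obtain F where "F \<subseteq> carrier G" "finite F" "\<F> = (\<lambda>g. g <# V) ` F" by (meson finite_subset_image)
  then have "F \<subseteq> carrier G \<and> finite F \<and> card F = card F \<and> E \<subseteq> (\<Union>g\<in>F. g <# V)"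
    using order_trans[OF E \<open>carrier G \<subseteq> \<Union>\<F>\<close>] by simp
  then have "\<exists>n. \<exists>F\<subseteq>carrier G. finite F \<and> card F = n \<and> E \<subseteq> (\<Union>g\<in>F. g <# V)"
    by (intro exI)
  from LeastI_ex[OF this] obtain F where "F \<subseteq> carrier G" "finite F" "card F = covering_number V E"
      "E \<subseteq> (\<Union>g\<in>F. g <# V)"
    unfolding covering_number_def by (elim exE conjE)
  then show thesis by (rule that)
qed

lemma covering_number_le:
  "\<lbrakk>F \<subseteq> carrier G; finite F; E \<subseteq> (\<Union>g\<in>F. g <# V)\<rbrakk> \<Longrightarrow> covering_number V E \<le> card F"
  unfolding covering_number_def by (rule Least_le) auto

lemma covering_number_mono:
  assumes "V \<in> nbhds_one" "E \<subseteq> F" "F \<subseteq> carrier G"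
  shows "covering_number V E \<le> covering_number V F"
proof -
  obtain F' where F': "F' \<subseteq> carrier G" "finite F'" "card F' = covering_number V F" "F \<subseteq> (\<Union>g\<in>F'. g <# V)"
    using finite_covering[OF assms(1,3)] .
  then show ?thesis
    using covering_number_le[OF F'(1,2) order_trans[OF assms(2) F'(4)]] by simp
qed

lemma covering_number_Un:
  assumes V: "V \<in> nbhds_one" and "E \<subseteq> carrier G" "E' \<subseteq> carrier G"
  shows "covering_number V (E \<union> E') \<le> covering_number V E + covering_number V E'"
proof -
  obtain F where F: "F \<subseteq> carrier G" "finite F" "card F = covering_number V E" "E \<subseteq> (\<Union>g\<in>F. g <# V)"
    using finite_covering[OF V assms(2)] .
  obtain F' where F': "F' \<subseteq> carrier G" "finite F'" "card F' = covering_number V E'" "E' \<subseteq> (\<Union>g\<in>F'. g <# V)"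
    using finite_covering[OF V assms(3)] .
  have "covering_number V (E \<union> E') \<le> card (F \<union> F')"
    using F F' by (intro covering_number_le) auto
  also have "\<dots> \<le> card F + card F'" by (rule card_Un_le)
  finally show ?thesis using F F' by simp
qed

lemma covering_number_l_coset_le:
  assumes V: "V \<in> nbhds_one" and E: "E \<subseteq> carrier G" and h: "h \<in> carrier G"
  shows "covering_number V (h <# E) \<le> covering_number V E"
proof -
  obtain F where F: "F \<subseteq> carrier G" "finite F" "card F = covering_number V E" "E \<subseteq> (\<Union>g\<in>F. g <# V)"
    using finite_covering[OF V E] .
  have "covering_number V (h <# E) \<le> card ((\<lambda>g. h \<otimes> g) ` F)"
  proof (rule covering_number_le)
    show "h <# E \<subseteq> (\<Union>g\<in>(\<lambda>g. h \<otimes> g) ` F. g <# V)"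
    proof
      fix x assume "x \<in> h <# E"
      then obtain e g v where "x = h \<otimes> e" "e = g \<otimes> v" and gv: "g \<in> F" "v \<in> V"
        using F(4) by (fastforce simp: l_coset_def)
      then have "x = (h \<otimes> g) \<otimes> v" using F(1) h nbhds_oneD(3)[OF V] by (auto simp: m_assoc subset_eq)
      then show "x \<in> (\<Union>g\<in>(\<lambda>g. h \<otimes> g) ` F. g <# V)" using gv by (auto simp: l_coset_def)
    qed
  qed (use F h in auto)
  also have "\<dots> \<le> card F" by (rule card_image_le) (rule F)
  finally show ?thesis using F by simp
qed

lemma covering_number_l_coset:
  assumes V: "V \<in> nbhds_one" and E: "E \<subseteq> carrier G" and h: "h \<in> carrier G"
  shows "covering_number V (h <# E) = covering_number V E"
  using covering_number_l_coset_le[OF V E h]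
    covering_number_l_coset_le[OF V l_coset_carrier[OF h E], of "inv h"] E h
  by (simp add: l_coset_inv)

lemma covering_number_empty: "covering_number V {} = 0"
  using covering_number_le[of "{}" "{}" V] by simp

lemma covering_number_carrier: "V \<in> nbhds_one \<Longrightarrow> covering_number V (carrier G) > 0"
proof -
  assume V: "V \<in> nbhds_one"
  obtain F where F: "F \<subseteq> carrier G" "finite F" "card F = covering_number V (carrier G)"
      "carrier G \<subseteq> (\<Union>g\<in>F. g <# V)"
    using finite_covering[OF V order_refl] .
  then have "F \<noteq> {}" using one_closed by auto
  then show ?thesis using F(2,3) card_gt_0_iff[of F] by simp
qed

definition separates :: "'a set \<Rightarrow> 'a set \<Rightarrow> 'a set \<Rightarrow> bool" where
  "separates V E E' \<longleftrightarrow> (\<forall>g\<in>carrier G. (g <# V) \<inter> E = {} \<or> (g <# V) \<inter> E' = {})"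

text \<open>
  No translate of \<open>V\<close> meets both sets, so an optimal covering of the union splits.
\<close>

lemma covering_number_separated:
  assumes V: "V \<in> nbhds_one" and E: "E \<subseteq> carrier G" "E' \<subseteq> carrier G" and s: "separates V E E'"
  shows "covering_number V E + covering_number V E' \<le> covering_number V (E \<union> E')"
proof -
  obtain F where F: "F \<subseteq> carrier G" "finite F" "card F = covering_number V (E \<union> E')"
     "E \<union> E' \<subseteq> (\<Union>g\<in>F. g <# V)"
    using finite_covering[OF V Un_least[OF E]] .
  let ?F = "\<lambda>E. {g\<in>F. (g <# V) \<inter> E \<noteq> {}}"
  have cov: "covering_number V X \<le> card (?F X)" if X: "X \<subseteq> E \<union> E'" for X
  proof (rule covering_number_le)
    show "X \<subseteq> (\<Union>g\<in>?F X. g <# V)"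
    proof
      fix x assume x: "x \<in> X"
      then obtain g where "g \<in> F" "x \<in> g <# V" using subsetD[OF F(4) subsetD[OF X x]] by (elim UN_E)
      then show "x \<in> (\<Union>g\<in>?F X. g <# V)" using x by (intro UN_I[of g]) auto
    qed
  qed (use F(1,2) in auto)
  have "?F E \<inter> ?F E' = {}"
    using s F(1) unfolding separates_def by blast
  then have "card (?F E) + card (?F E') = card (?F E \<union> ?F E')"
    using F(2) by (intro card_Un_disjoint[symmetric]) auto
  also have "\<dots> \<le> card F" using F(2) by (intro card_mono) auto
  finally show ?thesis using cov[OF Un_upper1] cov[OF Un_upper2] F(3) by linarith
qed

text \<open>
  The compact set of all \<open>x\<^sup>-\<^sup>1 y\<close> with \<open>x \<in> K\<close> and \<open>y \<in> L\<close> does not contain the identity, and a translate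
  of \<open>V\<close> that meets both sets produces an element of it of the form \<open>v\<^sup>-\<^sup>1 w\<close> with \<open>v, w \<in> V\<close>.
\<close>

lemma exists_separating:
  assumes K: "closedin (gtop G) K" and L: "closedin (gtop G) L" and KL: "K \<inter> L = {}"
  shows "\<exists>V\<in>nbhds_one. separates V K L"
proof -
  have Kc: "K \<subseteq> carrier G" "L \<subseteq> carrier G"
    using closedin_subset[OF K] closedin_subset[OF L] by (auto simp: topspace_gtop)
  define f where "f = (\<lambda>(x, y). inv x \<otimes> y)"
  have "continuous_map (prod_topology (gtop G) (gtop G)) (prod_topology (gtop G) (gtop G))
     (\<lambda>z. (inv fst z, snd z))"
    using continuous_map_compose[OF continuous_map_fst continuous_inv, of "gtop G"]
    by (intro continuous_map_pairedI continuous_map_snd) (simp add: o_def)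
  from continuous_map_compose[OF this continuous_mult]
  have f: "continuous_map (prod_topology (gtop G) (gtop G)) (gtop G) f"
    by (simp add: f_def o_def split_beta')
  have "compactin (gtop G) (f ` (K \<times> L))"
    by (intro image_compactin[OF _ f])
       (simp add: compactin_Times closedin_compact_space[OF compact] K L)
  then have cl: "closedin (gtop G) (f ` (K \<times> L))"
    by (rule compactin_imp_closedin[OF Hausdorff])
  have one: "\<one> \<notin> f ` (K \<times> L)"
  proof
    assume "\<one> \<in> f ` (K \<times> L)"
    then obtain x y where xy: "x \<in> K" "y \<in> L" "inv x \<otimes> y = \<one>" by (auto simp: f_def)
    have xc: "x \<in> carrier G" "y \<in> carrier G" using xy Kc by auto
    have "y = x \<otimes> (inv x \<otimes> y)" using xc by (simp add: m_assoc[symmetric])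
    then have "y = x" using xy xc by simp
    then show False using xy KL by auto
  qed
  let ?O = "topspace (gtop G) - f ` (K \<times> L)"
  have "openin (gtop G) ?O" using cl by (rule openin_diff[OF openin_topspace])
  then have "openin (prod_topology (gtop G) (gtop G)) {z \<in> topspace (prod_topology (gtop G) (gtop G)). f z \<in> ?O}"
    by (rule openin_continuous_map_preimage[OF f])
  moreover have "(\<one>, \<one>) \<in> {z \<in> topspace (prod_topology (gtop G) (gtop G)). f z \<in> ?O}"
    using one by (simp add: f_def topspace_gtop)
  ultimately obtain P Q where PQ: "openin (gtop G) P" "openin (gtop G) Q" "\<one> \<in> P" "\<one> \<in> Q"
     "P \<times> Q \<subseteq> {z \<in> topspace (prod_topology (gtop G) (gtop G)). f z \<in> ?O}"
    by (rule openin_prod_topology_rectangle)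
  have "P \<inter> Q \<in> nbhds_one" using PQ by (simp add: nbhds_one_def openin_Int)
  moreover have "separates (P \<inter> Q) K L"
    unfolding separates_def
  proof (rule ballI, rule ccontr)
    fix g assume g: "g \<in> carrier G" and "\<not> ((g <# (P \<inter> Q)) \<inter> K = {} \<or> (g <# (P \<inter> Q)) \<inter> L = {})"
    then obtain v w where vw: "v \<in> P" "w \<in> Q" "g \<otimes> v \<in> K" "g \<otimes> w \<in> L"
      by (auto simp: l_coset_def)
    have c: "v \<in> carrier G" "w \<in> carrier G"
      using vw openin_subset[OF PQ(1)] openin_subset[OF PQ(2)] by (auto simp: topspace_gtop)
    have "inv g \<otimes> (g \<otimes> w) = w" using c g by (simp flip: m_assoc)
    then have "f (g \<otimes> v, g \<otimes> w) = f (v, w)" using c g by (simp add: f_def inv_mult_group m_assoc)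
    moreover have "f (g \<otimes> v, g \<otimes> w) \<in> f ` (K \<times> L)" using vw by (intro imageI SigmaI)
    ultimately have "f (v, w) \<in> f ` (K \<times> L)" by (simp only:)
    moreover have "f (v, w) \<in> ?O" using subsetD[OF PQ(5), of "(v, w)"] vw by simp
    ultimately show False by simp
  qed
  ultimately show ?thesis by blast
qed

text \<open>
  The relative covering numbers live in a compact power of the unit interval. Any point that is
  a limit of them as the neighbourhood of the identity shrinks inherits monotonicity,
  subadditivity and invariance, and it is additive on disjoint closed sets because these are
  separated by all small neighbourhoods.
\<close>

theorem exists_invariant_content:
  obtains \<kappa> where "closed_content (gtop G) \<kappa>" "\<kappa> (carrier G) = 1"
    "\<And>g E. g \<in> carrier G \<Longrightarrow> E \<subseteq> carrier G \<Longrightarrow> \<kappa> (g <# E) = \<kappa> E"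
proof -
  define C :: "'a set \<Rightarrow> ('a set \<Rightarrow> real) set" where "C = (\<lambda>V. {\<kappa>. \<kappa> {} = 0 \<and> \<kappa> (carrier G) = 1 \<and>
     (\<forall>E F. E \<subseteq> F \<and> F \<subseteq> carrier G \<longrightarrow> \<kappa> E \<le> \<kappa> F) \<and>
     (\<forall>E F. E \<subseteq> carrier G \<and> F \<subseteq> carrier G \<longrightarrow> \<kappa> (E \<union> F) \<le> \<kappa> E + \<kappa> F) \<and>
     (\<forall>g E. g \<in> carrier G \<and> E \<subseteq> carrier G \<longrightarrow> \<kappa> (g <# E) = \<kappa> E) \<and>
     (\<forall>E F. E \<subseteq> carrier G \<and> F \<subseteq> carrier G \<and> separates V E F \<longrightarrow> \<kappa> E + \<kappa> F \<le> \<kappa> (E \<union> F))})"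
  define I :: "('a set \<Rightarrow> real) set" where "I = Pi\<^sub>E UNIV (\<lambda>_. {0..1})"
  have "compactin (product_topology (\<lambda>_. euclidean) UNIV) I"
    unfolding I_def by (simp add: compactin_PiE)
  then have cI: "compact I"
    by (simp add: euclidean_product_topology)
  have closed: "closed (C V)" for V
    unfolding C_def
    by (intro closed_Collect_conj closed_Collect_all closed_Collect_imp open_Collect_const
        closed_Collect_le closed_Collect_eq continuous_intros continuous_on_product_coordinates)
  have mem: "\<exists>\<kappa>. \<kappa> \<in> I \<inter> C V" if V: "V \<in> nbhds_one" for V
  proof -
    let ?n = "\<lambda>E. real (covering_number V E)"
    define \<kappa> where "\<kappa> = (\<lambda>E. if E \<subseteq> carrier G then ?n E / ?n (carrier G) else 0)"
    have pos: "?n (carrier G) > 0" using covering_number_carrier[OF V] by simp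
    have le1: "?n E / ?n (carrier G) \<le> 1" if "E \<subseteq> carrier G" for E
      using covering_number_mono[OF V that] pos by simp
    have "\<kappa> \<in> I" using le1 by (auto simp: I_def \<kappa>_def)
    moreover have "\<kappa> \<in> C V"
      unfolding C_def mem_Collect_eq
    proof (intro conjI allI impI; (elim conjE)?)
      show "\<kappa> {} = 0" by (simp add: \<kappa>_def covering_number_empty)
      show "\<kappa> (carrier G) = 1" using pos by (simp add: \<kappa>_def)
      fix E F assume F: "F \<subseteq> carrier G"
      { assume EF: "E \<subseteq> F"
        then have "E \<subseteq> carrier G" using F by auto
        then show "\<kappa> E \<le> \<kappa> F"
          using covering_number_mono[OF V EF F] F by (simp add: \<kappa>_def divide_right_mono) }
      assume E: "E \<subseteq> carrier G"
      have "?n (E \<union> F) \<le> ?n E + ?n F" using covering_number_Un[OF V E F] by (simp flip: of_nat_add)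
      then show "\<kappa> (E \<union> F) \<le> \<kappa> E + \<kappa> F"
        using E F by (simp add: \<kappa>_def divide_right_mono flip: add_divide_distrib)
      assume "separates V E F"
      then have "?n E + ?n F \<le> ?n (E \<union> F)"
        using covering_number_separated[OF V E F] by (simp flip: of_nat_add)
      then show "\<kappa> E + \<kappa> F \<le> \<kappa> (E \<union> F)"
        using E F by (simp add: \<kappa>_def divide_right_mono flip: add_divide_distrib)
    next
      fix g E assume "g \<in> carrier G" "E \<subseteq> carrier G"
      then show "\<kappa> (g <# E) = \<kappa> E"
        by (simp add: \<kappa>_def covering_number_l_coset[OF V] l_coset_carrier)
    qed
    ultimately show ?thesis by blast
  qed
  have "I \<inter> (\<Inter>V\<in>nbhds_one. C V) \<noteq> {}"
  proof (rule compact_imp_fip_image[OF cI closed])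
    fix N assume N: "finite N" "N \<subseteq> nbhds_one"
    define W where "W = carrier G \<inter> \<Inter>N"
    have "openin (gtop G) (\<Inter>(insert (carrier G) N))"
    proof (rule openin_Inter)
      show "openin (gtop G) V" if "V \<in> insert (carrier G) N" for V
        using that N(2) nbhds_oneD(1) openin_topspace[of "gtop G"] unfolding topspace_gtop by blast
    qed (use N in auto)
    moreover have "\<one> \<in> W" using N(2) nbhds_oneD(2) unfolding W_def by blast
    ultimately have "W \<in> nbhds_one" by (simp add: nbhds_one_def W_def)
    then obtain \<kappa> where \<kappa>: "\<kappa> \<in> I" "\<kappa> \<in> C W" using mem by blast
    have "\<kappa> \<in> C V" if V: "V \<in> N" for V
    proof -
      have "W \<subseteq> V" using V by (auto simp: W_def)
      then have "separates V E F \<Longrightarrow> separates W E F" for E F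
        unfolding separates_def l_coset_def by blast
      then show ?thesis using \<kappa>(2) unfolding C_def mem_Collect_eq by meson
    qed
    then show "I \<inter> (\<Inter>V\<in>N. C V) \<noteq> {}" using \<kappa>(1) by blast
  qed
  then obtain \<kappa> where \<kappa>: "\<kappa> \<in> I" "\<And>V. V \<in> nbhds_one \<Longrightarrow> \<kappa> \<in> C V" by blast
  have "carrier G \<in> nbhds_one"
    using openin_topspace[of "gtop G"] by (simp add: nbhds_one_def topspace_gtop)
  from \<kappa>(2)[OF this] have \<kappa>C: "\<kappa> {} = 0" "\<kappa> (carrier G) = 1"
    "\<And>E F. E \<subseteq> F \<Longrightarrow> F \<subseteq> carrier G \<Longrightarrow> \<kappa> E \<le> \<kappa> F"
    "\<And>E F. E \<subseteq> carrier G \<Longrightarrow> F \<subseteq> carrier G \<Longrightarrow> \<kappa> (E \<union> F) \<le> \<kappa> E + \<kappa> F"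
    "\<And>g E. g \<in> carrier G \<Longrightarrow> E \<subseteq> carrier G \<Longrightarrow> \<kappa> (g <# E) = \<kappa> E"
    unfolding C_def by auto
  have "closed_content (gtop G) \<kappa>"
  proof
    show "0 \<le> \<kappa> K" for K using \<kappa>(1) by (auto simp: I_def PiE_iff)
    fix K L
    assume K: "closedin (gtop G) K" and L: "closedin (gtop G) L" and "K \<inter> L = {}"
    then obtain V where V: "V \<in> nbhds_one" "separates V K L" using exists_separating by blast
    then show "\<kappa> K + \<kappa> L \<le> \<kappa> (K \<union> L)"
      using \<kappa>(2)[OF V(1)] closedin_subset[OF K] closedin_subset[OF L]
      unfolding C_def topspace_gtop by blast
  qed (use \<kappa>C in \<open>auto simp: compact Hausdorff topspace_gtop\<close>)
  then show thesis using that \<kappa>C by blast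
qed

theorem exists_haar_measure: "\<exists>\<mu>. haar_measure G \<mu>"
proof -
  obtain \<kappa> where "closed_content (gtop G) \<kappa>" and total: "\<kappa> (carrier G) = 1"
    and inv: "\<And>g E. g \<in> carrier G \<Longrightarrow> E \<subseteq> carrier G \<Longrightarrow> \<kappa> (g <# E) = \<kappa> E"
    by (rule exists_invariant_content) (rule that)
  then interpret \<kappa>: closed_content "gtop G" \<kappa> by simp
  let ?m = "outer_content (gtop G) \<kappa>"
  let ?\<mu> = "measure_of (carrier G) (sets (borel_of (gtop G))) ?m"
  have ss: "sigma_sets (carrier G) (sets (borel_of (gtop G))) = sets (borel_of (gtop G))"
    using sets.sigma_sets_eq[of "borel_of (gtop G)"] by (simp add: topspace_gtop)
  have sub: "sets (borel_of (gtop G)) \<subseteq> Pow (carrier G)"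
    using sets.space_closed[of "borel_of (gtop G)"] by (simp add: topspace_gtop)
  have sets: "sets ?\<mu> = sets (borel_of (gtop G))"
    using sets_measure_of[OF sub] ss by simp
  have em: "emeasure ?\<mu> E = ?m E" if "E \<in> sets (borel_of (gtop G))" for E
    using \<kappa>.measure_space_outer_content that sub
    by (intro emeasure_measure_of_sigma) (auto simp: measure_space_def topspace_gtop)
  have open_carrier: "openin (gtop G) (carrier G)" and closed_carrier: "closedin (gtop G) (carrier G)"
    using openin_topspace[of "gtop G"] closedin_topspace[of "gtop G"] by (simp_all add: topspace_gtop)
  have inner_le: "inner_content (gtop G) \<kappa> (g <# U) \<le> inner_content (gtop G) \<kappa> U"
    if g: "g \<in> carrier G" and U: "U \<subseteq> carrier G" for g U
  proof (rule \<kappa>.inner_content_le)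
    fix K assume K: "closedin (gtop G) K" and KU: "K \<subseteq> g <# U"
    have Kc: "K \<subseteq> carrier G" using closedin_subset[OF K] by (simp add: topspace_gtop)
    have "\<kappa> K = \<kappa> (inv g <# K)" using inv[of "inv g" K] g Kc by simp
    moreover have "inv g <# K \<subseteq> inv g <# (g <# U)" using KU by (auto simp: l_coset_def)
    then have "inv g <# K \<subseteq> U" using g U by (simp add: l_coset_inv)
    ultimately show "ennreal (\<kappa> K) \<le> inner_content (gtop G) \<kappa> U"
      using \<kappa>.inner_content_ge[OF closedin_l_coset[OF _ K], of "inv g" U] g by simp
  qed
  have outer_le: "?m (g <# E) \<le> ?m E" if g: "g \<in> carrier G" and E: "E \<subseteq> carrier G" for g E
  proof (rule \<kappa>.outer_content_ge)
    fix U assume U: "openin (gtop G) U" and EU: "E \<subseteq> U"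
    have "?m (g <# E) \<le> inner_content (gtop G) \<kappa> (g <# U)"
      using EU by (intro \<kappa>.outer_content_le openin_l_coset g U) (auto simp: l_coset_def)
    also have "\<dots> \<le> inner_content (gtop G) \<kappa> U"
      using openin_subset[OF U] by (intro inner_le g) (simp add: topspace_gtop)
    finally show "?m (g <# E) \<le> inner_content (gtop G) \<kappa> U" .
  qed
  have "haar_measure G ?\<mu>"
    unfolding haar_measure_def
  proof (intro conjI ballI)
    have "?m (carrier G) = inner_content (gtop G) \<kappa> (carrier G)"
      by (rule \<kappa>.outer_content_open[OF open_carrier])
    also have "\<dots> = 1"
      using \<kappa>.inner_content_ge[OF closed_carrier order_refl]
        \<kappa>.inner_content_le[of "carrier G" 1] \<kappa>.mono[of _ "carrier G"] total
      by (intro antisym) (auto simp: topspace_gtop intro!: ennreal_leI simp flip: ennreal_1)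
    finally show "emeasure ?\<mu> (carrier G) = 1"
      using open_carrier by (subst em) auto
    fix g X assume g: "g \<in> carrier G" and X: "X \<in> sets ?\<mu>"
    then have Xb: "X \<in> sets (borel_of (gtop G))" and Xc: "X \<subseteq> carrier G"
      using sets sub by auto
    have "(\<lambda>x. inv g \<otimes> x) -` X \<inter> space (borel_of (gtop G)) \<in> sets (borel_of (gtop G))"
      using measurable_sets[OF continuous_map_measurable[OF continuous_left_mult] Xb] g by simp
    moreover have "(\<lambda>x. inv g \<otimes> x) -` X \<inter> space (borel_of (gtop G)) = g <# X"
      using l_coset_vimage[OF g Xc] by (auto simp: topspace_gtop)
    ultimately have gX: "g <# X \<in> sets (borel_of (gtop G))" by simp
    have "?m (g <# X) = ?m X"
      using outer_le[OF g Xc] outer_le[of "inv g" "g <# X"] g Xc l_coset_carrier[OF g Xc]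
      by (simp add: l_coset_inv)
    then show "emeasure ?\<mu> (g <# X) = emeasure ?\<mu> X" using em Xb gX by simp
  qed (rule sets)
  then show ?thesis by blast
qed

end


section \<open>Homogeneous and inhomogeneous cochains\<close>

context comm_group
begin

lemma int_pow_sign: "a \<in> carrier G \<Longrightarrow> a [^] ((-1::int) ^ i) = (if even i then a else inv a)"
  by (auto simp: int_pow_neg)

lemma altprod_snoc:
  assumes "\<And>i. i < Suc n \<Longrightarrow> F i \<in> carrier G"
  shows "altprod G (Suc n) F = altprod G n F \<otimes> F n [^] ((-1::int) ^ n)"
  using altprod_add[of n 1 F] assms by (simp add: int_pow_sign)

lemma altprod_eq_finprod:
  assumes "\<And>i. F i \<in> carrier G"
  shows "altprod G (Suc n) F = F 0 \<otimes> (\<Otimes>i\<in>{1..n}. F i [^] ((-1::int) ^ i))"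
proof (induction n)
  case (Suc n)
  have "altprod G (Suc (Suc n)) F = altprod G (Suc n) F \<otimes> F (Suc n) [^] ((-1::int) ^ Suc n)"
    by (rule altprod_snoc) (rule assms)
  also have "altprod G (Suc n) F = F 0 \<otimes> (\<Otimes>i\<in>{1..n}. F i [^] ((-1::int) ^ i))" by (rule Suc)
  also have "F 0 \<otimes> (\<Otimes>i\<in>{1..n}. F i [^] ((-1::int) ^ i)) \<otimes> F (Suc n) [^] ((-1::int) ^ Suc n)
     = F 0 \<otimes> (\<Otimes>i\<in>{1..Suc n}. F i [^] ((-1::int) ^ i))"
    using assms by (simp add: atLeastAtMostSuc_conv m_ac Pi_iff del: power_Suc)
  finally show ?case .
qed (simp add: assms)

end

context measurable_module
begin

definition ratios :: "(nat \<Rightarrow> 'g) \<Rightarrow> nat \<Rightarrow> 'g" where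
  "ratios x j = inv\<^bsub>H\<^esub> x j \<otimes>\<^bsub>H\<^esub> x (Suc j)"

lemma measurable_ratios [measurable]: "ratios \<in> S \<rightarrow>\<^sub>M S"
  unfolding ratios_def[abs_def]
  by (rule measurable_PiM_single') (auto simp: space_M space_S_iff)

text \<open>
  Conditioned on the preceding point, each ratio is Haar distributed by left invariance; the
  induction peels off the first point.
\<close>

lemma emeasure_successive_ratios:
  assumes "\<And>j. E j \<in> sets M" "a \<in> carrier H"
  shows "emeasure S {y \<in> space S. \<forall>j<n. ratios (case_nat a y) j \<in> E j} = (\<Prod>j<n. emeasure M (E j))"
  using assms
proof (induction n arbitrary: E a)
  case 0
  then show ?case by (simp add: P.emeasure_space_1)
next
  case (Suc n)
  note E [measurable] = Suc.prems(1) and a = Suc.prems(2)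
  have ac [measurable]: "(\<lambda>_. a) \<in> N \<rightarrow>\<^sub>M M" for N :: "'z measure" using a by (simp add: space_M)
  let ?X = "{y \<in> space S. \<forall>j<Suc n. ratios (case_nat a y) j \<in> E j}"
  let ?Y = "\<lambda>b. {y \<in> space S. \<forall>j<n. ratios (case_nat b y) j \<in> E (Suc j)}"
  have m: "(\<lambda>y. ratios (case_nat a y) j) \<in> S \<rightarrow>\<^sub>M M"
    if "(\<lambda>_. a) \<in> S \<rightarrow>\<^sub>M M" for a j
    using that unfolding ratios_def by measurable
  have X: "?X \<in> sets S"
    using m[OF ac] by simp
  have Y: "?Y b \<in> sets S" if "b \<in> carrier H" for b
    using m[of b] that by (simp add: space_M)
  have "emeasure S ?X = (\<integral>\<^sup>+y. indicator ?X y \<partial>S)" by (rule nn_integral_indicator[OF X, symmetric])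
  also have "\<dots> = (\<integral>\<^sup>+b. \<integral>\<^sup>+y. indicator ?X (case_nat b y) \<partial>S \<partial>M)"
    by (rule nn_integral_case_nat[symmetric]) (rule borel_measurable_indicator[OF X])
  also have "\<dots> = (\<integral>\<^sup>+b. indicator (E 0) (inv\<^bsub>H\<^esub> a \<otimes>\<^bsub>H\<^esub> b) * (\<Prod>j<n. emeasure M (E (Suc j))) \<partial>M)"
  proof (rule nn_integral_cong)
    fix b assume b: "b \<in> space M"
    then have bc: "b \<in> carrier H" by (simp add: space_M)
    have "indicator ?X (case_nat b y) = indicator (E 0) (inv\<^bsub>H\<^esub> a \<otimes>\<^bsub>H\<^esub> b) * (indicator (?Y b) y :: ennreal)"
      if y: "y \<in> space S" for y
      using space_case_nat[OF b y] y
    proof -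
      have "ratios (case_nat a (case_nat b y)) 0 = inv\<^bsub>H\<^esub> a \<otimes>\<^bsub>H\<^esub> b"
        "ratios (case_nat a (case_nat b y)) (Suc j) = ratios (case_nat b y) j" for j
        by (simp_all add: ratios_def)
      then have "(\<forall>j<Suc n. ratios (case_nat a (case_nat b y)) j \<in> E j) \<longleftrightarrow>
          inv\<^bsub>H\<^esub> a \<otimes>\<^bsub>H\<^esub> b \<in> E 0 \<and> (\<forall>j<n. ratios (case_nat b y) j \<in> E (Suc j))"
        by (simp only: All_less_Suc2)
      then have "case_nat b y \<in> ?X \<longleftrightarrow> inv\<^bsub>H\<^esub> a \<otimes>\<^bsub>H\<^esub> b \<in> E 0 \<and> y \<in> ?Y b"
        using space_case_nat[OF b y] y by blast
      then show ?thesis by (simp only: indicator_def of_bool_conj)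
    qed
    then have "(\<integral>\<^sup>+y. indicator ?X (case_nat b y) \<partial>S)
        = (\<integral>\<^sup>+y. indicator (E 0) (inv\<^bsub>H\<^esub> a \<otimes>\<^bsub>H\<^esub> b) * indicator (?Y b) y \<partial>S)"
      by (rule nn_integral_cong)
    also have "\<dots> = indicator (E 0) (inv\<^bsub>H\<^esub> a \<otimes>\<^bsub>H\<^esub> b) * emeasure S (?Y b)"
      by (rule nn_integral_cmult_indicator[OF Y[OF bc]])
    also have "emeasure S (?Y b) = (\<Prod>j<n. emeasure M (E (Suc j)))"
      by (rule Suc.IH) (use E bc in auto)
    finally show "(\<integral>\<^sup>+y. indicator ?X (case_nat b y) \<partial>S)
      = indicator (E 0) (inv\<^bsub>H\<^esub> a \<otimes>\<^bsub>H\<^esub> b) * (\<Prod>j<n. emeasure M (E (Suc j)))" .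
  qed
  also have "\<dots> = (\<integral>\<^sup>+b. indicator (E 0) (inv\<^bsub>H\<^esub> a \<otimes>\<^bsub>H\<^esub> b) \<partial>M) * (\<Prod>j<n. emeasure M (E (Suc j)))"
    by (rule nn_integral_multc) measurable
  also have "(\<integral>\<^sup>+b. indicator (E 0) (inv\<^bsub>H\<^esub> a \<otimes>\<^bsub>H\<^esub> b) \<partial>M)
     = (\<integral>\<^sup>+b. indicator (E 0) b \<partial>distr M M (\<lambda>b. inv\<^bsub>H\<^esub> a \<otimes>\<^bsub>H\<^esub> b))"
    by (rule nn_integral_distr[symmetric]) measurable
  also have "\<dots> = emeasure M (E 0)"
    using left_invariant[of "inv\<^bsub>H\<^esub> a"] a E by simp
  finally show ?case by (simp only: prod.lessThan_Suc_shift)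
qed

text \<open>
  Successive ratios of independent Haar distributed elements are again independent and Haar
  distributed; this is what identifies almost everywhere statements about homogeneous and
  inhomogeneous cochains.
\<close>

lemma distr_ratios: "distr S S ratios = S"
proof (rule PiM_eq)
  fix J :: "nat set" and F
  assume J: "finite J" "J \<subseteq> UNIV" and F: "\<And>j. j \<in> J \<Longrightarrow> F j \<in> sets M"
  obtain n where n: "J \<subseteq> {..<n}" using finite_nat_iff_bounded[of J] J by auto
  define E where "E = (\<lambda>j. if j \<in> J then F j else space M)"
  have E [measurable]: "E j \<in> sets M" for j using F by (auto simp: E_def)
  let ?X = "prod_emb UNIV (\<lambda>_. M) J (Pi\<^sub>E J F)"
  have X [measurable]: "?X \<in> sets S" using J F by (auto intro!: sets_PiM_I)
  have X_iff: "x \<in> ?X \<longleftrightarrow> (\<forall>j<n. x j \<in> E j)" if "x \<in> space S" for x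
    using that n J by (auto simp: prod_emb_def space_PiM PiE_iff E_def subset_eq)
  have "emeasure (distr S S ratios) ?X = (\<integral>\<^sup>+x. indicator ?X (ratios x) \<partial>S)"
    by (subst nn_integral_distr[symmetric, OF measurable_ratios]) auto
  also have "\<dots> = (\<integral>\<^sup>+a. \<integral>\<^sup>+y. indicator ?X (ratios (case_nat a y)) \<partial>S \<partial>M)"
    by (rule nn_integral_case_nat[symmetric]) measurable
  also have "\<dots> = (\<integral>\<^sup>+a. (\<Prod>j<n. emeasure M (E j)) \<partial>M)"
  proof (rule nn_integral_cong)
    fix a assume a: "a \<in> space M"
    have [measurable]: "(\<lambda>_. a) \<in> S \<rightarrow>\<^sub>M M" using a by simp
    have Xs: "{y \<in> space S. \<forall>j<n. ratios (case_nat a y) j \<in> E j} \<in> sets S" by measurable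
    have "(\<integral>\<^sup>+y. indicator ?X (ratios (case_nat a y)) \<partial>S)
       = (\<integral>\<^sup>+y. indicator {y \<in> space S. \<forall>j<n. ratios (case_nat a y) j \<in> E j} y \<partial>S)"
      using X_iff[OF measurable_space[OF measurable_ratios]] space_case_nat[OF a]
      by (intro nn_integral_cong) (auto simp: indicator_def)
    also have "\<dots> = emeasure S {y \<in> space S. \<forall>j<n. ratios (case_nat a y) j \<in> E j}"
      using Xs by (rule nn_integral_indicator)
    also have "\<dots> = (\<Prod>j<n. emeasure M (E j))"
      by (rule emeasure_successive_ratios) (use E a in \<open>auto simp: space_M\<close>)
    finally show "(\<integral>\<^sup>+y. indicator ?X (ratios (case_nat a y)) \<partial>S) = (\<Prod>j<n. emeasure M (E j))" .
  qed
  also have "\<dots> = (\<Prod>j<n. emeasure M (E j))" by (simp add: M.emeasure_space_1)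
  also have "\<dots> = (\<Prod>j\<in>J. emeasure M (F j))"
    using n by (intro prod.mono_neutral_cong_right) (auto simp: E_def M.emeasure_space_1)
  finally show "emeasure (distr S S ratios) ?X = (\<Prod>j\<in>J. emeasure M (F j))" .
qed simp

abbreviation PM :: "nat \<Rightarrow> (nat \<Rightarrow> 'g) measure" where
  "PM p \<equiv> Pi\<^sub>M {..<p} (\<lambda>_. M)"

definition ratio_tuple :: "nat \<Rightarrow> (nat \<Rightarrow> 'g) \<Rightarrow> nat \<Rightarrow> 'g" where
  "ratio_tuple p x = restrict (ratios x) {..<p}"

lemma measurable_ratio_tuple [measurable]: "ratio_tuple p \<in> S \<rightarrow>\<^sub>M PM p"
proof -
  have "(\<lambda>x. restrict x {..<p}) \<in> S \<rightarrow>\<^sub>M PM p"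
    by (rule measurable_restrict_subset) simp
  from measurable_compose[OF measurable_ratios this] show ?thesis by (simp add: ratio_tuple_def[abs_def])
qed

lemma distr_ratio_tuple: "distr S (PM p) (ratio_tuple p) = PM p"
proof -
  have r: "(\<lambda>x. restrict x {..<p}) \<in> S \<rightarrow>\<^sub>M PM p"
    by (rule measurable_restrict_subset) simp
  have "distr S (PM p) (ratio_tuple p) = distr (distr S S ratios) (PM p) (\<lambda>x. restrict x {..<p})"
    by (subst distr_distr[OF r measurable_ratios]) (simp add: ratio_tuple_def[abs_def] comp_def)
  also have "\<dots> = PM p"
    unfolding distr_ratios by (rule distr_PiM_restrict_finite) auto
  finally show ?thesis .
qed

lemma nn_integral_ratio_tuple:
  "g \<in> borel_measurable (PM p) \<Longrightarrow> (\<integral>\<^sup>+x. g (ratio_tuple p x) \<partial>S) = (\<integral>\<^sup>+z. g z \<partial>PM p)"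
  using nn_integral_distr[OF measurable_ratio_tuple, of g p] by (simp add: distr_ratio_tuple)

lemma AE_ratio_tuple_iff:
  assumes "{z \<in> space (PM p). P z} \<in> sets (PM p)"
  shows "(AE x in S. P (ratio_tuple p x)) \<longleftrightarrow> (AE z in PM p. P z)"
  using AE_distr_iff[OF measurable_ratio_tuple assms] by (simp only: distr_ratio_tuple)

text \<open>The sequence of partial products of a tuple, continued constantly.\<close>

primrec partial_product :: "(nat \<Rightarrow> 'g) \<Rightarrow> nat \<Rightarrow> 'g" where
  "partial_product z 0 = \<one>\<^bsub>H\<^esub>"
| "partial_product z (Suc j) = partial_product z j \<otimes>\<^bsub>H\<^esub> z j"

definition partial_products :: "nat \<Rightarrow> (nat \<Rightarrow> 'g) \<Rightarrow> nat \<Rightarrow> 'g" where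
  "partial_products p z j = partial_product z (min j p)"

lemma space_PM: "space (PM p) = (\<Pi>\<^sub>E j\<in>{..<p}. carrier H)"
  by (simp add: space_PiM space_M)

lemma measurable_partial_product:
  "j \<le> p \<Longrightarrow> (\<lambda>z. partial_product z j) \<in> PM p \<rightarrow>\<^sub>M M"
  by (induction j) (auto simp: space_M intro!: measurable_mult measurable_component_singleton)

lemma measurable_partial_products [measurable]: "partial_products p \<in> PM p \<rightarrow>\<^sub>M S"
  unfolding partial_products_def[abs_def]
proof (rule measurable_PiM_single')
  show "(\<lambda>z. partial_product z (min j p)) \<in> PM p \<rightarrow>\<^sub>M M" for j
    by (rule measurable_partial_product) simp
  then show "(\<lambda>z j. partial_product z (min j p)) \<in> space (PM p) \<rightarrow> (\<Pi>\<^sub>E i\<in>UNIV. space M)"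
    by (auto dest: measurable_space)
qed

lemma space_partial_products: "z \<in> space (PM p) \<Longrightarrow> partial_products p z \<in> space S"
  by (rule measurable_space[OF measurable_partial_products])

lemma partial_product_closed:
  "z \<in> space (PM p) \<Longrightarrow> j \<le> p \<Longrightarrow> partial_product z j \<in> carrier H"
  using measurable_space[OF measurable_partial_product] by (auto simp: space_M)

lemma space_ratio_tuple: "x \<in> space S \<Longrightarrow> ratio_tuple p x \<in> space (PM p)"
  by (rule measurable_space[OF measurable_ratio_tuple])

lemma ratio_tuple_partial_products:
  assumes z: "z \<in> space (PM p)"
  shows "ratio_tuple p (partial_products p z) = z"
proof
  fix j
  show "ratio_tuple p (partial_products p z) j = z j"
  proof (cases "j < p")
    case True
    then have "partial_product z j \<in> carrier H" "z j \<in> carrier H"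
      using z partial_product_closed[OF z, of j] by (auto simp: space_PM PiE_iff)
    then show ?thesis
      using True by (simp add: ratio_tuple_def ratios_def partial_products_def min_def flip: H.m_assoc)
  next
    case False
    then show ?thesis using z by (auto simp: ratio_tuple_def space_PM PiE_iff extensional_def)
  qed
qed

lemma partial_product_ratio_tuple:
  assumes x: "x \<in> space S"
  shows "j \<le> p \<Longrightarrow> partial_product (ratio_tuple p x) j = inv\<^bsub>H\<^esub> x 0 \<otimes>\<^bsub>H\<^esub> x j"
proof (induction j)
  case 0
  then show ?case using x by (simp add: space_S_iff)
next
  case (Suc j)
  have c: "x 0 \<in> carrier H" "x j \<in> carrier H" "x (Suc j) \<in> carrier H"
    using x by (auto simp: space_S_iff)
  have "ratio_tuple p x j = inv\<^bsub>H\<^esub> x j \<otimes>\<^bsub>H\<^esub> x (Suc j)"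
    using Suc.prems by (simp add: ratio_tuple_def ratios_def)
  then have "partial_product (ratio_tuple p x) (Suc j) =
      inv\<^bsub>H\<^esub> x 0 \<otimes>\<^bsub>H\<^esub> (x j \<otimes>\<^bsub>H\<^esub> (inv\<^bsub>H\<^esub> x j \<otimes>\<^bsub>H\<^esub> x (Suc j)))"
    using Suc c by (simp add: H.m_assoc del: H.r_inv)
  also have "x j \<otimes>\<^bsub>H\<^esub> (inv\<^bsub>H\<^esub> x j \<otimes>\<^bsub>H\<^esub> x (Suc j)) = x (Suc j)"
    using c by (simp flip: H.m_assoc)
  finally show ?case .
qed

text \<open>
  The classical passage from inhomogeneous to homogeneous cochains,
  \<open>f(x\<^sub>0, \<dots>, x\<^sub>p) = x\<^sub>0 \<sigma>(x\<^sub>0\<^sup>-\<^sup>1 x\<^sub>1, \<dots>, x\<^sub>p\<^sub>-\<^sub>1\<^sup>-\<^sup>1 x\<^sub>p)\<close>, and its inverse.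
\<close>

definition homog :: "nat \<Rightarrow> ((nat \<Rightarrow> 'g) \<Rightarrow> 'a) \<Rightarrow> (nat \<Rightarrow> 'g) \<Rightarrow> 'a" where
  "homog p \<sigma> x = T (x 0) (\<sigma> (ratio_tuple p x))"

definition inhom :: "nat \<Rightarrow> ((nat \<Rightarrow> 'g) \<Rightarrow> 'a) \<Rightarrow> (nat \<Rightarrow> 'g) \<Rightarrow> 'a" where
  "inhom p f = (\<lambda>z\<in>space (PM p). f (partial_products p z))"

lemma cochain_homog:
  assumes \<sigma> [measurable]: "\<sigma> \<in> PM p \<rightarrow>\<^sub>M B"
  shows "cochain (Suc p) (homog p \<sigma>)"
  unfolding cochain_def
proof (intro conjI ballI allI impI)
  show "homog p \<sigma> \<in> S \<rightarrow>\<^sub>M B" unfolding homog_def by measurable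
next
  fix g x assume g: "g \<in> carrier H" and x: "x \<in> space S"
  have xc: "x j \<in> carrier H" for j using x by (simp add: space_S_iff)
  have "ratios (translate g x) j = ratios x j" for j
  proof -
    have "inv\<^bsub>H\<^esub> g \<otimes>\<^bsub>H\<^esub> (g \<otimes>\<^bsub>H\<^esub> x (Suc j)) = x (Suc j)"
      using g xc by (simp flip: H.m_assoc)
    then show ?thesis using g xc by (simp add: ratios_def H.inv_mult_group H.m_assoc)
  qed
  then have "ratios (translate g x) = ratios x" by (rule ext)
  then have "ratio_tuple p (translate g x) = ratio_tuple p x" by (simp only: ratio_tuple_def)
  moreover have "\<sigma> (ratio_tuple p x) \<in> carrier A"
    using measurable_space[OF \<sigma> space_ratio_tuple[OF x]] by (simp add: space_B)
  ultimately show "homog p \<sigma> (translate g x) = T g (homog p \<sigma> x)"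
    using g xc by (simp add: homog_def action_mult)
next
  fix x x' :: "nat \<Rightarrow> 'g" assume "\<forall>j<Suc p. x j = x' j"
  then have "ratio_tuple p x = ratio_tuple p x'" "x 0 = x' 0"
    by (auto simp: ratio_tuple_def ratios_def restrict_def fun_eq_iff)
  then show "homog p \<sigma> x = homog p \<sigma> x'" by (simp add: homog_def)
qed

lemma inhom_measurable: "cochain n f \<Longrightarrow> inhom p f \<in> PM p \<rightarrow>\<^sub>M B"
  using measurable_compose[OF measurable_partial_products cochain_measurable, of n f p]
  by (simp add: inhom_def restrict_def cong: measurable_cong)

lemma homog_inhom:
  assumes f: "cochain (Suc p) f" and x: "x \<in> space S"
  shows "homog p (inhom p f) x = f x"
proof -
  have xc: "x j \<in> carrier H" for j using x by (simp add: space_S_iff)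
  let ?y = "partial_products p (ratio_tuple p x)"
  have y: "?y \<in> space S" by (rule space_partial_products[OF space_ratio_tuple[OF x]])
  have "homog p (inhom p f) x = T (x 0) (f ?y)"
    using space_ratio_tuple[OF x] by (simp add: homog_def inhom_def)
  also have "\<dots> = f (translate (x 0) ?y)"
    using cochain_equivariant[OF f xc y] by simp
  also have "\<dots> = f x"
  proof -
    have "translate (x 0) ?y j = x j" if "j < Suc p" for j
      using that xc by (simp add: partial_products_def partial_product_ratio_tuple[OF x] flip: H.m_assoc)
    then show ?thesis using f by (simp add: cochain_def)
  qed
  finally show ?thesis .
qed

lemma inhom_homog:
  assumes \<sigma>: "\<sigma> \<in> PM p \<rightarrow>\<^sub>M B" and z: "z \<in> space (PM p)"
  shows "inhom p (homog p \<sigma>) z = \<sigma> z"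
  using measurable_space[OF \<sigma> z] z
  by (simp add: inhom_def homog_def ratio_tuple_partial_products space_B action_one partial_products_def)

lemma homog_one_iff:
  assumes \<sigma>: "\<sigma> \<in> PM p \<rightarrow>\<^sub>M B" and x: "x \<in> space S"
  shows "homog p \<sigma> x = \<one>\<^bsub>A\<^esub> \<longleftrightarrow> \<sigma> (ratio_tuple p x) = \<one>\<^bsub>A\<^esub>"
proof
  have xc: "x 0 \<in> carrier H" using x by (simp add: space_S_iff)
  have c: "\<sigma> (ratio_tuple p x) \<in> carrier A"
    using measurable_space[OF \<sigma> space_ratio_tuple[OF x]] by (simp add: space_B)
  have one: "T g \<one>\<^bsub>A\<^esub> = \<one>\<^bsub>A\<^esub>" if "g \<in> carrier H" for g
    using group_hom.hom_one[OF action_group_hom[OF that]] .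
  show "homog p \<sigma> x = \<one>\<^bsub>A\<^esub>" if "\<sigma> (ratio_tuple p x) = \<one>\<^bsub>A\<^esub>"
    using that one[OF xc] by (simp add: homog_def)
  assume "homog p \<sigma> x = \<one>\<^bsub>A\<^esub>"
  then have "T (inv\<^bsub>H\<^esub> x 0) (T (x 0) (\<sigma> (ratio_tuple p x))) = \<one>\<^bsub>A\<^esub>"
    using one xc by (simp add: homog_def)
  then show "\<sigma> (ratio_tuple p x) = \<one>\<^bsub>A\<^esub>"
    using xc c by (simp add: action_one flip: action_mult)
qed

end


section \<open>Measurable cochains of a second countable compact group\<close>

locale haar_module = polish_module G A T + C: sc_compact_group G
  for G :: "'g tgroup" and A :: "'a tgroup" and T :: "'g \<Rightarrow> 'a \<Rightarrow> 'a"
begin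

definition haar :: "'g measure" where
  "haar = (SOME \<mu>. haar_measure G \<mu>)"

lemma haar: "haar_measure G haar"
  unfolding haar_def by (rule someI_ex[OF C.exists_haar_measure])

abbreviation "BA \<equiv> borel_of (gtop A)"

lemma Hausdorff_A: "Hausdorff_space (gtop A)"
  using completely_metrizable_imp_metrizable_space[OF completely_metrizable]
  by (rule metrizable_imp_Hausdorff_space)

lemma action_AutoGroup: "g \<in> carrier G \<Longrightarrow> T g \<in> auto A"
  using action by (auto simp: hom_def AutoGroup_def)

sublocale mm: measurable_module haar G A BA T
proof -
  interpret prob_space haar by (rule C.haar_measureD[OF haar])
  interpret product_prob_space "\<lambda>_::nat. haar" UNIV ..
  interpret sequence_space haar ..
  note s = C.haar_measureD(1)[OF haar] and sp = C.haar_measureD(2)[OF haar]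
  have s2: "sets (haar \<Otimes>\<^sub>M haar) = sets (C.BG \<Otimes>\<^sub>M C.BG)" by (rule sets_pair_measure_cong[OF s s])
  have s3: "sets (haar \<Otimes>\<^sub>M BA) = sets (borel_of (prod_topology (gtop G) (gtop A)))"
    using sets_pair_measure_cong[OF s, of BA BA] sets_borel_of_prod[OF C.sc second_countable] by simp
  show "measurable_module haar G A BA T"
  proof
    show "space haar = carrier G" by (rule sp)
    show "(\<lambda>z. fst z \<otimes>\<^bsub>G\<^esub> snd z) \<in> haar \<Otimes>\<^sub>M haar \<rightarrow>\<^sub>M haar"
      using C.measurable_group_mult measurable_cong_sets[OF s2 s] by simp
    show "(\<lambda>x. inv\<^bsub>G\<^esub> x) \<in> haar \<rightarrow>\<^sub>M haar"
      using C.measurable_group_inv measurable_cong_sets[OF s s] by simp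
    show "distr haar haar (\<lambda>x. g \<otimes>\<^bsub>G\<^esub> x) = haar" if "g \<in> carrier G" for g
      by (rule C.haar_measureD(4)[OF haar that])
    show "space BA = carrier A" by (simp add: A.topspace_gtop)
    show "(\<lambda>z. fst z \<otimes>\<^bsub>A\<^esub> snd z) \<in> BA \<Otimes>\<^sub>M BA \<rightarrow>\<^sub>M BA"
      using continuous_map_measurable[OF A.continuous_mult]
      by (simp add: split_beta' measurable_cong_sets[OF sets_borel_of_prod[OF second_countable second_countable] refl])
    show "(\<lambda>a. inv\<^bsub>A\<^esub> a) \<in> BA \<rightarrow>\<^sub>M BA"
      by (rule continuous_map_measurable[OF A.continuous_inv])
    show "(\<lambda>z. T (fst z) (snd z)) \<in> haar \<Otimes>\<^sub>M BA \<rightarrow>\<^sub>M BA"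
      using continuous_map_measurable[OF continuous_action] measurable_cong_sets[OF s3 refl[of "sets BA"]]
      by (simp add: split_beta')
    show "T g \<in> hom A A" if "g \<in> carrier G" for g
      using action_AutoGroup[OF that] by (simp add: auto_def)
    fix a assume a: "a \<in> carrier A"
    show "T (g \<otimes>\<^bsub>G\<^esub> h) a = T g (T h a)" if g: "g \<in> carrier G" and h: "h \<in> carrier G" for g h
    proof -
      have "T (g \<otimes>\<^bsub>G\<^esub> h) = compose (carrier A) (T g) (T h)"
        using hom_mult[OF action g h] action_AutoGroup[OF g] action_AutoGroup[OF h]
        by (simp add: AutoGroup_def BijGroup_def auto_def)
      then show ?thesis using a by (simp add: compose_def)
    qed
    have one: "T \<one>\<^bsub>G\<^esub> = \<one>\<^bsub>AutoGroup A\<^esub>"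
      by (rule hom_one[OF action G.group_axioms A.AutoGroup])
    then show "T \<one>\<^bsub>G\<^esub> a = a" using a by (simp add: AutoGroup_def BijGroup_def)
  qed
qed

lemma carrier_tpower: "carrier (tpower G p) = space (mm.PM p)"
  by (simp add: product_tgroup_def mm.space_PM)

lemma haar_AE_iff: "haar_AE G p P \<longleftrightarrow> (AE z in mm.PM p. P z)"
  unfolding haar_AE_def using haar C.haar_measure_unique by metis

lemma measurable_tpower: "measurable (borel_of (gtop (tpower G p))) N = measurable (mm.PM p) N"
proof (rule measurable_cong_sets[OF _ refl])
  have "sets (Pi\<^sub>M {..<p} (\<lambda>_. C.BG)) = sets (mm.PM p)"
    by (rule sets_PiM_cong) (simp_all add: C.haar_measureD(1)[OF haar])
  then show "sets (borel_of (gtop (tpower G p))) = sets (mm.PM p)"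
    using sets_borel_of_power[OF C.sc, of "{..<p}"] by (simp add: product_tgroup_def)
qed

lemma borel_maps_iff:
  "\<phi> \<in> carrier (borel_maps G A p) \<longleftrightarrow> \<phi> \<in> extensional (space (mm.PM p)) \<and> \<phi> \<in> mm.PM p \<rightarrow>\<^sub>M BA"
  by (simp add: borel_maps_def measurable_tpower carrier_tpower)

lemma borel_maps_measurable: "\<phi> \<in> carrier (borel_maps G A p) \<Longrightarrow> \<phi> \<in> mm.PM p \<rightarrow>\<^sub>M BA"
  by (simp add: borel_maps_iff)

lemma borel_maps_closed:
  "\<lbrakk>\<phi> \<in> carrier (borel_maps G A p); z \<in> space (mm.PM p)\<rbrakk> \<Longrightarrow> \<phi> z \<in> carrier A"
  using measurable_space[OF borel_maps_measurable] by (simp add: A.topspace_gtop)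

lemma borel_maps_mult: "\<phi> \<otimes>\<^bsub>borel_maps G A p\<^esub> \<psi> = (\<lambda>z\<in>space (mm.PM p). \<phi> z \<otimes>\<^bsub>A\<^esub> \<psi> z)"
  by (simp add: borel_maps_def carrier_tpower)

lemma borel_maps_one: "\<one>\<^bsub>borel_maps G A p\<^esub> = (\<lambda>z\<in>space (mm.PM p). \<one>\<^bsub>A\<^esub>)"
  by (simp add: borel_maps_def carrier_tpower)

lemma borel_maps_restrictI:
  "\<phi> \<in> mm.PM p \<rightarrow>\<^sub>M BA \<Longrightarrow> restrict \<phi> (space (mm.PM p)) \<in> carrier (borel_maps G A p)"
  by (auto simp: borel_maps_iff cong: measurable_cong)

lemma borel_maps_eqI:
  assumes "\<phi> \<in> carrier (borel_maps G A p)" "\<psi> \<in> carrier (borel_maps G A p)"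
    and "\<And>z. z \<in> space (mm.PM p) \<Longrightarrow> \<phi> z = \<psi> z"
  shows "\<phi> = \<psi>"
  using assms by (intro extensionalityI[of _ "space (mm.PM p)"]) (auto simp: borel_maps_iff)

lemma comm_group_borel_maps: "comm_group (borel_maps G A p)"
proof (rule comm_groupI)
  let ?B = "borel_maps G A p"
  show cl: "\<phi> \<otimes>\<^bsub>?B\<^esub> \<psi> \<in> carrier ?B" if "\<phi> \<in> carrier ?B" "\<psi> \<in> carrier ?B" for \<phi> \<psi>
    using that unfolding borel_maps_mult
    by (intro borel_maps_restrictI mm.measurable_mult_A borel_maps_measurable)
  show one: "\<one>\<^bsub>?B\<^esub> \<in> carrier ?B"
    unfolding borel_maps_one
    by (intro borel_maps_restrictI measurable_const) (simp add: A.topspace_gtop)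
  fix \<phi> assume \<phi>: "\<phi> \<in> carrier ?B"
  show "\<one>\<^bsub>?B\<^esub> \<otimes>\<^bsub>?B\<^esub> \<phi> = \<phi>"
    using borel_maps_closed[OF \<phi>]
    by (intro borel_maps_eqI[OF cl[OF one \<phi>] \<phi>]) (simp add: borel_maps_mult borel_maps_one)
  show "\<exists>\<psi>\<in>carrier ?B. \<psi> \<otimes>\<^bsub>?B\<^esub> \<phi> = \<one>\<^bsub>?B\<^esub>"
  proof
    show i: "(\<lambda>z\<in>space (mm.PM p). inv\<^bsub>A\<^esub> \<phi> z) \<in> carrier ?B"
      by (intro borel_maps_restrictI mm.measurable_inv_A borel_maps_measurable \<phi>)
    show "(\<lambda>z\<in>space (mm.PM p). inv\<^bsub>A\<^esub> \<phi> z) \<otimes>\<^bsub>?B\<^esub> \<phi> = \<one>\<^bsub>?B\<^esub>"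
      using borel_maps_closed[OF \<phi>]
      by (intro borel_maps_eqI[OF cl[OF i \<phi>] one]) (simp add: borel_maps_mult borel_maps_one)
  qed
  fix \<psi> assume \<psi>: "\<psi> \<in> carrier ?B"
  show "\<phi> \<otimes>\<^bsub>?B\<^esub> \<psi> = \<psi> \<otimes>\<^bsub>?B\<^esub> \<phi>"
    using borel_maps_closed[OF \<phi>] borel_maps_closed[OF \<psi>]
    by (intro borel_maps_eqI[OF cl[OF \<phi> \<psi>] cl[OF \<psi> \<phi>]]) (simp add: borel_maps_mult A.m_comm)
  fix \<rho> assume \<rho>: "\<rho> \<in> carrier ?B"
  show "\<phi> \<otimes>\<^bsub>?B\<^esub> \<psi> \<otimes>\<^bsub>?B\<^esub> \<rho> = \<phi> \<otimes>\<^bsub>?B\<^esub> (\<psi> \<otimes>\<^bsub>?B\<^esub> \<rho>)"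
    using borel_maps_closed[OF \<phi>] borel_maps_closed[OF \<psi>] borel_maps_closed[OF \<rho>]
    by (intro borel_maps_eqI[OF cl[OF cl[OF \<phi> \<psi>] \<rho>] cl[OF \<phi> cl[OF \<psi> \<rho>]]])
       (simp add: borel_maps_mult A.m_assoc)
qed

sublocale bm: comm_group "borel_maps G A p" for p
  by (rule comm_group_borel_maps)

lemma borel_maps_inv:
  assumes \<phi>: "\<phi> \<in> carrier (borel_maps G A p)" and z: "z \<in> space (mm.PM p)"
  shows "(inv\<^bsub>borel_maps G A p\<^esub> \<phi>) z = inv\<^bsub>A\<^esub> \<phi> z"
proof -
  have "((inv\<^bsub>borel_maps G A p\<^esub> \<phi>) \<otimes>\<^bsub>borel_maps G A p\<^esub> \<phi>) z = \<one>\<^bsub>A\<^esub>"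
    using \<phi> z by (simp add: borel_maps_one)
  then have "(inv\<^bsub>borel_maps G A p\<^esub> \<phi>) z \<otimes>\<^bsub>A\<^esub> \<phi> z = \<one>\<^bsub>A\<^esub>" using z by (simp add: borel_maps_mult)
  then show ?thesis
    using A.inv_equality borel_maps_closed[OF \<phi> z] borel_maps_closed[OF bm.inv_closed[OF \<phi>] z] by metis
qed

lemma homog_mult:
  assumes "\<phi> \<in> carrier (borel_maps G A p)" "\<psi> \<in> carrier (borel_maps G A p)" and x: "x \<in> space mm.S"
  shows "mm.homog p (\<phi> \<otimes>\<^bsub>borel_maps G A p\<^esub> \<psi>) x = mm.homog p \<phi> x \<otimes>\<^bsub>A\<^esub> mm.homog p \<psi> x"
  using assms(1,2) mm.space_ratio_tuple[OF x] x
  by (simp add: mm.homog_def borel_maps_mult mm.action_prod borel_maps_closed mm.space_S_iff)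

lemma homog_inv:
  assumes "\<phi> \<in> carrier (borel_maps G A p)" and x: "x \<in> space mm.S"
  shows "mm.homog p (inv\<^bsub>borel_maps G A p\<^esub> \<phi>) x = inv\<^bsub>A\<^esub> mm.homog p \<phi> x"
  using assms(1) mm.space_ratio_tuple[OF x] x
  by (simp add: mm.homog_def borel_maps_inv mm.action_inv borel_maps_closed mm.space_S_iff)

lemma cochain_homog: "\<phi> \<in> carrier (borel_maps G A p) \<Longrightarrow> mm.cochain (Suc p) (mm.homog p \<phi>)"
  by (intro mm.cochain_homog borel_maps_measurable)

lemma inhom_borel_maps: "mm.cochain n f \<Longrightarrow> mm.inhom p f \<in> carrier (borel_maps G A p)"
  using mm.inhom_measurable[of n f p] by (simp add: borel_maps_iff mm.inhom_def)

lemma inhom_homog: "\<phi> \<in> carrier (borel_maps G A p) \<Longrightarrow> mm.inhom p (mm.homog p \<phi>) = \<phi>"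
  by (rule borel_maps_eqI[of _ p])
     (auto intro: inhom_borel_maps cochain_homog mm.inhom_homog borel_maps_measurable)

lemma borel_maps_homog_eqI:
  assumes "\<phi> \<in> carrier (borel_maps G A p)" "\<psi> \<in> carrier (borel_maps G A p)"
    and "\<And>x. x \<in> space mm.S \<Longrightarrow> mm.homog p \<phi> x = mm.homog p \<psi> x"
  shows "\<phi> = \<psi>"
proof -
  have "mm.inhom p (mm.homog p \<phi>) = mm.inhom p (mm.homog p \<psi>)"
    unfolding mm.inhom_def by (rule restrict_ext) (simp add: assms(3) mm.space_partial_products)
  then show ?thesis using assms by (simp add: inhom_homog)
qed

lemma one_set: "{\<one>\<^bsub>A\<^esub>} \<in> sets BA"
  by (rule closedin_sets_borel_of)
     (simp add: closedin_Hausdorff_singleton[OF Hausdorff_A] A.topspace_gtop)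

text \<open>
  Null maps are recognised on homogeneous cochains, where null sets are preserved by deleting
  entries; this makes the coboundary well defined on classes.
\<close>

lemma null_maps_iff:
  "\<phi> \<in> null_maps G A p \<longleftrightarrow>
     \<phi> \<in> carrier (borel_maps G A p) \<and> (AE x in mm.S. mm.homog p \<phi> x = \<one>\<^bsub>A\<^esub>)"
proof (rule conj_cong[OF refl, of "\<phi> \<in> carrier (borel_maps G A p)", THEN trans[rotated]])
  assume \<phi>: "\<phi> \<in> carrier (borel_maps G A p)"
  note m [measurable] = borel_maps_measurable[OF \<phi>]
  have "{z \<in> space (mm.PM p). \<phi> z = \<one>\<^bsub>A\<^esub>} = \<phi> -` {\<one>\<^bsub>A\<^esub>} \<inter> space (mm.PM p)" by auto
  then have "{z \<in> space (mm.PM p). \<phi> z = \<one>\<^bsub>A\<^esub>} \<in> sets (mm.PM p)"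
    using measurable_sets[OF m one_set] by simp
  then have "(AE z in mm.PM p. \<phi> z = \<one>\<^bsub>A\<^esub>) \<longleftrightarrow> (AE x in mm.S. \<phi> (mm.ratio_tuple p x) = \<one>\<^bsub>A\<^esub>)"
    by (rule mm.AE_ratio_tuple_iff[symmetric])
  also have "\<dots> \<longleftrightarrow> (AE x in mm.S. mm.homog p \<phi> x = \<one>\<^bsub>A\<^esub>)"
    by (rule AE_cong) (simp add: mm.homog_one_iff[OF m])
  finally show "haar_AE G p (\<lambda>x. \<phi> x = \<one>\<^bsub>A\<^esub>) \<longleftrightarrow> (AE x in mm.S. mm.homog p \<phi> x = \<one>\<^bsub>A\<^esub>)"
    by (simp add: haar_AE_iff)
qed (simp add: null_maps_def)

lemma subgroup_null_maps: "subgroup (null_maps G A p) (borel_maps G A p)"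
proof (rule bm.subgroupI)
  show "null_maps G A p \<subseteq> carrier (borel_maps G A p)" by (auto simp: null_maps_def)
  have "\<one>\<^bsub>borel_maps G A p\<^esub> \<in> null_maps G A p"
    by (auto simp: null_maps_def haar_AE_iff borel_maps_one bm.one_closed[unfolded borel_maps_one])
  then show "null_maps G A p \<noteq> {}" by auto
  fix \<phi> assume \<phi>: "\<phi> \<in> null_maps G A p"
  then have \<phi>B: "\<phi> \<in> carrier (borel_maps G A p)" by (simp add: null_maps_iff)
  have "AE x in mm.S. mm.homog p \<phi> x = \<one>\<^bsub>A\<^esub>" using \<phi> by (simp add: null_maps_iff)
  then have "AE x in mm.S. mm.homog p (inv\<^bsub>borel_maps G A p\<^esub> \<phi>) x = \<one>\<^bsub>A\<^esub>"
    by (rule AE_mp) (rule AE_I2, simp add: homog_inv \<phi>B)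
  then show "inv\<^bsub>borel_maps G A p\<^esub> \<phi> \<in> null_maps G A p" using \<phi>B by (simp add: null_maps_iff)
  fix \<psi> assume \<psi>: "\<psi> \<in> null_maps G A p"
  then have \<psi>B: "\<psi> \<in> carrier (borel_maps G A p)" by (simp add: null_maps_iff)
  have "AE x in mm.S. mm.homog p \<phi> x = \<one>\<^bsub>A\<^esub>" "AE x in mm.S. mm.homog p \<psi> x = \<one>\<^bsub>A\<^esub>"
    using \<phi> \<psi> by (simp_all add: null_maps_iff)
  then have "AE x in mm.S. mm.homog p (\<phi> \<otimes>\<^bsub>borel_maps G A p\<^esub> \<psi>) x = \<one>\<^bsub>A\<^esub>"
    using AE_space by eventually_elim (simp add: homog_mult \<phi>B \<psi>B)
  then show "\<phi> \<otimes>\<^bsub>borel_maps G A p\<^esub> \<psi> \<in> null_maps G A p" using \<phi>B \<psi>B by (simp add: null_maps_iff)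
qed

lemma coboundary_fun_eq_altprod:
  assumes \<phi>: "\<phi> \<in> carrier (borel_maps G A p)" and z: "z \<in> space (mm.PM (Suc p))"
  shows "coboundary_fun G A T p \<phi> z =
    altprod A (Suc (Suc p)) (\<lambda>i. if i = 0 then T (z 0) (\<phi> (\<lambda>j\<in>{..<p}. z (Suc j)))
      else if i \<le> p then \<phi> (merge_coords G p i z) else \<phi> (restrict z {..<p}))"
    (is "_ = altprod A _ ?F")
proof -
  have zc: "z j \<in> carrier G" if "j < Suc p" for j using z that by (auto simp: mm.space_PM PiE_iff)
  have cl: "?F i \<in> carrier A" for i
  proof -
    have "(\<lambda>j\<in>{..<p}. z (Suc j)) \<in> space (mm.PM p)" "merge_coords G p i z \<in> space (mm.PM p)"
      "restrict z {..<p} \<in> space (mm.PM p)"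
      using zc by (auto simp: mm.space_PM merge_coords_def)
    then show ?thesis using borel_maps_closed[OF \<phi>] zc[of 0] by auto
  qed
  have "altprod A (Suc (Suc p)) ?F = altprod A (Suc p) ?F \<otimes>\<^bsub>A\<^esub> ?F (Suc p) [^]\<^bsub>A\<^esub> ((-1::int) ^ Suc p)"
    by (rule A.altprod_snoc) (rule cl)
  also have "altprod A (Suc p) ?F = ?F 0 \<otimes>\<^bsub>A\<^esub> (\<Otimes>\<^bsub>A\<^esub>i\<in>{1..p}. ?F i [^]\<^bsub>A\<^esub> ((-1::int) ^ i))"
    by (rule A.altprod_eq_finprod) (rule cl)
  also have "(\<Otimes>\<^bsub>A\<^esub>i\<in>{1..p}. ?F i [^]\<^bsub>A\<^esub> ((-1::int) ^ i)) =
      (\<Otimes>\<^bsub>A\<^esub>i\<in>{1..p}. \<phi> (merge_coords G p i z) [^]\<^bsub>A\<^esub> ((-1::int) ^ i))"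
  proof (rule A.finprod_cong')
    show "(\<lambda>i. \<phi> (merge_coords G p i z) [^]\<^bsub>A\<^esub> ((-1::int) ^ i)) \<in> {1..p} \<rightarrow> carrier A"
    proof
      fix i assume "i \<in> {1..p}"
      then show "\<phi> (merge_coords G p i z) [^]\<^bsub>A\<^esub> ((-1::int) ^ i) \<in> carrier A"
        using cl[of i] by (auto intro: A.int_pow_closed)
    qed
  qed auto
  finally show ?thesis using z by (simp add: coboundary_fun_def carrier_tpower)
qed

text \<open>
  Deleting an entry of a sequence merges two neighbouring ratios, so that the inhomogeneous
  coboundary becomes the simplicial one.
\<close>

lemma homog_coboundary_fun:
  assumes \<phi>: "\<phi> \<in> carrier (borel_maps G A p)" and x: "x \<in> space mm.S"
  shows "mm.homog (Suc p) (coboundary_fun G A T p \<phi>) x = mm.d (Suc (Suc p)) (mm.homog p \<phi>) x"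
proof -
  let ?z = "mm.ratio_tuple (Suc p) x"
  let ?F = "\<lambda>i. if i = 0 then T (?z 0) (\<phi> (\<lambda>j\<in>{..<p}. ?z (Suc j)))
      else if i \<le> p then \<phi> (merge_coords G p i ?z) else \<phi> (restrict ?z {..<p})"
  have xc: "x j \<in> carrier G" for j using x by (simp add: mm.space_S_iff)
  have z: "?z \<in> space (mm.PM (Suc p))" by (rule mm.space_ratio_tuple[OF x])
  have zc: "?z j \<in> carrier G" if "j < Suc p" for j using z that by (auto simp: mm.space_PM PiE_iff)
  have zr: "?z j = inv\<^bsub>G\<^esub> x j \<otimes>\<^bsub>G\<^esub> x (Suc j)" if "j < Suc p" for j
    using that by (simp add: mm.ratio_tuple_def mm.ratios_def)
  have cl: "?F i \<in> carrier A" for i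
  proof -
    have "(\<lambda>j\<in>{..<p}. ?z (Suc j)) \<in> space (mm.PM p)" "merge_coords G p i ?z \<in> space (mm.PM p)"
      "restrict ?z {..<p} \<in> space (mm.PM p)"
      using zc by (auto simp: mm.space_PM merge_coords_def)
    then show ?thesis using borel_maps_closed[OF \<phi>] zc[of 0] by auto
  qed
  have face: "mm.homog p \<phi> (skip i x) = T (x 0) (?F i)" if i: "i < Suc (Suc p)" for i
  proof -
    consider "i = 0" | "0 < i" "i \<le> p" | "i = Suc p" using i by linarith
    then show ?thesis
    proof cases
      case 1
      have r: "mm.ratio_tuple p (skip 0 x) = (\<lambda>j\<in>{..<p}. ?z (Suc j))"
        by (auto simp: mm.ratio_tuple_def mm.ratios_def skip_def fun_eq_iff)
      have "(\<lambda>j\<in>{..<p}. ?z (Suc j)) \<in> space (mm.PM p)"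
        using zc by (auto simp: mm.space_PM)
      then have c: "\<phi> (\<lambda>j\<in>{..<p}. ?z (Suc j)) \<in> carrier A" by (rule borel_maps_closed[OF \<phi>])
      have "x 0 \<otimes>\<^bsub>G\<^esub> ?z 0 = x 1" using xc zr[of 0] by (simp flip: G.m_assoc)
      then have "T (x 1) (\<phi> (\<lambda>j\<in>{..<p}. ?z (Suc j))) = T (x 0) (?F 0)"
        using mm.action_mult[OF xc zc c, of 0 0] by simp
      then show ?thesis using 1 r by (simp add: mm.homog_def skip_def[of 0 x])
    next
      case 2
      have "mm.ratio_tuple p (skip i x) = merge_coords G p i ?z"
      proof
        fix j
        show "mm.ratio_tuple p (skip i x) j = merge_coords G p i ?z j"
        proof (cases "j < p")
          case True
          consider "Suc j < i" | "Suc j = i" | "i \<le> j" by linarith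
          then show ?thesis
          proof cases
            case 2
            have "inv\<^bsub>G\<^esub> x j \<otimes>\<^bsub>G\<^esub> x (Suc (Suc j)) =
              (inv\<^bsub>G\<^esub> x j \<otimes>\<^bsub>G\<^esub> x (Suc j)) \<otimes>\<^bsub>G\<^esub> (inv\<^bsub>G\<^esub> x (Suc j) \<otimes>\<^bsub>G\<^esub> x (Suc (Suc j)))"
            proof -
              have "x (Suc j) \<otimes>\<^bsub>G\<^esub> (inv\<^bsub>G\<^esub> x (Suc j) \<otimes>\<^bsub>G\<^esub> x (Suc (Suc j))) = x (Suc (Suc j))"
                using xc by (simp flip: G.m_assoc)
              then show ?thesis using xc by (simp add: G.m_assoc)
            qed
            then show ?thesis using 2 True
              by (auto simp: mm.ratio_tuple_def mm.ratios_def skip_def merge_coords_def)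
          qed (use True in \<open>auto simp: mm.ratio_tuple_def mm.ratios_def skip_def merge_coords_def\<close>)
        qed (simp add: mm.ratio_tuple_def merge_coords_def)
      qed
      then show ?thesis using 2 by (simp add: mm.homog_def skip_def[of i x])
    next
      case 3
      have "mm.ratio_tuple p (skip i x) = restrict ?z {..<p}"
        using 3 by (auto simp: mm.ratio_tuple_def mm.ratios_def skip_def fun_eq_iff restrict_def)
      moreover have "skip i x 0 = x 0" using 3 by (simp add: skip_def)
      moreover have "?F i = \<phi> (restrict ?z {..<p})" using 3 by simp
      ultimately show ?thesis by (simp only: mm.homog_def)
    qed
  qed
  have "mm.homog (Suc p) (coboundary_fun G A T p \<phi>) x = T (x 0) (altprod A (Suc (Suc p)) ?F)"
    by (simp only: mm.homog_def coboundary_fun_eq_altprod[OF \<phi> z])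
  also have "\<dots> = altprod A (Suc (Suc p)) (\<lambda>i. T (x 0) (?F i))"
    by (rule mm.action_altprod) (rule xc, rule cl)
  also have "\<dots> = mm.d (Suc (Suc p)) (mm.homog p \<phi>) x"
    by (rule altprod_cong) (simp only: face)
  finally show ?thesis .
qed

lemma coboundary_fun_eq_inhom:
  assumes \<phi>: "\<phi> \<in> carrier (borel_maps G A p)"
  shows "coboundary_fun G A T p \<phi> = mm.inhom (Suc p) (mm.d (Suc (Suc p)) (mm.homog p \<phi>))"
proof (rule extensionalityI[of _ "space (mm.PM (Suc p))"])
  show "coboundary_fun G A T p \<phi> \<in> extensional (space (mm.PM (Suc p)))"
    by (simp add: coboundary_fun_def carrier_tpower)
  show "mm.inhom (Suc p) (mm.d (Suc (Suc p)) (mm.homog p \<phi>)) \<in> extensional (space (mm.PM (Suc p)))"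
    unfolding mm.inhom_def by (rule restrict_extensional)
  fix z assume z: "z \<in> space (mm.PM (Suc p))"
  let ?x = "mm.partial_products (Suc p) z"
  have x: "?x \<in> space mm.S" by (rule mm.space_partial_products[OF z])
  have "mm.homog (Suc p) (coboundary_fun G A T p \<phi>) ?x = T \<one>\<^bsub>G\<^esub> (coboundary_fun G A T p \<phi> z)"
    by (simp add: mm.homog_def mm.ratio_tuple_partial_products[OF z] mm.partial_products_def)
  moreover have "coboundary_fun G A T p \<phi> z \<in> carrier A"
  proof -
    have zc: "z j \<in> carrier G" if "j < Suc p" for j using z that by (auto simp: mm.space_PM PiE_iff)
    have "(\<lambda>j\<in>{..<p}. z (Suc j)) \<in> space (mm.PM p)" "merge_coords G p i z \<in> space (mm.PM p)"
      "restrict z {..<p} \<in> space (mm.PM p)" for i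
      using zc by (auto simp: mm.space_PM merge_coords_def)
    then show ?thesis
      unfolding coboundary_fun_eq_altprod[OF \<phi> z]
      using borel_maps_closed[OF \<phi>] zc[of 0] by (intro A.altprod_closed) auto
  qed
  ultimately show "coboundary_fun G A T p \<phi> z = mm.inhom (Suc p) (mm.d (Suc (Suc p)) (mm.homog p \<phi>)) z"
    using homog_coboundary_fun[OF \<phi> x] z by (simp add: mm.inhom_def mm.action_one del: altprod.simps)
qed

lemma coboundary_fun_closed:
  "\<phi> \<in> carrier (borel_maps G A p) \<Longrightarrow> coboundary_fun G A T p \<phi> \<in> carrier (borel_maps G A (Suc p))"
  by (subst coboundary_fun_eq_inhom, assumption)
     (rule inhom_borel_maps[OF mm.cochain_d[OF cochain_homog]])

lemma coboundary_fun_hom: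
  "coboundary_fun G A T p \<in> hom (borel_maps G A p) (borel_maps G A (Suc p))"
proof (rule homI)
  fix \<phi> \<psi> assume \<phi>: "\<phi> \<in> carrier (borel_maps G A p)" and \<psi>: "\<psi> \<in> carrier (borel_maps G A p)"
  show "coboundary_fun G A T p (\<phi> \<otimes>\<^bsub>borel_maps G A p\<^esub> \<psi>) =
    coboundary_fun G A T p \<phi> \<otimes>\<^bsub>borel_maps G A (Suc p)\<^esub> coboundary_fun G A T p \<psi>"
  proof (rule borel_maps_homog_eqI)
    fix x assume x: "x \<in> space mm.S"
    have "mm.d (Suc (Suc p)) (mm.homog p (\<phi> \<otimes>\<^bsub>borel_maps G A p\<^esub> \<psi>)) x =
       altprod A (Suc (Suc p)) (\<lambda>i. mm.homog p \<phi> (skip i x) \<otimes>\<^bsub>A\<^esub> mm.homog p \<psi> (skip i x))"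
      by (rule altprod_cong) (simp add: homog_mult \<phi> \<psi> mm.space_skip[OF x])
    also have "\<dots> = mm.d (Suc (Suc p)) (mm.homog p \<phi>) x \<otimes>\<^bsub>A\<^esub> mm.d (Suc (Suc p)) (mm.homog p \<psi>) x"
      by (intro A.altprod_mult mm.cochain_closed[OF cochain_homog] \<phi> \<psi> mm.space_skip[OF x])
    finally show "mm.homog (Suc p) (coboundary_fun G A T p (\<phi> \<otimes>\<^bsub>borel_maps G A p\<^esub> \<psi>)) x =
      mm.homog (Suc p) (coboundary_fun G A T p \<phi> \<otimes>\<^bsub>borel_maps G A (Suc p)\<^esub> coboundary_fun G A T p \<psi>) x"
      using \<phi> \<psi> by (simp only: homog_coboundary_fun homog_mult x coboundary_fun_closed bm.m_closed)
  qed (intro coboundary_fun_closed bm.m_closed \<phi> \<psi>)+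
qed (rule coboundary_fun_closed)

lemma coboundary_fun_null:
  assumes "\<phi> \<in> null_maps G A p"
  shows "coboundary_fun G A T p \<phi> \<in> null_maps G A (Suc p)"
proof -
  have \<phi>: "\<phi> \<in> carrier (borel_maps G A p)" and ae: "AE x in mm.S. mm.homog p \<phi> x = \<one>\<^bsub>A\<^esub>"
    using assms by (simp_all add: null_maps_iff)
  have "AE x in mm.S. \<forall>i. mm.homog p \<phi> (skip i x) = \<one>\<^bsub>A\<^esub>"
    by (simp only: AE_all_countable) (intro allI mm.AE_skip ae)
  then have "AE x in mm.S. mm.homog (Suc p) (coboundary_fun G A T p \<phi>) x = \<one>\<^bsub>A\<^esub>"
    using AE_space
  proof eventually_elim
    case (elim x)
    then show ?case using homog_coboundary_fun[OF \<phi>] by (simp add: A.altprod_one)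
  qed
  then show ?thesis using coboundary_fun_closed[OF \<phi>] by (simp add: null_maps_iff)
qed

lemma coboundary_fun_coboundary_fun:
  assumes \<phi>: "\<phi> \<in> carrier (borel_maps G A p)"
  shows "coboundary_fun G A T (Suc p) (coboundary_fun G A T p \<phi>) \<in> null_maps G A (Suc (Suc p))"
proof -
  note c = coboundary_fun_closed[OF \<phi>]
  have "mm.homog (Suc (Suc p)) (coboundary_fun G A T (Suc p) (coboundary_fun G A T p \<phi>)) x = \<one>\<^bsub>A\<^esub>"
    if x: "x \<in> space mm.S" for x
  proof -
    have "mm.d (Suc (Suc (Suc p))) (mm.homog (Suc p) (coboundary_fun G A T p \<phi>)) x =
      altprod A (Suc (Suc (Suc p))) (\<lambda>i. mm.d (Suc (Suc p)) (mm.homog p \<phi>) (skip i x))"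
      by (rule altprod_cong) (rule homog_coboundary_fun[OF \<phi> mm.space_skip[OF x]])
    also have "\<dots> = \<one>\<^bsub>A\<^esub>"
      by (rule A.altprod_skip_skip[where X="carrier G"])
         (use x mm.cochain_closed[OF cochain_homog[OF \<phi>]] in \<open>auto simp: mm.space_S_iff\<close>)
    finally show ?thesis by (simp only: homog_coboundary_fun[OF c x])
  qed
  then show ?thesis
    using coboundary_fun_closed[OF c] by (auto simp: null_maps_iff)
qed

end


section \<open>Small cocycles are coboundaries of small cochains\<close>

locale haar_length_module = haar_module G A T + L: length_module haar G A "borel_of (gtop A)" T len
  for G :: "'g tgroup" and A :: "'a tgroup" and T :: "'g \<Rightarrow> 'a \<Rightarrow> 'a" and len :: "'a \<Rightarrow> ennreal"
begin

definition mean_len :: "nat \<Rightarrow> ((nat \<Rightarrow> 'g) \<Rightarrow> 'a) \<Rightarrow> ennreal" where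
  "mean_len p \<sigma> = (\<integral>\<^sup>+z. len (\<sigma> z) \<partial>mm.PM p)"

lemma mean_len_homog:
  assumes \<sigma>: "\<sigma> \<in> carrier (borel_maps G A p)"
  shows "mean_len p \<sigma> = (\<integral>\<^sup>+x. len (mm.homog p \<sigma> x) \<partial>mm.S)"
proof -
  have "(\<integral>\<^sup>+x. len (mm.homog p \<sigma> x) \<partial>mm.S) = (\<integral>\<^sup>+x. len (\<sigma> (mm.ratio_tuple p x)) \<partial>mm.S)"
    using borel_maps_closed[OF \<sigma> mm.space_ratio_tuple]
    by (intro nn_integral_cong) (simp add: mm.homog_def L.len_action mm.space_S_iff)
  also have "\<dots> = mean_len p \<sigma>"
    unfolding mean_len_def
    by (rule mm.nn_integral_ratio_tuple) (intro L.measurable_len borel_maps_measurable \<sigma>)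
  finally show ?thesis by simp
qed

lemma mean_len_div:
  assumes \<sigma>: "\<sigma> \<in> carrier (borel_maps G A p)" and \<tau>: "\<tau> \<in> carrier (borel_maps G A p)"
  shows "mean_len p (\<sigma> \<otimes>\<^bsub>borel_maps G A p\<^esub> inv\<^bsub>borel_maps G A p\<^esub> \<tau>) \<le> mean_len p \<sigma> + mean_len p \<tau>"
proof -
  have "mean_len p (\<sigma> \<otimes>\<^bsub>borel_maps G A p\<^esub> inv\<^bsub>borel_maps G A p\<^esub> \<tau>) \<le> (\<integral>\<^sup>+z. len (\<sigma> z) + len (\<tau> z) \<partial>mm.PM p)"
    unfolding mean_len_def
    by (rule nn_integral_mono)
       (simp add: borel_maps_mult borel_maps_inv \<tau> L.len_div borel_maps_closed[OF \<sigma>] borel_maps_closed[OF \<tau>])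
  also have "\<dots> = mean_len p \<sigma> + mean_len p \<tau>"
    unfolding mean_len_def by (intro nn_integral_add L.measurable_len borel_maps_measurable \<sigma> \<tau>)
  finally show ?thesis .
qed

lemma mean_len_inv:
  assumes \<sigma>: "\<sigma> \<in> carrier (borel_maps G A p)"
  shows "mean_len p (inv\<^bsub>borel_maps G A p\<^esub> \<sigma>) = mean_len p \<sigma>"
  unfolding mean_len_def
  by (rule nn_integral_cong) (simp add: borel_maps_inv \<sigma> L.len_inv borel_maps_closed[OF \<sigma>])

lemma mean_len_null: "\<sigma> \<in> null_maps G A p \<Longrightarrow> mean_len p \<sigma> = 0"
proof -
  assume \<sigma>: "\<sigma> \<in> null_maps G A p"
  then have "AE z in mm.PM p. \<sigma> z = \<one>\<^bsub>A\<^esub>" by (simp add: null_maps_def haar_AE_iff)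
  then have "mean_len p \<sigma> = (\<integral>\<^sup>+z. 0 \<partial>mm.PM p)"
    unfolding mean_len_def by (intro nn_integral_cong_AE) (auto simp: L.len_one)
  then show ?thesis by simp
qed

lemma mean_len_coboundary:
  assumes \<sigma>: "\<sigma> \<in> carrier (borel_maps G A p)"
  shows "mean_len (Suc p) (coboundary_fun G A T p \<sigma>) \<le> of_nat (Suc (Suc p)) * mean_len p \<sigma>"
proof -
  note c = cochain_homog[OF \<sigma>]
  note [measurable] = mm.cochain_measurable[OF c]
  have "mean_len (Suc p) (coboundary_fun G A T p \<sigma>) =
      (\<integral>\<^sup>+x. len (mm.d (Suc (Suc p)) (mm.homog p \<sigma>) x) \<partial>mm.S)"
    unfolding mean_len_homog[OF coboundary_fun_closed[OF \<sigma>]]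
    by (rule nn_integral_cong) (simp only: homog_coboundary_fun[OF \<sigma>])
  also have "\<dots> \<le> (\<integral>\<^sup>+x. (\<Sum>i<Suc (Suc p). len (mm.homog p \<sigma> (skip i x))) \<partial>mm.S)"
    by (intro nn_integral_mono L.len_altprod mm.cochain_closed[OF c] mm.space_skip)
  also have "\<dots> = (\<Sum>i<Suc (Suc p). \<integral>\<^sup>+x. len (mm.homog p \<sigma> (skip i x)) \<partial>mm.S)"
    by (rule nn_integral_sum) measurable
  also have "\<dots> = (\<Sum>i<Suc (Suc p). mean_len p \<sigma>)"
    unfolding mean_len_homog[OF \<sigma>]
    by (intro sum.cong refl mm.nn_integral_skip) measurable
  finally show ?thesis by (simp del: of_nat_Suc)
qed

end

text \<open>
  The averaging property says that uniformly small cocycles are coboundaries. It is immediate for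
  discrete modules, where a sufficiently small cocycle is trivial; for a torus it is proved by
  integrating over one of the variables. The radius is a parameter, so that one radius can serve
  several groups.
\<close>

locale averaging_module = haar_length_module +
  fixes r :: "nat \<Rightarrow> ennreal"
  assumes r_pos: "r q > 0"
    and averaging: "\<lbrakk>mm.cochain (Suc (Suc q)) f;
      AE x in mm.S. mm.d (Suc (Suc (Suc q))) f x = \<one>\<^bsub>A\<^esub>; AE x in mm.S. len (f x) \<le> c; c \<le> r q\<rbrakk>
      \<Longrightarrow> \<exists>\<phi>. mm.cochain (Suc q) \<phi> \<and> (\<integral>\<^sup>+x. len (\<phi> x) \<partial>mm.S) \<le> 2 * c \<and>
            (AE x in mm.S. mm.d (Suc (Suc q)) \<phi> x = f x)"
begin

text \<open>
  The primitive is the sum of the cochain that makes the cocycle uniformly small and the one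
  that averaging provides for the rest, of mean lengths at most one and two times the bound.
\<close>

theorem small_cocycle_is_small_coboundary:
  assumes \<sigma>: "\<sigma> \<in> carrier (borel_maps G A (Suc q))"
    and cocycle: "coboundary_fun G A T (Suc q) \<sigma> \<in> null_maps G A (Suc (Suc q))"
    and small: "zigzag_const (Suc q) * mean_len (Suc q) \<sigma> \<le> r q"
  obtains \<phi> where "\<phi> \<in> carrier (borel_maps G A q)"
    and "\<sigma> \<otimes>\<^bsub>borel_maps G A (Suc q)\<^esub> inv\<^bsub>borel_maps G A (Suc q)\<^esub> coboundary_fun G A T q \<phi> \<in> null_maps G A (Suc q)"
    and "mean_len q \<phi> \<le> 3 * (zigzag_const (Suc q) * mean_len (Suc q) \<sigma>)"
proof -
  define f where "f = mm.homog (Suc q) \<sigma>"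
  define \<epsilon> where "\<epsilon> = mean_len (Suc q) \<sigma>"
  let ?c = "zigzag_const (Suc q) * \<epsilon>"
  have f: "mm.cochain (Suc (Suc q)) f" unfolding f_def by (rule cochain_homog[OF \<sigma>])
  have "AE x in mm.S. mm.homog (Suc (Suc q)) (coboundary_fun G A T (Suc q) \<sigma>) x = \<one>\<^bsub>A\<^esub>"
    using cocycle by (simp only: null_maps_iff)
  then have df: "AE x in mm.S. mm.d (Suc (Suc (Suc q))) f x = \<one>\<^bsub>A\<^esub>"
    using AE_space by eventually_elim (simp only: homog_coboundary_fun[OF \<sigma>] f_def)
  have sm: "(\<integral>\<^sup>+x. len (f x) \<partial>mm.S) \<le> \<epsilon>" by (simp add: \<epsilon>_def f_def mean_len_homog[OF \<sigma>])
  obtain \<psi> where \<psi>: "mm.cochain (Suc q) \<psi>" and \<psi>small: "(\<integral>\<^sup>+x. len (\<psi> x) \<partial>mm.S) \<le> ?c"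
    and rest: "AE x in mm.S. len (f x \<otimes>\<^bsub>A\<^esub> inv\<^bsub>A\<^esub> mm.d (Suc (Suc q)) \<psi> x) \<le> ?c"
    by (rule L.small_cocycle_cohomologous_to_uniformly_small[OF f df sm])
  define f' where "f' = (\<lambda>x. f x \<otimes>\<^bsub>A\<^esub> inv\<^bsub>A\<^esub> mm.d (Suc (Suc q)) \<psi> x)"
  have dc: "mm.cochain (Suc (Suc q)) (mm.d (Suc (Suc q)) \<psi>)" by (rule mm.cochain_d[OF \<psi>])
  have f': "mm.cochain (Suc (Suc q)) f'"
    unfolding f'_def by (rule mm.cochain_mult[OF f mm.cochain_inv[OF dc]])
  have df': "AE x in mm.S. mm.d (Suc (Suc (Suc q))) f' x = \<one>\<^bsub>A\<^esub>"
    using df AE_space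
  proof eventually_elim
    case (elim x)
    have "mm.d (Suc (Suc (Suc q))) f' x = mm.d (Suc (Suc (Suc q))) f x \<otimes>\<^bsub>A\<^esub>
        inv\<^bsub>A\<^esub> mm.d (Suc (Suc (Suc q))) (mm.d (Suc (Suc q)) \<psi>) x"
      unfolding f'_def
      by (rule A.altprod_div) (intro mm.cochain_closed[OF f] mm.cochain_closed[OF dc] mm.space_skip elim)+
    also have "mm.d (Suc (Suc (Suc q))) (mm.d (Suc (Suc q)) \<psi>) x = \<one>\<^bsub>A\<^esub>"
      by (rule A.altprod_skip_skip[where X="carrier G"])
         (use elim mm.cochain_closed[OF \<psi>] in \<open>auto simp: mm.space_S_iff\<close>)
    finally show ?case using elim by (simp del: altprod.simps)
  qed
  have rest': "AE x in mm.S. len (f' x) \<le> ?c" using rest by (simp only: f'_def)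
  have c: "?c \<le> r q" using small by (simp only: \<epsilon>_def)
  obtain \<eta> where \<eta>: "mm.cochain (Suc q) \<eta>" and \<eta>small: "(\<integral>\<^sup>+x. len (\<eta> x) \<partial>mm.S) \<le> 2 * ?c"
    and d\<eta>: "AE x in mm.S. mm.d (Suc (Suc q)) \<eta> x = f' x"
    using averaging[OF f' df' rest' c] by blast
  define \<theta> where "\<theta> = (\<lambda>x. \<psi> x \<otimes>\<^bsub>A\<^esub> \<eta> x)"
  have \<theta>: "mm.cochain (Suc q) \<theta>" unfolding \<theta>_def by (rule mm.cochain_mult[OF \<psi> \<eta>])
  define \<phi> where "\<phi> = mm.inhom q \<theta>"
  have \<phi>: "\<phi> \<in> carrier (borel_maps G A q)" unfolding \<phi>_def by (rule inhom_borel_maps[OF \<theta>])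
  have h\<phi>: "mm.homog q \<phi> x = \<theta> x" if "x \<in> space mm.S" for x
    unfolding \<phi>_def by (rule mm.homog_inhom[OF \<theta> that])
  show thesis
  proof (rule that[OF \<phi>])
    have "mean_len q \<phi> = (\<integral>\<^sup>+x. len (\<theta> x) \<partial>mm.S)"
      unfolding mean_len_homog[OF \<phi>] by (rule nn_integral_cong) (simp add: h\<phi>)
    also have "\<dots> \<le> (\<integral>\<^sup>+x. len (\<psi> x) + len (\<eta> x) \<partial>mm.S)"
      unfolding \<theta>_def
      by (intro nn_integral_mono L.len_mult mm.cochain_closed[OF \<psi>] mm.cochain_closed[OF \<eta>])
    also have "\<dots> = (\<integral>\<^sup>+x. len (\<psi> x) \<partial>mm.S) + (\<integral>\<^sup>+x. len (\<eta> x) \<partial>mm.S)"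
      by (intro nn_integral_add L.measurable_len mm.cochain_measurable[OF \<psi>] mm.cochain_measurable[OF \<eta>])
    also have "\<dots> \<le> ?c + 2 * ?c" by (intro add_mono \<psi>small \<eta>small)
    also have "\<dots> = 3 * ?c"
      by (subst (2) mult_1[symmetric], subst distrib_right[symmetric]) simp
    finally show "mean_len q \<phi> \<le> 3 * (zigzag_const (Suc q) * mean_len (Suc q) \<sigma>)"
      by (simp only: \<epsilon>_def)
    let ?B = "borel_maps G A (Suc q)"
    have cc: "coboundary_fun G A T q \<phi> \<in> carrier ?B" by (rule coboundary_fun_closed[OF \<phi>])
    have "AE x in mm.S. mm.homog (Suc q) (\<sigma> \<otimes>\<^bsub>?B\<^esub> inv\<^bsub>?B\<^esub> coboundary_fun G A T q \<phi>) x = \<one>\<^bsub>A\<^esub>"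
      using d\<eta> AE_space
    proof eventually_elim
      case (elim x)
      have d\<phi>: "mm.d (Suc (Suc q)) (mm.homog q \<phi>) x = mm.d (Suc (Suc q)) \<psi> x \<otimes>\<^bsub>A\<^esub> mm.d (Suc (Suc q)) \<eta> x"
      proof -
        have "mm.d (Suc (Suc q)) (mm.homog q \<phi>) x = mm.d (Suc (Suc q)) \<theta> x"
          by (rule altprod_cong) (rule h\<phi>[OF mm.space_skip[OF elim(2)]])
        also have "\<dots> = mm.d (Suc (Suc q)) \<psi> x \<otimes>\<^bsub>A\<^esub> mm.d (Suc (Suc q)) \<eta> x"
          unfolding \<theta>_def
          by (rule A.altprod_mult) (intro mm.cochain_closed[OF \<psi>] mm.cochain_closed[OF \<eta>] mm.space_skip elim)+
        finally show ?thesis .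
      qed
      have cl: "f x \<in> carrier A" "mm.d (Suc (Suc q)) \<psi> x \<in> carrier A"
        using mm.cochain_closed[OF f elim(2)] mm.cochain_closed[OF dc elim(2)] .
      have "mm.homog (Suc q) (\<sigma> \<otimes>\<^bsub>?B\<^esub> inv\<^bsub>?B\<^esub> coboundary_fun G A T q \<phi>) x =
          f x \<otimes>\<^bsub>A\<^esub> inv\<^bsub>A\<^esub> mm.d (Suc (Suc q)) (mm.homog q \<phi>) x"
        using elim(2) \<sigma> cc by (simp only: homog_mult homog_inv bm.inv_closed homog_coboundary_fun[OF \<phi>] f_def)
      also have "\<dots> = f x \<otimes>\<^bsub>A\<^esub> inv\<^bsub>A\<^esub> (mm.d (Suc (Suc q)) \<psi> x \<otimes>\<^bsub>A\<^esub>
          (f x \<otimes>\<^bsub>A\<^esub> inv\<^bsub>A\<^esub> mm.d (Suc (Suc q)) \<psi> x))"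
        by (simp only: d\<phi> elim(1) f'_def)
      also have "mm.d (Suc (Suc q)) \<psi> x \<otimes>\<^bsub>A\<^esub> (f x \<otimes>\<^bsub>A\<^esub> inv\<^bsub>A\<^esub> mm.d (Suc (Suc q)) \<psi> x) = f x"
        using cl by (simp add: A.m_lcomm del: altprod.simps)
      finally show ?case using cl by (simp del: altprod.simps)
    qed
    then show "\<sigma> \<otimes>\<^bsub>?B\<^esub> inv\<^bsub>?B\<^esub> coboundary_fun G A T q \<phi> \<in> null_maps G A (Suc q)"
      using \<sigma> cc by (simp add: null_maps_iff)
  qed
qed

end


section \<open>Pulling back cochains along an epimorphism\<close>

locale haar_epi = X: haar_module G A T + Y: haar_module G' A T'
  for G :: "'g tgroup" and G' :: "'h tgroup" and A :: "'a tgroup"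
    and T :: "'g \<Rightarrow> 'a \<Rightarrow> 'a" and T' :: "'h \<Rightarrow> 'a \<Rightarrow> 'a" +
  fixes \<pi> :: "'h \<Rightarrow> 'g"
  assumes epi: "\<pi> \<in> epi G' G"
    and continuous: "continuous_map (gtop G') (gtop G) \<pi>"
    and action_eq: "g \<in> carrier G' \<Longrightarrow> T' g = T (\<pi> g)"
begin

lemma hom: "\<pi> \<in> hom G' G" using epi by (simp add: epi_def)

lemma \<pi>_closed: "g \<in> carrier G' \<Longrightarrow> \<pi> g \<in> carrier G" using hom by (auto simp: hom_def)

lemma \<pi>_measurable: "\<pi> \<in> Y.haar \<rightarrow>\<^sub>M X.haar"
  using continuous_map_measurable[OF continuous]
    measurable_cong_sets[OF Y.C.haar_measureD(1)[OF Y.haar] X.C.haar_measureD(1)[OF X.haar]] by simp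

text \<open>
  The image measure is a normalised Haar measure because \<open>\<pi>\<close> is onto; uniqueness identifies it.
\<close>

lemma distr_haar: "distr Y.haar X.haar \<pi> = X.haar"
proof -
  have "haar_measure G (distr Y.haar X.haar \<pi>)"
  proof (rule X.C.haar_measureI)
    show "sets (distr Y.haar X.haar \<pi>) = sets X.C.BG" by (simp add: X.C.haar_measureD(1)[OF X.haar])
    show "prob_space (distr Y.haar X.haar \<pi>)"
      by (rule prob_space.prob_space_distr[OF Y.C.haar_measureD(3)[OF Y.haar] \<pi>_measurable])
    fix g assume g: "g \<in> carrier G"
    then obtain h where h: "h \<in> carrier G'" "g = \<pi> h" using epi by (auto simp: epi_def)
    have mg: "(\<lambda>x. g \<otimes>\<^bsub>G\<^esub> x) \<in> X.haar \<rightarrow>\<^sub>M X.haar"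
      using measurable_compose[OF measurable_Pair1' X.mm.mult_measurable, of g] g by (simp add: X.mm.space_M)
    have mh: "(\<lambda>x. h \<otimes>\<^bsub>G'\<^esub> x) \<in> Y.haar \<rightarrow>\<^sub>M Y.haar"
      using measurable_compose[OF measurable_Pair1' Y.mm.mult_measurable, of h] h by (simp add: Y.mm.space_M)
    have "distr (distr Y.haar X.haar \<pi>) (distr Y.haar X.haar \<pi>) (\<lambda>x. g \<otimes>\<^bsub>G\<^esub> x)
        = distr (distr Y.haar X.haar \<pi>) X.haar (\<lambda>x. g \<otimes>\<^bsub>G\<^esub> x)"
      by (rule distr_cong) auto
    also have "\<dots> = distr Y.haar X.haar (\<lambda>x. g \<otimes>\<^bsub>G\<^esub> \<pi> x)"
      by (subst distr_distr[OF mg \<pi>_measurable]) (simp add: comp_def)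
    also have "\<dots> = distr Y.haar X.haar (\<lambda>x. \<pi> (h \<otimes>\<^bsub>G'\<^esub> x))"
      by (rule distr_cong) (auto simp: h hom_mult[OF hom h(1)] Y.mm.space_M)
    also have "\<dots> = distr (distr Y.haar Y.haar (\<lambda>x. h \<otimes>\<^bsub>G'\<^esub> x)) X.haar \<pi>"
      by (subst distr_distr[OF \<pi>_measurable mh]) (simp add: comp_def)
    also have "\<dots> = distr Y.haar X.haar \<pi>"
      by (simp only: Y.mm.left_invariant[OF h(1)])
    finally show "distr (distr Y.haar X.haar \<pi>) (distr Y.haar X.haar \<pi>) (\<lambda>x. g \<otimes>\<^bsub>G\<^esub> x)
      = distr Y.haar X.haar \<pi>" .
  qed
  then show ?thesis by (rule X.C.haar_measure_unique[OF _ X.haar])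
qed

lemma measurable_compose_\<pi>: "compose {..<p} \<pi> \<in> Y.mm.PM p \<rightarrow>\<^sub>M X.mm.PM p"
  unfolding compose_def by (intro measurable_restrict measurable_compose[OF _ \<pi>_measurable]) auto

lemma distr_compose_\<pi>: "distr (Y.mm.PM p) (X.mm.PM p) (compose {..<p} \<pi>) = X.mm.PM p"
  using distr_PiM_finite_prob_space'[of "{..<p}" "\<lambda>_. Y.haar" "\<lambda>_. X.haar" \<pi>]
  by (simp add: X.C.haar_measureD(3)[OF X.haar] Y.C.haar_measureD(3)[OF Y.haar] \<pi>_measurable distr_haar)

abbreviation "pull p \<equiv> pullback_fun G' p \<pi>"

lemma pull_eq: "pull p \<psi> = (\<lambda>z\<in>space (Y.mm.PM p). \<psi> (compose {..<p} \<pi> z))"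
  by (simp add: pullback_fun_def Y.carrier_tpower compose_def)

lemma space_compose_\<pi>: "z \<in> space (Y.mm.PM p) \<Longrightarrow> compose {..<p} \<pi> z \<in> space (X.mm.PM p)"
  by (rule measurable_space[OF measurable_compose_\<pi>])

lemma pull_closed:
  assumes "\<psi> \<in> carrier (borel_maps G A p)"
  shows "pull p \<psi> \<in> carrier (borel_maps G' A p)"
  unfolding pull_eq
  by (intro Y.borel_maps_restrictI measurable_compose[OF measurable_compose_\<pi>] X.borel_maps_measurable assms)

lemma pull_hom: "pull p \<in> hom (borel_maps G A p) (borel_maps G' A p)"
  by (rule homI[OF pull_closed], assumption)
     (auto simp: pull_eq X.borel_maps_mult Y.borel_maps_mult space_compose_\<pi>)

lemma pull_null:
  assumes "\<psi> \<in> null_maps G A p"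
  shows "pull p \<psi> \<in> null_maps G' A p"
proof -
  have ae: "AE z in X.mm.PM p. \<psi> z = \<one>\<^bsub>A\<^esub>" and \<psi>: "\<psi> \<in> carrier (borel_maps G A p)"
    using assms by (simp_all add: null_maps_def X.haar_AE_iff)
  have "AE z in Y.mm.PM p. \<psi> (compose {..<p} \<pi> z) = \<one>\<^bsub>A\<^esub>"
    by (rule AE_distrD[OF measurable_compose_\<pi>]) (simp only: distr_compose_\<pi> ae)
  then have "AE z in Y.mm.PM p. pull p \<psi> z = \<one>\<^bsub>A\<^esub>"
    using AE_space by eventually_elim (simp add: pull_eq)
  then show ?thesis using pull_closed[OF \<psi>] by (simp add: null_maps_def Y.haar_AE_iff)
qed

lemma homog_pull:
  assumes x: "x \<in> space Y.mm.S"
  shows "Y.mm.homog p (pull p \<psi>) x = X.mm.homog p \<psi> (\<lambda>j. \<pi> (x j))"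
proof -
  have xc: "x j \<in> carrier G'" for j using x by (simp add: Y.mm.space_S_iff)
  interpret group_hom G' G \<pi> by unfold_locales (rule hom)
  have "compose {..<p} \<pi> (Y.mm.ratio_tuple p x) = X.mm.ratio_tuple p (\<lambda>j. \<pi> (x j))"
    using xc by (auto simp: compose_def X.mm.ratio_tuple_def Y.mm.ratio_tuple_def
        X.mm.ratios_def Y.mm.ratios_def fun_eq_iff)
  then show ?thesis
    using Y.mm.space_ratio_tuple[OF x] xc
    by (simp add: X.mm.homog_def Y.mm.homog_def pull_eq action_eq)
qed

lemma pull_coboundary_fun:
  assumes \<psi>: "\<psi> \<in> carrier (borel_maps G A p)"
  shows "pull (Suc p) (coboundary_fun G A T p \<psi>) = coboundary_fun G' A T' p (pull p \<psi>)"
proof (rule Y.borel_maps_homog_eqI)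
  show "pull (Suc p) (coboundary_fun G A T p \<psi>) \<in> carrier (borel_maps G' A (Suc p))"
    by (intro pull_closed X.coboundary_fun_closed \<psi>)
  show "coboundary_fun G' A T' p (pull p \<psi>) \<in> carrier (borel_maps G' A (Suc p))"
    by (intro pull_closed Y.coboundary_fun_closed \<psi>)
  fix x assume x: "x \<in> space Y.mm.S"
  have x': "(\<lambda>j. \<pi> (x j)) \<in> space X.mm.S"
    using x by (simp add: X.mm.space_S_iff Y.mm.space_S_iff \<pi>_closed)
  have sk: "skip i (\<lambda>j. \<pi> (x j)) = (\<lambda>j. \<pi> (skip i x j))" for i by (simp add: skip_def)
  have "X.mm.d (Suc (Suc p)) (X.mm.homog p \<psi>) (\<lambda>j. \<pi> (x j)) =
      Y.mm.d (Suc (Suc p)) (Y.mm.homog p (pull p \<psi>)) x"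
    by (rule altprod_cong) (simp only: sk homog_pull Y.mm.space_skip[OF x])
  then show "Y.mm.homog (Suc p) (pull (Suc p) (coboundary_fun G A T p \<psi>)) x =
    Y.mm.homog (Suc p) (coboundary_fun G' A T' p (pull p \<psi>)) x"
    by (simp only: homog_pull[OF x] X.homog_coboundary_fun[OF \<psi> x'] Y.homog_coboundary_fun[OF pull_closed[OF \<psi>] x])
qed

lemma pull_mean_len:
  assumes "haar_length_module G A T len" "haar_length_module G' A T' len"
    and \<psi>: "\<psi> \<in> carrier (borel_maps G A p)"
  shows "haar_length_module.mean_len G' len p (pull p \<psi>) = haar_length_module.mean_len G len p \<psi>"
proof -
  interpret XL: haar_length_module G A T len by fact
  interpret YL: haar_length_module G' A T' len by fact
  have "(\<integral>\<^sup>+z. len (\<psi> z) \<partial>distr (Y.mm.PM p) (X.mm.PM p) (compose {..<p} \<pi>)) =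
      (\<integral>\<^sup>+z. len (\<psi> (compose {..<p} \<pi> z)) \<partial>Y.mm.PM p)"
    by (rule nn_integral_distr[OF measurable_compose_\<pi>])
       (simp only: distr_compose_\<pi>, intro XL.L.measurable_len X.borel_maps_measurable \<psi>)
  also have "\<dots> = (\<integral>\<^sup>+z. len (pull p \<psi> z) \<partial>Y.mm.PM p)"
    by (rule nn_integral_cong) (simp add: pull_eq)
  finally show ?thesis by (simp only: XL.mean_len_def YL.mean_len_def distr_compose_\<pi>)
qed

end


section \<open>Inverse limits of compact groups\<close>

text \<open>
  A countable base of the image is formed by the complements of images of complements of finite
  unions of basic sets, because fibres are compact and the map is closed.
\<close>

lemma second_countable_compact_image:
  assumes X: "compact_space X" "second_countable X" and Y: "Hausdorff_space Y"
    and f: "continuous_map X Y f" and surj: "f ` topspace X = topspace Y"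
  shows "second_countable Y"
proof -
  obtain B where B: "countable B" "\<And>V. V \<in> B \<Longrightarrow> openin X V"
      "\<And>U x. openin X U \<Longrightarrow> x \<in> U \<Longrightarrow> \<exists>V\<in>B. x \<in> V \<and> V \<subseteq> U"
    using X(2) unfolding second_countable_def by metis
  have cl: "closed_map X Y f"
    by (rule proper_imp_closed_map[OF continuous_imp_proper_map[OF X(1) Hausdorff_imp_kc_space[OF Y] f]])
  define N where "N = (\<lambda>F. topspace Y - f ` (topspace X - \<Union>F))"
  have openN: "openin Y (N F)" if "F \<subseteq> B" for F
  proof -
    have "openin X (\<Union>F)" using that B(2) by (intro openin_Union) auto
    then have "closedin X (topspace X - \<Union>F)" by (rule closedin_diff[OF closedin_topspace])
    then have "closedin Y (f ` (topspace X - \<Union>F))" using cl by (simp add: closed_map_def)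
    then show ?thesis unfolding N_def by (rule openin_diff[OF openin_topspace])
  qed
  have "countable (N ` {F. F \<subseteq> B \<and> finite F})"
    by (rule countable_image)
       (use countable_Collect_finite_subset[OF B(1)] in \<open>simp add: conj_commute\<close>)
  moreover have "\<exists>V\<in>N ` {F. F \<subseteq> B \<and> finite F}. y \<in> V \<and> V \<subseteq> U" if U: "openin Y U" and y: "y \<in> U" for U y
  proof -
    have yY: "y \<in> topspace Y" using openin_subset[OF U] y by blast
    let ?P = "{x \<in> topspace X. f x \<in> U}"
    have P: "openin X ?P" by (rule openin_continuous_map_preimage[OF f U])
    have "closedin Y {y}" by (simp add: closedin_Hausdorff_singleton[OF Y] yY)
    then have "closedin X {x \<in> topspace X. f x \<in> {y}}" by (rule closedin_continuous_map_preimage[OF f])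
    then have fibre: "compactin X {x \<in> topspace X. f x \<in> {y}}" by (rule closedin_compact_space[OF X(1)])
    have "\<exists>F. finite F \<and> F \<subseteq> {V \<in> B. V \<subseteq> ?P} \<and> {x \<in> topspace X. f x \<in> {y}} \<subseteq> \<Union>F"
    proof (rule compactinD[OF fibre])
      show "openin X V" if "V \<in> {V \<in> B. V \<subseteq> ?P}" for V using that B(2) by simp
      show "{x \<in> topspace X. f x \<in> {y}} \<subseteq> \<Union>{V \<in> B. V \<subseteq> ?P}"
      proof
        fix x assume "x \<in> {x \<in> topspace X. f x \<in> {y}}"
        then have "x \<in> ?P" using y by simp
        from B(3)[OF P this] show "x \<in> \<Union>{V \<in> B. V \<subseteq> ?P}" by blast
      qed
    qed
    then obtain F where F: "finite F" "F \<subseteq> {V \<in> B. V \<subseteq> ?P}" "{x \<in> topspace X. f x \<in> {y}} \<subseteq> \<Union>F"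
      by blast
    have "y \<in> N F" using yY F(3) by (auto simp: N_def)
    moreover have "N F \<subseteq> U"
    proof
      fix v assume v: "v \<in> N F"
      then obtain x where x: "x \<in> topspace X" "v = f x" using surj by (auto simp: N_def)
      then have "x \<in> \<Union>F" using v by (auto simp: N_def)
      then show "v \<in> U" using F(2) x by blast
    qed
    ultimately show ?thesis using F by blast
  qed
  ultimately show ?thesis
    unfolding second_countable_def using openN by (intro exI[of _ "N ` {F. F \<subseteq> B \<and> finite F}"]) blast
qed

lemma (in compact_inverse_system) finite_upper_bound:
  fixes n0 :: 'i
  shows "finite N \<Longrightarrow> \<exists>m. n0 \<le> m \<and> (\<forall>n\<in>N. n \<le> m)"
proof (induction N rule: finite_induct)
  case empty
  show ?case by (intro exI[of _ n0]) simp
next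
  case (insert n N)
  then obtain m where m: "n0 \<le> m" "\<forall>n\<in>N. n \<le> m" by blast
  obtain m' where m': "m \<le> m'" "n \<le> m'" using directed by blast
  have "k \<le> m'" if "k \<in> insert n N" for k
    using that m(2) m' order_trans[OF _ m'(1)] by auto
  then show ?case using order_trans[OF m(1) m'(1)] by blast
qed

locale limit_system = compact_inverse_system G \<pi>
  for G :: "'i::preorder \<Rightarrow> 'g tgroup" and \<pi> :: "'i \<Rightarrow> 'i \<Rightarrow> 'g \<Rightarrow> 'g" +
  fixes A :: "'a tgroup" and T :: "('i \<Rightarrow> 'g) \<Rightarrow> 'a \<Rightarrow> 'a" and S :: "'i \<Rightarrow> 'g \<Rightarrow> 'a \<Rightarrow> 'a"
  assumes sc_limit: "second_countable (gtop (inverse_limit G \<pi>))"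
    and module: "polish_module (inverse_limit G \<pi>) A T"
    and factors: "g \<in> carrier (inverse_limit G \<pi>) \<Longrightarrow> T g = S m (g m)"
begin

abbreviation "L \<equiv> inverse_limit G \<pi>"

abbreviation "X \<equiv> product_topology (\<lambda>i. gtop (G i)) UNIV"

lemma topspace_G: "topspace (gtop (G i)) = carrier (G i)"
  using compact_group[of i] by (simp add: compact_group_def topological_group.topspace_gtop)

lemma group_G: "group (G i)"
  using compact_group[of i] by (simp add: compact_group_def topological_group_def)

lemma Hausdorff_G: "Hausdorff_space (gtop (G i))"
  using compact_group[of i] by (rule compact_group.Hausdorff)

lemma carrier_L: "x \<in> carrier L \<longleftrightarrow> (\<forall>i. x i \<in> carrier (G i)) \<and> (\<forall>k m. k \<le> m \<longrightarrow> \<pi> m k (x m) = x k)"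
  by (auto simp: inverse_limit_def product_tgroup_def Let_def PiE_iff)

lemma mult_L: "x \<otimes>\<^bsub>L\<^esub> y = (\<lambda>i. x i \<otimes>\<^bsub>G i\<^esub> y i)"
  by (simp add: inverse_limit_def product_tgroup_def Let_def restrict_UNIV)

lemma gtop_L: "gtop L = subtopology X (carrier L)"
  by (simp add: inverse_limit_def product_tgroup_def Let_def)

lemma topspace_X: "x \<in> topspace X \<longleftrightarrow> (\<forall>i. x i \<in> carrier (G i))"
  by (simp add: PiE_iff topspace_G)

lemma compact_X: "compact_space X"
  using compact_group by (simp add: compact_space_product_topology compact_group.compact)

lemma \<pi>_hom: "k \<le> m \<Longrightarrow> \<pi> m k \<in> hom (G m) (G k)"
  using epi[of k m] by (simp add: epi_def)

lemma \<pi>_closed: "k \<le> m \<Longrightarrow> x \<in> carrier (G m) \<Longrightarrow> \<pi> m k x \<in> carrier (G k)"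
  using \<pi>_hom by (auto simp: hom_def)

lemma continuous_coordinate: "continuous_map X (gtop (G k)) (\<lambda>x. x k)"
  by (rule continuous_map_product_projection) simp

lemma closedin_compatible:
  assumes km: "k \<le> m"
  shows "closedin X {x \<in> topspace X. \<pi> m k (x m) = x k}"
proof -
  have "continuous_map X (gtop (G k)) (\<lambda>x. \<pi> m k (x m))"
    using continuous_map_compose[OF continuous_coordinate[of m] continuous[OF km]] by (simp add: o_def)
  then show ?thesis
    by (rule closedin_continuous_maps_eq[OF Hausdorff_G _ continuous_coordinate])
qed

lemma closedin_L: "closedin X (carrier L)"
proof -
  let ?F = "(\<lambda>(k, m). {x \<in> topspace X. \<pi> m k (x m) = x k}) ` {(k, m). k \<le> m}"
  have "carrier L = \<Inter>?F"
    by (rule Set.set_eqI) (auto simp: carrier_L topspace_X simp del: topspace_product_topology)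
  moreover have "closedin X (\<Inter>?F)"
  proof (rule closedin_Inter)
    have "(undefined, undefined) \<in> {(k::'i, m). k \<le> m}" by simp
    then have "{(k::'i, m). k \<le> m} \<noteq> {}" by (rule ex_in_conv[THEN iffD1, OF exI])
    then show "?F \<noteq> {}" unfolding image_is_empty .
    show "closedin X C" if "C \<in> ?F" for C
      using that by (elim imageE CollectE) (simp only: split_beta closedin_compatible)
  qed
  ultimately show ?thesis by (simp only:)
qed

lemma coordinate_closed: "x \<in> carrier L \<Longrightarrow> x m \<in> carrier (G m)"
  unfolding carrier_L by blast

lemma topspace_L: "topspace (gtop L) = carrier L"
  using closedin_subset[OF closedin_L] by (auto simp: gtop_L)

lemma compact_L: "compact_space (gtop L)"
  unfolding gtop_L by (intro compact_space_subtopology closedin_compact_space compact_X closedin_L)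

lemma Hausdorff_L: "Hausdorff_space (gtop L)"
  unfolding gtop_L
  by (intro Hausdorff_space_subtopology) (simp add: Hausdorff_space_product_topology Hausdorff_G)

sublocale LM: haar_module L A T
proof -
  interpret polish_module L A T by (rule module)
  show "haar_module L A T"
    by unfold_locales (rule compact_L, rule Hausdorff_L, rule sc_limit)
qed

lemma continuous_projection: "continuous_map (gtop L) (gtop (G m)) (\<lambda>x. x m)"
  unfolding gtop_L by (rule continuous_map_from_subtopology[OF continuous_coordinate])

text \<open>
  The projections are onto: the threads through a given point are the intersection of a
  directed family of nonempty closed sets, in each of which compatibility is only required
  below a fixed index.
\<close>

lemma projection_surj:
  assumes z: "z \<in> carrier (G m)"
  obtains x where "x \<in> carrier L" "x m = z"
proof -
  define D where "D = (\<lambda>n. {x \<in> topspace X. x m = z \<and> (\<forall>k\<le>n. \<pi> n k (x n) = x k)})"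
  have D_iff: "x \<in> D n \<longleftrightarrow> (\<forall>i. x i \<in> carrier (G i)) \<and> x m = z \<and> (\<forall>k\<le>n. x k = \<pi> n k (x n))" for x n
    unfolding D_def mem_Collect_eq topspace_X by metis
  have closed: "closedin X (D n)" for n
  proof -
    have "D n = {x \<in> topspace X. x m \<in> {z}} \<inter> (topspace X \<inter> \<Inter>((\<lambda>k. {x \<in> topspace X. \<pi> n k (x n) = x k}) ` {..n}))"
      by (auto simp: D_def simp del: topspace_product_topology)
    also have "closedin X \<dots>"
    proof (intro closedin_Int)
      show "closedin X {x \<in> topspace X. x m \<in> {z}}"
        by (rule closedin_continuous_map_preimage[OF continuous_coordinate])
           (simp add: closedin_Hausdorff_singleton[OF Hausdorff_G] topspace_G z)
      have ne: "(\<lambda>k. {x \<in> topspace X. \<pi> n k (x n) = x k}) ` {..n} \<noteq> {}" by auto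
      show "closedin X (\<Inter>((\<lambda>k. {x \<in> topspace X. \<pi> n k (x n) = x k}) ` {..n}))"
      proof (rule closedin_Inter[OF ne])
        fix C assume "C \<in> (\<lambda>k. {x \<in> topspace X. \<pi> n k (x n) = x k}) ` {..n}"
        then obtain k where k: "k \<le> n" "C = {x \<in> topspace X. \<pi> n k (x n) = x k}"
          by (elim imageE) simp
        show "closedin X C" unfolding k(2) by (rule closedin_compatible[OF k(1)])
      qed
    qed (rule closedin_topspace)
    finally show ?thesis .
  qed
  have nonempty: "D n \<noteq> {}" if n: "m \<le> n" for n
  proof -
    have "z \<in> \<pi> n m ` carrier (G n)" using epi[OF n] z by (simp add: epi_def)
    then obtain w where w: "w \<in> carrier (G n)" "\<pi> n m w = z" by blast
    define x where "x = (\<lambda>k. if k \<le> n then \<pi> n k w else \<one>\<^bsub>G k\<^esub>)"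
    have "x k \<in> carrier (G k)" for k
      using \<pi>_closed[OF _ w(1)] group.is_monoid[OF group_G] by (simp add: x_def monoid.one_closed)
    then have "x \<in> D n"
      using n w connecting_id[OF w(1)] by (simp add: D_iff x_def)
    then show ?thesis by blast
  qed
  have antimono: "D n \<subseteq> D n'" if n: "n' \<le> n" for n n'
  proof
    fix x assume x: "x \<in> D n"
    then have xc: "x n \<in> carrier (G n)" and eq: "\<And>k. k \<le> n \<Longrightarrow> x k = \<pi> n k (x n)"
      unfolding D_iff by blast+
    have "x k = \<pi> n' k (x n')" if k: "k \<le> n'" for k
      using connecting_comp[OF k n xc] eq[OF n] eq[OF order_trans[OF k n]] by simp
    then show "x \<in> D n'" using x unfolding D_iff by blast
  qed
  have "\<Inter>(D ` {m..}) \<noteq> {}"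
  proof (rule compact_space_fip[THEN iffD1, OF compact_X, rule_format], intro conjI ballI allI impI)
    show "closedin X C" if "C \<in> D ` {m..}" for C using that closed by auto
    fix \<F> assume "finite \<F> \<and> \<F> \<subseteq> D ` {m..}"
    then obtain N where N: "finite N" "N \<subseteq> {m..}" "\<F> = D ` N" by (meson finite_subset_image)
    then obtain n where "m \<le> n" "\<forall>n'\<in>N. n' \<le> n" using finite_upper_bound by blast
    then have "D n \<subseteq> \<Inter>\<F>" "D n \<noteq> {}" using antimono nonempty N(3) by blast+
    then show "\<Inter>\<F> \<noteq> {}" by blast
  qed
  then obtain x where x: "\<And>n. m \<le> n \<Longrightarrow> x \<in> D n" by auto
  show thesis
  proof (rule that)
    show "x m = z" using x[OF order_refl] unfolding D_iff by blast
    have "\<pi> l k (x l) = x k" if kl: "k \<le> l" for k l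
    proof -
      obtain n where n: "m \<le> n" "l \<le> n" using directed by blast
      have xc: "x n \<in> carrier (G n)" and eq: "\<And>k. k \<le> n \<Longrightarrow> x k = \<pi> n k (x n)"
        using x[OF n(1)] unfolding D_iff by blast+
      show ?thesis
        using connecting_comp[OF kl n(2) xc] eq[OF n(2)] eq[OF order_trans[OF kl n(2)]] by simp
    qed
    then show "x \<in> carrier L" using x[OF order_refl] unfolding carrier_L D_iff by blast
  qed
qed

lemma projection_epi: "(\<lambda>x. x m) \<in> epi L (G m)"
proof -
  have "(\<lambda>x. x m) \<in> hom L (G m)"
    by (rule homI) (simp_all add: carrier_L mult_L)
  moreover have "(\<lambda>x. x m) ` carrier L = carrier (G m)"
  proof
    show "carrier (G m) \<subseteq> (\<lambda>x. x m) ` carrier L"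
    proof
      fix z assume "z \<in> carrier (G m)"
      then obtain x where "x \<in> carrier L" "x m = z" by (rule projection_surj)
      then show "z \<in> (\<lambda>x. x m) ` carrier L" by blast
    qed
  qed (use coordinate_closed in blast)
  ultimately show ?thesis by (simp add: epi_def)
qed

lemma image_projection: "(\<lambda>x. x m) ` carrier L = carrier (G m)"
  using projection_epi[of m] by (simp add: epi_def)

text \<open>
  Second countability and continuity of the action descend from the limit, because the
  projection is proper and onto and remains so, hence a quotient map, after forming the product
  with \<open>A\<close>.
\<close>

lemma haar_module_G: "haar_module (G m) A (S m)"
proof -
  interpret Gm: compact_group "G m" by (rule compact_group)
  let ?p = "\<lambda>x::'i \<Rightarrow> 'g. x m"
  have proper: "proper_map (gtop L) (gtop (G m)) ?p"
    by (rule continuous_imp_proper_map[OF compact_L Hausdorff_imp_kc_space[OF Hausdorff_G] continuous_projection])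
  have sc: "second_countable (gtop (G m))"
    by (rule second_countable_compact_image[OF compact_L sc_limit Hausdorff_G continuous_projection])
       (simp only: topspace_L topspace_G image_projection)
  have Seq: "S m (x m) = T x" if "x \<in> carrier L" for x using factors[OF that, of m] by simp
  have hom: "S m \<in> hom (G m) (AutoGroup A)"
  proof (rule homI)
    fix z assume z: "z \<in> carrier (G m)"
    obtain x where x: "x \<in> carrier L" "x m = z" by (rule projection_surj[OF z])
    show "S m z \<in> carrier (AutoGroup A)"
      using hom_in_carrier[OF LM.action x(1)] Seq[OF x(1)] x(2) by simp
    fix w assume w: "w \<in> carrier (G m)"
    obtain y where y: "y \<in> carrier L" "y m = w" by (rule projection_surj[OF w])
    have "S m (z \<otimes>\<^bsub>G m\<^esub> w) = T (x \<otimes>\<^bsub>L\<^esub> y)"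
      using Seq[OF LM.G.m_closed[OF x(1) y(1)]] x(2) y(2) by (simp add: mult_L)
    also have "\<dots> = T x \<otimes>\<^bsub>AutoGroup A\<^esub> T y" by (rule hom_mult[OF LM.action x(1) y(1)])
    finally show "S m (z \<otimes>\<^bsub>G m\<^esub> w) = S m z \<otimes>\<^bsub>AutoGroup A\<^esub> S m w"
      using Seq[OF x(1)] Seq[OF y(1)] x(2) y(2) by simp
  qed
  have cont: "continuous_map (prod_topology (gtop (G m)) (gtop A)) (gtop A) (\<lambda>(g, a). S m g a)"
  proof (rule continuous_compose_quotient_map)
    let ?q = "\<lambda>(x, a). (?p x, a)"
    have "proper_map (gtop A) (gtop A) (\<lambda>a. a)" by (simp add: proper_map_id[unfolded id_def])
    then have pq: "proper_map (prod_topology (gtop L) (gtop A)) (prod_topology (gtop (G m)) (gtop A)) ?q"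
      using proper_map_prod[of "gtop L" "gtop A" "gtop (G m)" "gtop A" ?p "\<lambda>a. a"] proper by simp
    show "quotient_map (prod_topology (gtop L) (gtop A)) (prod_topology (gtop (G m)) (gtop A)) ?q"
    proof (rule continuous_closed_imp_quotient_map)
      show "continuous_map (prod_topology (gtop L) (gtop A)) (prod_topology (gtop (G m)) (gtop A)) ?q"
        unfolding split_beta'
        using continuous_map_compose[OF continuous_map_fst continuous_projection]
        by (intro continuous_map_pairedI continuous_map_snd) (simp add: o_def)
      show "closed_map (prod_topology (gtop L) (gtop A)) (prod_topology (gtop (G m)) (gtop A)) ?q"
        by (rule proper_imp_closed_map[OF pq])
      have "?q ` (carrier L \<times> topspace (gtop A)) = (?p ` carrier L) \<times> topspace (gtop A)" by force
      then show "?q ` topspace (prod_topology (gtop L) (gtop A)) = topspace (prod_topology (gtop (G m)) (gtop A))"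
        by (simp only: topspace_prod_topology topspace_L topspace_G image_projection)
    qed
    show "continuous_map (prod_topology (gtop L) (gtop A)) (gtop A) ((\<lambda>(g, a). S m g a) \<circ> ?q)"
      by (rule continuous_map_eq[OF LM.continuous_action]) (auto simp: topspace_L Seq)
  qed
  show ?thesis
    by unfold_locales (rule LM.completely_metrizable, rule LM.second_countable, rule hom, rule cont, rule sc)
qed

lemma haar_epi_limit: "haar_epi (G m) L A (S m) T (\<lambda>x. x m)"
proof -
  interpret Gm: haar_module "G m" A "S m" by (rule haar_module_G)
  show ?thesis by unfold_locales (rule projection_epi, rule continuous_projection, rule factors)
qed

lemma haar_epi_connecting:
  assumes kn: "k \<le> n"
  shows "haar_epi (G k) (G n) A (S k) (S n) (\<pi> n k)"
proof -
  interpret Gk: haar_module "G k" A "S k" by (rule haar_module_G)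
  interpret Gn: haar_module "G n" A "S n" by (rule haar_module_G)
  show ?thesis
  proof unfold_locales
    show "\<pi> n k \<in> epi (G n) (G k)" by (rule epi[OF kn])
    show "continuous_map (gtop (G n)) (gtop (G k)) (\<pi> n k)" by (rule continuous[OF kn])
    fix z assume z: "z \<in> carrier (G n)"
    obtain x where x: "x \<in> carrier L" "x n = z" by (rule projection_surj[OF z])
    have "\<pi> n k (x n) = x k" using x(1) kn unfolding carrier_L by blast
    then show "S n z = S k (\<pi> n k z)"
      using factors[OF x(1), of n] factors[OF x(1), of k] x(2) by simp
  qed
qed


section \<open>Approximation by cochains on the factors\<close>

abbreviation proj_tuple :: "nat \<Rightarrow> 'i \<Rightarrow> (nat \<Rightarrow> 'i \<Rightarrow> 'g) \<Rightarrow> nat \<Rightarrow> 'g" where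
  "proj_tuple p m \<equiv> compose {..<p} (\<lambda>x. x m)"

abbreviation PMG :: "'i \<Rightarrow> nat \<Rightarrow> (nat \<Rightarrow> 'g) measure" where
  "PMG m p \<equiv> Pi\<^sub>M {..<p} (\<lambda>_. haar_module.haar (G m))"

definition cylinder :: "nat \<Rightarrow> 'i \<Rightarrow> (nat \<Rightarrow> 'i \<Rightarrow> 'g) set \<Rightarrow> bool" where
  "cylinder p m C \<longleftrightarrow> (\<exists>B\<in>sets (PMG m p). C = proj_tuple p m -` B \<inter> space (LM.mm.PM p))"

lemma measurable_proj_tuple: "proj_tuple p m \<in> LM.mm.PM p \<rightarrow>\<^sub>M PMG m p"
  by (rule haar_epi.measurable_compose_\<pi>[OF haar_epi_limit])

lemma cylinder_sets: "cylinder p m C \<Longrightarrow> C \<in> sets (LM.mm.PM p)"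
  using measurable_sets[OF measurable_proj_tuple] by (auto simp: cylinder_def)

lemma proj_tuple_connecting:
  assumes "k \<le> n" "z \<in> space (LM.mm.PM p)"
  shows "compose {..<p} (\<pi> n k) (proj_tuple p n z) = proj_tuple p k z"
proof
  fix j
  show "compose {..<p} (\<pi> n k) (proj_tuple p n z) j = proj_tuple p k z j"
  proof (cases "j < p")
    case True
    then have "z j \<in> carrier L" using assms(2) by (auto simp: LM.mm.space_PM PiE_iff)
    then have "\<pi> n k (z j n) = z j k" using assms(1) unfolding carrier_L by blast
    then show ?thesis using True by (simp add: compose_def)
  next
    case False
    then show ?thesis by (simp add: compose_def restrict_def)
  qed
qed

lemma cylinder_lift:
  assumes mn: "m \<le> n" and C: "cylinder p m C"
  shows "cylinder p n C"
proof -
  obtain B where B: "B \<in> sets (PMG m p)" "C = proj_tuple p m -` B \<inter> space (LM.mm.PM p)"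
    using C by (auto simp: cylinder_def)
  let ?B = "compose {..<p} (\<pi> n m) -` B \<inter> space (PMG n p)"
  have "?B \<in> sets (PMG n p)"
    by (rule measurable_sets[OF haar_epi.measurable_compose_\<pi>[OF haar_epi_connecting[OF mn]] B(1)])
  moreover have "C = proj_tuple p n -` ?B \<inter> space (LM.mm.PM p)"
    unfolding B(2) using proj_tuple_connecting[OF mn] measurable_space[OF measurable_proj_tuple] by auto
  ultimately show ?thesis unfolding cylinder_def by blast
qed

lemma cylinder_Un: "\<lbrakk>cylinder p m C; cylinder p m D\<rbrakk> \<Longrightarrow> cylinder p m (C \<union> D)"
  unfolding cylinder_def by (metis Int_Un_distrib2 sets.Un vimage_Un)

lemma cylinder_compl:
  assumes "cylinder p m C"
  shows "cylinder p m (space (LM.mm.PM p) - C)"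
proof -
  obtain B where B: "B \<in> sets (PMG m p)" "C = proj_tuple p m -` B \<inter> space (LM.mm.PM p)"
    using assms by (auto simp: cylinder_def)
  have "space (LM.mm.PM p) - C = proj_tuple p m -` (space (PMG m p) - B) \<inter> space (LM.mm.PM p)"
    unfolding B(2) using measurable_space[OF measurable_proj_tuple] by auto
  then show ?thesis using B(1) unfolding cylinder_def by blast
qed

lemma sets_haar_G: "sets (haar_module.haar (G m)) = sets (borel_of (gtop (G m)))"
proof -
  interpret Gm: haar_module "G m" A "S m" by (rule haar_module_G)
  show ?thesis by (rule Gm.C.haar_measureD(1)[OF Gm.haar])
qed

lemma prob_PM: "prob_space (LM.mm.PM p)"
  by (rule prob_space_PiM) (rule LM.C.haar_measureD(3)[OF LM.haar])

text \<open>
  Approximability in measure by sets that depend on one index only. It is closed under the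
  operations of a sigma algebra and holds for open conditions on one coordinate, hence for all
  measurable sets.
\<close>

definition approximable :: "nat \<Rightarrow> (nat \<Rightarrow> 'i \<Rightarrow> 'g) set \<Rightarrow> bool" where
  "approximable p E \<longleftrightarrow> E \<in> sets (LM.mm.PM p) \<and>
     (\<forall>e>0. \<exists>m C. cylinder p m C \<and> measure (LM.mm.PM p) ((E - C) \<union> (C - E)) < e)"

lemma approximable_cylinder: "cylinder p m C \<Longrightarrow> approximable p C"
  unfolding approximable_def
  by (intro conjI allI impI exI[of _ m] exI[of _ C]) (auto simp: cylinder_sets)

lemma approximable_compl:
  assumes "approximable p E"
  shows "approximable p (space (LM.mm.PM p) - E)"
  unfolding approximable_def
proof (intro conjI allI impI)
  have E: "E \<in> sets (LM.mm.PM p)" using assms by (simp add: approximable_def)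
  then show "space (LM.mm.PM p) - E \<in> sets (LM.mm.PM p)" by (rule sets.compl_sets)
  fix e :: real assume "e > 0"
  then obtain m C where C: "cylinder p m C" "measure (LM.mm.PM p) ((E - C) \<union> (C - E)) < e"
    using assms unfolding approximable_def by blast
  let ?D = "space (LM.mm.PM p) - C"
  have "((space (LM.mm.PM p) - E) - ?D) \<union> (?D - (space (LM.mm.PM p) - E)) = (E - C) \<union> (C - E)"
    using sets.sets_into_space[OF E] sets.sets_into_space[OF cylinder_sets[OF C(1)]] by blast
  then show "\<exists>m C. cylinder p m C \<and> measure (LM.mm.PM p)
      (((space (LM.mm.PM p) - E) - C) \<union> (C - (space (LM.mm.PM p) - E))) < e"
    using cylinder_compl[OF C(1)] C(2) by (intro exI[of _ m] exI[of _ ?D]) simp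
qed

lemma approximable_Un:
  assumes E: "approximable p E" and F: "approximable p F"
  shows "approximable p (E \<union> F)"
  unfolding approximable_def
proof (intro conjI allI impI)
  interpret Q: prob_space "LM.mm.PM p" by (rule prob_PM)
  have s: "E \<in> sets (LM.mm.PM p)" "F \<in> sets (LM.mm.PM p)"
    using assms by (simp_all add: approximable_def)
  then show "E \<union> F \<in> sets (LM.mm.PM p)" by (rule sets.Un)
  fix e :: real assume "e > 0"
  then have e: "e / 2 > 0" by simp
  obtain m C where C: "cylinder p m C" "Q.prob ((E - C) \<union> (C - E)) < e / 2"
    using E e unfolding approximable_def by blast
  obtain m' D where D: "cylinder p m' D" "Q.prob ((F - D) \<union> (D - F)) < e / 2"
    using F e unfolding approximable_def by blast
  obtain n where "m \<le> n" "m' \<le> n" using directed by blast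
  then have CD: "cylinder p n (C \<union> D)" using cylinder_lift C(1) D(1) cylinder_Un by blast
  note cs = cylinder_sets[OF C(1)] cylinder_sets[OF D(1)]
  have "Q.prob (((E \<union> F) - (C \<union> D)) \<union> ((C \<union> D) - (E \<union> F)))
      \<le> Q.prob (((E - C) \<union> (C - E)) \<union> ((F - D) \<union> (D - F)))"
    by (rule Q.finite_measure_mono) (use s cs in auto)
  also have "\<dots> \<le> Q.prob ((E - C) \<union> (C - E)) + Q.prob ((F - D) \<union> (D - F))"
    by (rule measure_Un_le) (use s cs in auto)
  also have "\<dots> < e" using C(2) D(2) by simp
  finally show "\<exists>m C. cylinder p m C \<and> Q.prob (((E \<union> F) - C) \<union> (C - (E \<union> F))) < e"
    using CD by blast
qed

lemma approximable_UN:
  fixes E :: "nat \<Rightarrow> _"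
  assumes E: "\<And>j. approximable p (E j)"
  shows "approximable p (\<Union>j. E j)"
  unfolding approximable_def
proof (intro conjI allI impI)
  interpret Q: prob_space "LM.mm.PM p" by (rule prob_PM)
  have s: "E j \<in> sets (LM.mm.PM p)" for j using E by (simp add: approximable_def)
  then show U: "(\<Union>j. E j) \<in> sets (LM.mm.PM p)" by blast
  let ?F = "\<lambda>n. \<Union>j<Suc n. E j"
  have sF: "?F n \<in> sets (LM.mm.PM p)" for n using s by blast
  have apF: "approximable p (?F n)" for n
  proof (induction n)
    case (Suc n)
    have "?F (Suc n) = ?F n \<union> E (Suc n)" by (auto simp: less_Suc_eq)
    then show ?case using approximable_Un[OF Suc E] by simp
  next
    case 0
    have "?F 0 = E 0" by auto
    then show ?case using E by (simp only:)
  qed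
  fix e :: real assume e: "e > 0"
  have "incseq ?F" by (intro monoI UN_mono) auto
  then have "(\<lambda>n. Q.prob (?F n)) \<longlonglongrightarrow> Q.prob (\<Union>n. ?F n)"
    using sF by (intro Q.finite_Lim_measure_incseq) auto
  moreover have "(\<Union>n. ?F n) = (\<Union>j. E j)" by auto
  ultimately have "(\<lambda>n. Q.prob (?F n)) \<longlonglongrightarrow> Q.prob (\<Union>j. E j)" by simp
  then have "\<forall>\<^sub>F n in sequentially. dist (Q.prob (?F n)) (Q.prob (\<Union>j. E j)) < e / 2"
    by (rule tendstoD) (use e in simp)
  then obtain n where n: "dist (Q.prob (?F n)) (Q.prob (\<Union>j. E j)) < e / 2"
    by (auto simp: eventually_sequentially)
  have sub: "?F n \<subseteq> (\<Union>j. E j)" by auto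
  have "Q.prob ((\<Union>j. E j) - ?F n) = Q.prob (\<Union>j. E j) - Q.prob (?F n)"
    by (rule Q.finite_measure_Diff[OF U sF sub])
  then have tail: "Q.prob ((\<Union>j. E j) - ?F n) < e / 2" using n unfolding dist_real_def by linarith
  obtain m C where C: "cylinder p m C" "Q.prob ((?F n - C) \<union> (C - ?F n)) < e / 2"
    using apF[of n] e unfolding approximable_def by (meson half_gt_zero)
  note cs = cylinder_sets[OF C(1)]
  have "Q.prob (((\<Union>j. E j) - C) \<union> (C - (\<Union>j. E j)))
      \<le> Q.prob (((\<Union>j. E j) - ?F n) \<union> ((?F n - C) \<union> (C - ?F n)))"
    by (rule Q.finite_measure_mono) (use U sF cs sub in auto)
  also have "\<dots> \<le> Q.prob ((\<Union>j. E j) - ?F n) + Q.prob ((?F n - C) \<union> (C - ?F n))"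
    by (rule measure_Un_le) (use U sF cs in auto)
  also have "\<dots> < e" using C(2) tail by simp
  finally show "\<exists>m C. cylinder p m C \<and> Q.prob (((\<Union>j. E j) - C) \<union> (C - (\<Union>j. E j))) < e"
    using C(1) by blast
qed

text \<open>
  A basic open set of the product constrains finitely many coordinates, all of which are
  determined by the coordinate at a common upper bound of their indices.
\<close>

lemma open_limit_cylinder:
  assumes U: "openin (gtop L) U" and x: "x \<in> U"
  obtains n V where "openin (gtop (G n)) V" "x n \<in> V" "{y \<in> carrier L. y n \<in> V} \<subseteq> U"
proof -
  have xL: "x \<in> carrier L" using openin_subset[OF U] x topspace_L by blast
  obtain W where W: "openin X W" "U = W \<inter> carrier L"
    using U unfolding gtop_L openin_subtopology by blast
  obtain F where F: "finite {i. F i \<noteq> topspace (gtop (G i))}" "\<And>i. openin (gtop (G i)) (F i)"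
      "x \<in> Pi\<^sub>E UNIV F" "Pi\<^sub>E UNIV F \<subseteq> W"
    using W x unfolding openin_product_topology_alt by auto
  let ?I = "{i. F i \<noteq> topspace (gtop (G i))}"
  obtain n where n: "\<forall>i\<in>?I. i \<le> n" using finite_upper_bound[OF F(1)] by blast
  define V where "V = \<Inter>(insert (topspace (gtop (G n))) ((\<lambda>i. {z \<in> topspace (gtop (G n)). \<pi> n i z \<in> F i}) ` ?I))"
  have "openin (gtop (G n)) V"
    unfolding V_def
  proof (rule openin_Inter)
    fix W assume "W \<in> insert (topspace (gtop (G n))) ((\<lambda>i. {z \<in> topspace (gtop (G n)). \<pi> n i z \<in> F i}) ` ?I)"
    then show "openin (gtop (G n)) W"
      using n openin_continuous_map_preimage[OF continuous F(2)] by auto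
  qed (use F(1) in auto)
  moreover have "x n \<in> V"
  proof -
    have "x n \<in> topspace (gtop (G n))" using xL by (simp add: carrier_L topspace_G)
    moreover have "\<pi> n i (x n) \<in> F i" if "i \<in> ?I" for i
    proof -
      have "\<pi> n i (x n) = x i" using xL n that unfolding carrier_L by blast
      then show ?thesis using F(3) by (simp add: PiE_iff)
    qed
    ultimately show ?thesis by (simp add: V_def)
  qed
  moreover have "{y \<in> carrier L. y n \<in> V} \<subseteq> U"
  proof
    fix y assume y: "y \<in> {y \<in> carrier L. y n \<in> V}"
    have "y i \<in> F i" for i
    proof (cases "i \<in> ?I")
      case True
      then have "\<pi> n i (y n) = y i" using y n unfolding carrier_L by blast
      moreover have "\<pi> n i (y n) \<in> F i" using y True by (auto simp: V_def)
      ultimately show ?thesis by simp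
    next
      case False
      then show ?thesis using y by (simp add: carrier_L topspace_G)
    qed
    then have "y \<in> Pi\<^sub>E UNIV F" by (simp add: PiE_iff)
    then show "y \<in> U" using F(4) W(2) y by blast
  qed
  ultimately show thesis by (rule that)
qed

lemma approximable_open:
  assumes i: "i < p" and U: "openin (gtop L) U"
  shows "approximable p {z \<in> space (LM.mm.PM p). z i \<in> U}"
proof -
  obtain B where B: "countable B" "\<And>V. V \<in> B \<Longrightarrow> openin (gtop L) V"
      "\<And>U x. openin (gtop L) U \<Longrightarrow> x \<in> U \<Longrightarrow> \<exists>V\<in>B. x \<in> V \<and> V \<subseteq> U"
    using sc_limit unfolding second_countable_def by metis
  define good where "good = (\<lambda>b (n, V). openin (gtop (G n)) V \<and> b \<subseteq> {y \<in> carrier L. y n \<in> V} \<and>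
     {y \<in> carrier L. y n \<in> V} \<subseteq> U)"
  define B' where "B' = {b \<in> B. \<exists>c. good b c}"
  define c where "c = (\<lambda>b. SOME c. good b c)"
  have c: "good b (c b)" if "b \<in> B'" for b
    unfolding c_def by (rule someI_ex) (use that in \<open>simp add: B'_def\<close>)
  define Y where "Y = (\<lambda>b. {z \<in> space (LM.mm.PM p). z i \<in> {y \<in> carrier L. y (fst (c b)) \<in> snd (c b)}})"
  have Ycyl: "cylinder p (fst (c b)) (Y b)" if b: "b \<in> B'" for b
  proof -
    let ?n = "fst (c b)" and ?V = "snd (c b)"
    have V: "openin (gtop (G ?n)) ?V" using c[OF b] by (simp add: good_def split_beta)
    let ?B = "(\<lambda>w. w i) -` ?V \<inter> space (PMG ?n p)"
    have "?B \<in> sets (PMG ?n p)"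
    proof (rule measurable_sets)
      show "(\<lambda>w. w i) \<in> PMG ?n p \<rightarrow>\<^sub>M haar_module.haar (G ?n)"
        by (rule measurable_component_singleton) (use i in simp)
      show "?V \<in> sets (haar_module.haar (G ?n))" using V by (auto simp: sets_haar_G)
    qed
    moreover have "Y b = proj_tuple p ?n -` ?B \<inter> space (LM.mm.PM p)"
    proof (rule Set.set_eqI)
      fix z
      show "z \<in> Y b \<longleftrightarrow> z \<in> proj_tuple p ?n -` ?B \<inter> space (LM.mm.PM p)"
      proof (cases "z \<in> space (LM.mm.PM p)")
        case True
        have "z i \<in> carrier L" using True i by (auto simp: LM.mm.space_PM PiE_iff)
        moreover have "proj_tuple p ?n z \<in> space (PMG ?n p)"
          by (rule measurable_space[OF measurable_proj_tuple True])
        moreover have "proj_tuple p ?n z i = z i ?n" using i by (simp add: compose_def)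
        ultimately show ?thesis using True unfolding Y_def by simp
      next
        case False
        then show ?thesis unfolding Y_def by blast
      qed
    qed
    ultimately show ?thesis unfolding cylinder_def by blast
  qed
  have UY: "{z \<in> space (LM.mm.PM p). z i \<in> U} = (\<Union>b\<in>B'. Y b)"
  proof
    show "(\<Union>b\<in>B'. Y b) \<subseteq> {z \<in> space (LM.mm.PM p). z i \<in> U}"
    proof
      fix z assume "z \<in> (\<Union>b\<in>B'. Y b)"
      then obtain b where b: "b \<in> B'" "z \<in> Y b" by blast
      then show "z \<in> {z \<in> space (LM.mm.PM p). z i \<in> U}"
        using c[OF b(1)] unfolding good_def Y_def split_beta by blast
    qed
    show "{z \<in> space (LM.mm.PM p). z i \<in> U} \<subseteq> (\<Union>b\<in>B'. Y b)"
    proof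
      fix z assume z: "z \<in> {z \<in> space (LM.mm.PM p). z i \<in> U}"
      then have zU: "z i \<in> U" by simp
      obtain n V where nV: "openin (gtop (G n)) V" "z i n \<in> V" "{y \<in> carrier L. y n \<in> V} \<subseteq> U"
        by (rule open_limit_cylinder[OF U zU])
      have "openin (gtop L) {y \<in> topspace (gtop L). y n \<in> V}"
        by (rule openin_continuous_map_preimage[OF continuous_projection nV(1)])
      moreover have "z i \<in> {y \<in> topspace (gtop L). y n \<in> V}"
        using nV(2) zU openin_subset[OF U] by blast
      ultimately obtain b where b: "b \<in> B" "z i \<in> b" "b \<subseteq> {y \<in> topspace (gtop L). y n \<in> V}"
        using B(3) by blast
      then have "good b (n, V)" using nV by (simp add: good_def topspace_L)
      then have bB: "b \<in> B'" using b by (auto simp: B'_def)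
      then have "b \<subseteq> {y \<in> carrier L. y (fst (c b)) \<in> snd (c b)}"
        using c[OF bB] by (simp add: good_def split_beta)
      then have "z \<in> Y b" using z b(2) by (auto simp: Y_def)
      then show "z \<in> (\<Union>b\<in>B'. Y b)" using bB by blast
    qed
  qed
  show ?thesis
  proof (cases "B' = {}")
    case True
    have "cylinder p undefined {}" unfolding cylinder_def by (intro bexI[of _ "{}"]) auto
    moreover have "{z \<in> space (LM.mm.PM p). z i \<in> U} = {}" unfolding UY True by (rule UN_empty)
    ultimately show ?thesis using approximable_cylinder[of p undefined "{}"] by (simp only:)
  next
    case False
    have "countable B'" using B(1) by (auto simp: B'_def)
    then have "(\<Union>b\<in>B'. Y b) = (\<Union>j. Y (from_nat_into B' j))"
      using range_from_nat_into[OF False] by (metis image_image)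
    then show ?thesis
      unfolding UY using approximable_UN[of p "\<lambda>j. Y (from_nat_into B' j)"]
        approximable_cylinder[OF Ycyl[OF from_nat_into[OF False]]] by simp
  qed
qed

lemma sets_approximable: "E \<in> sets (LM.mm.PM p) \<Longrightarrow> approximable p E"
proof -
  assume E: "E \<in> sets (LM.mm.PM p)"
  let ?\<Omega> = "space (LM.mm.PM p)"
  have sub: "Collect (approximable p) \<subseteq> Pow ?\<Omega>"
    using sets.sets_into_space unfolding approximable_def by blast
  have "cylinder p m {}" for m unfolding cylinder_def by (intro bexI[of _ "{}"]) auto
  then have sa: "sigma_algebra ?\<Omega> (Collect (approximable p))"
    unfolding sigma_algebra_iff2
  proof (intro conjI ballI allI impI)
    fix F :: "nat \<Rightarrow> (nat \<Rightarrow> 'i \<Rightarrow> 'g) set" assume "range F \<subseteq> Collect (approximable p)"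
    then show "(\<Union>j. F j) \<in> Collect (approximable p)" using approximable_UN[of p F] by blast
  qed (use sub approximable_cylinder approximable_compl in blast)+
  define N where "N = sigma ?\<Omega> (Collect (approximable p))"
  have setsN: "sets N = Collect (approximable p)" and spaceN: "space N = ?\<Omega>"
    unfolding N_def using sub sigma_algebra.sigma_sets_eq[OF sa]
    by (simp_all add: sets_measure_of space_measure_of)
  have comp: "(\<lambda>z. z i) \<in> N \<rightarrow>\<^sub>M borel_of (gtop L)" if i: "i < p" for i
  proof (rule measurable_borel_of)
    show "(\<lambda>z. z i) \<in> space N \<rightarrow> topspace (gtop L)"
      using i by (auto simp: spaceN LM.mm.space_PM PiE_iff topspace_L)
    fix U assume U: "openin (gtop L) U"
    have "(\<lambda>z. z i) -` U \<inter> space N = {z \<in> ?\<Omega>. z i \<in> U}" by (auto simp: spaceN)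
    then show "(\<lambda>z. z i) -` U \<inter> space N \<in> sets N"
      using approximable_open[OF i U] by (simp add: setsN)
  qed
  have "(\<lambda>z. z) \<in> N \<rightarrow>\<^sub>M LM.mm.PM p"
  proof (rule measurable_PiM_single')
    show "(\<lambda>z. z i) \<in> N \<rightarrow>\<^sub>M LM.haar" if "i \<in> {..<p}" for i
      using comp[of i] that measurable_cong_sets[OF refl LM.C.haar_measureD(1)[OF LM.haar], of N] by simp
    show "(\<lambda>z. z) \<in> space N \<rightarrow> (\<Pi>\<^sub>E i\<in>{..<p}. space LM.haar)"
      by (simp add: spaceN space_PiM)
  qed
  from measurable_sets[OF this E] have "E \<inter> ?\<Omega> \<in> sets N" by (simp add: spaceN)
  then show ?thesis using sets.sets_into_space[OF E] by (simp add: setsN Int_absorb2)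
qed

text \<open>
  Countably many translates of a neighbourhood of the identity on which the length is small cover
  \<open>A\<close>, which cuts the domain of \<open>\<sigma>\<close> into countably many pieces on which it is nearly constant. All
  but finitely many are discarded, the others are replaced by sets coming from a common index
  \<open>n\<close>, and the approximating cochain takes on these the corresponding constant values.
\<close>

lemma cochain_approximation:
  assumes len: "haar_length_module L A T len"
    and bounded: "\<And>a. a \<in> carrier A \<Longrightarrow> len a \<le> ennreal K" and K: "K \<ge> 0"
    and nbhd: "\<And>e. e > 0 \<Longrightarrow> \<exists>U. openin (gtop A) U \<and> \<one>\<^bsub>A\<^esub> \<in> U \<and> (\<forall>a\<in>U. len a \<le> ennreal e)"
    and \<sigma>: "\<sigma> \<in> carrier (borel_maps L A p)" and e: "e > 0"
  obtains n \<psi> where "m0 \<le> n" "\<psi> \<in> carrier (borel_maps (G n) A p)"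
    "haar_length_module.mean_len L len p (\<sigma> \<otimes>\<^bsub>borel_maps L A p\<^esub>
       inv\<^bsub>borel_maps L A p\<^esub> pullback_fun L p (\<lambda>x. x n) \<psi>) \<le> ennreal e"
proof -
  interpret HL: haar_length_module L A T len by (rule len)
  interpret Q: prob_space "LM.mm.PM p" by (rule prob_PM)
  let ?Q = "LM.mm.PM p"
  \<comment> \<open>An error of \<open>\<delta>\<close> off a set of measure \<open>2 * \<delta>\<close>, on which lengths are bounded by \<open>K\<close>, amounts to \<open>e\<close>.\<close>
  define \<delta> where "\<delta> = e / (1 + 2 * K)"
  have "\<delta> * (1 + 2 * K) = e" using K by (simp add: \<delta>_def)
  then have "\<delta> + K * (2 * \<delta>) = e" by (simp add: algebra_simps)
  moreover have "\<delta> > 0" using e K by (simp add: \<delta>_def)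
  ultimately have \<delta>: "\<delta> > 0" "\<delta> + K * (2 * \<delta>) = e" by simp_all
  obtain U where U: "openin (gtop A) U" "\<one>\<^bsub>A\<^esub> \<in> U" "\<And>a. a \<in> U \<Longrightarrow> len a \<le> ennreal \<delta>"
    using nbhd[OF \<delta>(1)] by blast
  obtain D where D: "countable D" "D \<subseteq> topspace (gtop A)" "gtop A closure_of D = topspace (gtop A)"
    using second_countable_imp_separable_space[OF LM.second_countable] unfolding separable_space_def by blast
  have meets: "D \<inter> W \<noteq> {}" if "openin (gtop A) W" "W \<noteq> {}" for W
    using D(3) that unfolding dense_intersects_open by blast
  have "D \<noteq> {}" using meets[OF U(1)] U(2) by blast
  define a where "a = from_nat_into D"
  have range_a: "range a = D" unfolding a_def by (rule range_from_nat_into[OF \<open>D \<noteq> {}\<close> D(1)])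
  have ac: "a j \<in> carrier A" for j
    using D(2) range_a LM.A.topspace_gtop by auto
  have cover: "\<exists>j. inv\<^bsub>A\<^esub> a j \<otimes>\<^bsub>A\<^esub> b \<in> U" if b: "b \<in> carrier A" for b
  proof -
    have "continuous_map (gtop A) (prod_topology (gtop A) (gtop A)) (\<lambda>x. (inv\<^bsub>A\<^esub> x, b))"
      by (rule continuous_map_pairedI[OF LM.A.continuous_inv]) (simp add: b LM.A.topspace_gtop)
    from continuous_map_compose[OF this LM.A.continuous_mult]
    have c: "continuous_map (gtop A) (gtop A) (\<lambda>x. inv\<^bsub>A\<^esub> x \<otimes>\<^bsub>A\<^esub> b)" by (simp add: o_def)
    let ?W = "{x \<in> topspace (gtop A). inv\<^bsub>A\<^esub> x \<otimes>\<^bsub>A\<^esub> b \<in> U}"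
    have "openin (gtop A) ?W" by (rule openin_continuous_map_preimage[OF c U(1)])
    moreover have "b \<in> ?W" using b U(2) by (simp add: LM.A.topspace_gtop)
    ultimately have "D \<inter> ?W \<noteq> {}" using meets by blast
    then show ?thesis using range_a by blast
  qed
  define E where "E = (\<lambda>j. {z \<in> space ?Q. inv\<^bsub>A\<^esub> a j \<otimes>\<^bsub>A\<^esub> \<sigma> z \<in> U})"
  have Es: "E j \<in> sets ?Q" for j
  proof -
    have "(\<lambda>z. inv\<^bsub>A\<^esub> a j \<otimes>\<^bsub>A\<^esub> \<sigma> z) \<in> ?Q \<rightarrow>\<^sub>M LM.BA"
      by (rule LM.mm.measurable_mult_A[OF measurable_const LM.borel_maps_measurable[OF \<sigma>]])
         (simp add: LM.A.topspace_gtop ac)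
    from measurable_sets[OF this openin_sets_borel_of[OF U(1)]]
    show ?thesis unfolding E_def vimage_def Int_def by (simp add: conj_commute)
  qed
  have EU: "(\<Union>j. E j) = space ?Q"
  proof
    show "space ?Q \<subseteq> (\<Union>j. E j)"
    proof
      fix z assume z: "z \<in> space ?Q"
      obtain j where "inv\<^bsub>A\<^esub> a j \<otimes>\<^bsub>A\<^esub> \<sigma> z \<in> U" using cover[OF LM.borel_maps_closed[OF \<sigma> z]] by blast
      then show "z \<in> (\<Union>j. E j)" using z by (auto simp: E_def)
    qed
  qed (auto simp: E_def)
  let ?F = "\<lambda>n. \<Union>j<n. E j"
  have sF: "?F n \<in> sets ?Q" for n using Es by blast
  have "incseq ?F" by (intro monoI UN_mono) auto
  then have "(\<lambda>n. Q.prob (?F n)) \<longlonglongrightarrow> Q.prob (\<Union>n. ?F n)"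
    by (intro Q.finite_Lim_measure_incseq) (use sF in blast)
  moreover have "(\<Union>n. ?F n) = space ?Q" unfolding EU[symmetric] by auto
  ultimately have "(\<lambda>n. Q.prob (?F n)) \<longlonglongrightarrow> 1" by (simp add: Q.prob_space)
  then have "\<forall>\<^sub>F n in sequentially. dist (Q.prob (?F n)) 1 < \<delta>" by (rule tendstoD[OF _ \<delta>(1)])
  then obtain N where N: "dist (Q.prob (?F N)) 1 < \<delta>" unfolding eventually_sequentially by blast
  have tail: "Q.prob (space ?Q - ?F N) < \<delta>"
    unfolding Q.prob_compl[OF sF] using N unfolding dist_real_def by linarith
  have "\<delta> / (real N + 1) > 0" using \<delta>(1) by simp
  then have "\<forall>j. \<exists>m C. cylinder p m C \<and> Q.prob ((E j - C) \<union> (C - E j)) < \<delta> / (real N + 1)"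
    using sets_approximable[OF Es] unfolding approximable_def by blast
  then obtain m C where C: "\<And>j. cylinder p (m j) (C j)"
      "\<And>j. Q.prob ((E j - C j) \<union> (C j - E j)) < \<delta> / (real N + 1)" by metis
  obtain n where n: "m0 \<le> n" "\<forall>k\<in>m ` {..<N}. k \<le> n"
    using finite_upper_bound[of "m ` {..<N}"] by blast
  have "\<exists>B. B \<in> sets (PMG n p) \<and> C j = proj_tuple p n -` B \<inter> space ?Q" if j: "j < N" for j
  proof -
    have "m j \<le> n" using n(2) j by simp
    from cylinder_lift[OF this C(1)] show ?thesis unfolding cylinder_def by blast
  qed
  then obtain B where B: "\<And>j. j < N \<Longrightarrow> B j \<in> sets (PMG n p)"
      "\<And>j. j < N \<Longrightarrow> C j = proj_tuple p n -` B j \<inter> space ?Q" by metis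
  \<comment> \<open>The first alternative ensures that some index satisfies the condition.\<close>
  define P where "P = (\<lambda>j w. j \<ge> N \<or> w \<in> B j)"
  have [measurable]: "Measurable.pred (PMG n p) (P j)" for j
  proof (cases "j < N")
    case True
    note B(1)[OF True, measurable]
    show ?thesis unfolding P_def by measurable
  next
    case False
    then show ?thesis by (simp add: P_def)
  qed
  define \<psi> where "\<psi> = (\<lambda>w\<in>space (PMG n p). a (LEAST j. P j w))"
  interpret Gn: haar_module "G n" A "S n" by (rule haar_module_G)
  interpret En: haar_epi "G n" L A "S n" T "\<lambda>x. x n" by (rule haar_epi_limit)
  have \<psi>: "\<psi> \<in> carrier (borel_maps (G n) A p)"
  proof -
    have "a \<in> count_space UNIV \<rightarrow>\<^sub>M LM.BA" by (simp add: ac LM.A.topspace_gtop)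
    moreover have "(\<lambda>w. LEAST j. P j w) \<in> PMG n p \<rightarrow>\<^sub>M count_space UNIV" by measurable
    ultimately have "(\<lambda>w. a (LEAST j. P j w)) \<in> PMG n p \<rightarrow>\<^sub>M LM.BA" by (rule measurable_compose[rotated])
    then show ?thesis unfolding \<psi>_def by (rule Gn.borel_maps_restrictI)
  qed
  define bad where "bad = (space ?Q - ?F N) \<union> (\<Union>j<N. (E j - C j) \<union> (C j - E j))"
  have symm: "(E j - C j) \<union> (C j - E j) \<in> sets ?Q" for j
    by (intro sets.Un sets.Diff Es cylinder_sets[OF C(1)])
  have bads: "bad \<in> sets ?Q"
    unfolding bad_def by (intro sets.Un sets.Diff sets.top sF sets.finite_UN symm) auto
  have "Q.prob (\<Union>j<k. (E j - C j) \<union> (C j - E j)) \<le> real k * (\<delta> / (real N + 1))" for k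
  proof (induction k)
    case (Suc k)
    have "(\<Union>j<Suc k. (E j - C j) \<union> (C j - E j)) =
       (\<Union>j<k. (E j - C j) \<union> (C j - E j)) \<union> ((E k - C k) \<union> (C k - E k))"
      unfolding lessThan_Suc UN_insert by (rule Un_commute)
    then have "Q.prob (\<Union>j<Suc k. (E j - C j) \<union> (C j - E j)) \<le>
        Q.prob (\<Union>j<k. (E j - C j) \<union> (C j - E j)) + Q.prob ((E k - C k) \<union> (C k - E k))"
      by (simp only:) (intro measure_Un_le sets.finite_UN symm finite_lessThan)
    then show ?case using Suc C(2)[of k] by (simp only: of_nat_Suc distrib_right)
  qed simp
  from this[of N] have "Q.prob (\<Union>j<N. (E j - C j) \<union> (C j - E j)) \<le> real N * (\<delta> / (real N + 1))" .
  also have "\<dots> \<le> \<delta>" using \<delta>(1) by (simp add: field_simps)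
  finally have mid: "Q.prob (\<Union>j<N. (E j - C j) \<union> (C j - E j)) \<le> \<delta>" .
  have "Q.prob bad \<le> Q.prob (space ?Q - ?F N) + Q.prob (\<Union>j<N. (E j - C j) \<union> (C j - E j))"
    unfolding bad_def
    by (intro measure_Un_le sets.Diff sets.top sF sets.finite_UN symm finite_lessThan)
  then have badm: "Q.prob bad \<le> 2 * \<delta>" using tail mid by linarith
  let ?R = "\<sigma> \<otimes>\<^bsub>borel_maps L A p\<^esub> inv\<^bsub>borel_maps L A p\<^esub> En.pull p \<psi>"
  have pc: "En.pull p \<psi> \<in> carrier (borel_maps L A p)" by (rule En.pull_closed[OF \<psi>])
  have R: "?R \<in> carrier (borel_maps L A p)" by (intro LM.bm.m_closed LM.bm.inv_closed \<sigma> pc)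
  have le: "len (?R z) \<le> ennreal \<delta> + ennreal K * indicator bad z" if z: "z \<in> space ?Q" for z
  proof (cases "z \<in> bad")
    case True
    then show ?thesis
      using bounded[OF LM.borel_maps_closed[OF R z]] by (simp add: add_increasing)
  next
    case False
    let ?w = "proj_tuple p n z"
    have w: "?w \<in> space (PMG n p)" by (rule measurable_space[OF measurable_proj_tuple z])
    have ECB: "z \<in> E j \<longleftrightarrow> ?w \<in> B j" if "j < N" for j
    proof -
      have "z \<in> E j \<longleftrightarrow> z \<in> C j" using False that unfolding bad_def by blast
      then show ?thesis using B(2)[OF that] z by blast
    qed
    obtain j where j: "j < N" "z \<in> E j" using False z unfolding bad_def by blast
    define k where "k = (LEAST j. P j ?w)"
    have Pj: "P j ?w" using ECB[OF j(1)] j(2) unfolding P_def by blast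
    have "P k ?w" unfolding k_def by (rule LeastI[of "\<lambda>j. P j ?w", OF Pj])
    moreover have "k \<le> j" unfolding k_def by (rule Least_le[of "\<lambda>j. P j ?w", OF Pj])
    ultimately have "k < N" "?w \<in> B k" using j(1) unfolding P_def by auto
    then have "z \<in> E k" using ECB by blast
    then have "len (inv\<^bsub>A\<^esub> a k \<otimes>\<^bsub>A\<^esub> \<sigma> z) \<le> ennreal \<delta>" using U(3) unfolding E_def by blast
    moreover have "En.pull p \<psi> z = a k" using z w by (simp add: En.pull_eq \<psi>_def k_def)
    then have "?R z = inv\<^bsub>A\<^esub> a k \<otimes>\<^bsub>A\<^esub> \<sigma> z"
      using z ac LM.borel_maps_closed[OF \<sigma> z]
      by (simp add: LM.borel_maps_mult LM.borel_maps_inv[OF pc z] LM.A.m_comm)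
    ultimately show ?thesis by (simp add: add_increasing2)
  qed
  have "HL.mean_len p ?R \<le> (\<integral>\<^sup>+z. ennreal \<delta> + ennreal K * indicator bad z \<partial>?Q)"
    unfolding HL.mean_len_def by (rule nn_integral_mono[OF le])
  also have "\<dots> = (\<integral>\<^sup>+z. ennreal \<delta> \<partial>?Q) + (\<integral>\<^sup>+z. ennreal K * indicator bad z \<partial>?Q)"
    using bads by (intro nn_integral_add) auto
  also have "\<dots> = ennreal \<delta> + ennreal K * emeasure ?Q bad"
    by (simp only: nn_integral_const Q.emeasure_space_1 mult_1_right nn_integral_cmult_indicator[OF bads])
  also have "\<dots> \<le> ennreal \<delta> + ennreal K * ennreal (2 * \<delta>)"
    unfolding Q.emeasure_eq_measure by (intro add_left_mono mult_left_mono ennreal_leI badm zero_le)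
  also have "\<dots> = ennreal e"
    using \<delta> K by (simp flip: ennreal_mult ennreal_plus)
  finally show thesis using that[OF n(1) \<psi>] by blast
qed

end


section \<open>Discrete modules\<close>

definition discrete_len :: "'a tgroup \<Rightarrow> 'a \<Rightarrow> ennreal" where
  "discrete_len A a = (if a = \<one>\<^bsub>A\<^esub> then 0 else 1)"

context haar_module
begin

lemma action_one_iff:
  assumes g: "g \<in> carrier G" and a: "a \<in> carrier A"
  shows "T g a = \<one>\<^bsub>A\<^esub> \<longleftrightarrow> a = \<one>\<^bsub>A\<^esub>"
proof
  have one: "T h \<one>\<^bsub>A\<^esub> = \<one>\<^bsub>A\<^esub>" if "h \<in> carrier G" for h
    by (rule group_hom.hom_one[OF mm.action_group_hom[OF that]])
  show "T g a = \<one>\<^bsub>A\<^esub>" if "a = \<one>\<^bsub>A\<^esub>" using that one[OF g] by simp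
  assume "T g a = \<one>\<^bsub>A\<^esub>"
  then have "T (inv\<^bsub>G\<^esub> g) (T g a) = \<one>\<^bsub>A\<^esub>" using one[of "inv\<^bsub>G\<^esub> g"] g by simp
  then show "a = \<one>\<^bsub>A\<^esub>" using g a by (simp add: mm.action_one flip: mm.action_mult)
qed

lemma haar_length_module_discrete: "haar_length_module G A T (discrete_len A)"
proof unfold_locales
  have "{a \<in> space BA. discrete_len A a \<in> W} \<in> sets BA" for W
  proof -
    have eq: "{a \<in> space BA. discrete_len A a \<in> W} =
       (if 0 \<in> W then {\<one>\<^bsub>A\<^esub>} else {}) \<union> (if 1 \<in> W then space BA - {\<one>\<^bsub>A\<^esub>} else {})"
      by (auto simp: discrete_len_def A.topspace_gtop)
    have "(if 0 \<in> W then {\<one>\<^bsub>A\<^esub>} else {}) \<in> sets BA" using one_set by simp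
    moreover have "(if 1 \<in> W then space BA - {\<one>\<^bsub>A\<^esub>} else {}) \<in> sets BA"
      using sets.compl_sets[OF one_set] by simp
    ultimately show ?thesis unfolding eq by (rule sets.Un)
  qed
  then show "discrete_len A \<in> borel_measurable BA"
    by (intro measurableI) (simp_all add: vimage_def Int_def conj_commute)
  show "discrete_len A \<one>\<^bsub>A\<^esub> = 0" by (simp add: discrete_len_def)
  show "discrete_len A (a \<otimes>\<^bsub>A\<^esub> b) \<le> discrete_len A a + discrete_len A b"
    if "a \<in> carrier A" "b \<in> carrier A" for a b
    using that by (auto simp: discrete_len_def)
  show "discrete_len A (inv\<^bsub>A\<^esub> a) = discrete_len A a" if "a \<in> carrier A" for a
    using that by (simp add: discrete_len_def A.inv_eq_1_iff)
  show "discrete_len A (T g a) = discrete_len A a" if "g \<in> carrier G" "a \<in> carrier A" for g a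
    using that by (simp add: discrete_len_def action_one_iff)
qed

lemma averaging_module_discrete: "averaging_module G A T (discrete_len A) (\<lambda>_. ennreal (1/2))"
proof -
  interpret haar_length_module G A T "discrete_len A" by (rule haar_length_module_discrete)
  show ?thesis
  proof unfold_locales
    show "ennreal (1/2) > 0" by (simp only: ennreal_less_zero_iff)
    fix q f c
    assume f: "mm.cochain (Suc (Suc q)) f" and ae: "AE x in mm.S. discrete_len A (f x) \<le> c"
      and c: "c \<le> ennreal (1/2)"
    have "AE x in mm.S. mm.d (Suc (Suc q)) (\<lambda>_. \<one>\<^bsub>A\<^esub>) x = f x"
      using ae
    proof eventually_elim
      case (elim x)
      then have "discrete_len A (f x) \<le> ennreal (1/2)" using c by (rule order_trans)
      then have "f x = \<one>\<^bsub>A\<^esub>"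
      proof (rule contrapos_pp)
        assume "f x \<noteq> \<one>\<^bsub>A\<^esub>"
        then have "discrete_len A (f x) = ennreal 1" by (simp add: discrete_len_def)
        then show "\<not> discrete_len A (f x) \<le> ennreal (1/2)"
          by (simp only: ennreal_le_iff)
      qed
      then show ?case by (simp only: A.altprod_one)
    qed
    then show "\<exists>\<phi>. mm.cochain (Suc q) \<phi> \<and> (\<integral>\<^sup>+x. discrete_len A (\<phi> x) \<partial>mm.S) \<le> 2 * c \<and>
        (AE x in mm.S. mm.d (Suc (Suc q)) \<phi> x = f x)"
      by (intro exI[of _ "\<lambda>_. \<one>\<^bsub>A\<^esub>"] conjI mm.cochain_one) (simp_all add: discrete_len_def)
  qed
qed

end


section \<open>Angles and characters\<close>

text \<open>
  Only the values at points of the circle near \<open>1\<close> matter, where this is the argument; it is chosen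
  because it is visibly measurable and bounded.
\<close>

definition angle :: "complex \<Rightarrow> real" where
  "angle z = arctan (Im z / Re z)"

lemma abs_angle_less: "\<bar>angle z\<bar> < pi / 2"
  unfolding angle_def using arctan_bounded[of "Im z / Re z"] by linarith

lemma angle_measurable [measurable]: "angle \<in> borel_measurable borel"
proof -
  have [measurable]: "arctan \<in> borel_measurable borel"
    by (intro borel_measurable_continuous_onI continuous_at_imp_continuous_on ballI isCont_arctan)
  have [measurable]: "Im \<in> borel_measurable borel" "Re \<in> borel_measurable borel"
    by (intro borel_measurable_continuous_onI continuous_intros)+
  show ?thesis unfolding angle_def[abs_def] by measurable
qed

lemma angle_near_one:
  assumes z: "norm z = 1" and near: "norm (z - 1) \<le> 1/2"
  shows "cis (angle z) = z" and "\<bar>angle z\<bar> \<le> 2 * norm (z - 1)"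
proof -
  have re: "Re z \<ge> 1/2" using near abs_Re_le_cmod[of "z - 1"] by simp
  have im: "\<bar>Im z\<bar> \<le> norm (z - 1)" using abs_Im_le_cmod[of "z - 1"] by simp
  have sq: "(Re z)\<^sup>2 + (Im z)\<^sup>2 = 1" using z by (simp add: cmod_def)
  have "1 + (Im z / Re z)\<^sup>2 = (1 / Re z)\<^sup>2"
    using re sq by (simp add: power_divide field_simps)
  then have rt: "sqrt (1 + (Im z / Re z)\<^sup>2) = 1 / Re z" using re by (simp add: real_sqrt_divide)
  show "cis (angle z) = z"
    using re by (simp add: complex_eq_iff angle_def cos_arctan sin_arctan rt)
  have "\<bar>angle z\<bar> \<le> \<bar>Im z / Re z\<bar>" unfolding angle_def by (rule abs_arctan_le)
  also have "\<dots> = \<bar>Im z\<bar> / Re z" using re by simp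
  also have "\<dots> \<le> \<bar>Im z\<bar> / (1/2)" using re by (intro divide_left_mono) auto
  finally show "\<bar>angle z\<bar> \<le> 2 * norm (z - 1)" using im by simp
qed

lemma norm_cis_minus_one_le: "norm (cis t - 1) \<le> \<bar>t\<bar>"
  using dist_exp_i_1[of t] abs_sin_x_le_abs_x[of "t / 2"] by (simp add: cis_conv_exp)

lemma cis_inj_small:
  assumes "\<bar>s\<bar> < pi" "\<bar>t\<bar> < pi" "cis s = cis t"
  shows "s = t"
proof -
  have "s = Arg (cis s)" by (rule Arg_cis[symmetric]) (use assms(1) in \<open>auto simp: abs_less_iff\<close>)
  also have "\<dots> = Arg (cis t)" by (rule arg_cong[OF assms(3)])
  also have "\<dots> = t" by (rule Arg_cis) (use assms(2) in \<open>auto simp: abs_less_iff\<close>)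
  finally show ?thesis .
qed

text \<open>A segment through \<open>0\<close> whose image on the circle avoids \<open>-1\<close> is shorter than \<open>pi\<close>.\<close>

lemma abs_less_pi_if_segment_small:
  assumes "\<And>s. \<lbrakk>0 \<le> s; s \<le> 1\<rbrakk> \<Longrightarrow> norm (cis (s * t) - 1) \<le> 1/2"
  shows "\<bar>t\<bar> < pi"
proof (rule ccontr)
  assume "\<not> \<bar>t\<bar> < pi"
  then have t: "pi \<le> \<bar>t\<bar>" "t \<noteq> 0" using pi_gt_zero by auto
  have "pi / \<bar>t\<bar> * t = pi \<or> pi / \<bar>t\<bar> * t = - pi" using t(2) by (cases "t > 0") (auto simp: field_simps)
  then have "cis (pi / \<bar>t\<bar> * t) = -1" by (auto simp: complex_eq_iff)
  then show False using assms[of "pi / \<bar>t\<bar>"] t by simp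
qed

text \<open>
  Integrating \<open>\<gamma>\<close> over a short interval gives a nonzero number \<open>I\<close> with \<open>\<gamma> t * I\<close> differentiable in \<open>t\<close>,
  so \<open>\<gamma>\<close> solves a linear differential equation.
\<close>

lemma continuous_character:
  fixes \<gamma> :: "real \<Rightarrow> complex"
  assumes cont: "continuous_on UNIV \<gamma>" and add: "\<And>s t. \<gamma> (s + t) = \<gamma> s * \<gamma> t"
    and norm: "\<And>t. norm (\<gamma> t) = 1"
  obtains c where "\<And>t. \<gamma> t = cis (c * t)"
proof -
  have c': "continuous_on S \<gamma>" for S using cont by (rule continuous_on_subset) simp
  have int: "\<gamma> integrable_on {a..b}" for a b by (rule integrable_continuous_real[OF c'])
  have nz: "\<gamma> t \<noteq> 0" for t using norm[of t] by auto
  have \<gamma>0: "\<gamma> 0 = 1" using add[of 0 0] nz[of 0] by simp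
  obtain a where a: "a > 0" "\<And>s. \<bar>s\<bar> < 2 * a \<Longrightarrow> norm (\<gamma> s - 1) < 1/2"
  proof -
    have "isCont \<gamma> 0" using cont by (simp add: continuous_on_eq_continuous_at)
    then obtain e where "e > 0" "\<And>s. dist s 0 < e \<Longrightarrow> dist (\<gamma> s) (\<gamma> 0) < 1/2"
      unfolding continuous_at_eps_delta by (metis half_gt_zero_iff zero_less_one)
    then show thesis using that[of "e / 2"] by (simp add: dist_norm \<gamma>0)
  qed
  define I where "I = integral {0..a} \<gamma>"
  have "norm (integral {0..a} (\<lambda>s. \<gamma> s - 1)) \<le> 1/2 * (a - 0)"
  proof (rule integral_bound)
    show "continuous_on {0..a} (\<lambda>s. \<gamma> s - 1)" by (intro continuous_intros c')
    show "norm (\<gamma> s - 1) \<le> 1/2" if "s \<in> {0..a}" for s using a(2)[of s] that a(1) by auto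
  qed (use a(1) in simp)
  moreover have "integral {0..a} (\<lambda>s. \<gamma> s - 1) = I - of_real a"
    unfolding I_def using a(1) by (subst integral_diff[OF int]) (auto simp: scaleR_conv_of_real)
  ultimately have "I \<noteq> 0" using a(1) by auto
  have shift: "\<gamma> t * I = integral {t..t+a} \<gamma>" for t
  proof -
    have "\<gamma> t * I = integral {0..a} (\<lambda>s. \<gamma> t * \<gamma> s)" unfolding I_def by (rule integral_mult_right[symmetric])
    also have "(\<lambda>s. \<gamma> t * \<gamma> s) = \<gamma> \<circ> ((+) t)" by (auto simp: add)
    also have "integral {0..a} (\<gamma> \<circ> ((+) t)) = integral {0+t..a+t} \<gamma>" by (rule integral_shift_Icc_real)
    finally show ?thesis by (simp add: add.commute)
  qed
  define k where "k = (\<gamma> a - 1) / I"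
  have deriv: "(\<gamma> has_vector_derivative \<gamma> t * k) (at t)" for t
  proof -
    define b where "b = t - 1"
    define Q where "Q = (\<lambda>u. integral {b..u} \<gamma>)"
    have Qd: "(Q has_vector_derivative \<gamma> u) (at u)" if u: "b < u" for u
    proof -
      have "(Q has_vector_derivative \<gamma> u) (at u within {b..u + 1})"
        unfolding Q_def by (rule integral_has_vector_derivative[OF c']) (use u in simp)
      moreover have "at u within {b..u + 1} = at u" by (rule at_within_interior) (use u in simp)
      ultimately show ?thesis by simp
    qed
    have "((\<lambda>s. s + a) has_vector_derivative 1) (at t)" by (auto intro!: derivative_eq_intros)
    from vector_diff_chain_at[OF this, of Q "\<gamma> (t + a)"]
    have "((\<lambda>s. Q (s + a)) has_vector_derivative \<gamma> (t + a)) (at t)"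
      using Qd[of "t + a"] a(1) by (simp add: o_def b_def)
    from has_vector_derivative_diff[OF this Qd[of t]]
    have QQ: "((\<lambda>s. Q (s + a) - Q s) has_vector_derivative \<gamma> (t + a) - \<gamma> t) (at t)"
      by (simp add: b_def)
    have eq: "Q (s + a) - Q s = \<gamma> s * I" if "s \<in> {b<..}" for s
      unfolding shift Q_def
      using Henstock_Kurzweil_Integration.integral_combine[of b s "s + a" \<gamma>] that a(1) int
      by (auto simp: algebra_simps)
    have "((\<lambda>s. \<gamma> s * I) has_vector_derivative \<gamma> (t + a) - \<gamma> t) (at t)"
      by (rule has_vector_derivative_transform_within_open[OF QQ, of "{b<..}"]) (use eq in \<open>auto simp: b_def\<close>)
    from has_vector_derivative_mult_left[OF this, of "1 / I"]
    show ?thesis using \<open>I \<noteq> 0\<close> by (simp add: k_def add field_simps)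
  qed
  define w where "w = (\<lambda>t. \<gamma> t * exp (t *\<^sub>R (- k)))"
  have "(w has_vector_derivative 0) (at t within UNIV)" for t
  proof -
    have "(w has_vector_derivative \<gamma> t * (exp (t *\<^sub>R (- k)) * (- k)) + \<gamma> t * k * exp (t *\<^sub>R (- k))) (at t)"
      unfolding w_def by (rule has_vector_derivative_mult[OF deriv exp_scaleR_has_vector_derivative_right])
    then show ?thesis by (simp add: algebra_simps)
  qed
  then obtain c0 where c0: "\<And>t. w t = c0"
    using has_vector_derivative_zero_constant[of UNIV w] by auto
  have \<gamma>exp: "\<gamma> t = exp (t *\<^sub>R k)" for t
  proof -
    have "\<gamma> t * exp (t *\<^sub>R (- k)) = 1" using c0[of t] c0[of 0] by (simp add: w_def \<gamma>0)
    then show ?thesis by (simp add: exp_minus field_simps)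
  qed
  have "Re k = 0" using norm[of 1] by (simp add: \<gamma>exp)
  then have "\<gamma> t = cis (Im k * t)" for t
    unfolding \<gamma>exp cis_conv_exp by (intro arg_cong[of _ _ exp]) (simp add: complex_eq_iff)
  then show thesis by (rule that)
qed


section \<open>Tori\<close>

abbreviation torus :: "nat \<Rightarrow> (nat \<Rightarrow> complex) tgroup" where
  "torus n \<equiv> product_tgroup {..<n} (\<lambda>_. circle_group)"

lemma carrier_torus: "carrier (torus n) = (\<Pi>\<^sub>E i\<in>{..<n}. sphere 0 1)"
  by (simp add: product_tgroup_def circle_group_def)

lemma gtop_torus: "gtop (torus n) = product_topology (\<lambda>_. top_of_set (sphere 0 1)) {..<n}"
  by (simp add: product_tgroup_def circle_group_def)

lemma mult_torus: "i < n \<Longrightarrow> (x \<otimes>\<^bsub>torus n\<^esub> y) i = x i * y i"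
  by (simp add: product_tgroup_def circle_group_def)

lemma norm_unit_mult_minus_one:
  fixes z w :: complex
  assumes "norm z = 1"
  shows "norm (z * w - 1) \<le> norm (z - 1) + norm (w - 1)"
proof -
  have "z * w - 1 = z * (w - 1) + (z - 1)" by (simp add: algebra_simps)
  then have "norm (z * w - 1) \<le> norm (z * (w - 1)) + norm (z - 1)" by (metis norm_triangle_ineq)
  then show ?thesis using assms by (simp add: norm_mult)
qed

lemma norm_unit_inverse_minus_one:
  fixes z :: complex
  assumes "norm z = 1"
  shows "norm (inverse z - 1) = norm (z - 1)"
proof -
  have "z \<noteq> 0" using assms by auto
  then have "inverse z - 1 = inverse z * (1 - z)" by (simp add: right_diff_distrib)
  then have "norm (inverse z - 1) = norm (1 - z)" using assms by (simp add: norm_mult norm_inverse)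
  then show ?thesis by (simp add: norm_minus_commute)
qed

locale torus_module = haar_module G A T
  for G :: "'g tgroup" and A :: "'a tgroup" and T :: "'g \<Rightarrow> 'a \<Rightarrow> 'a" +
  fixes \<Phi> :: "'a \<Rightarrow> nat \<Rightarrow> complex" and n :: nat
  assumes iso: "\<Phi> \<in> tgroup_iso A (torus n)"
begin

lemma \<Phi>_bij: "bij_betw \<Phi> (carrier A) (\<Pi>\<^sub>E i\<in>{..<n}. sphere 0 1)"
  using iso by (simp add: tgroup_iso_def iso_def carrier_torus)

lemma \<Phi>_homeo: "homeomorphic_map (gtop A) (gtop (torus n)) \<Phi>"
  using iso by (simp add: tgroup_iso_def)

lemma norm_\<Phi>: "\<lbrakk>a \<in> carrier A; i < n\<rbrakk> \<Longrightarrow> norm (\<Phi> a i) = 1"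
  using bij_betwE[OF \<Phi>_bij] by (auto simp: PiE_iff)

lemma \<Phi>_mult: "\<lbrakk>a \<in> carrier A; b \<in> carrier A; i < n\<rbrakk> \<Longrightarrow> \<Phi> (a \<otimes>\<^bsub>A\<^esub> b) i = \<Phi> a i * \<Phi> b i"
  using iso by (simp add: tgroup_iso_def iso_def hom_def mult_torus)

lemma \<Phi>_one: "i < n \<Longrightarrow> \<Phi> \<one>\<^bsub>A\<^esub> i = 1"
  using \<Phi>_mult[of "\<one>\<^bsub>A\<^esub>" "\<one>\<^bsub>A\<^esub>" i] norm_\<Phi>[of "\<one>\<^bsub>A\<^esub>" i] by auto

lemma \<Phi>_inv: "\<lbrakk>a \<in> carrier A; i < n\<rbrakk> \<Longrightarrow> \<Phi> (inv\<^bsub>A\<^esub> a) i = inverse (\<Phi> a i)"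
  using \<Phi>_mult[of "inv\<^bsub>A\<^esub> a" a i] \<Phi>_one[of i] norm_\<Phi>[of a i] by (auto simp: inverse_unique eq_divide_eq field_simps)

lemma \<Phi>_eqI:
  assumes "a \<in> carrier A" "b \<in> carrier A" "\<And>i. i < n \<Longrightarrow> \<Phi> a i = \<Phi> b i"
  shows "a = b"
proof -
  have "\<Phi> a = \<Phi> b"
    using bij_betwE[OF \<Phi>_bij] assms
    by (intro extensionalityI[of _ "{..<n}"]) (auto simp: PiE_iff)
  then show ?thesis using bij_betw_imp_inj_on[OF \<Phi>_bij] assms by (auto simp: inj_on_def)
qed

lemma continuous_\<Phi>: "i < n \<Longrightarrow> continuous_map (gtop A) euclidean (\<lambda>a. \<Phi> a i)"
proof -
  assume i: "i < n"
  have "continuous_map (product_topology (\<lambda>_. top_of_set (sphere 0 1)) {..<n}) (top_of_set (sphere 0 1)) (\<lambda>x. x i :: complex)"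
    by (rule continuous_map_product_projection) (use i in simp)
  from continuous_map_compose[OF homeomorphic_imp_continuous_map[OF \<Phi>_homeo[unfolded gtop_torus]] this]
  have "continuous_map (gtop A) (top_of_set (sphere 0 1)) (\<lambda>a. \<Phi> a i)" by (simp add: o_def)
  then show ?thesis by (rule continuous_map_into_fulltopology)
qed

text \<open>
  The covering map from angles to the torus.
\<close>

definition expo :: "(nat \<Rightarrow> real) \<Rightarrow> 'a" where
  "expo \<theta> = inv_into (carrier A) \<Phi> (\<lambda>i\<in>{..<n}. cis (\<theta> i))"

lemma expo: "expo \<theta> \<in> carrier A" "i < n \<Longrightarrow> \<Phi> (expo \<theta>) i = cis (\<theta> i)"
proof -
  have "(\<lambda>i\<in>{..<n}. cis (\<theta> i)) \<in> \<Phi> ` carrier A"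
    using \<Phi>_bij by (simp add: bij_betw_def)
  then show "expo \<theta> \<in> carrier A" "i < n \<Longrightarrow> \<Phi> (expo \<theta>) i = cis (\<theta> i)"
    unfolding expo_def by (simp_all add: inv_into_into f_inv_into_f)
qed

lemma \<Phi>_expo: "\<Phi> (expo \<theta>) = (\<lambda>i\<in>{..<n}. cis (\<theta> i))"
  using bij_betwE[OF \<Phi>_bij] expo(1)[of \<theta>]
  by (intro extensionalityI[of _ "{..<n}"]) (auto simp: PiE_iff expo(2))

lemma expo_cong: "(\<And>i. i < n \<Longrightarrow> \<theta> i = \<theta>' i) \<Longrightarrow> expo \<theta> = expo \<theta>'"
  by (rule \<Phi>_eqI) (simp_all add: expo)

lemma expo_add: "expo (\<lambda>i. \<theta> i + \<theta>' i) = expo \<theta> \<otimes>\<^bsub>A\<^esub> expo \<theta>'"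
  by (rule \<Phi>_eqI) (simp_all add: expo \<Phi>_mult cis_mult)

lemma \<Phi>_altprod:
  assumes "\<And>k. k < m \<Longrightarrow> F k \<in> carrier A" "\<And>k. k < m \<Longrightarrow> \<Phi> (F k) i = cis (t k)" and i: "i < n"
  shows "\<Phi> (altprod A m F) i = cis (\<Sum>k<m. (-1) ^ k * t k)"
  using assms(1,2)
proof (induction m arbitrary: F t)
  case 0
  then show ?case using i by (simp add: \<Phi>_one)
next
  case (Suc m)
  have IH: "\<Phi> (altprod A m (\<lambda>k. F (Suc k))) i = cis (\<Sum>k<m. (-1) ^ k * t (Suc k))"
    by (rule Suc.IH) (simp_all add: Suc.prems)
  have c: "altprod A m (\<lambda>k. F (Suc k)) \<in> carrier A" by (rule A.altprod_closed) (simp add: Suc.prems)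
  have "\<Phi> (altprod A (Suc m) F) i = cis (t 0) * inverse (cis (\<Sum>k<m. (-1) ^ k * t (Suc k)))"
    using i c by (simp add: \<Phi>_mult \<Phi>_inv Suc.prems IH)
  also have "\<dots> = cis (t 0 - (\<Sum>k<m. (-1) ^ k * t (Suc k)))"
    by (simp add: cis_mult)
  also have "t 0 - (\<Sum>k<m. (-1) ^ k * t (Suc k)) = (\<Sum>k<Suc m. (-1) ^ k * t k)"
    by (simp add: sum.lessThan_Suc_shift sum_negf del: sum.lessThan_Suc)
  finally show ?case .
qed

definition len0 :: "'a \<Rightarrow> real" where
  "len0 a = (\<Sum>i<n. norm (\<Phi> a i - 1))"

text \<open>
  The supremum over the orbit makes the length invariant under the action.
\<close>

definition torus_len :: "'a \<Rightarrow> ennreal" where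
  "torus_len a = (SUP g\<in>carrier G. ennreal (len0 (T g a)))"

lemma len0_nonneg: "len0 a \<ge> 0"
  by (simp add: len0_def sum_nonneg)

lemma len0_coord: "i < n \<Longrightarrow> norm (\<Phi> a i - 1) \<le> len0 a"
  unfolding len0_def by (rule member_le_sum) auto

lemma len0_one: "len0 \<one>\<^bsub>A\<^esub> = 0"
  by (simp add: len0_def \<Phi>_one)

lemma len0_mult: "\<lbrakk>a \<in> carrier A; b \<in> carrier A\<rbrakk> \<Longrightarrow> len0 (a \<otimes>\<^bsub>A\<^esub> b) \<le> len0 a + len0 b"
  unfolding len0_def sum.distrib[symmetric]
  by (rule sum_mono) (simp add: \<Phi>_mult norm_unit_mult_minus_one norm_\<Phi>)

lemma len0_inv: "a \<in> carrier A \<Longrightarrow> len0 (inv\<^bsub>A\<^esub> a) = len0 a"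
  unfolding len0_def by (rule sum.cong) (simp_all add: \<Phi>_inv norm_unit_inverse_minus_one norm_\<Phi>)

lemma torus_len_ge: "g \<in> carrier G \<Longrightarrow> ennreal (len0 (T g a)) \<le> torus_len a"
  unfolding torus_len_def by (rule SUP_upper)

lemma torus_len_le: "(\<And>g. g \<in> carrier G \<Longrightarrow> ennreal (len0 (T g a)) \<le> c) \<Longrightarrow> torus_len a \<le> c"
  unfolding torus_len_def by (rule SUP_least)

lemma torus_len_bounded:
  assumes a: "a \<in> carrier A"
  shows "torus_len a \<le> ennreal (2 * real n)"
proof (rule torus_len_le)
  fix g assume g: "g \<in> carrier G"
  have c: "T g a \<in> carrier A" using g a by simp
  have "len0 (T g a) \<le> (\<Sum>i<n. 2)"
    unfolding len0_def
  proof (rule sum_mono)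
    fix i assume "i \<in> {..<n}"
    then show "norm (\<Phi> (T g a) i - 1) \<le> 2"
      using norm_triangle_ineq4[of "\<Phi> (T g a) i" 1] norm_\<Phi>[OF c, of i] by simp
  qed
  then show "ennreal (len0 (T g a)) \<le> ennreal (2 * real n)" by (intro ennreal_leI) simp
qed

lemma continuous_len0_action: "continuous_map (prod_topology (gtop G) (gtop A)) euclidean (\<lambda>z. len0 (T (fst z) (snd z)))"
proof -
  have "continuous_map (prod_topology (gtop G) (gtop A)) euclidean (\<lambda>z. \<Phi> (T (fst z) (snd z)) i)" if "i < n" for i
    using continuous_map_compose[OF continuous_action continuous_\<Phi>[OF that]] by (simp add: o_def split_beta')
  then show ?thesis
    unfolding len0_def
    by (intro continuous_map_sum continuous_map_norm continuous_map_diff) auto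
qed

text \<open>
  By compactness of \<open>G\<close> (tube lemma) the supremum is small near the identity.
\<close>

lemma torus_len_nbhd:
  assumes e: "e > 0"
  shows "\<exists>U. openin (gtop A) U \<and> \<one>\<^bsub>A\<^esub> \<in> U \<and> (\<forall>a\<in>U. torus_len a \<le> ennreal e)"
proof -
  let ?P = "prod_topology (gtop G) (gtop A)"
  let ?W = "{z \<in> topspace ?P. len0 (T (fst z) (snd z)) \<in> {..<e}}"
  have W: "openin ?P ?W"
    by (rule openin_continuous_map_preimage[OF continuous_len0_action]) simp
  have "carrier G \<times> {\<one>\<^bsub>A\<^esub>} \<subseteq> ?W"
    using e by (auto simp: G.topspace_gtop A.topspace_gtop action_one_iff[THEN iffD2] len0_one)
  moreover have "compactin (gtop G) (carrier G)"
    using C.compact by (simp add: compact_space_def G.topspace_gtop)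
  ultimately obtain U V where UV: "openin (gtop A) V" "carrier G \<subseteq> U" "\<one>\<^bsub>A\<^esub> \<in> V" "U \<times> V \<subseteq> ?W"
    using tube_lemma_left[OF W, of "carrier G" "\<one>\<^bsub>A\<^esub>"] by (auto simp: A.topspace_gtop)
  have "torus_len a \<le> ennreal e" if a: "a \<in> V" for a
  proof (rule torus_len_le)
    fix g assume "g \<in> carrier G"
    then have "(g, a) \<in> ?W" using UV(2,4) a by blast
    then show "ennreal (len0 (T g a)) \<le> ennreal e" by (intro ennreal_leI) simp
  qed
  then show ?thesis using UV by blast
qed

lemma haar_length_module_torus: "haar_length_module G A T torus_len"
proof unfold_locales
  show "torus_len \<in> borel_measurable BA"
  proof (rule borel_measurableI_greater)
    fix y :: ennreal
    have "openin (gtop A) {a \<in> topspace (gtop A). ennreal (len0 (T g a)) \<in> {y<..}}" if g: "g \<in> carrier G" for g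
    proof (rule openin_continuous_map_preimage)
      have "continuous_map (gtop A) (prod_topology (gtop G) (gtop A)) (\<lambda>a. (g, a))"
        by (rule continuous_map_pairedI) (simp_all add: G.topspace_gtop g)
      from continuous_map_compose[OF this continuous_len0_action]
      have "continuous_map (gtop A) euclidean (\<lambda>a. len0 (T g a))" by (simp add: o_def)
      moreover have "continuous_map euclidean euclidean ennreal"
        by (simp add: continuous_on_ennreal)
      ultimately show "continuous_map (gtop A) euclidean (\<lambda>a. ennreal (len0 (T g a)))"
        using continuous_map_compose[of "gtop A" euclidean "\<lambda>a. len0 (T g a)" euclidean ennreal]
        by (simp add: o_def)
    qed simp
    then have "openin (gtop A) (\<Union>g\<in>carrier G. {a \<in> topspace (gtop A). ennreal (len0 (T g a)) \<in> {y<..}})"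
      by (intro openin_Union) blast
    moreover have "(\<Union>g\<in>carrier G. {a \<in> topspace (gtop A). ennreal (len0 (T g a)) \<in> {y<..}})
       = {a \<in> space BA. y < torus_len a}"
      by (auto simp: torus_len_def less_SUP_iff)
    ultimately show "{a \<in> space BA. y < torus_len a} \<in> sets BA" by auto
  qed
  show "torus_len \<one>\<^bsub>A\<^esub> = 0"
    using torus_len_le[of "\<one>\<^bsub>A\<^esub>" 0] by (simp add: action_one_iff[THEN iffD2] len0_one)
  show "torus_len (a \<otimes>\<^bsub>A\<^esub> b) \<le> torus_len a + torus_len b" if a: "a \<in> carrier A" and b: "b \<in> carrier A" for a b
  proof (rule torus_len_le)
    fix g assume g: "g \<in> carrier G"
    have "ennreal (len0 (T g (a \<otimes>\<^bsub>A\<^esub> b))) \<le> ennreal (len0 (T g a) + len0 (T g b))"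
      using g a b by (intro ennreal_leI) (simp add: mm.action_prod len0_mult)
    also have "\<dots> = ennreal (len0 (T g a)) + ennreal (len0 (T g b))" by (simp add: len0_nonneg)
    also have "\<dots> \<le> torus_len a + torus_len b" by (intro add_mono torus_len_ge g)
    finally show "ennreal (len0 (T g (a \<otimes>\<^bsub>A\<^esub> b))) \<le> torus_len a + torus_len b" .
  qed
  show "torus_len (inv\<^bsub>A\<^esub> a) = torus_len a" if "a \<in> carrier A" for a
    unfolding torus_len_def using that by (intro SUP_cong) (simp_all add: mm.action_inv len0_inv)
  have le: "torus_len (T h a) \<le> torus_len a" if h: "h \<in> carrier G" and a: "a \<in> carrier A" for h a
  proof (rule torus_len_le)
    fix g assume g: "g \<in> carrier G"
    show "ennreal (len0 (T g (T h a))) \<le> torus_len a"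
      using torus_len_ge[of "g \<otimes>\<^bsub>G\<^esub> h" a] g h a by (simp add: mm.action_mult)
  qed
  show "torus_len (T g a) = torus_len a" if g: "g \<in> carrier G" and a: "a \<in> carrier A" for g a
  proof (rule antisym[OF le[OF g a]])
    have "torus_len (T (inv\<^bsub>G\<^esub> g) (T g a)) \<le> torus_len (T g a)" using le g a by simp
    then show "torus_len a \<le> torus_len (T g a)"
      using g a by (simp add: mm.action_one flip: mm.action_mult)
  qed
qed

lemma expo_small:
  obtains \<rho> where "\<rho> > 0" "\<And>\<theta>. (\<And>i. i < n \<Longrightarrow> \<bar>\<theta> i\<bar> < \<rho>) \<Longrightarrow> torus_len (expo \<theta>) \<le> ennreal (1/2)"
proof -
  obtain U where U: "openin (gtop A) U" "\<one>\<^bsub>A\<^esub> \<in> U" "\<And>a. a \<in> U \<Longrightarrow> torus_len a \<le> ennreal (1/2)"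
    using torus_len_nbhd[of "1/2"] by auto
  have "openin (gtop (torus n)) (\<Phi> ` U)"
    using homeomorphic_imp_open_map[OF \<Phi>_homeo] U(1) by (simp add: open_map_def)
  moreover have "\<Phi> \<one>\<^bsub>A\<^esub> \<in> \<Phi> ` U" using U(2) by blast
  ultimately have "\<exists>V. (\<forall>i\<in>{..<n}. openin (top_of_set (sphere 0 1)) (V i)) \<and>
      \<Phi> \<one>\<^bsub>A\<^esub> \<in> Pi\<^sub>E {..<n} V \<and> Pi\<^sub>E {..<n} V \<subseteq> \<Phi> ` U"
    unfolding gtop_torus openin_product_topology_alt by blast
  then obtain V where V0: "\<forall>i\<in>{..<n}. openin (top_of_set (sphere 0 1)) (V i)"
    and V: "\<Phi> \<one>\<^bsub>A\<^esub> \<in> Pi\<^sub>E {..<n} V" "Pi\<^sub>E {..<n} V \<subseteq> \<Phi> ` U"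
    by blast
  have "\<exists>d>0. \<forall>z. norm z = 1 \<longrightarrow> norm (z - 1) < d \<longrightarrow> z \<in> V i" if i: "i < n" for i
  proof -
    have Vi: "openin (top_of_set (sphere 0 1)) (V i)" using V0 i by blast
    have "1 \<in> V i" using PiE_mem[OF V(1), of i] i \<Phi>_one[OF i] by simp
    then obtain d where "d > 0" "\<forall>z\<in>sphere 0 1. dist z 1 < d \<longrightarrow> z \<in> V i"
      using Vi unfolding openin_euclidean_subtopology_iff by blast
    then show ?thesis by (intro exI[of _ d]) (simp add: dist_norm)
  qed
  then obtain d where d: "\<And>i. i < n \<Longrightarrow> d i > 0" "\<And>i z. i < n \<Longrightarrow> norm z = 1 \<Longrightarrow> norm (z - 1) < d i \<Longrightarrow> z \<in> V i"
    by metis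
  define \<rho> where "\<rho> = Min (insert 1 (d ` {..<n}))"
  have "\<rho> > 0" unfolding \<rho>_def using d(1) by (subst Min_gr_iff) auto
  moreover have "\<rho> \<le> d i" if "i < n" for i unfolding \<rho>_def using that by (intro Min_le) auto
  then have "torus_len (expo \<theta>) \<le> ennreal (1/2)" if \<theta>: "\<And>i. i < n \<Longrightarrow> \<bar>\<theta> i\<bar> < \<rho>" for \<theta>
  proof -
    have "\<Phi> (expo \<theta>) i \<in> V i" if i: "i < n" for i
      using d(2)[OF i, of "cis (\<theta> i)"] norm_cis_minus_one_le[of "\<theta> i"] \<theta>[OF i] \<open>\<And>i. i < n \<Longrightarrow> \<rho> \<le> d i\<close>[OF i]
      by (simp add: expo i)
    moreover have "\<Phi> (expo \<theta>) \<in> extensional {..<n}"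
      using bij_betwE[OF \<Phi>_bij] expo(1) by (auto simp: PiE_iff)
    ultimately have "\<Phi> (expo \<theta>) \<in> Pi\<^sub>E {..<n} V" by (simp add: PiE_iff)
    then have "\<Phi> (expo \<theta>) \<in> \<Phi> ` U" using V(2) by blast
    then obtain u where u: "u \<in> U" "\<Phi> (expo \<theta>) = \<Phi> u" by blast
    have "u \<in> carrier A" using openin_subset[OF U(1)] u(1) by (auto simp: A.topspace_gtop)
    then have "expo \<theta> = u" using \<Phi>_eqI[OF expo(1)] u(2) by simp
    then show ?thesis using U(3) u(1) by simp
  qed
  ultimately show thesis by (rule that)
qed

text \<open>Every automorphism in the action lifts to a linear map of the universal cover.\<close>

lemma action_expo_linear:
  assumes g: "g \<in> carrier G"
  obtains c where "\<And>\<theta> i. i < n \<Longrightarrow> \<Phi> (T g (expo \<theta>)) i = cis (\<Sum>j<n. c i j * \<theta> j)"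
proof -
  let ?e = "\<lambda>j t. expo (\<lambda>i. if i = j then t else 0)"
  have "\<exists>c. \<forall>t. \<Phi> (T g (?e j t)) i = cis (c * t)" if i: "i < n" for i j
  proof -
    have add: "\<Phi> (T g (?e j (s + t))) i = \<Phi> (T g (?e j s)) i * \<Phi> (T g (?e j t)) i" for s t
    proof -
      have "?e j (s + t) = ?e j s \<otimes>\<^bsub>A\<^esub> ?e j t"
        by (subst expo_add[symmetric]) (rule expo_cong, simp)
      then show ?thesis using g i expo(1) by (simp add: mm.action_prod \<Phi>_mult)
    qed
    have "continuous_map euclidean (gtop (torus n)) (\<lambda>t. \<lambda>i\<in>{..<n}. cis (if i = j then t else 0))"
      unfolding gtop_torus continuous_map_componentwise
    proof (intro conjI ballI)
      fix k assume k: "k \<in> {..<n}"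
      have "continuous_on UNIV (\<lambda>t. cis (if k = j then t else 0))"
        by (cases "k = j") (auto intro!: continuous_intros)
      then show "continuous_map euclidean (top_of_set (sphere 0 1)) (\<lambda>t. (\<lambda>i\<in>{..<n}. cis (if i = j then t else 0)) k)"
        using k by (simp add: continuous_map_in_subtopology)
    qed auto
    moreover obtain \<Psi> where \<Psi>: "homeomorphic_maps (gtop A) (gtop (torus n)) \<Phi> \<Psi>"
      using \<Phi>_homeo by (auto simp: homeomorphic_map_maps)
    ultimately have "continuous_map euclidean (gtop A) (\<lambda>t. \<Psi> (\<lambda>i\<in>{..<n}. cis (if i = j then t else 0)))"
      using continuous_map_compose[of euclidean "gtop (torus n)" _ "gtop A" \<Psi>]
      by (simp add: homeomorphic_maps_def o_def)
    moreover have "\<Psi> (\<lambda>i\<in>{..<n}. cis (if i = j then t else 0)) = ?e j t" for t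
    proof -
      have "\<Phi> (?e j t) = (\<lambda>i\<in>{..<n}. cis (if i = j then t else 0))"
        by (rule \<Phi>_expo)
      moreover have "\<Psi> (\<Phi> (?e j t)) = ?e j t"
        using \<Psi> expo(1) by (simp add: homeomorphic_maps_def A.topspace_gtop)
      ultimately show ?thesis by simp
    qed
    ultimately have ce: "continuous_map euclidean (gtop A) (?e j)" by simp
    have "continuous_map (gtop A) (prod_topology (gtop G) (gtop A)) (\<lambda>a. (g, a))"
      by (rule continuous_map_pairedI) (simp_all add: G.topspace_gtop g)
    from continuous_map_compose[OF this continuous_action]
    have "continuous_map (gtop A) (gtop A) (T g)" by (simp add: o_def)
    from continuous_map_compose[OF ce continuous_map_compose[OF this continuous_\<Phi>[OF i]]]
    have cont: "continuous_on UNIV (\<lambda>t. \<Phi> (T g (?e j t)) i)" by (simp add: o_def)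
    have "norm (\<Phi> (T g (?e j t)) i) = 1" for t using g i expo(1) by (simp add: norm_\<Phi>)
    from continuous_character[OF cont add this] show ?thesis by metis
  qed
  then obtain c where c: "\<And>i j t. i < n \<Longrightarrow> \<Phi> (T g (?e j t)) i = cis (c i j * t)" by metis
  show thesis
  proof (rule that[of c])
    fix \<theta> i assume i: "i < n"
    have "\<Phi> (T g (expo (\<lambda>j. if j < m then \<theta> j else 0))) i = cis (\<Sum>j<m. c i j * \<theta> j)" for m
    proof (induction m)
      case 0
      have "expo (\<lambda>j. 0) = \<one>\<^bsub>A\<^esub>" by (rule \<Phi>_eqI) (simp_all add: expo \<Phi>_one)
      then show ?case using g i by (simp add: action_one_iff[THEN iffD2] \<Phi>_one)
    next
      case (Suc m)
      have "expo (\<lambda>j. if j < Suc m then \<theta> j else 0) = expo (\<lambda>j. if j < m then \<theta> j else 0) \<otimes>\<^bsub>A\<^esub> ?e m (\<theta> m)"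
        by (subst expo_add[symmetric]) (rule expo_cong, auto simp: less_Suc_eq)
      then show ?case
        using g i Suc expo(1) by (simp add: mm.action_prod \<Phi>_mult c cis_mult)
    qed
    from this[of n] show "\<Phi> (T g (expo \<theta>)) i = cis (\<Sum>j<n. c i j * \<theta> j)"
      using expo_cong[of "\<lambda>j. if j < n then \<theta> j else 0" \<theta>] by simp
  qed
qed

definition expo_radius :: real where
  "expo_radius = (SOME \<rho>. \<rho> > 0 \<and> (\<forall>\<theta>. (\<forall>i<n. \<bar>\<theta> i\<bar> < \<rho>) \<longrightarrow> torus_len (expo \<theta>) \<le> ennreal (1/2)))"

lemma expo_radius:
  "expo_radius > 0" "(\<And>i. i < n \<Longrightarrow> \<bar>\<theta> i\<bar> < expo_radius) \<Longrightarrow> torus_len (expo \<theta>) \<le> ennreal (1/2)"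
proof -
  have "\<exists>\<rho>. \<rho> > 0 \<and> (\<forall>\<theta>. (\<forall>i<n. \<bar>\<theta> i\<bar> < \<rho>) \<longrightarrow> torus_len (expo \<theta>) \<le> ennreal (1/2))"
    by (rule expo_small) blast
  then have "expo_radius > 0 \<and> (\<forall>\<theta>. (\<forall>i<n. \<bar>\<theta> i\<bar> < expo_radius) \<longrightarrow> torus_len (expo \<theta>) \<le> ennreal (1/2))"
    unfolding expo_radius_def by (rule someI_ex)
  then show "expo_radius > 0" "(\<And>i. i < n \<Longrightarrow> \<bar>\<theta> i\<bar> < expo_radius) \<Longrightarrow> torus_len (expo \<theta>) \<le> ennreal (1/2)"
    by blast+
qed

text \<open>
  With this bound on the values, each coordinate is close enough to \<open>1\<close> to be recovered from its
  angle, the segment from \<open>0\<close> to the angles stays within \<open>expo_radius\<close>, and an alternating sum of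
  \<open>q + 2\<close> angles stays below \<open>pi\<close>.
\<close>

definition torus_radius :: "nat \<Rightarrow> real" where
  "torus_radius q = min (1/4) (min (expo_radius / 4) (1 / (real q + 2)))"

lemma torus_radius_pos: "torus_radius q > 0"
  using expo_radius(1) by (simp add: torus_radius_def)

lemma len0_action_le:
  assumes "g \<in> carrier G" "torus_len a \<le> ennreal c" "0 \<le> c"
  shows "len0 (T g a) \<le> c"
  using order_trans[OF torus_len_ge[OF assms(1)] assms(2)] assms(3) by (simp add: ennreal_le_iff)

text \<open>
  The linear lift of the action agrees with the angle modulo \<open>2 * pi\<close>. Along the segment from \<open>0\<close>
  the image of the action remains close to \<open>1\<close>, so the lift has absolute value below \<open>pi\<close> and the
  agreement is exact.
\<close>

lemma angle_action_linear:
  assumes g: "g \<in> carrier G"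
  obtains c where "\<And>\<theta> i. i < n \<Longrightarrow> \<Phi> (T g (expo \<theta>)) i = cis (\<Sum>j<n. c i j * \<theta> j)"
    and "\<And>a i. \<lbrakk>a \<in> carrier A; torus_len a \<le> ennreal (torus_radius q); i < n\<rbrakk> \<Longrightarrow>
      angle (\<Phi> (T g a) i) = (\<Sum>j<n. c i j * angle (\<Phi> a j))"
proof -
  obtain c where c: "\<And>\<theta> i. i < n \<Longrightarrow> \<Phi> (T g (expo \<theta>)) i = cis (\<Sum>j<n. c i j * \<theta> j)"
    by (rule action_expo_linear[OF g]) (rule that)
  have "angle (\<Phi> (T g a) i) = (\<Sum>j<n. c i j * angle (\<Phi> a j))"
    if a: "a \<in> carrier A" and small: "torus_len a \<le> ennreal (torus_radius q)" and i: "i < n" for a i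
  proof -
    have r: "torus_radius q \<le> 1/4" "torus_radius q \<le> expo_radius / 4" "0 \<le> torus_radius q"
      using torus_radius_pos[of q] by (simp_all add: torus_radius_def)
    have near: "norm (\<Phi> (T h a) j - 1) \<le> torus_radius q" if "h \<in> carrier G" "j < n" for h j
      using len0_coord[OF that(2), of "T h a"] len0_action_le[OF that(1) small r(3)] by linarith
    have near1: "norm (\<Phi> a j - 1) \<le> torus_radius q" if "j < n" for j
      using near[OF G.one_closed that] a by (simp add: mm.action_one)
    let ?\<theta> = "\<lambda>j. angle (\<Phi> a j)"
    let ?t = "\<Sum>j<n. c i j * ?\<theta> j"
    have th: "cis (?\<theta> j) = \<Phi> a j" "\<bar>?\<theta> j\<bar> \<le> 2 * torus_radius q" if j: "j < n" for j
      using angle_near_one[OF norm_\<Phi>[OF a j]] near1[OF j] r(1) by auto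
    have ea: "expo ?\<theta> = a" by (rule \<Phi>_eqI[OF expo(1) a]) (simp add: expo(2) th(1))
    have "\<bar>?t\<bar> < pi"
    proof (rule abs_less_pi_if_segment_small)
      fix s :: real assume s: "0 \<le> s" "s \<le> 1"
      have "torus_len (expo (\<lambda>j. s * ?\<theta> j)) \<le> ennreal (1/2)"
      proof (rule expo_radius(2))
        fix j assume j: "j < n"
        have "\<bar>s * ?\<theta> j\<bar> \<le> 1 * \<bar>?\<theta> j\<bar>" unfolding abs_mult using s by (intro mult_right_mono) auto
        then show "\<bar>s * ?\<theta> j\<bar> < expo_radius" using th(2)[OF j] r(2) expo_radius(1) by linarith
      qed
      then have "len0 (T g (expo (\<lambda>j. s * ?\<theta> j))) \<le> 1/2" by (intro len0_action_le g) auto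
      then have "norm (\<Phi> (T g (expo (\<lambda>j. s * ?\<theta> j))) i - 1) \<le> 1/2" using len0_coord[OF i] order_trans by blast
      moreover have "(\<Sum>j<n. c i j * (s * ?\<theta> j)) = s * ?t"
        by (simp add: sum_distrib_left algebra_simps)
      ultimately show "norm (cis (s * ?t) - 1) \<le> 1/2" by (simp only: c[OF i])
    qed
    moreover have "\<bar>angle (\<Phi> (T g a) i)\<bar> < pi" using abs_angle_less[of "\<Phi> (T g a) i"] pi_gt_zero by linarith
    moreover have "cis (angle (\<Phi> (T g a) i)) = \<Phi> (T g a) i"
      by (rule angle_near_one(1)) (use near[OF g i] r(1) norm_\<Phi>[OF _ i] g a in auto)
    then have "cis (angle (\<Phi> (T g a) i)) = cis ?t" using c[OF i, of ?\<theta>] ea by simp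
    ultimately show ?thesis by (intro cis_inj_small)
  qed
  then show thesis using that c by blast
qed

lemma \<Phi>_measurable: "i < n \<Longrightarrow> (\<lambda>a. \<Phi> a i) \<in> borel_measurable BA"
  using continuous_map_measurable[OF continuous_\<Phi>]
  by (simp add: borel_of_def borel_def)

lemma expo_measurable:
  assumes "\<And>i. i < n \<Longrightarrow> m i \<in> borel_measurable N"
  shows "(\<lambda>x. expo (\<lambda>i. m i x)) \<in> N \<rightarrow>\<^sub>M BA"
proof -
  obtain \<Psi> where \<Psi>: "homeomorphic_maps (gtop A) (gtop (torus n)) \<Phi> \<Psi>"
    using \<Phi>_homeo by (auto simp: homeomorphic_map_maps)
  let ?C = "top_of_set (sphere 0 1) :: complex topology"
  obtain B :: "complex set set" where "countable B" "topological_basis B" using ex_countable_basis by blast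
  then have "second_countable (euclidean :: complex topology)"
    unfolding second_countable_def
  proof (intro exI[of _ B] conjI ballI allI impI)
    show "openin euclidean V" if "V \<in> B" for V
      using topological_basis_open[OF \<open>topological_basis B\<close> that] by (simp only: open_openin)
    show "\<exists>V\<in>B. z \<in> V \<and> V \<subseteq> U" if "openin euclidean U \<and> z \<in> U" for U z
    proof -
      have U: "open U" "z \<in> U" using that by (simp_all only: open_openin)
      obtain V where "V \<in> B" "z \<in> V" "V \<subseteq> U" by (rule topological_basisE[OF \<open>topological_basis B\<close> U])
      then show ?thesis by blast
    qed
  qed
  then have sc: "second_countable ?C" by (rule second_countable_subtopology)
  have comp: "(\<lambda>x. cis (m i x)) \<in> N \<rightarrow>\<^sub>M borel_of ?C" if i: "i < n" for i
  proof (rule measurable_borel_of)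
    fix U assume "openin ?C U"
    then obtain W where W: "open W" "U = sphere 0 1 \<inter> W" by (auto simp: openin_open)
    have [measurable]: "cis \<in> borel_measurable borel"
      by (intro borel_measurable_continuous_onI continuous_intros)
    have "(\<lambda>x. cis (m i x)) -` W \<inter> space N \<in> sets N"
      using measurable_compose[OF assms[OF i] \<open>cis \<in> borel_measurable borel\<close>] W(1)
      by (intro measurable_sets[of _ N borel]) auto
    moreover have "(\<lambda>x. cis (m i x)) -` U \<inter> space N = (\<lambda>x. cis (m i x)) -` W \<inter> space N"
      by (auto simp: W(2))
    ultimately show "(\<lambda>x. cis (m i x)) -` U \<inter> space N \<in> sets N" by simp
  qed auto
  have "(\<lambda>x. \<lambda>i\<in>{..<n}. cis (m i x)) \<in> N \<rightarrow>\<^sub>M Pi\<^sub>M {..<n} (\<lambda>_. borel_of ?C)"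
    by (rule measurable_restrict) (use comp in auto)
  then have "(\<lambda>x. \<lambda>i\<in>{..<n}. cis (m i x)) \<in> N \<rightarrow>\<^sub>M borel_of (gtop (torus n))"
    unfolding gtop_torus using measurable_cong_sets[OF refl sets_borel_of_power[OF sc, of "{..<n}"], of N] by simp
  moreover have "\<Psi> \<in> borel_of (gtop (torus n)) \<rightarrow>\<^sub>M BA"
    by (rule continuous_map_measurable) (use \<Psi> in \<open>simp add: homeomorphic_maps_def\<close>)
  ultimately have "(\<lambda>x. \<Psi> (\<lambda>i\<in>{..<n}. cis (m i x))) \<in> N \<rightarrow>\<^sub>M BA"
    by (rule measurable_compose)
  moreover have "\<Psi> (\<lambda>i\<in>{..<n}. cis (m i x)) = expo (\<lambda>i. m i x)" for x
  proof -
    have "\<Psi> (\<Phi> (expo (\<lambda>i. m i x))) = expo (\<lambda>i. m i x)"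
      using \<Psi> expo(1) by (simp add: homeomorphic_maps_def A.topspace_gtop)
    then show ?thesis by (simp only: \<Phi>_expo)
  qed
  ultimately show ?thesis by simp
qed

text \<open>
  A uniformly small cocycle is integrated over its last variable. The angles of its values are
  so small that the cocycle identity holds for them as real numbers, and integration commutes
  with the action because the latter is linear on angles.
\<close>

theorem torus_averaging:
  assumes f0: "mm.cochain (Suc (Suc q)) f0"
    and cocycle0: "AE x in mm.S. mm.d (Suc (Suc (Suc q))) f0 x = \<one>\<^bsub>A\<^esub>"
    and small0: "AE x in mm.S. torus_len (f0 x) \<le> c0" and c0: "c0 \<le> ennreal (torus_radius q)"
  shows "\<exists>\<phi>. mm.cochain (Suc q) \<phi> \<and> (\<integral>\<^sup>+x. torus_len (\<phi> x) \<partial>mm.S) \<le> 2 * c0 \<and>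
      (AE x in mm.S. mm.d (Suc (Suc q)) \<phi> x = f0 x)"
proof -
  interpret HL: haar_length_module G A T torus_len by (rule haar_length_module_torus)
  have "c0 < \<infinity>" using c0 by (simp add: le_less_trans)
  then obtain c where c: "c0 = ennreal c" "0 \<le> c" by (cases c0) auto
  have cr: "c \<le> torus_radius q" using c0 c torus_radius_pos[of q] by (simp add: ennreal_le_iff)
  then have c4: "c \<le> 1/4" and cq: "c \<le> 1 / (real q + 2)" by (simp_all add: torus_radius_def)
  define f where "f = (\<lambda>x. if torus_len (f0 x) \<le> c0 then f0 x else \<one>\<^bsub>A\<^esub>)"
  have f: "mm.cochain (Suc (Suc q)) f"
    unfolding mm.cochain_def
  proof (intro conjI ballI allI impI)
    note [measurable] = mm.cochain_measurable[OF f0]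
    show "f \<in> mm.S \<rightarrow>\<^sub>M BA"
      unfolding f_def by (rule measurable_If) (simp_all add: A.topspace_gtop mm.cochain_measurable[OF f0])
  next
    fix g x assume g: "g \<in> carrier G" and x: "x \<in> space mm.S"
    have "torus_len (T g (f0 x)) = torus_len (f0 x)"
      by (rule HL.L.len_action[OF g mm.cochain_closed[OF f0 x]])
    then show "f (mm.translate g x) = T g (f x)"
      using mm.cochain_equivariant[OF f0 g x] g by (simp add: f_def action_one_iff[THEN iffD2])
  next
    fix x x' :: "nat \<Rightarrow> 'g" assume "\<forall>j<Suc (Suc q). x j = x' j"
    then have "f0 x = f0 x'" using f0 unfolding mm.cochain_def by blast
    then show "f x = f x'" by (simp add: f_def)
  qed
  have ff0: "AE x in mm.S. f x = f0 x" using small0 by eventually_elim (simp add: f_def)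
  have fcl: "f x \<in> carrier A" if "x \<in> space mm.S" for x by (rule mm.cochain_closed[OF f that])
  have fsmall: "torus_len (f x) \<le> ennreal c" for x by (simp add: f_def c(1) HL.L.len_one)
  have fsmallr: "torus_len (f x) \<le> ennreal (torus_radius q)" for x
    by (rule order_trans[OF fsmall ennreal_leI[OF cr]])
  have ffaces: "AE x in mm.S. \<forall>i. f (skip i x) = f0 (skip i x)"
    by (simp only: AE_all_countable) (intro allI mm.AE_skip ff0)
  have cocycle: "AE x in mm.S. mm.d (Suc (Suc (Suc q))) f x = \<one>\<^bsub>A\<^esub>"
    using cocycle0 ffaces by eventually_elim (simp only:)
  define v where "v = (\<lambda>j x y. angle (\<Phi> (f (comb_seq (Suc q) x y)) j))"
  define m where "m = (\<lambda>j x. \<integral>y. v j x y \<partial>mm.S)"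
  define \<phi>1 where "\<phi>1 = (\<lambda>x. expo (\<lambda>j. m j x))"
  note fm [measurable] = mm.cochain_measurable[OF f]
  have vm: "(\<lambda>z. v j (fst z) (snd z)) \<in> borel_measurable (mm.S \<Otimes>\<^sub>M mm.S)" if j: "j < n" for j
  proof -
    have "(\<lambda>z. f (comb_seq (Suc q) (fst z) (snd z))) \<in> mm.S \<Otimes>\<^sub>M mm.S \<rightarrow>\<^sub>M BA" by measurable
    from measurable_compose[OF measurable_compose[OF this \<Phi>_measurable[OF j]] angle_measurable]
    show ?thesis by (simp add: v_def)
  qed
  have vy: "v j x \<in> borel_measurable mm.S" if "j < n" "x \<in> space mm.S" for j x
    using measurable_compose[OF measurable_Pair1'[OF that(2)] vm[OF that(1)]] by simp
  have vint: "integrable mm.S (v j x)" if "j < n" "x \<in> space mm.S" for j x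
  proof (rule mm.P.integrable_const_bound[where B="pi/2"])
    show "AE y in mm.S. norm (v j x y) \<le> pi/2"
      by (rule AE_I2) (simp only: real_norm_def v_def, rule less_imp_le[OF abs_angle_less])
  qed (rule vy[OF that])
  have mm: "m j \<in> borel_measurable mm.S" if "j < n" for j
    unfolding m_def
    by (rule mm.P.borel_measurable_lebesgue_integral) (use vm[OF that] in \<open>simp add: split_beta'\<close>)
  have lin: "\<exists>c. (\<forall>\<theta> i. i < n \<longrightarrow> \<Phi> (T g (expo \<theta>)) i = cis (\<Sum>j<n. c i j * \<theta> j)) \<and>
     (\<forall>x\<in>space mm.S. \<forall>y\<in>space mm.S. \<forall>i<n.
       angle (\<Phi> (T g (f (comb_seq (Suc q) x y))) i) = (\<Sum>j<n. c i j * v j x y))" if g: "g \<in> carrier G" for g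
  proof -
    obtain c where c: "\<And>\<theta> i. i < n \<Longrightarrow> \<Phi> (T g (expo \<theta>)) i = cis (\<Sum>j<n. c i j * \<theta> j)"
      "\<And>a i. \<lbrakk>a \<in> carrier A; torus_len a \<le> ennreal (torus_radius q); i < n\<rbrakk> \<Longrightarrow>
        angle (\<Phi> (T g a) i) = (\<Sum>j<n. c i j * angle (\<Phi> a j))"
      by (rule angle_action_linear[OF g]) (rule that)
    show ?thesis
      unfolding v_def by (intro exI[of _ c] conjI allI ballI impI c fcl fsmallr mm.space_comb_seq)
  qed
  have action_mean: "\<Phi> (T g (\<phi>1 x)) i = cis (\<integral>y. angle (\<Phi> (T g (f (comb_seq (Suc q) x y))) i) \<partial>mm.S)"
    if g: "g \<in> carrier G" and x: "x \<in> space mm.S" and i: "i < n" for g x i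
  proof -
    obtain c where c: "\<forall>\<theta> i. i < n \<longrightarrow> \<Phi> (T g (expo \<theta>)) i = cis (\<Sum>j<n. c i j * \<theta> j)"
      "\<forall>x\<in>space mm.S. \<forall>y\<in>space mm.S. \<forall>i<n.
       angle (\<Phi> (T g (f (comb_seq (Suc q) x y))) i) = (\<Sum>j<n. c i j * v j x y)"
      using lin[OF g] by blast
    have "(\<integral>y. angle (\<Phi> (T g (f (comb_seq (Suc q) x y))) i) \<partial>mm.S) = (\<integral>y. (\<Sum>j<n. c i j * v j x y) \<partial>mm.S)"
      by (rule Bochner_Integration.integral_cong[OF refl]) (use c(2) x i in blast)
    also have "\<dots> = (\<Sum>j<n. \<integral>y. c i j * v j x y \<partial>mm.S)"
      by (rule Bochner_Integration.integral_sum) (intro integrable_mult_right vint x, simp)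
    also have "\<dots> = (\<Sum>j<n. c i j * m j x)" unfolding m_def by simp
    finally show ?thesis using c(1) i by (simp add: \<phi>1_def)
  qed
  have \<phi>1: "mm.cochain (Suc q) \<phi>1"
    unfolding mm.cochain_def
  proof (intro conjI ballI allI impI)
    show "\<phi>1 \<in> mm.S \<rightarrow>\<^sub>M BA" unfolding \<phi>1_def by (rule expo_measurable) (rule mm)
  next
    fix g x assume g: "g \<in> carrier G" and x: "x \<in> space mm.S"
    have gx: "mm.translate g x \<in> space mm.S" by (rule mm.space_translate[OF g x])
    show "\<phi>1 (mm.translate g x) = T g (\<phi>1 x)"
    proof (rule \<Phi>_eqI)
      fix i assume i: "i < n"
      have "m i (mm.translate g x) = (\<integral>y. v i (mm.translate g x) (mm.translate g y) \<partial>mm.S)"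
        unfolding m_def
        using integral_distr[OF mm.measurable_translate[OF g] vy[OF i gx]]
        by (simp only: mm.distr_translate[OF g])
      also have "\<dots> = (\<integral>y. angle (\<Phi> (T g (f (comb_seq (Suc q) x y))) i) \<partial>mm.S)"
      proof (rule Bochner_Integration.integral_cong[OF refl])
        fix y assume y: "y \<in> space mm.S"
        have "comb_seq (Suc q) (mm.translate g x) (mm.translate g y) = mm.translate g (comb_seq (Suc q) x y)"
          by (auto simp: comb_seq_def)
        then show "v i (mm.translate g x) (mm.translate g y) = angle (\<Phi> (T g (f (comb_seq (Suc q) x y))) i)"
          using mm.cochain_equivariant[OF f g mm.space_comb_seq[OF x y]] by (simp only: v_def)
      qed
      finally show "\<Phi> (\<phi>1 (mm.translate g x)) i = \<Phi> (T g (\<phi>1 x)) i"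
        using action_mean[OF g x i] i by (simp add: \<phi>1_def expo(2))
    qed (simp_all add: \<phi>1_def expo(1) g)
  next
    fix x x' :: "nat \<Rightarrow> 'g" assume "\<forall>j<Suc q. x j = x' j"
    then have "comb_seq (Suc q) x = comb_seq (Suc q) x'" by (auto simp: comb_seq_def fun_eq_iff)
    then show "\<phi>1 x = \<phi>1 x'" by (simp only: \<phi>1_def m_def v_def)
  qed
  have \<phi>1cl: "\<phi>1 x \<in> carrier A" for x by (simp add: \<phi>1_def expo(1))
  have near: "norm (\<Phi> (T g (f x)) i - 1) \<le> c" if "g \<in> carrier G" "i < n" for g x i
    using len0_coord[OF that(2), of "T g (f x)"] len0_action_le[OF that(1) fsmall c(2), of x] by linarith
  have \<phi>1small: "torus_len (\<phi>1 x) \<le> 2 * c0" if x: "x \<in> space mm.S" for x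
  proof (rule torus_len_le)
    fix g assume g: "g \<in> carrier G"
    let ?u = "\<lambda>i y. angle (\<Phi> (T g (f (comb_seq (Suc q) x y))) i)"
    have um: "?u i \<in> borel_measurable mm.S" if i: "i < n" for i
    proof -
      have [measurable]: "(\<lambda>_. x) \<in> mm.S \<rightarrow>\<^sub>M mm.S" "(\<lambda>_. g) \<in> mm.S \<rightarrow>\<^sub>M haar"
        using x g by (simp_all add: mm.space_M)
      have "(\<lambda>y. T g (f (comb_seq (Suc q) x y))) \<in> mm.S \<rightarrow>\<^sub>M BA" by measurable
      from measurable_compose[OF measurable_compose[OF this \<Phi>_measurable[OF i]] angle_measurable]
      show ?thesis .
    qed
    have uint: "integrable mm.S (?u i)" if i: "i < n" for i
    proof (rule mm.P.integrable_const_bound[where B="pi/2"])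
      show "AE y in mm.S. norm (?u i y) \<le> pi/2"
        by (rule AE_I2) (simp only: real_norm_def, rule less_imp_le[OF abs_angle_less])
    qed (rule um[OF i])
    have "len0 (T g (\<phi>1 x)) \<le> (\<Sum>i<n. \<integral>y. \<bar>?u i y\<bar> \<partial>mm.S)"
      unfolding len0_def
    proof (rule sum_mono)
      fix i assume "i \<in> {..<n}"
      then have i: "i < n" by simp
      have "norm (\<Phi> (T g (\<phi>1 x)) i - 1) \<le> \<bar>\<integral>y. ?u i y \<partial>mm.S\<bar>"
        unfolding action_mean[OF g x i] by (rule norm_cis_minus_one_le)
      also have "\<dots> \<le> (\<integral>y. \<bar>?u i y\<bar> \<partial>mm.S)" by (rule integral_abs_bound)
      finally show "norm (\<Phi> (T g (\<phi>1 x)) i - 1) \<le> (\<integral>y. \<bar>?u i y\<bar> \<partial>mm.S)" .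
    qed
    also have "\<dots> = (\<integral>y. (\<Sum>i<n. \<bar>?u i y\<bar>) \<partial>mm.S)"
      by (rule Bochner_Integration.integral_sum[symmetric]) (intro integrable_abs uint, simp)
    also have "\<dots> \<le> (\<integral>y. 2 * c \<partial>mm.S)"
    proof (rule integral_mono)
      show "integrable mm.S (\<lambda>y. \<Sum>i<n. \<bar>?u i y\<bar>)"
        by (rule Bochner_Integration.integrable_sum) (intro integrable_abs uint, simp)
      fix y assume y: "y \<in> space mm.S"
      let ?a = "T g (f (comb_seq (Suc q) x y))"
      have "?a \<in> carrier A" using g fcl[OF mm.space_comb_seq[OF x y]] by simp
      have "(\<Sum>i<n. \<bar>?u i y\<bar>) \<le> (\<Sum>i<n. 2 * norm (\<Phi> ?a i - 1))"
      proof (rule sum_mono)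
        fix i assume "i \<in> {..<n}"
        then have i: "i < n" by simp
        show "\<bar>?u i y\<bar> \<le> 2 * norm (\<Phi> ?a i - 1)"
          by (rule angle_near_one(2)[OF norm_\<Phi>[OF \<open>?a \<in> carrier A\<close> i]])
             (use near[OF g i, of "comb_seq (Suc q) x y"] c4 in linarith)
      qed
      also have "\<dots> = 2 * len0 ?a" by (simp add: len0_def sum_distrib_left)
      also have "\<dots> \<le> 2 * c" using len0_action_le[OF g fsmall c(2)] by simp
      finally show "(\<Sum>i<n. \<bar>?u i y\<bar>) \<le> 2 * c" .
    qed simp
    also have "\<dots> = 2 * c" by (simp add: mm.P.prob_space)
    finally have "ennreal (len0 (T g (\<phi>1 x))) \<le> ennreal (2 * c)" by (rule ennreal_leI)
    also have "\<dots> = 2 * c0" using c by (simp add: ennreal_mult)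
    finally show "ennreal (len0 (T g (\<phi>1 x))) \<le> 2 * c0" .
  qed
  define w where "w = (\<lambda>x. if even q then inv\<^bsub>A\<^esub> f x else f x)"
  have wcl: "w x \<in> carrier A" if "x \<in> space mm.S" for x using fcl[OF that] by (simp add: w_def)
  have d\<phi>1: "AE x in mm.S. mm.d (Suc (Suc q)) \<phi>1 x = w x"
    using mm.AE_comb_seq[OF cocycle, of "Suc (Suc q)"] AE_space
  proof eventually_elim
    case (elim x)
    then have x: "x \<in> space mm.S" by simp
    have sk: "skip i x \<in> space mm.S" for i by (rule mm.space_skip[OF x])
    let ?F = "\<lambda>y i. f (comb_seq (Suc q) (skip i x) y)"
    have alt: "AE y in mm.S. altprod A (Suc (Suc q)) (?F y) = w x"
      using elim(1) AE_space
    proof eventually_elim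
      case (elim y)
      then have y: "y \<in> space mm.S" by simp
      let ?z = "comb_seq (Suc (Suc q)) x y"
      have zc: "f (skip i ?z) \<in> carrier A" for i by (intro fcl mm.space_skip mm.space_comb_seq x y)
      have "Suc (Suc (Suc q)) = Suc (Suc q) + 1" by simp
      then have "\<one>\<^bsub>A\<^esub> = altprod A (Suc (Suc q) + 1) (\<lambda>i. f (skip i ?z))" using elim(1) by (simp only:)
      also have "\<dots> = altprod A (Suc (Suc q)) (\<lambda>i. f (skip i ?z)) \<otimes>\<^bsub>A\<^esub>
          (if even (Suc (Suc q)) then altprod A 1 (\<lambda>i. f (skip (Suc (Suc q) + i) ?z))
           else inv\<^bsub>A\<^esub> altprod A 1 (\<lambda>i. f (skip (Suc (Suc q) + i) ?z)))"
        by (rule A.altprod_add) (rule zc)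
      also have "altprod A (Suc (Suc q)) (\<lambda>i. f (skip i ?z)) = altprod A (Suc (Suc q)) (?F y)"
        by (rule altprod_cong) (simp add: skip_comb_seq_less)
      also have "altprod A 1 (\<lambda>i. f (skip (Suc (Suc q) + i) ?z)) = f x"
      proof -
        have "f (skip (Suc (Suc q) + 0) ?z) = f x"
          using f unfolding mm.cochain_def skip_comb_seq_add by (simp add: comb_seq_def)
        then show ?thesis using fcl[OF x] by simp
      qed
      finally have one: "altprod A (Suc (Suc q)) (?F y) \<otimes>\<^bsub>A\<^esub> (if even q then f x else inv\<^bsub>A\<^esub> f x) = \<one>\<^bsub>A\<^esub>"
        by (simp del: altprod.simps)
      have ac: "altprod A (Suc (Suc q)) (?F y) \<in> carrier A"
        by (intro A.altprod_closed fcl mm.space_comb_seq sk y)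
      show ?case
      proof (cases "even q")
        case True
        have "altprod A (Suc (Suc q)) (?F y) \<otimes>\<^bsub>A\<^esub> f x = \<one>\<^bsub>A\<^esub>" using one by (simp only: True if_True)
        from A.inv_equality[OF this fcl[OF x] ac] show ?thesis by (simp only: w_def True if_True)
      next
        case False
        have "altprod A (Suc (Suc q)) (?F y) \<otimes>\<^bsub>A\<^esub> inv\<^bsub>A\<^esub> f x = \<one>\<^bsub>A\<^esub>" using one by (simp only: False if_False)
        from A.inv_equality[OF this A.inv_closed[OF fcl[OF x]] ac] show ?thesis
          by (simp only: w_def False if_False A.inv_inv[OF fcl[OF x]])
      qed
    qed
    show ?case
    proof (rule \<Phi>_eqI)
      show "mm.d (Suc (Suc q)) \<phi>1 x \<in> carrier A" by (intro A.altprod_closed \<phi>1cl)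
      show "w x \<in> carrier A" by (rule wcl[OF x])
      fix j assume j: "j < n"
      have fx: "norm (\<Phi> (f x') j - 1) \<le> c" if "x' \<in> space mm.S" for x'
        using near[OF G.one_closed j, of x'] fcl[OF that] by (simp add: mm.action_one)
      have wx: "norm (\<Phi> (w x) j - 1) \<le> c"
        using fx[OF x] fcl[OF x] j
        by (simp add: w_def \<Phi>_inv norm_unit_inverse_minus_one norm_\<Phi>)
      have cw: "cis (angle (\<Phi> (w x) j)) = \<Phi> (w x) j"
        by (rule angle_near_one(1)[OF norm_\<Phi>[OF wcl[OF x] j]]) (use wx c4 in linarith)
      have "AE y in mm.S. (\<Sum>i<Suc (Suc q). (-1) ^ i * v j (skip i x) y) = angle (\<Phi> (w x) j)"
        using alt AE_space
      proof eventually_elim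
        case (elim y)
        then have y: "y \<in> space mm.S" by simp
        have Fs: "comb_seq (Suc q) (skip i x) y \<in> space mm.S" for i by (intro mm.space_comb_seq sk y)
        have vi: "cis (v j (skip i x) y) = \<Phi> (?F y i) j" "\<bar>v j (skip i x) y\<bar> \<le> 2 * c" for i
        proof -
          have half: "norm (\<Phi> (?F y i) j - 1) \<le> 1/2" using fx[OF Fs, of i] c4 by linarith
          show "cis (v j (skip i x) y) = \<Phi> (?F y i) j"
            unfolding v_def by (rule angle_near_one(1)[OF norm_\<Phi>[OF fcl[OF Fs] j] half])
          have "\<bar>v j (skip i x) y\<bar> \<le> 2 * norm (\<Phi> (?F y i) j - 1)"
            unfolding v_def by (rule angle_near_one(2)[OF norm_\<Phi>[OF fcl[OF Fs] j] half])
          then show "\<bar>v j (skip i x) y\<bar> \<le> 2 * c" using fx[OF Fs, of i] by linarith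
        qed
        have "\<Phi> (altprod A (Suc (Suc q)) (?F y)) j = cis (\<Sum>i<Suc (Suc q). (-1) ^ i * v j (skip i x) y)"
          by (rule \<Phi>_altprod) (simp_all add: fcl[OF Fs] vi(1) j)
        then have "cis (\<Sum>i<Suc (Suc q). (-1) ^ i * v j (skip i x) y) = cis (angle (\<Phi> (w x) j))"
          using elim(1) cw by (simp only:)
        moreover have "\<bar>\<Sum>i<Suc (Suc q). (-1) ^ i * v j (skip i x) y\<bar> < pi"
        proof -
          have "\<bar>\<Sum>i<Suc (Suc q). (-1) ^ i * v j (skip i x) y\<bar> \<le> (\<Sum>i<Suc (Suc q). 2 * c)"
            by (rule order_trans[OF sum_abs sum_mono]) (simp add: abs_mult power_abs vi(2))
          also have "\<dots> = 2 * ((real q + 2) * c)" by (simp add: algebra_simps)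
          also have "(real q + 2) * c \<le> 1" using cq by (simp add: field_simps)
          finally show ?thesis using pi_gt3 by linarith
        qed
        moreover have "\<bar>angle (\<Phi> (w x) j)\<bar> < pi" using abs_angle_less[of "\<Phi> (w x) j"] pi_gt_zero by linarith
        ultimately show ?case by (intro cis_inj_small)
      qed
      then have "(\<integral>y. (\<Sum>i<Suc (Suc q). (-1) ^ i * v j (skip i x) y) \<partial>mm.S) = (\<integral>y. angle (\<Phi> (w x) j) \<partial>mm.S)"
        by (intro integral_cong_AE borel_measurable_sum borel_measurable_times borel_measurable_const vy j sk)
      also have "\<dots> = angle (\<Phi> (w x) j)" by (simp add: mm.P.prob_space)
      also have "(\<integral>y. (\<Sum>i<Suc (Suc q). (-1) ^ i * v j (skip i x) y) \<partial>mm.S)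
          = (\<Sum>i<Suc (Suc q). \<integral>y. (-1) ^ i * v j (skip i x) y \<partial>mm.S)"
        by (rule Bochner_Integration.integral_sum) (intro integrable_mult_right vint j sk)
      also have "\<dots> = (\<Sum>i<Suc (Suc q). (-1) ^ i * m j (skip i x))"
        by (rule sum.cong[OF refl]) (simp add: m_def)
      finally have sum: "(\<Sum>i<Suc (Suc q). (-1) ^ i * m j (skip i x)) = angle (\<Phi> (w x) j)" .
      have "\<Phi> (mm.d (Suc (Suc q)) \<phi>1 x) j = cis (\<Sum>i<Suc (Suc q). (-1) ^ i * m j (skip i x))"
        by (rule \<Phi>_altprod) (simp_all add: \<phi>1_def expo j)
      then show "\<Phi> (mm.d (Suc (Suc q)) \<phi>1 x) j = \<Phi> (w x) j" by (simp only: sum cw)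
    qed
  qed
  define \<phi> where "\<phi> = (\<lambda>x. if even q then inv\<^bsub>A\<^esub> \<phi>1 x else \<phi>1 x)"
  have "mm.cochain (Suc q) \<phi>" unfolding \<phi>_def using \<phi>1 mm.cochain_inv[OF \<phi>1] by (cases "even q") simp_all
  moreover have "(\<integral>\<^sup>+x. torus_len (\<phi> x) \<partial>mm.S) \<le> 2 * c0"
  proof -
    have "(\<integral>\<^sup>+x. torus_len (\<phi> x) \<partial>mm.S) \<le> (\<integral>\<^sup>+x. 2 * c0 \<partial>mm.S)"
      by (rule nn_integral_mono) (simp add: \<phi>_def HL.L.len_inv \<phi>1cl \<phi>1small)
    then show ?thesis by (simp add: mm.P.emeasure_space_1)
  qed
  moreover have "AE x in mm.S. mm.d (Suc (Suc q)) \<phi> x = f0 x"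
    using d\<phi>1 ff0 AE_space
  proof eventually_elim
    case (elim x)
    show ?case
    proof (cases "even q")
      case True
      have "mm.d (Suc (Suc q)) \<phi> x = inv\<^bsub>A\<^esub> mm.d (Suc (Suc q)) \<phi>1 x"
        unfolding \<phi>_def using True by (simp only: if_True) (rule A.altprod_inv, rule \<phi>1cl)
      then show ?thesis using elim True fcl[OF elim(3)] by (simp only: w_def if_True A.inv_inv)
    next
      case False
      then have "\<phi> = \<phi>1" by (simp add: \<phi>_def)
      then show ?thesis using elim False by (simp only: w_def if_False)
    qed
  qed
  ultimately show ?thesis by blast
qed

lemma averaging_module_torus: "averaging_module G A T torus_len (\<lambda>q. ennreal (torus_radius q))"
proof -
  interpret haar_length_module G A T torus_len by (rule haar_length_module_torus)
  show ?thesis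
    by unfold_locales (simp add: torus_radius_pos, rule torus_averaging)
qed

end


section \<open>Quotients and cohomology classes\<close>

text \<open>
  Cosets in a commutative group, in the generality that serves both for classes of maps
  modulo null maps and for cocycles modulo coboundaries.
\<close>

locale comm_group_pair = H: comm_group H for H (structure) +
  fixes N assumes sub: "subgroup N H"
begin

lemma normal: "N \<lhd> H" by (rule H.subgroup_imp_normal[OF sub])

lemma closed: "x \<in> carrier H \<Longrightarrow> N #> x \<in> carrier (H Mod N)"
  by (simp add: carrier_FactGroup)

lemma mult: "\<lbrakk>x \<in> carrier H; y \<in> carrier H\<rbrakk> \<Longrightarrow> (N #> x) \<otimes>\<^bsub>H Mod N\<^esub> (N #> y) = N #> (x \<otimes> y)"
  using normal.rcos_sum[OF normal] by simp

lemma quotient: "comm_group (H Mod N)"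
proof (rule group.group_comm_groupI)
  show "group (H Mod N)" by (rule normal.factorgroup_is_group[OF normal])
  fix X Y assume "X \<in> carrier (H Mod N)" "Y \<in> carrier (H Mod N)"
  then obtain x y where "x \<in> carrier H" "X = N #> x" "y \<in> carrier H" "Y = N #> y"
    by (auto simp: carrier_FactGroup)
  then show "X \<otimes>\<^bsub>H Mod N\<^esub> Y = Y \<otimes>\<^bsub>H Mod N\<^esub> X" by (simp only: mult) (simp only: H.m_comm)
qed

lemma one_iff: "x \<in> carrier H \<Longrightarrow> N #> x = \<one>\<^bsub>H Mod N\<^esub> \<longleftrightarrow> x \<in> N"
  using H.coset_join1[OF _ _ sub] H.coset_join2[OF _ sub] by auto

lemma eq_iff:
  assumes "x \<in> carrier H" "y \<in> carrier H"
  shows "N #> x = N #> y \<longleftrightarrow> x \<otimes> inv y \<in> N"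
proof
  have N: "N \<subseteq> carrier H" by (rule subgroup.subset[OF sub])
  have xy: "x \<otimes> inv y \<in> carrier H" using assms by simp
  show "x \<otimes> inv y \<in> N" if "N #> x = N #> y"
    by (rule H.coset_join1[OF H.coset_mult_inv2[OF that assms N] xy sub])
  show "N #> x = N #> y" if "x \<otimes> inv y \<in> N"
    by (rule H.coset_mult_inv1[OF H.coset_join2[OF xy sub that] assms N])
qed

end

text \<open>All the cosets in the union defining the induced map coincide with the one of \<open>f x\<close>.\<close>

lemma quotient_hom_coset:
  assumes M: "comm_group_pair K M" and N: "comm_group_pair H N"
    and f: "f \<in> hom K H" and MN: "f ` M \<subseteq> N" and x: "x \<in> carrier K"
  shows "quotient_hom H N f (M #>\<^bsub>K\<^esub> x) = N #>\<^bsub>H\<^esub> f x"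
proof -
  interpret M: comm_group_pair K M by (rule M)
  interpret N: comm_group_pair H N by (rule N)
  have eq: "N #>\<^bsub>H\<^esub> f y = N #>\<^bsub>H\<^esub> f x" if y: "y \<in> M #>\<^bsub>K\<^esub> x" for y
  proof -
    obtain m where m: "m \<in> M" "y = m \<otimes>\<^bsub>K\<^esub> x" using y by (auto simp: r_coset_def)
    have mK: "m \<in> carrier K" using m(1) subgroup.subset[OF M.sub] by auto
    have fm: "f m \<in> N" "f m \<in> carrier H" "f x \<in> carrier H"
      using MN m(1) f mK x by (auto simp: hom_def)
    have "f y = f m \<otimes>\<^bsub>H\<^esub> f x" using f mK x m(2) by (simp add: hom_mult)
    then have "N #>\<^bsub>H\<^esub> f y = (N #>\<^bsub>H\<^esub> f m) #>\<^bsub>H\<^esub> f x"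
      using fm N.H.coset_mult_assoc[OF subgroup.subset[OF N.sub]] by simp
    then show ?thesis using N.H.coset_join2[OF fm(2) N.sub fm(1)] by simp
  qed
  have "x \<in> M #>\<^bsub>K\<^esub> x" by (rule M.H.rcos_self[OF x M.sub])
  then show ?thesis unfolding quotient_hom_def using eq by blast
qed

lemma quotient_hom_hom:
  assumes M: "comm_group_pair K M" and N: "comm_group_pair H N"
    and f: "f \<in> hom K H" and MN: "f ` M \<subseteq> N"
  shows "quotient_hom H N f \<in> hom (K Mod M) (H Mod N)"
proof -
  interpret M: comm_group_pair K M by (rule M)
  interpret N: comm_group_pair H N by (rule N)
  have fc: "f x \<in> carrier H" if "x \<in> carrier K" for x using f that by (auto simp: hom_def)
  note q = quotient_hom_coset[OF M N f MN]
  show ?thesis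
  proof (rule homI)
    fix X assume "X \<in> carrier (K Mod M)"
    then obtain x where x: "x \<in> carrier K" "X = M #>\<^bsub>K\<^esub> x" by (auto simp: carrier_FactGroup)
    show "quotient_hom H N f X \<in> carrier (H Mod N)"
      unfolding x(2) q[OF x(1)] by (rule N.closed[OF fc[OF x(1)]])
    fix Y assume "Y \<in> carrier (K Mod M)"
    then obtain y where y: "y \<in> carrier K" "Y = M #>\<^bsub>K\<^esub> y" by (auto simp: carrier_FactGroup)
    show "quotient_hom H N f (X \<otimes>\<^bsub>K Mod M\<^esub> Y) = quotient_hom H N f X \<otimes>\<^bsub>H Mod N\<^esub> quotient_hom H N f Y"
      unfolding x(2) y(2) M.mult[OF x(1) y(1)] q[OF x(1)] q[OF y(1)] q[OF M.H.m_closed[OF x(1) y(1)]]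
        N.mult[OF fc[OF x(1)] fc[OF y(1)]] hom_mult[OF f x(1) y(1)] ..
  qed
qed

text \<open>
  Cocycles and coboundaries on the level of Borel maps, so that statements about cohomology
  classes become statements about maps modulo null maps.
\<close>

definition cocycle_maps ::
  "'g tgroup \<Rightarrow> 'a tgroup \<Rightarrow> ('g \<Rightarrow> 'a \<Rightarrow> 'a) \<Rightarrow> nat \<Rightarrow> ((nat \<Rightarrow> 'g) \<Rightarrow> 'a) set" where
  "cocycle_maps G A T p =
     {\<sigma> \<in> carrier (borel_maps G A p). coboundary_fun G A T p \<sigma> \<in> null_maps G A (Suc p)}"

fun coboundary_maps ::
  "'g tgroup \<Rightarrow> 'a tgroup \<Rightarrow> ('g \<Rightarrow> 'a \<Rightarrow> 'a) \<Rightarrow> nat \<Rightarrow> ((nat \<Rightarrow> 'g) \<Rightarrow> 'a) set" where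
  "coboundary_maps G A T 0 = null_maps G A 0"
| "coboundary_maps G A T (Suc q) =
     {\<sigma> \<in> carrier (borel_maps G A (Suc q)). \<exists>\<phi>\<in>carrier (borel_maps G A q).
        \<sigma> \<otimes>\<^bsub>borel_maps G A (Suc q)\<^esub> inv\<^bsub>borel_maps G A (Suc q)\<^esub> coboundary_fun G A T q \<phi>
          \<in> null_maps G A (Suc q)}"

definition cohomology_class ::
  "'g tgroup \<Rightarrow> 'a tgroup \<Rightarrow> ('g \<Rightarrow> 'a \<Rightarrow> 'a) \<Rightarrow> nat \<Rightarrow> ((nat \<Rightarrow> 'g) \<Rightarrow> 'a) \<Rightarrow>
     ((nat \<Rightarrow> 'g) \<Rightarrow> 'a) set set" where
  "cohomology_class G A T p \<sigma> =
     coboundaries G A T p #>\<^bsub>cocycle_group G A T p\<^esub> (null_maps G A p #>\<^bsub>borel_maps G A p\<^esub> \<sigma>)"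

context haar_module
begin

lemma null_pair: "comm_group_pair (borel_maps G A p) (null_maps G A p)"
  by (intro comm_group_pair.intro comm_group_pair_axioms.intro bm.comm_group_axioms subgroup_null_maps)

sublocale nul: comm_group_pair "borel_maps G A p" "null_maps G A p" for p
  by (rule null_pair)

lemma comm_group_cochains: "comm_group (cochains G A p)"
  unfolding cochains_def by (rule nul.quotient)

abbreviation ae_class :: "nat \<Rightarrow> ((nat \<Rightarrow> 'g) \<Rightarrow> 'a) \<Rightarrow> ((nat \<Rightarrow> 'g) \<Rightarrow> 'a) set" where
  "ae_class p \<sigma> \<equiv> null_maps G A p #>\<^bsub>borel_maps G A p\<^esub> \<sigma>"

lemma coboundary_ae_class:
  "\<sigma> \<in> carrier (borel_maps G A p) \<Longrightarrow>
     coboundary G A T p (ae_class p \<sigma>) = ae_class (Suc p) (coboundary_fun G A T p \<sigma>)"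
  unfolding coboundary_def
  by (rule quotient_hom_coset[OF null_pair null_pair coboundary_fun_hom]) (auto intro: coboundary_fun_null)

lemma coboundary_hom: "coboundary G A T p \<in> hom (cochains G A p) (cochains G A (Suc p))"
  unfolding coboundary_def cochains_def
  by (rule quotient_hom_hom[OF null_pair null_pair coboundary_fun_hom]) (auto intro: coboundary_fun_null)

lemma group_hom_coboundary: "group_hom (cochains G A p) (cochains G A (Suc p)) (coboundary G A T p)"
  by (intro group_hom.intro group_hom_axioms.intro coboundary_hom comm_group.axioms(2) comm_group_cochains)

lemma carrier_cochains: "carrier (cochains G A p) = ae_class p ` carrier (borel_maps G A p)"
  unfolding cochains_def by (rule carrier_FactGroup)

lemma ae_class_cocycles_iff:
  assumes \<sigma>: "\<sigma> \<in> carrier (borel_maps G A p)"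
  shows "ae_class p \<sigma> \<in> cocycles G A T p \<longleftrightarrow> \<sigma> \<in> cocycle_maps G A T p"
  using \<sigma> nul.one_iff[OF coboundary_fun_closed[OF \<sigma>]] nul.closed[OF \<sigma>]
  by (simp add: cocycles_def kernel_def cocycle_maps_def coboundary_ae_class[OF \<sigma>] cochains_def)

lemma cocycles_eq: "cocycles G A T p = ae_class p ` cocycle_maps G A T p"
proof
  show "cocycles G A T p \<subseteq> ae_class p ` cocycle_maps G A T p"
  proof
    fix X assume X: "X \<in> cocycles G A T p"
    then have "X \<in> carrier (cochains G A p)" by (simp add: cocycles_def kernel_def)
    then obtain \<sigma> where \<sigma>: "\<sigma> \<in> carrier (borel_maps G A p)" "X = ae_class p \<sigma>"
      unfolding carrier_cochains by blast
    then show "X \<in> ae_class p ` cocycle_maps G A T p" using X ae_class_cocycles_iff[OF \<sigma>(1)] by blast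
  qed
  show "ae_class p ` cocycle_maps G A T p \<subseteq> cocycles G A T p"
    using ae_class_cocycles_iff by (auto simp: cocycle_maps_def)
qed

lemma subgroup_cocycles: "subgroup (cocycles G A T p) (cochains G A p)"
  unfolding cocycles_def by (rule group_hom.subgroup_kernel[OF group_hom_coboundary])

lemma comm_group_cocycle_group: "comm_group (cocycle_group G A T p)"
  unfolding cocycle_group_def
proof (rule group.group_comm_groupI)
  interpret C: comm_group "cochains G A p" by (rule comm_group_cochains)
  show "group (cochains G A p \<lparr>carrier := cocycles G A T p\<rparr>)"
    by (rule subgroup.subgroup_is_group[OF subgroup_cocycles C.group_axioms])
  fix X Y assume "X \<in> carrier (cochains G A p \<lparr>carrier := cocycles G A T p\<rparr>)"
    "Y \<in> carrier (cochains G A p \<lparr>carrier := cocycles G A T p\<rparr>)"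
  then have "X \<in> carrier (cochains G A p)" "Y \<in> carrier (cochains G A p)"
    using subgroup.subset[OF subgroup_cocycles] by auto
  then show "X \<otimes>\<^bsub>cochains G A p \<lparr>carrier := cocycles G A T p\<rparr>\<^esub> Y =
      Y \<otimes>\<^bsub>cochains G A p \<lparr>carrier := cocycles G A T p\<rparr>\<^esub> X"
    using C.m_comm by simp
qed

lemma subgroup_coboundaries: "subgroup (coboundaries G A T p) (cocycle_group G A T p)"
proof -
  interpret C: comm_group "cochains G A p" by (rule comm_group_cochains)
  have "subgroup (coboundaries G A T p) (cochains G A p) \<and> coboundaries G A T p \<subseteq> cocycles G A T p"
  proof (cases p)
    case 0
    then show ?thesis
      using C.triv_subgroup subgroup.one_closed[OF subgroup_cocycles, of p] by simp
  next
    case (Suc q)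
    have "coboundary G A T q X \<in> cocycles G A T (Suc q)" if X: "X \<in> carrier (cochains G A q)" for X
    proof -
      obtain \<phi> where \<phi>: "\<phi> \<in> carrier (borel_maps G A q)" "X = ae_class q \<phi>"
        using X unfolding carrier_cochains by blast
      show ?thesis
        unfolding \<phi>(2) coboundary_ae_class[OF \<phi>(1)] ae_class_cocycles_iff[OF coboundary_fun_closed[OF \<phi>(1)]]
        by (simp add: cocycle_maps_def coboundary_fun_closed \<phi>(1) coboundary_fun_coboundary_fun)
    qed
    then show ?thesis
      using group_hom.img_is_subgroup[OF group_hom_coboundary, of q] unfolding Suc by auto
  qed
  then show ?thesis unfolding cocycle_group_def by (intro C.subgroup_incl subgroup_cocycles) auto
qed

lemma coboundaries_pair: "comm_group_pair (cocycle_group G A T p) (coboundaries G A T p)"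
  by (intro comm_group_pair.intro comm_group_pair_axioms.intro comm_group_cocycle_group subgroup_coboundaries)

sublocale cob: comm_group_pair "cocycle_group G A T p" "coboundaries G A T p" for p
  by (rule coboundaries_pair)

lemma comm_group_cohomology: "comm_group (cohomology G A T p)"
  unfolding cohomology_def by (rule cob.quotient)

lemma ae_class_cocycle: "\<sigma> \<in> cocycle_maps G A T p \<Longrightarrow> ae_class p \<sigma> \<in> carrier (cocycle_group G A T p)"
  by (simp add: cocycle_group_def cocycles_eq)

lemma carrier_cohomology:
  "carrier (cohomology G A T p) = cohomology_class G A T p ` cocycle_maps G A T p"
  unfolding cohomology_def carrier_FactGroup cohomology_class_def
  by (auto simp: cocycle_group_def cocycles_eq)

lemma subgroup_cocycle_maps: "subgroup (cocycle_maps G A T p) (borel_maps G A p)"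
proof -
  interpret C: group_hom "borel_maps G A p" "borel_maps G A (Suc p)" "coboundary_fun G A T p"
    by (intro group_hom.intro group_hom_axioms.intro coboundary_fun_hom bm.group_axioms)
  show ?thesis
    by (rule bm.subgroupI)
       (auto simp: cocycle_maps_def coboundary_fun_closed subgroup.m_inv_closed[OF subgroup_null_maps]
          subgroup.m_closed[OF subgroup_null_maps] simp del: bm.one_closed
        intro!: exI[of _ "\<one>\<^bsub>borel_maps G A p\<^esub>"] bm.one_closed subgroup.one_closed[OF subgroup_null_maps])
qed

lemma cohomology_class_mult:
  assumes "\<sigma> \<in> cocycle_maps G A T p" "\<tau> \<in> cocycle_maps G A T p"
  shows "cohomology_class G A T p (\<sigma> \<otimes>\<^bsub>borel_maps G A p\<^esub> \<tau>) =
    cohomology_class G A T p \<sigma> \<otimes>\<^bsub>cohomology G A T p\<^esub> cohomology_class G A T p \<tau>"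
proof -
  have c: "\<sigma> \<in> carrier (borel_maps G A p)" "\<tau> \<in> carrier (borel_maps G A p)"
    using assms by (auto simp: cocycle_maps_def)
  have "ae_class p (\<sigma> \<otimes>\<^bsub>borel_maps G A p\<^esub> \<tau>) = ae_class p \<sigma> \<otimes>\<^bsub>cocycle_group G A T p\<^esub> ae_class p \<tau>"
    using nul.mult[OF c] by (simp add: cocycle_group_def cochains_def)
  then show ?thesis
    unfolding cohomology_class_def cohomology_def
    using cob.mult[OF ae_class_cocycle[OF assms(1)] ae_class_cocycle[OF assms(2)]] by simp
qed

lemma cohomology_class_eq_one_iff:
  assumes \<sigma>: "\<sigma> \<in> cocycle_maps G A T p"
  shows "cohomology_class G A T p \<sigma> = \<one>\<^bsub>cohomology G A T p\<^esub> \<longleftrightarrow> \<sigma> \<in> coboundary_maps G A T p"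
proof -
  have c: "\<sigma> \<in> carrier (borel_maps G A p)" using \<sigma> by (simp add: cocycle_maps_def)
  have "cohomology_class G A T p \<sigma> = \<one>\<^bsub>cohomology G A T p\<^esub> \<longleftrightarrow> ae_class p \<sigma> \<in> coboundaries G A T p"
    unfolding cohomology_class_def cohomology_def by (rule cob.one_iff[OF ae_class_cocycle[OF \<sigma>]])
  also have "\<dots> \<longleftrightarrow> \<sigma> \<in> coboundary_maps G A T p"
  proof (cases p)
    case 0
    then show ?thesis using nul.one_iff[OF c] by (simp add: cochains_def)
  next
    case (Suc q)
    have "ae_class p \<sigma> \<in> coboundaries G A T p \<longleftrightarrow>
      (\<exists>\<phi>\<in>carrier (borel_maps G A q). ae_class p \<sigma> = ae_class p (coboundary_fun G A T q \<phi>))"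
      unfolding Suc coboundaries.simps carrier_cochains image_image
      by (simp add: image_iff coboundary_ae_class cong: bex_cong)
    also have "\<dots> \<longleftrightarrow> \<sigma> \<in> coboundary_maps G A T p"
      using c nul.eq_iff[of \<sigma> "Suc q"] coboundary_fun_closed[of _ q] by (simp add: Suc cong: bex_cong)
    finally show ?thesis .
  qed
  finally show ?thesis .
qed

end

context haar_epi
begin

lemma pull_cocycle: "\<psi> \<in> cocycle_maps G A T p \<Longrightarrow> pull p \<psi> \<in> cocycle_maps G' A T' p"
  using pull_null[of "coboundary_fun G A T p \<psi>" "Suc p"]
  by (auto simp: cocycle_maps_def pull_closed pull_coboundary_fun)

lemma pull_coboundary: "\<psi> \<in> coboundary_maps G A T p \<Longrightarrow> pull p \<psi> \<in> coboundary_maps G' A T' p"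
proof (cases p)
  case 0
  moreover assume "\<psi> \<in> coboundary_maps G A T p"
  ultimately show ?thesis using pull_null by simp
next
  case (Suc q)
  interpret P: group_hom "borel_maps G A p" "borel_maps G' A p" "pull p"
    by (intro group_hom.intro group_hom_axioms.intro pull_hom X.bm.group_axioms Y.bm.group_axioms)
  assume "\<psi> \<in> coboundary_maps G A T p"
  then obtain \<phi> where \<phi>: "\<phi> \<in> carrier (borel_maps G A q)" and \<psi>: "\<psi> \<in> carrier (borel_maps G A p)"
    and n: "\<psi> \<otimes>\<^bsub>borel_maps G A p\<^esub> inv\<^bsub>borel_maps G A p\<^esub> coboundary_fun G A T q \<phi> \<in> null_maps G A p"
    unfolding Suc by auto
  have c: "coboundary_fun G A T q \<phi> \<in> carrier (borel_maps G A p)"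
    unfolding Suc by (rule X.coboundary_fun_closed[OF \<phi>])
  have "pull p \<psi> \<otimes>\<^bsub>borel_maps G' A p\<^esub> inv\<^bsub>borel_maps G' A p\<^esub> coboundary_fun G' A T' q (pull q \<phi>)
     = pull p (\<psi> \<otimes>\<^bsub>borel_maps G A p\<^esub> inv\<^bsub>borel_maps G A p\<^esub> coboundary_fun G A T q \<phi>)"
    using P.hom_mult[OF \<psi> X.bm.inv_closed[OF c]] P.hom_inv[OF c] pull_coboundary_fun[OF \<phi>]
    by (simp only: Suc)
  then have "pull p \<psi> \<otimes>\<^bsub>borel_maps G' A p\<^esub> inv\<^bsub>borel_maps G' A p\<^esub> coboundary_fun G' A T' q (pull q \<phi>)
     \<in> null_maps G' A p"
    using pull_null[OF n] by simp
  then show ?thesis using pull_closed[OF \<psi>] pull_closed[OF \<phi>] unfolding Suc by auto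
qed

text \<open>
  On representatives, inflation is composition with \<open>\<pi>\<close>; both of the nested quotient maps are
  evaluated on one coset.
\<close>

lemma inflation_class:
  assumes \<psi>: "\<psi> \<in> cocycle_maps G A T p"
  shows "inflation G' A T' p \<pi> (cohomology_class G A T p \<psi>) = cohomology_class G' A T' p (pull p \<psi>)"
proof -
  let ?h = "quotient_hom (borel_maps G' A p) (null_maps G' A p) (pull p)"
  have pn: "pull p ` null_maps G A p \<subseteq> null_maps G' A p" by (auto intro: pull_null)
  have h: "?h (X.ae_class p \<sigma>) = Y.ae_class p (pull p \<sigma>)" if "\<sigma> \<in> carrier (borel_maps G A p)" for \<sigma>
    by (rule quotient_hom_coset[OF X.null_pair Y.null_pair pull_hom pn that])
  have hh: "?h \<in> hom (cochains G A p) (cochains G' A p)"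
    unfolding cochains_def by (rule quotient_hom_hom[OF X.null_pair Y.null_pair pull_hom pn])
  have hz: "?h ` cocycles G A T p \<subseteq> cocycles G' A T' p"
    unfolding X.cocycles_eq Y.cocycles_eq using h pull_cocycle by (force simp: cocycle_maps_def)
  have "?h \<in> hom (cocycle_group G A T p) (cocycle_group G' A T' p)"
  proof (rule homI)
    fix X assume X: "X \<in> carrier (cocycle_group G A T p)"
    then show "?h X \<in> carrier (cocycle_group G' A T' p)" using hz by (auto simp: cocycle_group_def)
    fix Y assume Y: "Y \<in> carrier (cocycle_group G A T p)"
    have "X \<in> carrier (cochains G A p)" "Y \<in> carrier (cochains G A p)"
      using X Y subgroup.subset[OF X.subgroup_cocycles] by (auto simp: cocycle_group_def)
    then show "?h (X \<otimes>\<^bsub>cocycle_group G A T p\<^esub> Y) = ?h X \<otimes>\<^bsub>cocycle_group G' A T' p\<^esub> ?h Y"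
      using hom_mult[OF hh] by (simp add: cocycle_group_def)
  qed
  moreover have "?h ` coboundaries G A T p \<subseteq> coboundaries G' A T' p"
  proof
    fix Y assume "Y \<in> ?h ` coboundaries G A T p"
    then obtain X where X: "X \<in> coboundaries G A T p" "Y = ?h X" by blast
    have "X \<in> cocycles G A T p"
      using X(1) subgroup.subset[OF X.subgroup_coboundaries] by (auto simp: cocycle_group_def)
    then obtain \<sigma> where \<sigma>: "\<sigma> \<in> cocycle_maps G A T p" "X = X.ae_class p \<sigma>" unfolding X.cocycles_eq by blast
    have c: "\<sigma> \<in> carrier (borel_maps G A p)" using \<sigma>(1) by (simp add: cocycle_maps_def)
    have "cohomology_class G A T p \<sigma> = \<one>\<^bsub>cohomology G A T p\<^esub>"
      using X(1) X.cob.one_iff[OF X.ae_class_cocycle[OF \<sigma>(1)]] \<sigma>(2)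
      by (simp add: cohomology_class_def cohomology_def)
    then have "pull p \<sigma> \<in> coboundary_maps G' A T' p"
      using X.cohomology_class_eq_one_iff[OF \<sigma>(1)] pull_coboundary by blast
    then have "cohomology_class G' A T' p (pull p \<sigma>) = \<one>\<^bsub>cohomology G' A T' p\<^esub>"
      using Y.cohomology_class_eq_one_iff[OF pull_cocycle[OF \<sigma>(1)]] by blast
    then show "Y \<in> coboundaries G' A T' p"
      using Y.cob.one_iff[OF Y.ae_class_cocycle[OF pull_cocycle[OF \<sigma>(1)]]] h[OF c] X(2) \<sigma>(2)
      by (simp add: cohomology_class_def cohomology_def)
  qed
  ultimately have "inflation G' A T' p \<pi> (cohomology_class G A T p \<psi>) =
      coboundaries G' A T' p #>\<^bsub>cocycle_group G' A T' p\<^esub> ?h (X.ae_class p \<psi>)"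
    unfolding inflation_def cohomology_class_def
    by (rule quotient_hom_coset[OF X.coboundaries_pair Y.coboundaries_pair _ _ X.ae_class_cocycle[OF \<psi>]])
  also have "?h (X.ae_class p \<psi>) = Y.ae_class p (pull p \<psi>)"
    using \<psi> by (intro h) (simp add: cocycle_maps_def)
  finally show ?thesis by (simp only: cohomology_class_def)
qed

lemma inflation_hom: "inflation G' A T' p \<pi> \<in> hom (cohomology G A T p) (cohomology G' A T' p)"
proof (rule homI)
  fix X assume "X \<in> carrier (cohomology G A T p)"
  then obtain \<sigma> where \<sigma>: "\<sigma> \<in> cocycle_maps G A T p" "X = cohomology_class G A T p \<sigma>"
    unfolding X.carrier_cohomology by blast
  show "inflation G' A T' p \<pi> X \<in> carrier (cohomology G' A T' p)"
    unfolding \<sigma>(2) inflation_class[OF \<sigma>(1)] Y.carrier_cohomology by (intro imageI pull_cocycle \<sigma>(1))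
  fix Y assume "Y \<in> carrier (cohomology G A T p)"
  then obtain \<tau> where \<tau>: "\<tau> \<in> cocycle_maps G A T p" "Y = cohomology_class G A T p \<tau>"
    unfolding X.carrier_cohomology by blast
  have "\<sigma> \<in> carrier (borel_maps G A p)" "\<tau> \<in> carrier (borel_maps G A p)"
    using \<sigma>(1) \<tau>(1) by (simp_all add: cocycle_maps_def)
  then show "inflation G' A T' p \<pi> (X \<otimes>\<^bsub>cohomology G A T p\<^esub> Y) =
      inflation G' A T' p \<pi> X \<otimes>\<^bsub>cohomology G' A T' p\<^esub> inflation G' A T' p \<pi> Y"
    unfolding \<sigma>(2) \<tau>(2) X.cohomology_class_mult[OF \<sigma>(1) \<tau>(1), symmetric]
      inflation_class[OF \<sigma>(1)] inflation_class[OF \<tau>(1)]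
      inflation_class[OF subgroup.m_closed[OF X.subgroup_cocycle_maps \<sigma>(1) \<tau>(1)]]
      Y.cohomology_class_mult[OF pull_cocycle[OF \<sigma>(1)] pull_cocycle[OF \<tau>(1)], symmetric]
    by (simp add: hom_mult[OF pull_hom])
qed

end


section \<open>A criterion for direct limits\<close>

text \<open>
  Compatibility of the maps \<open>F m\<close> and the condition on their kernels say that two elements are
  identified in the direct limit exactly when their images agree. Hence the elements of the
  direct limit are the nonempty fibres of the maps \<open>F m\<close> taken together.
\<close>

lemma direct_limit_map_iso:
  fixes H :: "'i::preorder \<Rightarrow> 'h monoid"
  assumes directed: "\<And>k m :: 'i. \<exists>n. k \<le> n \<and> m \<le> n"
    and H: "\<And>m. group (H m)" and K: "group K"
    and f: "\<And>k m. k \<le> m \<Longrightarrow> f k m \<in> hom (H k) (H m)"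
    and comp: "\<And>k m n x. \<lbrakk>k \<le> m; m \<le> n; x \<in> carrier (H k)\<rbrakk> \<Longrightarrow> f m n (f k m x) = f k n x"
    and F: "\<And>m. F m \<in> hom (H m) K"
    and compat: "\<And>k m x. \<lbrakk>k \<le> m; x \<in> carrier (H k)\<rbrakk> \<Longrightarrow> F m (f k m x) = F k x"
    and onto: "\<And>y. y \<in> carrier K \<Longrightarrow> \<exists>m. \<exists>x\<in>carrier (H m). F m x = y"
    and ker: "\<And>m x. \<lbrakk>x \<in> carrier (H m); F m x = \<one>\<^bsub>K\<^esub>\<rbrakk> \<Longrightarrow> \<exists>n\<ge>m. f m n x = \<one>\<^bsub>H n\<^esub>"
  shows "direct_limit_map F \<in> iso (direct_limit H f) K"
proof -
  interpret K: group K by (rule K)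
  have fc: "f k m x \<in> carrier (H m)" if "k \<le> m" "x \<in> carrier (H k)" for k m x
    using hom_in_carrier[OF f[OF that(1)] that(2)] .
  have Fc: "F m x \<in> carrier K" if "x \<in> carrier (H m)" for m x using hom_in_carrier[OF F that] .
  let ?R = "direct_limit_rel H f"
  have agree: "\<exists>n. k \<le> n \<and> l \<le> n \<and> f k n x = f l n y"
    if x: "x \<in> carrier (H k)" and y: "y \<in> carrier (H l)" and xy: "F k x = F l y" for k l x y
  proof -
    obtain m where m: "k \<le> m" "l \<le> m" using directed by blast
    interpret Hm: group_hom "H m" K "F m"
      by (intro group_hom.intro group_hom_axioms.intro H K F)
    let ?x = "f k m x" and ?y = "f l m y"
    have xm: "?x \<in> carrier (H m)" "?y \<in> carrier (H m)" using m x y by (simp_all add: fc)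
    have "F m (?x \<otimes>\<^bsub>H m\<^esub> inv\<^bsub>H m\<^esub> ?y) = \<one>\<^bsub>K\<^esub>"
      using xm compat[OF m(1) x] compat[OF m(2) y] xy Fc[OF y] by simp
    then obtain n where n: "m \<le> n" "f m n (?x \<otimes>\<^bsub>H m\<^esub> inv\<^bsub>H m\<^esub> ?y) = \<one>\<^bsub>H n\<^esub>"
      using ker[of "?x \<otimes>\<^bsub>H m\<^esub> inv\<^bsub>H m\<^esub> ?y" m] xm by auto
    interpret mn: group_hom "H m" "H n" "f m n"
      by (intro group_hom.intro group_hom_axioms.intro H f n(1))
    have "f m n ?x \<otimes>\<^bsub>H n\<^esub> inv\<^bsub>H n\<^esub> f m n ?y = \<one>\<^bsub>H n\<^esub>" using n(2) xm by simp
    then have "f m n ?x = f m n ?y"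
      using mn.hom_closed[OF xm(1)] mn.hom_closed[OF xm(2)] mn.H.inv_solve_right' by fastforce
    then have "f k n x = f l n y" using comp[OF m(1) n(1) x] comp[OF m(2) n(1) y] by simp
    then show ?thesis using m n(1) order_trans by blast
  qed
  have R: "((k, x), (l, y)) \<in> ?R \<longleftrightarrow> x \<in> carrier (H k) \<and> y \<in> carrier (H l) \<and> F k x = F l y" for k l x y
  proof
    assume "((k, x), (l, y)) \<in> ?R"
    then obtain n where "x \<in> carrier (H k)" "y \<in> carrier (H l)" "k \<le> n" "l \<le> n" "f k n x = f l n y"
      by (auto simp: direct_limit_rel_def)
    then show "x \<in> carrier (H k) \<and> y \<in> carrier (H l) \<and> F k x = F l y"
      using compat[of k n x] compat[of l n y] by simp
  qed (use agree in \<open>auto simp: direct_limit_rel_def\<close>)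
  define fib where "fib = (\<lambda>t. {(l, y). y \<in> carrier (H l) \<and> F l y = t})"
  have cls: "?R `` {(k, x)} = fib (F k x)" if "x \<in> carrier (H k)" for k x
    using that by (auto simp: fib_def R)
  have car: "carrier (direct_limit H f) = fib ` carrier K"
  proof -
    have "carrier (direct_limit H f) = (\<lambda>(k, x). ?R `` {(k, x)}) ` (SIGMA m:UNIV. carrier (H m))"
      by (auto simp: direct_limit_def quotient_def)
    also have "\<dots> = (\<lambda>(k, x). fib (F k x)) ` (SIGMA m:UNIV. carrier (H m))"
      by (rule image_cong[OF refl]) (simp only: split_paired_all mem_Sigma_iff split_conv cls)
    also have "\<dots> = fib ` carrier K"
    proof
      show "(\<lambda>(k, x). fib (F k x)) ` (SIGMA m:UNIV. carrier (H m)) \<subseteq> fib ` carrier K" using Fc by auto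
      show "fib ` carrier K \<subseteq> (\<lambda>(k, x). fib (F k x)) ` (SIGMA m:UNIV. carrier (H m))"
        using onto by (force simp: image_iff)
    qed
    finally show ?thesis .
  qed
  have map: "direct_limit_map F (fib t) = t" if t: "t \<in> carrier K" for t
  proof -
    obtain m x where "x \<in> carrier (H m)" "F m x = t" using onto[OF t] by blast
    then have "(\<lambda>(m, x). F m x) ` fib t = {t}" by (force simp: fib_def)
    then show ?thesis by (simp add: direct_limit_map_def)
  qed
  have mult: "fib s \<otimes>\<^bsub>direct_limit H f\<^esub> fib t = fib (s \<otimes>\<^bsub>K\<^esub> t)" if s: "s \<in> carrier K" and t: "t \<in> carrier K" for s t
  proof -
    let ?M = "{?R `` {(m, f k m x \<otimes>\<^bsub>H m\<^esub> f l m y)} | k l m x y.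
        (k, x) \<in> fib s \<and> (l, y) \<in> fib t \<and> k \<le> m \<and> l \<le> m}"
    have eq: "?R `` {(m, f k m x \<otimes>\<^bsub>H m\<^esub> f l m y)} = fib (s \<otimes>\<^bsub>K\<^esub> t)"
      if "(k, x) \<in> fib s" "(l, y) \<in> fib t" "k \<le> m" "l \<le> m" for k l m x y
    proof -
      interpret Hm: group "H m" by (rule H)
      have c: "x \<in> carrier (H k)" "y \<in> carrier (H l)" "F k x = s" "F l y = t"
        using that by (auto simp: fib_def)
      have "F m (f k m x \<otimes>\<^bsub>H m\<^esub> f l m y) = s \<otimes>\<^bsub>K\<^esub> t"
        using hom_mult[OF F fc[OF that(3) c(1)] fc[OF that(4) c(2)]] compat that(3,4) c by simp
      then show ?thesis
        using cls[OF Hm.m_closed[OF fc[OF that(3) c(1)] fc[OF that(4) c(2)]]] by simp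
    qed
    obtain k x l y where w: "(k, x) \<in> fib s" "(l, y) \<in> fib t"
      using onto[OF s] onto[OF t] unfolding fib_def by auto
    obtain m where m: "k \<le> m" "l \<le> m" using directed by blast
    have "fib (s \<otimes>\<^bsub>K\<^esub> t) \<in> ?M" using eq[OF w m] w m by blast
    moreover have "?M \<subseteq> {fib (s \<otimes>\<^bsub>K\<^esub> t)}" using eq by blast
    ultimately have "?M = {fib (s \<otimes>\<^bsub>K\<^esub> t)}" by blast
    then show ?thesis by (simp add: direct_limit_def)
  qed
  show ?thesis
    unfolding iso_def
  proof (intro CollectI conjI homI)
    fix X assume "X \<in> carrier (direct_limit H f)"
    then obtain s where s: "s \<in> carrier K" "X = fib s" unfolding car by blast
    then show "direct_limit_map F X \<in> carrier K" by (simp only: map)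
    fix Y assume "Y \<in> carrier (direct_limit H f)"
    then obtain t where t: "t \<in> carrier K" "Y = fib t" unfolding car by blast
    show "direct_limit_map F (X \<otimes>\<^bsub>direct_limit H f\<^esub> Y) = direct_limit_map F X \<otimes>\<^bsub>K\<^esub> direct_limit_map F Y"
      using s t by (simp only: mult map K.m_closed)
  next
    show "bij_betw (direct_limit_map F) (carrier (direct_limit H f)) (carrier K)"
      unfolding car by (rule bij_betw_byWitness[where f'=fib]) (auto simp: map)
  qed
qed


section \<open>Passage to the limit\<close>

lemma ex_scaled_ennreal_le:
  assumes K: "K < \<infinity>" and r: "r > (0::ennreal)"
  obtains e where "e > 0" "K * ennreal e \<le> r"
proof -
  obtain k where k: "K = ennreal k" "0 \<le> k" using K by (cases K) auto
  obtain s where s: "0 < s" "ennreal s \<le> r"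
  proof (cases r)
    case (real t)
    then show ?thesis using that[of t] r by (simp add: less_le)
  next
    case top
    then show ?thesis using that[of 1] by simp
  qed
  have "k * (s / (k + 1)) \<le> s" using k s(1) by (simp add: field_simps)
  then have "ennreal (k * (s / (k + 1))) \<le> r" using s(2) by (meson ennreal_leI order_trans)
  then have "K * ennreal (s / (k + 1)) \<le> r"
    using k s(1) by (simp only: k(1)) (subst ennreal_mult[symmetric], simp_all)
  then show thesis using that[of "s / (k + 1)"] k s(1) by simp
qed

lemma (in haar_module) cocycle_maps_div_coboundary:
  assumes "\<sigma> \<in> cocycle_maps G A T (Suc q)" "\<phi> \<in> carrier (borel_maps G A q)"
  shows "\<sigma> \<otimes>\<^bsub>borel_maps G A (Suc q)\<^esub> inv\<^bsub>borel_maps G A (Suc q)\<^esub> coboundary_fun G A T q \<phi> \<in> cocycle_maps G A T (Suc q)"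
  using assms
  by (intro subgroup.m_closed[OF subgroup_cocycle_maps] subgroup.m_inv_closed[OF subgroup_cocycle_maps])
     (simp_all add: cocycle_maps_def coboundary_fun_closed coboundary_fun_coboundary_fun)

text \<open>
  Haar measure on \<open>G\<close> is the image of Haar measure on \<open>G'\<close>, so a set is null if its preimage is.
\<close>

lemma (in haar_epi) pull_reflects_null:
  assumes \<psi>: "\<psi> \<in> carrier (borel_maps G A p)" and null: "pull p \<psi> \<in> null_maps G' A p"
  shows "\<psi> \<in> null_maps G A p"
proof -
  have "AE z in Y.mm.PM p. pull p \<psi> z = \<one>\<^bsub>A\<^esub>" using null by (simp add: null_maps_def Y.haar_AE_iff)
  then have ae: "AE z in Y.mm.PM p. \<psi> (compose {..<p} \<pi> z) = \<one>\<^bsub>A\<^esub>"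
    using AE_space by eventually_elim (simp add: pull_eq)
  have "{z \<in> space (X.mm.PM p). \<psi> z = \<one>\<^bsub>A\<^esub>} = \<psi> -` {\<one>\<^bsub>A\<^esub>} \<inter> space (X.mm.PM p)" by auto
  then have "{z \<in> space (X.mm.PM p). \<psi> z = \<one>\<^bsub>A\<^esub>} \<in> sets (X.mm.PM p)"
    using measurable_sets[OF X.borel_maps_measurable[OF \<psi>] X.one_set] by simp
  from AE_distr_iff[OF measurable_compose_\<pi> this] ae
  have "AE z in X.mm.PM p. \<psi> z = \<one>\<^bsub>A\<^esub>" by (simp only: distr_compose_\<pi>)
  then show ?thesis using \<psi> by (simp add: null_maps_def X.haar_AE_iff)
qed

context limit_system
begin

lemma pull_limit_connecting:
  assumes kn: "k \<le> n"
  shows "pullback_fun L p (\<lambda>x. x n) (pullback_fun (G n) p (\<pi> n k) \<psi>) = pullback_fun L p (\<lambda>x. x k) \<psi>"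
proof
  fix z
  show "pullback_fun L p (\<lambda>x. x n) (pullback_fun (G n) p (\<pi> n k) \<psi>) z = pullback_fun L p (\<lambda>x. x k) \<psi> z"
  proof (cases "z \<in> space (LM.mm.PM p)")
    case True
    have "proj_tuple p n z \<in> space (PMG n p)"
      using measurable_space[OF measurable_proj_tuple True] .
    then show ?thesis
      using True proj_tuple_connecting[OF kn True]
      by (simp add: haar_epi.pull_eq[OF haar_epi_limit] haar_epi.pull_eq[OF haar_epi_connecting[OF kn]])
  next
    case False
    then show ?thesis by (simp add: haar_epi.pull_eq[OF haar_epi_limit])
  qed
qed

lemma pull_connecting_connecting:
  assumes km: "k \<le> m" and mn: "m \<le> n"
  shows "pullback_fun (G n) p (\<pi> n m) (pullback_fun (G m) p (\<pi> m k) \<psi>) = pullback_fun (G n) p (\<pi> n k) \<psi>"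
proof
  fix z
  interpret E: haar_epi "G m" "G n" A "S m" "S n" "\<pi> n m" by (rule haar_epi_connecting[OF mn])
  show "pullback_fun (G n) p (\<pi> n m) (pullback_fun (G m) p (\<pi> m k) \<psi>) z = pullback_fun (G n) p (\<pi> n k) \<psi> z"
  proof (cases "z \<in> space (E.Y.mm.PM p)")
    case True
    have "z j \<in> carrier (G n)" if "j < p" for j
      using True that by (auto simp: E.Y.carrier_tpower[symmetric] product_tgroup_def)
    then have "compose {..<p} (\<pi> m k) (compose {..<p} (\<pi> n m) z) = compose {..<p} (\<pi> n k) z"
      by (auto simp: compose_def fun_eq_iff connecting_comp[OF km mn])
    then show ?thesis
      using True E.space_compose_\<pi>[OF True]
      by (simp add: E.pull_eq haar_epi.pull_eq[OF haar_epi_connecting[OF km]]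
          haar_epi.pull_eq[OF haar_epi_connecting[OF order_trans[OF km mn]]])
  next
    case False
    then show ?thesis
      by (simp add: E.pull_eq haar_epi.pull_eq[OF haar_epi_connecting[OF order_trans[OF km mn]]])
  qed
qed

end

text \<open>
  All the groups of the system share one length on the module and one radius below which
  cocycles are integrated.
\<close>

locale averaging_system = limit_system G \<pi> A T S
  for G :: "'i::preorder \<Rightarrow> 'g tgroup" and \<pi> :: "'i \<Rightarrow> 'i \<Rightarrow> 'g \<Rightarrow> 'g"
    and A :: "'a tgroup" and T :: "('i \<Rightarrow> 'g) \<Rightarrow> 'a \<Rightarrow> 'a" and S :: "'i \<Rightarrow> 'g \<Rightarrow> 'a \<Rightarrow> 'a" +
  fixes len :: "'a \<Rightarrow> ennreal" and r :: "nat \<Rightarrow> ennreal" and K :: real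
  assumes averaging_L: "averaging_module L A T len r"
    and averaging_G: "averaging_module (G m) A (S m) len r"
    and len_bounded: "a \<in> carrier A \<Longrightarrow> len a \<le> ennreal K" and K_nonneg: "K \<ge> 0"
    and len_nbhd: "e > 0 \<Longrightarrow> \<exists>U. openin (gtop A) U \<and> \<one>\<^bsub>A\<^esub> \<in> U \<and> (\<forall>a\<in>U. len a \<le> ennreal e)"
begin

abbreviation lmean :: "nat \<Rightarrow> ((nat \<Rightarrow> 'i \<Rightarrow> 'g) \<Rightarrow> 'a) \<Rightarrow> ennreal" where
  "lmean \<equiv> haar_length_module.mean_len L len"

abbreviation gmean :: "'i \<Rightarrow> nat \<Rightarrow> ((nat \<Rightarrow> 'g) \<Rightarrow> 'a) \<Rightarrow> ennreal" where
  "gmean m \<equiv> haar_length_module.mean_len (G m) len"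

lemma length_L: "haar_length_module L A T len"
  using averaging_L by (rule averaging_module.axioms(1))

lemma length_G: "haar_length_module (G m) A (S m) len"
  using averaging_G by (rule averaging_module.axioms(1))

abbreviation lpull :: "nat \<Rightarrow> 'i \<Rightarrow> ((nat \<Rightarrow> 'g) \<Rightarrow> 'a) \<Rightarrow> (nat \<Rightarrow> 'i \<Rightarrow> 'g) \<Rightarrow> 'a" where
  "lpull p m \<equiv> pullback_fun L p (\<lambda>x. x m)"

lemma approximation:
  assumes "\<sigma> \<in> carrier (borel_maps L A p)" and "e > 0"
  obtains n \<psi> where "m0 \<le> n" "\<psi> \<in> carrier (borel_maps (G n) A p)"
    "lmean p (\<sigma> \<otimes>\<^bsub>borel_maps L A p\<^esub> inv\<^bsub>borel_maps L A p\<^esub> lpull p n \<psi>) \<le> ennreal e"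
  by (rule cochain_approximation[OF length_L _ K_nonneg _ assms, of m0])
     (rule len_bounded, assumption, rule len_nbhd, assumption, rule that, assumption+)

lemma lmean_lpull: "\<psi> \<in> carrier (borel_maps (G m) A p) \<Longrightarrow> lmean p (lpull p m \<psi>) = gmean m p \<psi>"
  by (rule haar_epi.pull_mean_len[OF haar_epi_limit length_G length_L])

text \<open>
  A cocycle on the limit is approximated by a cochain on a factor. The coboundary of the latter
  is a small cocycle on the factor, hence the coboundary of a small cochain, by which the
  approximation is corrected to a cocycle; it differs from the given one by a small cocycle.
\<close>

lemma cocycle_from_factor:
  assumes \<sigma>: "\<sigma> \<in> cocycle_maps L A T (Suc q)"
  obtains n \<psi> where "\<psi> \<in> cocycle_maps (G n) A (S n) (Suc q)"
    "\<sigma> \<otimes>\<^bsub>borel_maps L A (Suc q)\<^esub> inv\<^bsub>borel_maps L A (Suc q)\<^esub> lpull (Suc q) n \<psi>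
      \<in> coboundary_maps L A T (Suc q)"
proof -
  interpret LA: averaging_module L A T len r by (rule averaging_L)
  let ?B = "borel_maps L A (Suc q)" and ?B2 = "borel_maps L A (Suc (Suc q))"
  let ?N2 = "null_maps L A (Suc (Suc q))"
  let ?dL = "coboundary_fun L A T (Suc q)"
  define C1 C2 where "C1 = zigzag_const (Suc (Suc q)) * of_nat (Suc (Suc (Suc q)))"
    and "C2 = zigzag_const (Suc q) * (1 + 3 * C1)"
  have fin: "C1 < \<infinity>" "C2 < \<infinity>"
    unfolding C1_def C2_def
    by (simp_all add: ennreal_mult_less_top zigzag_const_less_top[simplified] ennreal_of_nat_eq_real_of_nat)
  obtain e1 where e1: "e1 > 0" "C1 * ennreal e1 \<le> r (Suc q)"
    by (rule ex_scaled_ennreal_le[OF fin(1) LA.r_pos])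
  obtain e2 where e2: "e2 > 0" "C2 * ennreal e2 \<le> r q"
    by (rule ex_scaled_ennreal_le[OF fin(2) LA.r_pos])
  define e where "e = min e1 e2"
  have e: "e > 0" "C1 * ennreal e \<le> r (Suc q)" "C2 * ennreal e \<le> r q"
    using e1 e2 order_trans[OF mult_left_mono[OF ennreal_leI[of e e1]] e1(2)]
      order_trans[OF mult_left_mono[OF ennreal_leI[of e e2]] e2(2)]
    by (simp_all add: e_def)
  have \<sigma>B: "\<sigma> \<in> carrier ?B" and \<sigma>Z: "?dL \<sigma> \<in> ?N2" using \<sigma> by (simp_all add: cocycle_maps_def)
  obtain n \<psi>0 where \<psi>0: "\<psi>0 \<in> carrier (borel_maps (G n) A (Suc q))"
    and close: "lmean (Suc q) (\<sigma> \<otimes>\<^bsub>?B\<^esub> inv\<^bsub>?B\<^esub> lpull (Suc q) n \<psi>0) \<le> ennreal e"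
    by (rule approximation[OF \<sigma>B e(1), of undefined]) (rule that)
  interpret E: haar_epi "G n" L A "S n" T "\<lambda>x. x n" by (rule haar_epi_limit)
  interpret GA: averaging_module "G n" A "S n" len r by (rule averaging_G)
  let ?Bn = "borel_maps (G n) A (Suc q)" and ?Bn2 = "borel_maps (G n) A (Suc (Suc q))"
  let ?dG = "coboundary_fun (G n) A (S n) (Suc q)"
  let ?P = "lpull (Suc q) n"
  interpret dL: group_hom ?B ?B2 ?dL
    by (intro group_hom.intro group_hom_axioms.intro LM.coboundary_fun_hom LM.bm.group_axioms)
  interpret dG: group_hom ?Bn ?Bn2 ?dG
    by (intro group_hom.intro group_hom_axioms.intro E.X.coboundary_fun_hom E.X.bm.group_axioms)
  interpret P: group_hom ?Bn ?B ?P
    by (intro group_hom.intro group_hom_axioms.intro E.pull_hom E.X.bm.group_axioms LM.bm.group_axioms)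
  have P0: "?P \<psi>0 \<in> carrier ?B" by (rule E.pull_closed[OF \<psi>0])
  let ?\<delta> = "\<sigma> \<otimes>\<^bsub>?B\<^esub> inv\<^bsub>?B\<^esub> ?P \<psi>0"
  have \<delta>: "?\<delta> \<in> carrier ?B" by (intro LM.bm.m_closed LM.bm.inv_closed \<sigma>B P0)
  have P\<psi>0: "?P \<psi>0 = inv\<^bsub>?B\<^esub> ?\<delta> \<otimes>\<^bsub>?B\<^esub> \<sigma>"
  proof -
    have "inv\<^bsub>?B\<^esub> ?\<delta> = ?P \<psi>0 \<otimes>\<^bsub>?B\<^esub> inv\<^bsub>?B\<^esub> \<sigma>"
      using \<sigma>B P0 LM.bm.m_comm[OF LM.bm.inv_closed[OF \<sigma>B] P0] by (simp add: LM.bm.inv_mult)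
    then show ?thesis using \<sigma>B P0 by (simp add: LM.bm.m_assoc LM.bm.l_inv)
  qed
  \<comment> \<open>Modulo null maps the coboundary of \<open>?P \<psi>0\<close> is the inverse of the coboundary of \<open>?\<delta>\<close>.\<close>
  have d\<psi>0: "lmean (Suc (Suc q)) (?dL (?P \<psi>0)) \<le> of_nat (Suc (Suc (Suc q))) * ennreal e"
  proof -
    have c: "?dL ?\<delta> \<in> carrier ?B2" "?dL \<sigma> \<in> carrier ?B2" by (rule LM.coboundary_fun_closed[OF \<delta>]) (rule LM.coboundary_fun_closed[OF \<sigma>B])
    have "?dL (?P \<psi>0) = ?dL (inv\<^bsub>?B\<^esub> ?\<delta> \<otimes>\<^bsub>?B\<^esub> \<sigma>)" by (rule arg_cong[OF P\<psi>0])
    also have "\<dots> = ?dL \<sigma> \<otimes>\<^bsub>?B2\<^esub> inv\<^bsub>?B2\<^esub> ?dL ?\<delta>"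
      unfolding dL.hom_mult[OF LM.bm.inv_closed[OF \<delta>] \<sigma>B] dL.hom_inv[OF \<delta>]
      by (rule LM.bm.m_comm[OF LM.bm.inv_closed[OF c(1)] c(2)])
    finally have "lmean (Suc (Suc q)) (?dL (?P \<psi>0)) \<le> lmean (Suc (Suc q)) (?dL \<sigma>) + lmean (Suc (Suc q)) (?dL ?\<delta>)"
      using LA.mean_len_div[OF c(2) c(1)] by simp
    also have "\<dots> = lmean (Suc (Suc q)) (?dL ?\<delta>)" by (simp add: LA.mean_len_null[OF \<sigma>Z])
    also have "\<dots> \<le> of_nat (Suc (Suc (Suc q))) * lmean (Suc q) ?\<delta>" by (rule LA.mean_len_coboundary[OF \<delta>])
    also have "\<dots> \<le> of_nat (Suc (Suc (Suc q))) * ennreal e" by (rule mult_left_mono[OF close]) simp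
    finally show ?thesis .
  qed
  have d\<psi>0B: "?dG \<psi>0 \<in> carrier ?Bn2" by (rule E.X.coboundary_fun_closed[OF \<psi>0])
  have gm: "gmean n (Suc (Suc q)) (?dG \<psi>0) \<le> of_nat (Suc (Suc (Suc q))) * ennreal e"
    using d\<psi>0 lmean_lpull[OF d\<psi>0B] E.pull_coboundary_fun[OF \<psi>0] by simp
  have zg: "zigzag_const (Suc (Suc q)) * gmean n (Suc (Suc q)) (?dG \<psi>0) \<le> C1 * ennreal e"
    using mult_left_mono[OF gm, of "zigzag_const (Suc (Suc q))"] by (simp only: C1_def mult.assoc zero_le)
  obtain \<phi>0 where \<phi>0: "\<phi>0 \<in> carrier ?Bn"
    and null: "?dG \<psi>0 \<otimes>\<^bsub>?Bn2\<^esub> inv\<^bsub>?Bn2\<^esub> ?dG \<phi>0 \<in> null_maps (G n) A (Suc (Suc q))"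
    and small0: "gmean n (Suc q) \<phi>0 \<le> 3 * (zigzag_const (Suc (Suc q)) * gmean n (Suc (Suc q)) (?dG \<psi>0))"
    by (rule GA.small_cocycle_is_small_coboundary[OF d\<psi>0B E.X.coboundary_fun_coboundary_fun[OF \<psi>0]
          order_trans[OF zg e(2)]])
  have small: "gmean n (Suc q) \<phi>0 \<le> 3 * (C1 * ennreal e)"
    by (rule order_trans[OF small0 mult_left_mono[OF zg]]) simp
  let ?\<psi> = "\<psi>0 \<otimes>\<^bsub>?Bn\<^esub> inv\<^bsub>?Bn\<^esub> \<phi>0"
  have \<psi>B: "?\<psi> \<in> carrier ?Bn" by (intro E.X.bm.m_closed E.X.bm.inv_closed \<psi>0 \<phi>0)
  have "?dG ?\<psi> = ?dG \<psi>0 \<otimes>\<^bsub>?Bn2\<^esub> inv\<^bsub>?Bn2\<^esub> ?dG \<phi>0"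
    unfolding dG.hom_mult[OF \<psi>0 E.X.bm.inv_closed[OF \<phi>0]] dG.hom_inv[OF \<phi>0] ..
  then have \<psi>: "?\<psi> \<in> cocycle_maps (G n) A (S n) (Suc q)"
    using null \<psi>B by (simp add: cocycle_maps_def)
  have P\<psi>: "?P ?\<psi> = ?P \<psi>0 \<otimes>\<^bsub>?B\<^esub> inv\<^bsub>?B\<^esub> ?P \<phi>0"
    unfolding P.hom_mult[OF \<psi>0 E.X.bm.inv_closed[OF \<phi>0]] P.hom_inv[OF \<phi>0] ..
  have P\<phi>0: "?P \<phi>0 \<in> carrier ?B" by (rule E.pull_closed[OF \<phi>0])
  let ?\<tau> = "\<sigma> \<otimes>\<^bsub>?B\<^esub> inv\<^bsub>?B\<^esub> ?P ?\<psi>"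
  have \<tau>: "?\<tau> = ?\<delta> \<otimes>\<^bsub>?B\<^esub> inv\<^bsub>?B\<^esub> (inv\<^bsub>?B\<^esub> ?P \<phi>0)"
    unfolding P\<psi> using \<sigma>B P0 P\<phi>0 by (simp add: LM.bm.inv_mult LM.bm.m_ac)
  have \<tau>Z: "?\<tau> \<in> cocycle_maps L A T (Suc q)"
    by (intro subgroup.m_closed[OF LM.subgroup_cocycle_maps] subgroup.m_inv_closed[OF LM.subgroup_cocycle_maps]
        \<sigma> E.pull_cocycle \<psi>)
  have "lmean (Suc q) ?\<tau> \<le> lmean (Suc q) ?\<delta> + lmean (Suc q) (?P \<phi>0)"
    unfolding \<tau> using LA.mean_len_div[OF \<delta> LM.bm.inv_closed[OF P\<phi>0]] LA.mean_len_inv[OF P\<phi>0] by simp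
  also have "\<dots> \<le> ennreal e + 3 * (C1 * ennreal e)"
    by (rule add_mono[OF close]) (simp only: lmean_lpull[OF \<phi>0] small)
  also have "\<dots> = (1 + 3 * C1) * ennreal e" by (simp add: distrib_right mult.assoc)
  finally have "zigzag_const (Suc q) * lmean (Suc q) ?\<tau> \<le> zigzag_const (Suc q) * ((1 + 3 * C1) * ennreal e)"
    by (rule mult_left_mono) simp
  also have "\<dots> = C2 * ennreal e" by (simp only: C2_def mult.assoc)
  finally have small\<tau>: "zigzag_const (Suc q) * lmean (Suc q) ?\<tau> \<le> r q" using e(3) by (rule order_trans)
  have \<tau>B: "?\<tau> \<in> carrier ?B" and \<tau>d: "?dL ?\<tau> \<in> ?N2" using \<tau>Z by (simp_all only: cocycle_maps_def mem_Collect_eq)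
  obtain \<phi> where "\<phi> \<in> carrier (borel_maps L A q)"
    "?\<tau> \<otimes>\<^bsub>?B\<^esub> inv\<^bsub>?B\<^esub> coboundary_fun L A T q \<phi> \<in> null_maps L A (Suc q)"
    by (rule LA.small_cocycle_is_small_coboundary[OF \<tau>B \<tau>d small\<tau>])
  then have "?\<tau> \<in> coboundary_maps L A T (Suc q)" using \<tau>B by auto
  with \<psi> show thesis by (rule that)
qed

text \<open>
  If a cocycle on a factor becomes a coboundary on the limit, a primitive on the limit is
  approximated by a cochain on a further factor, whose coboundary differs from the cocycle by a
  small cocycle.
\<close>

lemma coboundary_on_factor:
  assumes \<psi>: "\<psi> \<in> cocycle_maps (G m) A (S m) (Suc q)"
    and cob: "lpull (Suc q) m \<psi> \<in> coboundary_maps L A T (Suc q)"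
  obtains n where "m \<le> n" "pullback_fun (G n) (Suc q) (\<pi> n m) \<psi> \<in> coboundary_maps (G n) A (S n) (Suc q)"
proof -
  interpret LA: averaging_module L A T len r by (rule averaging_L)
  let ?B = "borel_maps L A (Suc q)" and ?BB = "borel_maps L A q"
  let ?dL = "coboundary_fun L A T q"
  define C where "C = zigzag_const (Suc q) * of_nat (Suc (Suc q))"
  have "C < \<infinity>" unfolding C_def by (simp add: ennreal_mult_less_top zigzag_const_less_top[simplified] ennreal_of_nat_eq_real_of_nat)
  then obtain e where e: "e > 0" "C * ennreal e \<le> r q" by (rule ex_scaled_ennreal_le[OF _ LA.r_pos])
  obtain \<phi> where \<phi>: "\<phi> \<in> carrier ?BB" and PB: "lpull (Suc q) m \<psi> \<in> carrier ?B"
    and null: "lpull (Suc q) m \<psi> \<otimes>\<^bsub>?B\<^esub> inv\<^bsub>?B\<^esub> ?dL \<phi> \<in> null_maps L A (Suc q)"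
    using cob by auto
  obtain n \<phi>0 where n: "m \<le> n" and \<phi>0: "\<phi>0 \<in> carrier (borel_maps (G n) A q)"
    and close: "lmean q (\<phi> \<otimes>\<^bsub>?BB\<^esub> inv\<^bsub>?BB\<^esub> lpull q n \<phi>0) \<le> ennreal e"
    by (rule approximation[OF \<phi> e(1), of m]) (rule that)
  interpret E: haar_epi "G n" L A "S n" T "\<lambda>x. x n" by (rule haar_epi_limit)
  interpret GA: averaging_module "G n" A "S n" len r by (rule averaging_G)
  let ?Bn = "borel_maps (G n) A (Suc q)"
  let ?dG = "coboundary_fun (G n) A (S n) q"
  let ?P = "lpull (Suc q) n"
  interpret dL: group_hom ?BB ?B ?dL
    by (intro group_hom.intro group_hom_axioms.intro LM.coboundary_fun_hom LM.bm.group_axioms)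
  interpret P: group_hom ?Bn ?B ?P
    by (intro group_hom.intro group_hom_axioms.intro E.pull_hom E.X.bm.group_axioms LM.bm.group_axioms)
  let ?\<psi>n = "pullback_fun (G n) (Suc q) (\<pi> n m) \<psi>"
  have \<psi>n: "?\<psi>n \<in> cocycle_maps (G n) A (S n) (Suc q)"
    by (rule haar_epi.pull_cocycle[OF haar_epi_connecting[OF n] \<psi>])
  then have \<psi>nB: "?\<psi>n \<in> carrier ?Bn" by (simp add: cocycle_maps_def)
  have P\<psi>n: "?P ?\<psi>n = lpull (Suc q) m \<psi>" by (rule pull_limit_connecting[OF n])
  let ?\<tau> = "?\<psi>n \<otimes>\<^bsub>?Bn\<^esub> inv\<^bsub>?Bn\<^esub> ?dG \<phi>0"
  have \<tau>Z: "?\<tau> \<in> cocycle_maps (G n) A (S n) (Suc q)" by (rule E.X.cocycle_maps_div_coboundary[OF \<psi>n \<phi>0])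
  have dB: "?dG \<phi>0 \<in> carrier ?Bn" by (rule E.X.coboundary_fun_closed[OF \<phi>0])
  have \<tau>B: "?\<tau> \<in> carrier ?Bn" by (intro E.X.bm.m_closed E.X.bm.inv_closed \<psi>nB dB)
  have P0: "lpull q n \<phi>0 \<in> carrier ?BB" by (rule E.pull_closed[OF \<phi>0])
  let ?\<delta> = "\<phi> \<otimes>\<^bsub>?BB\<^esub> inv\<^bsub>?BB\<^esub> lpull q n \<phi>0"
  have \<delta>: "?\<delta> \<in> carrier ?BB" by (intro LM.bm.m_closed LM.bm.inv_closed \<phi> P0)
  have c: "?dL \<phi> \<in> carrier ?B" "?dL (lpull q n \<phi>0) \<in> carrier ?B" "?dL ?\<delta> \<in> carrier ?B"
    by (rule LM.coboundary_fun_closed[OF \<phi>], rule LM.coboundary_fun_closed[OF P0], rule LM.coboundary_fun_closed[OF \<delta>])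
  let ?\<nu> = "lpull (Suc q) m \<psi> \<otimes>\<^bsub>?B\<^esub> inv\<^bsub>?B\<^esub> ?dL \<phi>"
  have \<nu>B: "?\<nu> \<in> carrier ?B" by (intro LM.bm.m_closed LM.bm.inv_closed PB c)
  have "?P ?\<tau> = lpull (Suc q) m \<psi> \<otimes>\<^bsub>?B\<^esub> inv\<^bsub>?B\<^esub> ?dL (lpull q n \<phi>0)"
    unfolding P.hom_mult[OF \<psi>nB E.X.bm.inv_closed[OF dB]] P.hom_inv[OF dB] P\<psi>n E.pull_coboundary_fun[OF \<phi>0] ..
  also have "\<dots> = ?\<nu> \<otimes>\<^bsub>?B\<^esub> (?dL \<phi> \<otimes>\<^bsub>?B\<^esub> inv\<^bsub>?B\<^esub> ?dL (lpull q n \<phi>0))"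
    using PB c by (simp add: LM.bm.m_assoc) (simp add: LM.bm.m_assoc[symmetric] LM.bm.l_inv)
  also have "?dL \<phi> \<otimes>\<^bsub>?B\<^esub> inv\<^bsub>?B\<^esub> ?dL (lpull q n \<phi>0) = ?dL ?\<delta>"
    unfolding dL.hom_mult[OF \<phi> LM.bm.inv_closed[OF P0]] dL.hom_inv[OF P0] ..
  also have "?\<nu> \<otimes>\<^bsub>?B\<^esub> ?dL ?\<delta> = ?\<nu> \<otimes>\<^bsub>?B\<^esub> inv\<^bsub>?B\<^esub> (inv\<^bsub>?B\<^esub> ?dL ?\<delta>)"
    by (simp only: LM.bm.inv_inv[OF c(3)])
  finally have P\<tau>: "?P ?\<tau> = ?\<nu> \<otimes>\<^bsub>?B\<^esub> inv\<^bsub>?B\<^esub> (inv\<^bsub>?B\<^esub> ?dL ?\<delta>)" .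
  have "gmean n (Suc q) ?\<tau> = lmean (Suc q) (?P ?\<tau>)" by (rule lmean_lpull[OF \<tau>B, symmetric])
  also have "\<dots> \<le> lmean (Suc q) ?\<nu> + lmean (Suc q) (inv\<^bsub>?B\<^esub> ?dL ?\<delta>)"
    unfolding P\<tau> by (rule LA.mean_len_div[OF \<nu>B LM.bm.inv_closed[OF c(3)]])
  also have "\<dots> = lmean (Suc q) (?dL ?\<delta>)" by (simp add: LA.mean_len_null[OF null] LA.mean_len_inv[OF c(3)])
  also have "\<dots> \<le> of_nat (Suc (Suc q)) * lmean q ?\<delta>" by (rule LA.mean_len_coboundary[OF \<delta>])
  also have "\<dots> \<le> of_nat (Suc (Suc q)) * ennreal e" by (rule mult_left_mono[OF close]) simp
  finally have "zigzag_const (Suc q) * gmean n (Suc q) ?\<tau> \<le> zigzag_const (Suc q) * (of_nat (Suc (Suc q)) * ennreal e)"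
    by (rule mult_left_mono) simp
  also have "\<dots> = C * ennreal e" by (simp only: C_def mult.assoc)
  finally have small: "zigzag_const (Suc q) * gmean n (Suc q) ?\<tau> \<le> r q" using e(2) by (rule order_trans)
  have \<tau>d: "coboundary_fun (G n) A (S n) (Suc q) ?\<tau> \<in> null_maps (G n) A (Suc (Suc q))"
    using \<tau>Z by (simp only: cocycle_maps_def mem_Collect_eq)
  obtain \<phi>1 where \<phi>1: "\<phi>1 \<in> carrier (borel_maps (G n) A q)"
    and null1: "?\<tau> \<otimes>\<^bsub>?Bn\<^esub> inv\<^bsub>?Bn\<^esub> ?dG \<phi>1 \<in> null_maps (G n) A (Suc q)"
    by (rule GA.small_cocycle_is_small_coboundary[OF \<tau>B \<tau>d small])
  have d1: "?dG \<phi>1 \<in> carrier ?Bn" by (rule E.X.coboundary_fun_closed[OF \<phi>1])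
  have "?\<tau> \<otimes>\<^bsub>?Bn\<^esub> inv\<^bsub>?Bn\<^esub> ?dG \<phi>1 =
      ?\<psi>n \<otimes>\<^bsub>?Bn\<^esub> inv\<^bsub>?Bn\<^esub> ?dG (\<phi>0 \<otimes>\<^bsub>borel_maps (G n) A q\<^esub> \<phi>1)"
    unfolding hom_mult[OF E.X.coboundary_fun_hom \<phi>0 \<phi>1] E.X.bm.inv_mult[OF dB d1]
    by (rule E.X.bm.m_assoc[OF \<psi>nB E.X.bm.inv_closed[OF dB] E.X.bm.inv_closed[OF d1]])
  then have "?\<psi>n \<in> coboundary_maps (G n) A (S n) (Suc q)"
    using null1 \<psi>nB E.X.bm.m_closed[OF \<phi>0 \<phi>1] by auto
  with n show thesis by (rule that)
qed

text \<open>In degree 0 a cocycle is an invariant element of \<open>A\<close>, because \<open>G\<^sup>0\<close> is a point.\<close>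

lemma cocycle_from_factor_0:
  assumes \<sigma>: "\<sigma> \<in> cocycle_maps L A T 0"
  obtains n \<psi> where "\<psi> \<in> cocycle_maps (G n) A (S n) 0" "lpull 0 n \<psi> = \<sigma>"
proof -
  fix n :: 'i
  interpret E: haar_epi "G n" L A "S n" T "\<lambda>x. x n" by (rule haar_epi_limit)
  have \<sigma>B: "\<sigma> \<in> carrier (borel_maps L A 0)" using \<sigma> by (simp add: cocycle_maps_def)
  have pt: "space (LM.mm.PM 0) = {\<lambda>_. undefined}" "space (E.X.mm.PM 0) = {\<lambda>_. undefined}"
    by (simp_all add: space_PiM)
  define \<psi> where "\<psi> = (\<lambda>z\<in>space (E.X.mm.PM 0). \<sigma> (\<lambda>_. undefined))"
  have "\<sigma> (\<lambda>_. undefined) \<in> carrier A" by (rule LM.borel_maps_closed[OF \<sigma>B]) (simp add: pt)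
  then have \<psi>B: "\<psi> \<in> carrier (borel_maps (G n) A 0)"
    unfolding \<psi>_def by (intro E.X.borel_maps_restrictI measurable_const) (simp add: space_borel_of LM.A.topspace_gtop)
  have eq: "lpull 0 n \<psi> = \<sigma>"
  proof (rule LM.borel_maps_eqI[OF E.pull_closed[OF \<psi>B] \<sigma>B])
    show "lpull 0 n \<psi> z = \<sigma> z" if "z \<in> space (LM.mm.PM 0)" for z
    proof -
      have "z = (\<lambda>_. undefined)" using that unfolding pt by simp
      then show ?thesis using that E.space_compose_\<pi>[OF that] by (simp only: E.pull_eq \<psi>_def restrict_apply') 
    qed
  qed
  have "pullback_fun L (Suc 0) (\<lambda>x. x n) (coboundary_fun (G n) A (S n) 0 \<psi>) \<in> null_maps L A (Suc 0)"
    using \<sigma> unfolding E.pull_coboundary_fun[OF \<psi>B] eq by (simp add: cocycle_maps_def)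
  then have "\<psi> \<in> cocycle_maps (G n) A (S n) 0"
    using \<psi>B E.pull_reflects_null[OF E.X.coboundary_fun_closed[OF \<psi>B]] by (simp add: cocycle_maps_def)
  then show thesis using eq by (rule that)
qed

text \<open>
  The inflation maps are jointly onto, and a class that dies on the limit dies at a finite
  index; this is the criterion for direct limits.
\<close>

theorem direct_limit_inflation_iso:
  "direct_limit_map (\<lambda>m. inflation L A T p (\<lambda>g. g m))
    \<in> iso (direct_limit (\<lambda>m. cohomology (G m) A (S m) p)
                        (\<lambda>k m. inflation (G m) A (S m) p (\<pi> m k)))
          (cohomology L A T p)"
proof (rule direct_limit_map_iso)
  show "\<exists>n. k \<le> n \<and> m \<le> n" for k m :: 'i by (rule directed)
  show "group (cohomology (G m) A (S m) p)" for m
    using haar_module.comm_group_cohomology[OF haar_module_G] by (rule comm_group.axioms(2))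
  show "group (cohomology L A T p)" using LM.comm_group_cohomology by (rule comm_group.axioms(2))
  show "inflation (G m) A (S m) p (\<pi> m k) \<in> hom (cohomology (G k) A (S k) p) (cohomology (G m) A (S m) p)"
    if "k \<le> m" for k m
    by (rule haar_epi.inflation_hom[OF haar_epi_connecting[OF that]])
  show "inflation L A T p (\<lambda>g. g m) \<in> hom (cohomology (G m) A (S m) p) (cohomology L A T p)" for m
    by (rule haar_epi.inflation_hom[OF haar_epi_limit])
  note cls = haar_epi.inflation_class[OF haar_epi_connecting] haar_epi.inflation_class[OF haar_epi_limit]
  note car = haar_module.carrier_cohomology[OF haar_module_G]
  note pc = haar_epi.pull_cocycle[OF haar_epi_connecting] haar_epi.pull_cocycle[OF haar_epi_limit]
  show "inflation (G n) A (S n) p (\<pi> n m) (inflation (G m) A (S m) p (\<pi> m k) x) = inflation (G n) A (S n) p (\<pi> n k) x"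
    if km: "k \<le> m" and mn: "m \<le> n" and x: "x \<in> carrier (cohomology (G k) A (S k) p)" for k m n x
  proof -
    obtain \<psi> where \<psi>: "\<psi> \<in> cocycle_maps (G k) A (S k) p" "x = cohomology_class (G k) A (S k) p \<psi>"
      using x unfolding car by blast
    show ?thesis
      unfolding \<psi>(2) cls(1)[OF km \<psi>(1)] cls(1)[OF mn pc(1)[OF km \<psi>(1)]] cls(1)[OF order_trans[OF km mn] \<psi>(1)]
        pull_connecting_connecting[OF km mn] ..
  qed
  show "inflation L A T p (\<lambda>g. g m) (inflation (G m) A (S m) p (\<pi> m k) x) = inflation L A T p (\<lambda>g. g k) x"
    if km: "k \<le> m" and x: "x \<in> carrier (cohomology (G k) A (S k) p)" for k m x
  proof -
    obtain \<psi> where \<psi>: "\<psi> \<in> cocycle_maps (G k) A (S k) p" "x = cohomology_class (G k) A (S k) p \<psi>"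
      using x unfolding car by blast
    show ?thesis
      unfolding \<psi>(2) cls(1)[OF km \<psi>(1)] cls(2)[OF pc(1)[OF km \<psi>(1)]] cls(2)[OF \<psi>(1)]
        pull_limit_connecting[OF km] ..
  qed
  show "\<exists>m. \<exists>x\<in>carrier (cohomology (G m) A (S m) p). inflation L A T p (\<lambda>g. g m) x = y"
    if y: "y \<in> carrier (cohomology L A T p)" for y
  proof -
    obtain \<sigma> where \<sigma>: "\<sigma> \<in> cocycle_maps L A T p" "y = cohomology_class L A T p \<sigma>"
      using y unfolding LM.carrier_cohomology by blast
    obtain n \<psi> where \<psi>: "\<psi> \<in> cocycle_maps (G n) A (S n) p"
      and eq: "cohomology_class L A T p (lpull p n \<psi>) = cohomology_class L A T p \<sigma>"
    proof (cases p)
      case 0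
      obtain n \<psi> where "\<psi> \<in> cocycle_maps (G n) A (S n) 0" "lpull 0 n \<psi> = \<sigma>"
        using \<sigma>(1) unfolding 0 by (rule cocycle_from_factor_0)
      then show ?thesis using that[of \<psi> n] by (simp add: 0)
    next
      case (Suc q)
      obtain n \<psi> where \<psi>: "\<psi> \<in> cocycle_maps (G n) A (S n) p"
        "\<sigma> \<otimes>\<^bsub>borel_maps L A p\<^esub> inv\<^bsub>borel_maps L A p\<^esub> lpull p n \<psi> \<in> coboundary_maps L A T p"
        using \<sigma>(1) unfolding Suc by (rule cocycle_from_factor)
      interpret H: comm_group "cohomology L A T p" by (rule LM.comm_group_cohomology)
      let ?\<tau> = "\<sigma> \<otimes>\<^bsub>borel_maps L A p\<^esub> inv\<^bsub>borel_maps L A p\<^esub> lpull p n \<psi>"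
      have P: "lpull p n \<psi> \<in> cocycle_maps L A T p" by (rule pc(2)[OF \<psi>(1)])
      have \<tau>: "?\<tau> \<in> cocycle_maps L A T p"
        by (intro subgroup.m_closed[OF LM.subgroup_cocycle_maps] subgroup.m_inv_closed[OF LM.subgroup_cocycle_maps] \<sigma>(1) P)
      have PB: "lpull p n \<psi> \<in> carrier (borel_maps L A p)" "\<sigma> \<in> carrier (borel_maps L A p)"
        using P \<sigma>(1) by (simp_all add: cocycle_maps_def)
      have "cohomology_class L A T p \<sigma> = cohomology_class L A T p (?\<tau> \<otimes>\<^bsub>borel_maps L A p\<^esub> lpull p n \<psi>)"
        using PB by (simp add: LM.bm.m_assoc LM.bm.l_inv)
      also have "\<dots> = cohomology_class L A T p (lpull p n \<psi>)"
        unfolding LM.cohomology_class_mult[OF \<tau> P] LM.cohomology_class_eq_one_iff[OF \<tau>, THEN iffD2, OF \<psi>(2)]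
        by (rule H.l_one) (use P in \<open>simp add: LM.carrier_cohomology\<close>)
      finally show ?thesis using that[OF \<psi>(1)] by simp
    qed
    have "cohomology_class (G n) A (S n) p \<psi> \<in> carrier (cohomology (G n) A (S n) p)"
      using \<psi> unfolding car by blast
    moreover have "inflation L A T p (\<lambda>g. g n) (cohomology_class (G n) A (S n) p \<psi>) = y"
      unfolding cls(2)[OF \<psi>] eq \<sigma>(2) ..
    ultimately show ?thesis by blast
  qed
  show "\<exists>n\<ge>m. inflation (G n) A (S n) p (\<pi> n m) x = \<one>\<^bsub>cohomology (G n) A (S n) p\<^esub>"
    if x: "x \<in> carrier (cohomology (G m) A (S m) p)"
      and one: "inflation L A T p (\<lambda>g. g m) x = \<one>\<^bsub>cohomology L A T p\<^esub>" for m x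
  proof -
    obtain \<psi> where \<psi>: "\<psi> \<in> cocycle_maps (G m) A (S m) p" "x = cohomology_class (G m) A (S m) p \<psi>"
      using x unfolding car by blast
    have cob: "lpull p m \<psi> \<in> coboundary_maps L A T p"
      using one unfolding \<psi>(2) cls(2)[OF \<psi>(1)] LM.cohomology_class_eq_one_iff[OF pc(2)[OF \<psi>(1)]] .
    obtain n where n: "m \<le> n" "pullback_fun (G n) p (\<pi> n m) \<psi> \<in> coboundary_maps (G n) A (S n) p"
    proof (cases p)
      case 0
      have "\<psi> \<in> null_maps (G m) A p"
        using haar_epi.pull_reflects_null[OF haar_epi_limit] \<psi>(1) cob by (auto simp: 0 cocycle_maps_def)
      then have "\<psi> \<in> coboundary_maps (G m) A (S m) p" by (simp add: 0)
      from that[OF order_refl haar_epi.pull_coboundary[OF haar_epi_connecting[OF order_refl] this]]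
      show ?thesis .
    next
      case (Suc q)
      show ?thesis using \<psi>(1) cob that unfolding Suc by (rule coboundary_on_factor)
    qed
    have "inflation (G n) A (S n) p (\<pi> n m) x = \<one>\<^bsub>cohomology (G n) A (S n) p\<^esub>"
      unfolding \<psi>(2) cls(1)[OF n(1) \<psi>(1)]
        haar_module.cohomology_class_eq_one_iff[OF haar_module_G pc(1)[OF n(1) \<psi>(1)]] by (rule n(2))
    then show ?thesis using n(1) by blast
  qed
qed

end


section \<open>Common lengths for all groups of the system\<close>

context limit_system
begin

lemma averaging_system_discrete:
  assumes "discrete_group A"
  shows "averaging_system G \<pi> A T S (discrete_len A) (\<lambda>_. ennreal (1/2)) 1"
proof (intro averaging_system.intro averaging_system_axioms.intro limit_system_axioms)
  show "averaging_module L A T (discrete_len A) (\<lambda>_. ennreal (1/2))"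
    by (rule LM.averaging_module_discrete)
  show "averaging_module (G m) A (S m) (discrete_len A) (\<lambda>_. ennreal (1/2))" for m
    by (rule haar_module.averaging_module_discrete[OF haar_module_G])
  show "discrete_len A a \<le> ennreal 1" for a by (simp add: discrete_len_def)
  show "\<exists>U. openin (gtop A) U \<and> \<one>\<^bsub>A\<^esub> \<in> U \<and> (\<forall>a\<in>U. discrete_len A a \<le> ennreal e)" for e
    using assms by (intro exI[of _ "{\<one>\<^bsub>A\<^esub>}"]) (simp add: discrete_group_def discrete_len_def)
qed simp

text \<open>The length of an element of a torus depends only on its orbit, which is the same for all the groups.\<close>

lemma averaging_system_torus:
  assumes \<Phi>: "\<Phi> \<in> tgroup_iso A (tpower circle_group n)"
  shows "averaging_system G \<pi> A T S (torus_module.torus_len L T \<Phi> n)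
    (\<lambda>q. ennreal (torus_module.torus_radius L A T \<Phi> n q)) (2 * real n)"
proof -
  interpret LT: torus_module L A T \<Phi> n
    by (intro torus_module.intro torus_module_axioms.intro \<Phi> LM.haar_module_axioms)
  have tm: "torus_module (G m) A (S m) \<Phi> n" for m
    by (intro torus_module.intro torus_module_axioms.intro \<Phi> haar_module_G)
  have "LT.torus_len a = torus_module.torus_len (G m) (S m) \<Phi> n a" for a m
  proof -
    interpret GT: torus_module "G m" A "S m" \<Phi> n by (rule tm)
    have "LT.torus_len a = (SUP x\<in>carrier L. ennreal (LT.len0 (S m (x m) a)))"
      unfolding LT.torus_len_def by (rule SUP_cong[OF refl]) (simp only: factors[of _ m])
    also have "\<dots> = (SUP g\<in>(\<lambda>x. x m) ` carrier L. ennreal (LT.len0 (S m g a)))"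
      by (simp only: image_image)
    finally show ?thesis unfolding image_projection GT.torus_len_def .
  qed
  then have len: "torus_module.torus_len (G m) (S m) \<Phi> n = LT.torus_len" for m by (simp add: fun_eq_iff)
  have rad: "torus_module.torus_radius (G m) A (S m) \<Phi> n = LT.torus_radius" for m
    by (simp only: fun_eq_iff torus_module.torus_radius_def[OF tm] torus_module.expo_radius_def[OF tm] len
        LT.torus_radius_def LT.expo_radius_def simp_thms)
  show ?thesis
  proof (intro averaging_system.intro averaging_system_axioms.intro limit_system_axioms)
    show "averaging_module L A T LT.torus_len (\<lambda>q. ennreal (LT.torus_radius q))"
      by (rule LT.averaging_module_torus)
    show "averaging_module (G m) A (S m) LT.torus_len (\<lambda>q. ennreal (LT.torus_radius q))" for m
      using torus_module.averaging_module_torus[OF tm, of m] by (simp only: len rad)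
    show "LT.torus_len a \<le> ennreal (2 * real n)" if "a \<in> carrier A" for a
      using that by (rule LT.torus_len_bounded)
    show "\<exists>U. openin (gtop A) U \<and> \<one>\<^bsub>A\<^esub> \<in> U \<and> (\<forall>a\<in>U. LT.torus_len a \<le> ennreal e)" if "e > 0" for e
      using that by (rule LT.torus_len_nbhd)
  qed simp
qed

end

theorem theoremB:
  fixes G :: "'i::preorder \<Rightarrow> 'g tgroup"
    and \<pi> :: "'i \<Rightarrow> 'i \<Rightarrow> 'g \<Rightarrow> 'g"
    and A :: "'a tgroup"
    and T :: "('i \<Rightarrow> 'g) \<Rightarrow> 'a \<Rightarrow> 'a"
    and S :: "'i \<Rightarrow> 'g \<Rightarrow> 'a \<Rightarrow> 'a"
    and p :: nat
  assumes "compact_inverse_system G \<pi>"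
    and "second_countable (gtop (inverse_limit G \<pi>))"
    and "polish_module (inverse_limit G \<pi>) A T"
    and "discrete_group A \<or> finite_dim_torus A"
    and "\<And>m g. g \<in> carrier (inverse_limit G \<pi>) \<Longrightarrow> T g = S m (g m)"
  shows "direct_limit_map (\<lambda>m. inflation (inverse_limit G \<pi>) A T p (\<lambda>g. g m))
    \<in> iso (direct_limit (\<lambda>m. cohomology (G m) A (S m) p)
                        (\<lambda>k m. inflation (G m) A (S m) p (\<pi> m k)))
          (cohomology (inverse_limit G \<pi>) A T p)"
proof -
  interpret limit_system G \<pi> A T S
    by (intro limit_system.intro limit_system_axioms.intro assms)
  from assms(4) show ?thesis
  proof
    assume "discrete_group A"
    from averaging_system.direct_limit_inflation_iso[OF averaging_system_discrete[OF this]] show ?thesis .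
  next
    assume "finite_dim_torus A"
    then obtain n \<Phi> where "\<Phi> \<in> tgroup_iso A (tpower circle_group n)" by (auto simp: finite_dim_torus_def)
    from averaging_system.direct_limit_inflation_iso[OF averaging_system_torus[OF this]] show ?thesis .
  qed
qed

end
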